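(* Let $(R,\mathfrak m,k)$ be a local ring with $\mathfrak m^2=0$ and $\operatorname{edim}R=e\ge2$. Put $\mathcal E=\operatorname{Ext}_R(k,k)$, $\mathcal S=\widehat{\operatorname{Ext}}_R(k,k)$, let $\iota\colon\mathcal E\to\mathcal S$ be the canonical homomorphism of graded $k$-algebras, and let $\mathcal I=\operatorname{Hom}_k(\mathcal E,k)$. Then the following hold. (1) There is an exact sequence of graded left $\mathcal E$-modules $$0\longrightarrow\mathcal E\xrightarrow{\ \iota\ }\mathcal S\longrightarrow(\Sigma\mathcal I)^{e}\oplus\coprod_{i=0}^{\infty}(\Sigma^{-i}\mathcal I)^{e^i(e^2-1)}\longrightarrow0.$$ (2) The left $\mathcal E$-submodule $\iota(\mathcal E)$ has no direct complement in $\mathcal S$ (as a graded left $\mathcal E$-module). (3) One has $\operatorname{Ext}^n_{\mathcal E}(k,\mathcal S)=0$ for all $n\in\mathbb Z$.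
   Context: A local ring $(R,\mathfrak m,k)$ is a commutative noetherian ring with unique maximal ideal $\mathfrak m$ and residue field $k=R/\mathfrak m$; $\operatorname{edim}R$ is the minimal number of generators of $\mathfrak m$. Stable cohomology: for $R$-modules $M,N$ with projective resolutions $F\to M$, $G\to N$, let $\operatorname{Hom}_R(F,G)$ be the complex with $\operatorname{Hom}_R(F,G)^n=\prod_{i}\operatorname{Hom}_R(F_i,G_{i-n})$ and differential $\beta\mapsto\partial^G\beta-(-1)^{|\beta|}\beta\partial^F$; let $\overline{\operatorname{Hom}}_R(F,G)$ be the subcomplex of those $\beta$ with $\beta_i=0$ for all $i\gg0$, and $\widehat{\operatorname{Hom}}_R(F,G)$ the quotient complex. Then $\operatorname{Ext}^n_R(M,N)$ and $\widehat{\operatorname{Ext}}{}^n_R(M,N)$ ($n\in\mathbb Z$) are the $n$-th cohomology of $\operatorname{Hom}_R(F,G)$ and $\widehat{\operatorname{Hom}}_R(F,G)$, respectively; they do not depend on the choice of resolutions. Composition of homomorphisms makes $\mathcal E$ and $\mathcal S$ into $\mathbb Z$-graded $k$-algebras; the quotient map of complexes induces the homomorphism of graded algebras $\iota\colon\mathcal E\to\mathcal S$, through which $\mathcal S$ is a left $\mathcal E$-module. $\mathcal I=\operatorname{Hom}_k(\mathcal E,k)$ is the graded dual ($\mathcal I^{n}=\operatorname{Hom}_k(\mathcal E^{-n},k)$) with left action $(\varepsilon\cdot e)(\varepsilon')=(-1)^{|\varepsilon|(|e|+|\varepsilon'|)}e(\varepsilon'\varepsilon)$. Shift: $(\Sigma^s\mathcal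 C)^n=\mathcal C^{n+s}$ (upper degrees), with $a\cdot\sigma^s(c)=(-1)^{|a|s}\sigma^s(ac)$, where $\sigma^s\colon\mathcal C\to\Sigma^s\mathcal C$ is the identity on elements. $\coprod$ denotes direct sum. In (3), $k=\mathcal E/\mathcal E^{\geqslant1}$ and Ext is taken over graded left $\mathcal E$-modules (with homomorphisms of all degrees). *)

theory Defs
  imports "HOL-Algebra.Module" "HOL-Algebra.QuotRing" "HOL-Algebra.Ideal_Product"
    "HOL-Algebra.Ring_Divisibility" "HOL-Library.FuncSet"
begin

section \<open>Local rings\<close>

definition local_ring :: "('a, 'r) ring_scheme \<Rightarrow> 'a set \<Rightarrow> bool" where
  "local_ring R m \<longleftrightarrow> cring R \<and> noetherian_ring R \<and> maximalideal m R \<and>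
     (\<forall>m'. maximalideal m' R \<longrightarrow> m' = m)"

definition edim :: "('a, 'r) ring_scheme \<Rightarrow> 'a set \<Rightarrow> nat" where
  "edim R m = (LEAST n. \<exists>A. A \<subseteq> carrier R \<and> finite A \<and> card A = n \<and> Idl\<^bsub>R\<^esub> A = m)"


section \<open>Modules\<close>

text \<open>The record type \<^typ>\<open>('a, 'b) module\<close> inherits multiplicative fields from rings;
  they play no role for modules and are left unspecified here.\<close>

definition make_module ::
    "'b set \<Rightarrow> 'b \<Rightarrow> ('b \<Rightarrow> 'b \<Rightarrow> 'b) \<Rightarrow> ('a \<Rightarrow> 'b \<Rightarrow> 'b) \<Rightarrow> ('a, 'b) module" where
  "make_module C z a s =
     \<lparr>carrier = C, monoid.mult = undefined, one = undefined, zero = z, add = a, smult = s\<rparr>"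

definition ring_module :: "('a, 'r) ring_scheme \<Rightarrow> ('a, 'a) module" where
  "ring_module R = make_module (carrier R) \<zero>\<^bsub>R\<^esub> (add R) (monoid.mult R)"

definition module_hom ::
    "('a, 'r) ring_scheme \<Rightarrow> ('a, 'b) module \<Rightarrow> ('a, 'c) module \<Rightarrow> ('b \<Rightarrow> 'c) set" where
  "module_hom R M N = {f \<in> hom (add_monoid M) (add_monoid N).
     \<forall>r \<in> carrier R. \<forall>x \<in> carrier M. f (r \<odot>\<^bsub>M\<^esub> x) = r \<odot>\<^bsub>N\<^esub> f x}"

definition prod_module :: "'i set \<Rightarrow> ('i \<Rightarrow> ('a, 'b) module) \<Rightarrow> ('a, 'i \<Rightarrow> 'b) module" where
  "prod_module J M = make_module (\<Pi>\<^sub>E j \<in> J. carrier (M j)) (\<lambda>j \<in> J. \<zero>\<^bsub>M j\<^esub>)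
     (\<lambda>x y. \<lambda>j \<in> J. x j \<oplus>\<^bsub>M j\<^esub> y j) (\<lambda>r x. \<lambda>j \<in> J. r \<odot>\<^bsub>M j\<^esub> x j)"

definition coprod_module :: "'i set \<Rightarrow> ('i \<Rightarrow> ('a, 'b) module) \<Rightarrow> ('a, 'i \<Rightarrow> 'b) module" where
  "coprod_module J M = (prod_module J M)
     \<lparr>carrier := {x \<in> \<Pi>\<^sub>E j \<in> J. carrier (M j). finite {j \<in> J. x j \<noteq> \<zero>\<^bsub>M j\<^esub>}}\<rparr>"

definition dsum_module ::
    "('a, 'b) module \<Rightarrow> ('a, 'c) module \<Rightarrow> ('a, 'b \<times> 'c) module" where
  "dsum_module M N = make_module (carrier M \<times> carrier N) (\<zero>\<^bsub>M\<^esub>, \<zero>\<^bsub>N\<^esub>)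
     (\<lambda>x y. (fst x \<oplus>\<^bsub>M\<^esub> fst y, snd x \<oplus>\<^bsub>N\<^esub> snd y))
     (\<lambda>r x. (r \<odot>\<^bsub>M\<^esub> fst x, r \<odot>\<^bsub>N\<^esub> snd x))"

definition hom_module ::
    "('a, 'r) ring_scheme \<Rightarrow> ('a, 'b) module \<Rightarrow> ('a, 'c) module \<Rightarrow> ('a, 'b \<Rightarrow> 'c) module" where
  "hom_module R M N = (prod_module (carrier M) (\<lambda>_. N))
     \<lparr>carrier := module_hom R M N \<inter> extensional (carrier M)\<rparr>"

text \<open>\<^term>\<open>quot_map N U f X\<close> is the coset modulo \<^term>\<open>U\<close> represented by \<^term>\<open>f x\<close> for any
  \<^term>\<open>x\<close> in the coset \<^term>\<open>X\<close>; it is used only when \<^term>\<open>f\<close> maps a submodule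
  to be divided out into \<^term>\<open>U\<close>. Similarly for \<open>quot_map2\<close>.\<close>

definition quot_map :: "('a, 'c) module \<Rightarrow> 'c set \<Rightarrow> ('b \<Rightarrow> 'c) \<Rightarrow> 'b set \<Rightarrow> 'c set" where
  "quot_map N U f X = U <+>\<^bsub>N\<^esub> (f ` X)"

definition quot_map2 ::
    "('a, 'd) module \<Rightarrow> 'd set \<Rightarrow> ('b \<Rightarrow> 'c \<Rightarrow> 'd) \<Rightarrow> 'b set \<Rightarrow> 'c set \<Rightarrow> 'd set" where
  "quot_map2 N U f X Y = U <+>\<^bsub>N\<^esub> {f x y | x y. x \<in> X \<and> y \<in> Y}"

definition quot_module :: "('a, 'b) module \<Rightarrow> 'b set \<Rightarrow> ('a, 'b set) module" where
  "quot_module M U = make_module (a_rcosets\<^bsub>M\<^esub> U) U (set_add M)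
     (\<lambda>r. quot_map M U (\<lambda>x. r \<odot>\<^bsub>M\<^esub> x))"

text \<open>An \<^term>\<open>R\<close>-module killed by an ideal \<^term>\<open>I\<close>, as a module over \<^term>\<open>R Quot I\<close>: a coset
  acts through any of its representatives.\<close>

definition residue_scalars :: "('a, 'b) module \<Rightarrow> ('a set, 'b) module" where
  "residue_scalars M = make_module (carrier M) \<zero>\<^bsub>M\<^esub> (add M) (\<lambda>c x. (SOME r. r \<in> c) \<odot>\<^bsub>M\<^esub> x)"

text \<open>The lifting property is required for test modules on the types \<^typ>\<open>'b \<Rightarrow> 'a\<close> and \<^typ>\<open>'b\<close>
  only, as a definition cannot quantify over types. This is no restriction: the surjection onto
  \<^term>\<open>P\<close> from the free module on its elements (finitely supported functions \<^typ>\<open>'b \<Rightarrow> 'a\<close>) is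
  among the tests, so \<^term>\<open>P\<close> is a direct summand of a free module.\<close>

definition projective_module :: "('a, 'r) ring_scheme \<Rightarrow> ('a, 'b) module \<Rightarrow> bool" where
  "projective_module R P \<longleftrightarrow> module R P \<and>
     (\<forall>(M :: ('a, 'b \<Rightarrow> 'a) module) (N :: ('a, 'b) module) g f.
        module R M \<and> module R N \<and> g \<in> module_hom R M N \<and> g ` carrier M = carrier N \<and>
        f \<in> module_hom R P N \<longrightarrow>
        (\<exists>h \<in> module_hom R P M. \<forall>x \<in> carrier P. g (h x) = f x))"


section \<open>Complexes\<close>

text \<open>A projective resolution \<^term>\<open>F\<close> is indexed by \<^typ>\<open>int\<close> with \<^term>\<open>F i\<close> zero for negative
  \<^term>\<open>i\<close>; the differential \<^term>\<open>d i\<close> goes from \<^term>\<open>F i\<close> to \<^term>\<open>F (i - 1)\<close>.\<close>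

definition projective_resolution ::
    "('a, 'r) ring_scheme \<Rightarrow> (int \<Rightarrow> ('a, 'b) module) \<Rightarrow> (int \<Rightarrow> 'b \<Rightarrow> 'b) \<Rightarrow> ('b \<Rightarrow> 'c) \<Rightarrow>
     ('a, 'c) module \<Rightarrow> bool" where
  "projective_resolution R F d aug M \<longleftrightarrow>
     module R M \<and>
     (\<forall>i. projective_module R (F i)) \<and>
     (\<forall>i<0. carrier (F i) = {\<zero>\<^bsub>F i\<^esub>}) \<and>
     (\<forall>i. d i \<in> module_hom R (F i) (F (i - 1))) \<and>
     aug \<in> module_hom R (F 0) M \<and>
     aug ` carrier (F 0) = carrier M \<and>
     a_kernel (F 0) M aug = d 1 ` carrier (F 1) \<and>
     (\<forall>i\<ge>1. a_kernel (F i) (F (i - 1)) (d i) = d (i + 1) ` carrier (F (i + 1)))"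

text \<open>Cochain complexes: \<^term>\<open>d n\<close> goes from \<^term>\<open>C n\<close> to \<^term>\<open>C (n + 1)\<close>.\<close>

definition cocycle_module ::
    "(int \<Rightarrow> ('a, 'b) module) \<Rightarrow> (int \<Rightarrow> 'b \<Rightarrow> 'b) \<Rightarrow> int \<Rightarrow> ('a, 'b) module" where
  "cocycle_module C d n = (C n)\<lparr>carrier := a_kernel (C n) (C (n + 1)) (d n)\<rparr>"

definition coboundaries ::
    "(int \<Rightarrow> ('a, 'b) module) \<Rightarrow> (int \<Rightarrow> 'b \<Rightarrow> 'b) \<Rightarrow> int \<Rightarrow> 'b set" where
  "coboundaries C d n = d (n - 1) ` carrier (C (n - 1))"

definition cohomology ::
    "(int \<Rightarrow> ('a, 'b) module) \<Rightarrow> (int \<Rightarrow> 'b \<Rightarrow> 'b) \<Rightarrow> int \<Rightarrow> ('a, 'b set) module" where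
  "cohomology C d n = quot_module (cocycle_module C d n) (coboundaries C d n)"

text \<open>\<open>(-1)\<^sup>n x\<close> in the additive group of \<^term>\<open>M\<close>.\<close>

definition sgn_act :: "('a, 'b) module \<Rightarrow> int \<Rightarrow> 'b \<Rightarrow> 'b" where
  "sgn_act M n x = (if even n then x else \<ominus>\<^bsub>M\<^esub> x)"

definition hom_cx ::
    "('a, 'r) ring_scheme \<Rightarrow> (int \<Rightarrow> ('a, 'b) module) \<Rightarrow> (int \<Rightarrow> ('a, 'c) module) \<Rightarrow>
     int \<Rightarrow> ('a, int \<Rightarrow> 'b \<Rightarrow> 'c) module" where
  "hom_cx R F G n = prod_module UNIV (\<lambda>i. hom_module R (F i) (G (i - n)))"

definition hom_diff ::
    "(int \<Rightarrow> ('a, 'b) module) \<Rightarrow> (int \<Rightarrow> 'b \<Rightarrow> 'b) \<Rightarrow> (int \<Rightarrow> ('a, 'c) module) \<Rightarrow>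
     (int \<Rightarrow> 'c \<Rightarrow> 'c) \<Rightarrow> int \<Rightarrow> (int \<Rightarrow> 'b \<Rightarrow> 'c) \<Rightarrow> (int \<Rightarrow> 'b \<Rightarrow> 'c)" where
  "hom_diff F dF G dG n \<beta> = (\<lambda>i. \<lambda>x \<in> carrier (F i).
     dG (i - n) (\<beta> i x) \<ominus>\<^bsub>G (i - n - 1)\<^esub> sgn_act (G (i - n - 1)) n (\<beta> (i - 1) (dF i x)))"

definition hom_bounded ::
    "('a, 'r) ring_scheme \<Rightarrow> (int \<Rightarrow> ('a, 'b) module) \<Rightarrow> (int \<Rightarrow> ('a, 'c) module) \<Rightarrow>
     int \<Rightarrow> (int \<Rightarrow> 'b \<Rightarrow> 'c) set" where
  "hom_bounded R F G n = {\<beta> \<in> carrier (hom_cx R F G n).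
     \<exists>N. \<forall>i\<ge>N. \<beta> i = \<zero>\<^bsub>hom_module R (F i) (G (i - n))\<^esub>}"


section \<open>Graded algebras and graded left modules\<close>

text \<open>Everything is graded by upper degree. The operations carry the degrees of their arguments as
  parameters: \<^term>\<open>amult A m n a b\<close> is the product of \<^term>\<open>a\<close> of degree \<^term>\<open>m\<close> and \<^term>\<open>b\<close> of
  degree \<^term>\<open>n\<close>, and similarly for \<open>mact\<close>.\<close>

record ('k, 'e) gr_algebra =
  acomp :: "int \<Rightarrow> ('k, 'e) module"
  amult :: "int \<Rightarrow> int \<Rightarrow> 'e \<Rightarrow> 'e \<Rightarrow> 'e"
  aone :: "'e"

record ('k, 'e, 'v) gr_module =
  mcomp :: "int \<Rightarrow> ('k, 'v) module"
  mact :: "int \<Rightarrow> int \<Rightarrow> 'e \<Rightarrow> 'v \<Rightarrow> 'v"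

definition graded_left_module ::
    "('k, 'r) ring_scheme \<Rightarrow> ('k, 'e) gr_algebra \<Rightarrow> ('k, 'e, 'v) gr_module \<Rightarrow> bool" where
  "graded_left_module K A M \<longleftrightarrow>
     (\<forall>n. module K (mcomp M n)) \<and>
     (\<forall>m n. \<forall>a \<in> carrier (acomp A m). mact M m n a \<in> module_hom K (mcomp M n) (mcomp M (m + n))) \<and>
     (\<forall>m n. \<forall>x \<in> carrier (mcomp M n).
        (\<lambda>a. mact M m n a x) \<in> module_hom K (acomp A m) (mcomp M (m + n))) \<and>
     (\<forall>n. \<forall>x \<in> carrier (mcomp M n). mact M 0 n (aone A) x = x) \<and>
     (\<forall>l m n. \<forall>a \<in> carrier (acomp A l). \<forall>b \<in> carrier (acomp A m). \<forall>x \<in> carrier (mcomp M n).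
        mact M (l + m) n (amult A l m a b) x = mact M l (m + n) a (mact M m n b x))"

text \<open>Homomorphisms of degree \<^term>\<open>j\<close>, with the sign rule
  \<open>f (a x) = (-1)\<^bsup>j|a|\<^esup> a (f x)\<close>.\<close>

definition gr_hom ::
    "('k, 'r) ring_scheme \<Rightarrow> ('k, 'e) gr_algebra \<Rightarrow> int \<Rightarrow> ('k, 'e, 'v) gr_module \<Rightarrow>
     ('k, 'e, 'w) gr_module \<Rightarrow> (int \<Rightarrow> 'v \<Rightarrow> 'w) set" where
  "gr_hom K A j M N = {f.
     (\<forall>n. f n \<in> module_hom K (mcomp M n) (mcomp N (n + j))) \<and>
     (\<forall>m n. \<forall>a \<in> carrier (acomp A m). \<forall>x \<in> carrier (mcomp M n).
        f (m + n) (mact M m n a x) =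
          sgn_act (mcomp N (m + n + j)) (j * m) (mact N m (n + j) a (f n x)))}"

definition gr_hom_module ::
    "('k, 'r) ring_scheme \<Rightarrow> ('k, 'e) gr_algebra \<Rightarrow> int \<Rightarrow> ('k, 'e, 'v) gr_module \<Rightarrow>
     ('k, 'e, 'w) gr_module \<Rightarrow> ('k, int \<Rightarrow> 'v \<Rightarrow> 'w) module" where
  "gr_hom_module K A j M N =
     (let H = prod_module UNIV (\<lambda>n. hom_module K (mcomp M n) (mcomp N (n + j)))
      in H\<lparr>carrier := carrier H \<inter> gr_hom K A j M N\<rparr>)"

definition gr_short_exact ::
    "('k, 'r) ring_scheme \<Rightarrow> ('k, 'e) gr_algebra \<Rightarrow> ('k, 'e, 'u) gr_module \<Rightarrow> (int \<Rightarrow> 'u \<Rightarrow> 'v) \<Rightarrow>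
     ('k, 'e, 'v) gr_module \<Rightarrow> (int \<Rightarrow> 'v \<Rightarrow> 'w) \<Rightarrow> ('k, 'e, 'w) gr_module \<Rightarrow> bool" where
  "gr_short_exact K A L f M g N \<longleftrightarrow>
     graded_left_module K A L \<and> graded_left_module K A M \<and> graded_left_module K A N \<and>
     f \<in> gr_hom K A 0 L M \<and> g \<in> gr_hom K A 0 M N \<and>
     (\<forall>n. inj_on (f n) (carrier (mcomp L n)) \<and>
          f n ` carrier (mcomp L n) = a_kernel (mcomp M n) (mcomp N n) (g n) \<and>
          g n ` carrier (mcomp M n) = carrier (mcomp N n))"

definition gr_submodule ::
    "('k, 'r) ring_scheme \<Rightarrow> ('k, 'e) gr_algebra \<Rightarrow> ('k, 'e, 'v) gr_module \<Rightarrow> (int \<Rightarrow> 'v set) \<Rightarrow> bool"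
  where
  "gr_submodule K A M T \<longleftrightarrow>
     (\<forall>n. submodule (T n) K (mcomp M n)) \<and>
     (\<forall>m n. \<forall>a \<in> carrier (acomp A m). \<forall>x \<in> T n. mact M m n a x \<in> T (m + n))"

definition has_direct_complement ::
    "('k, 'r) ring_scheme \<Rightarrow> ('k, 'e) gr_algebra \<Rightarrow> ('k, 'e, 'v) gr_module \<Rightarrow> (int \<Rightarrow> 'v set) \<Rightarrow> bool"
  where
  "has_direct_complement K A M U \<longleftrightarrow>
     (\<exists>T. gr_submodule K A M T \<and>
        (\<forall>n. U n \<inter> T n = {\<zero>\<^bsub>mcomp M n\<^esub>} \<and> U n <+>\<^bsub>mcomp M n\<^esub> T n = carrier (mcomp M n)))"

definition regular_module :: "('k, 'e) gr_algebra \<Rightarrow> ('k, 'e, 'e) gr_module" where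
  "regular_module A = \<lparr>mcomp = acomp A, mact = amult A\<rparr>"

text \<open>The algebra \<^term>\<open>B\<close> as a left module over the source of a homomorphism \<^term>\<open>h\<close> into it.\<close>

definition module_via ::
    "(int \<Rightarrow> 'e \<Rightarrow> 'f) \<Rightarrow> ('k, 'f) gr_algebra \<Rightarrow> ('k, 'e, 'f) gr_module" where
  "module_via h B = \<lparr>mcomp = acomp B, mact = (\<lambda>m n a x. amult B m n (h m a) x)\<rparr>"

definition gr_quot_module ::
    "('k, 'e, 'v) gr_module \<Rightarrow> (int \<Rightarrow> 'v set) \<Rightarrow> ('k, 'e, 'v set) gr_module" where
  "gr_quot_module M T =
     \<lparr>mcomp = (\<lambda>n. quot_module (mcomp M n) (T n)),
      mact = (\<lambda>m n a. quot_map (mcomp M (m + n)) (T (m + n)) (mact M m n a))\<rparr>"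

definition degree_ge_one :: "('k, 'e) gr_algebra \<Rightarrow> int \<Rightarrow> 'e set" where
  "degree_ge_one A n = (if n \<ge> 1 then carrier (acomp A n) else {\<zero>\<^bsub>acomp A n\<^esub>})"

definition gr_dual ::
    "('k, 'r) ring_scheme \<Rightarrow> ('k, 'e) gr_algebra \<Rightarrow> ('k, 'e, 'e \<Rightarrow> 'k) gr_module" where
  "gr_dual K A =
     \<lparr>mcomp = (\<lambda>n. hom_module K (acomp A (- n)) (ring_module K)),
      mact = (\<lambda>m n a f. \<lambda>b \<in> carrier (acomp A (- (m + n))).
        sgn_act (ring_module K) (m * (n + - (m + n))) (f (amult A (- (m + n)) m b a)))\<rparr>"

definition gr_shift :: "int \<Rightarrow> ('k, 'e, 'v) gr_module \<Rightarrow> ('k, 'e, 'v) gr_module" where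
  "gr_shift s M =
     \<lparr>mcomp = (\<lambda>n. mcomp M (n + s)),
      mact = (\<lambda>m n a x. sgn_act (mcomp M (m + n + s)) (m * s) (mact M m (n + s) a x))\<rparr>"

definition gr_dsum ::
    "('k, 'e, 'v) gr_module \<Rightarrow> ('k, 'e, 'w) gr_module \<Rightarrow> ('k, 'e, 'v \<times> 'w) gr_module" where
  "gr_dsum M N =
     \<lparr>mcomp = (\<lambda>n. dsum_module (mcomp M n) (mcomp N n)),
      mact = (\<lambda>m n a x. (mact M m n a (fst x), mact N m n a (snd x)))\<rparr>"

definition gr_coprod ::
    "'i set \<Rightarrow> ('i \<Rightarrow> ('k, 'e, 'v) gr_module) \<Rightarrow> ('k, 'e, 'i \<Rightarrow> 'v) gr_module" where
  "gr_coprod J M =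
     \<lparr>mcomp = (\<lambda>n. coprod_module J (\<lambda>j. mcomp (M j) n)),
      mact = (\<lambda>m n a x. \<lambda>j \<in> J. mact (M j) m n a (x j))\<rparr>"

definition gr_power :: "('k, 'e, 'v) gr_module \<Rightarrow> nat \<Rightarrow> ('k, 'e, nat \<Rightarrow> 'v) gr_module" where
  "gr_power M r = gr_coprod {..<r} (\<lambda>_. M)"

text \<open>As for \<^const>\<open>projective_module\<close>, the types of the test modules are large enough to include
  the surjection onto \<^term>\<open>P\<close> from the graded free module on the homogeneous elements of
  \<^term>\<open>P\<close>, whose elements are finitely supported functions \<^typ>\<open>int \<times> 'v \<Rightarrow> 'e\<close>.\<close>

definition gr_projective ::
    "('k, 'r) ring_scheme \<Rightarrow> ('k, 'e) gr_algebra \<Rightarrow> ('k, 'e, 'v) gr_module \<Rightarrow> bool" where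
  "gr_projective K A P \<longleftrightarrow> graded_left_module K A P \<and>
     (\<forall>(M :: ('k, 'e, int \<times> 'v \<Rightarrow> 'e) gr_module) (N :: ('k, 'e, 'v) gr_module) g f.
        graded_left_module K A M \<and> graded_left_module K A N \<and> g \<in> gr_hom K A 0 M N \<and>
        (\<forall>n. g n ` carrier (mcomp M n) = carrier (mcomp N n)) \<and> f \<in> gr_hom K A 0 P N \<longrightarrow>
        (\<exists>h \<in> gr_hom K A 0 P M. \<forall>n. \<forall>x \<in> carrier (mcomp P n). g n (h n x) = f n x))"

definition gr_projective_resolution ::
    "('k, 'r) ring_scheme \<Rightarrow> ('k, 'e) gr_algebra \<Rightarrow> (int \<Rightarrow> ('k, 'e, 'v) gr_module) \<Rightarrow>
     (int \<Rightarrow> int \<Rightarrow> 'v \<Rightarrow> 'v) \<Rightarrow> (int \<Rightarrow> 'v \<Rightarrow> 'w) \<Rightarrow> ('k, 'e, 'w) gr_module \<Rightarrow> bool" where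
  "gr_projective_resolution K A P d aug M \<longleftrightarrow>
     graded_left_module K A M \<and>
     (\<forall>i. gr_projective K A (P i)) \<and>
     (\<forall>i<0. \<forall>n. carrier (mcomp (P i) n) = {\<zero>\<^bsub>mcomp (P i) n\<^esub>}) \<and>
     (\<forall>i. d i \<in> gr_hom K A 0 (P i) (P (i - 1))) \<and>
     aug \<in> gr_hom K A 0 (P 0) M \<and>
     (\<forall>n. aug n ` carrier (mcomp (P 0) n) = carrier (mcomp M n)) \<and>
     (\<forall>n. a_kernel (mcomp (P 0) n) (mcomp M n) (aug n) = d 1 n ` carrier (mcomp (P 1) n)) \<and>
     (\<forall>i\<ge>1. \<forall>n. a_kernel (mcomp (P i) n) (mcomp (P (i - 1)) n) (d i n) =
        d (i + 1) n ` carrier (mcomp (P (i + 1)) n))"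

text \<open>The degree \<^term>\<open>j\<close> part of \<open>Ext\<^sup>n\<close> over \<^term>\<open>A\<close> into \<^term>\<open>N\<close>, computed from a graded
  projective resolution \<^term>\<open>P\<close> with differential \<^term>\<open>d\<close>. The usual sign of the differential
  \<open>f \<mapsto> \<plusminus> f \<circ> d\<close> is omitted: it changes neither kernels nor images.\<close>

definition gr_Ext ::
    "('k, 'r) ring_scheme \<Rightarrow> ('k, 'e) gr_algebra \<Rightarrow> (int \<Rightarrow> ('k, 'e, 'v) gr_module) \<Rightarrow>
     (int \<Rightarrow> int \<Rightarrow> 'v \<Rightarrow> 'v) \<Rightarrow> ('k, 'e, 'w) gr_module \<Rightarrow> int \<Rightarrow> int \<Rightarrow>
     ('k, (int \<Rightarrow> 'v \<Rightarrow> 'w) set) module" where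
  "gr_Ext K A P d N n j =
     cohomology (\<lambda>i. gr_hom_module K A j (P i) N)
       (\<lambda>i f. \<lambda>l. \<lambda>x \<in> carrier (mcomp (P (i + 1)) l). f l (d (i + 1) l x)) n"


section \<open>Cohomology algebras\<close>

definition quot_algebra ::
    "('k, 'e) gr_algebra \<Rightarrow> (int \<Rightarrow> 'e set) \<Rightarrow> ('k, 'e set) gr_algebra" where
  "quot_algebra A J =
     \<lparr>acomp = (\<lambda>n. quot_module (acomp A n) (J n)),
      amult = (\<lambda>m n. quot_map2 (acomp A (m + n)) (J (m + n)) (amult A m n)),
      aone = J 0 +>\<^bsub>acomp A 0\<^esub> aone A\<rparr>"

definition cohomology_algebra ::
    "('k, 'e) gr_algebra \<Rightarrow> (int \<Rightarrow> 'e \<Rightarrow> 'e) \<Rightarrow> ('k, 'e set) gr_algebra" where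
  "cohomology_algebra A d =
     quot_algebra (A\<lparr>acomp := cocycle_module (acomp A) d\<rparr>) (coboundaries (acomp A) d)"

definition residue_algebra :: "('a, 'e) gr_algebra \<Rightarrow> ('a set, 'e) gr_algebra" where
  "residue_algebra A =
     \<lparr>acomp = (\<lambda>n. residue_scalars (acomp A n)), amult = amult A, aone = aone A\<rparr>"

definition endo_algebra ::
    "('a, 'r) ring_scheme \<Rightarrow> (int \<Rightarrow> ('a, 'b) module) \<Rightarrow> ('a, int \<Rightarrow> 'b \<Rightarrow> 'b) gr_algebra" where
  "endo_algebra R F =
     \<lparr>acomp = hom_cx R F F,
      amult = (\<lambda>m n \<alpha> \<beta>. \<lambda>i. compose (carrier (F i)) (\<alpha> (i - n)) (\<beta> i)),
      aone = (\<lambda>i. \<lambda>x \<in> carrier (F i). x)\<rparr>"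

definition stable_endo_algebra ::
    "('a, 'r) ring_scheme \<Rightarrow> (int \<Rightarrow> ('a, 'b) module) \<Rightarrow> ('a, (int \<Rightarrow> 'b \<Rightarrow> 'b) set) gr_algebra" where
  "stable_endo_algebra R F = quot_algebra (endo_algebra R F) (hom_bounded R F F)"

definition stable_hom_diff ::
    "('a, 'r) ring_scheme \<Rightarrow> (int \<Rightarrow> ('a, 'b) module) \<Rightarrow> (int \<Rightarrow> 'b \<Rightarrow> 'b) \<Rightarrow> int \<Rightarrow>
     (int \<Rightarrow> 'b \<Rightarrow> 'b) set \<Rightarrow> (int \<Rightarrow> 'b \<Rightarrow> 'b) set" where
  "stable_hom_diff R F d n =
     quot_map (hom_cx R F F (n + 1)) (hom_bounded R F F (n + 1)) (hom_diff F d F d n)"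

text \<open>\<open>Ext\<close> and stable \<open>Ext\<close> of the residue field of \<^term>\<open>R\<close> with itself, as algebras over the
  residue field, computed from a projective resolution \<^term>\<open>F\<close> of it with differential
  \<^term>\<open>d\<close>, and the canonical map between them.\<close>

definition Ext_algebra ::
    "('a, 'r) ring_scheme \<Rightarrow> (int \<Rightarrow> ('a, 'b) module) \<Rightarrow> (int \<Rightarrow> 'b \<Rightarrow> 'b) \<Rightarrow>
     ('a set, (int \<Rightarrow> 'b \<Rightarrow> 'b) set) gr_algebra" where
  "Ext_algebra R F d =
     residue_algebra (cohomology_algebra (endo_algebra R F) (hom_diff F d F d))"

definition stable_Ext_algebra ::
    "('a, 'r) ring_scheme \<Rightarrow> (int \<Rightarrow> ('a, 'b) module) \<Rightarrow> (int \<Rightarrow> 'b \<Rightarrow> 'b) \<Rightarrow>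
     ('a set, (int \<Rightarrow> 'b \<Rightarrow> 'b) set set) gr_algebra" where
  "stable_Ext_algebra R F d =
     residue_algebra (cohomology_algebra (stable_endo_algebra R F) (stable_hom_diff R F d))"

definition Ext_to_stable_Ext ::
    "('a, 'r) ring_scheme \<Rightarrow> (int \<Rightarrow> ('a, 'b) module) \<Rightarrow> (int \<Rightarrow> 'b \<Rightarrow> 'b) \<Rightarrow> int \<Rightarrow>
     (int \<Rightarrow> 'b \<Rightarrow> 'b) set \<Rightarrow> (int \<Rightarrow> 'b \<Rightarrow> 'b) set set" where
  "Ext_to_stable_Ext R F d n =
     quot_map (acomp (stable_endo_algebra R F) n)
       (coboundaries (acomp (stable_endo_algebra R F)) (stable_hom_diff R F d) n)
       (\<lambda>\<beta>. hom_bounded R F F n +>\<^bsub>hom_cx R F F n\<^esub> \<beta>)"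

end

theory Submission
  imports Defs
begin

text \<open>The maximal ideal \<open>m\<close>, with minimal generators \<open>c\<^sub>0, \<dots>, c\<^sub>e\<^sub>-\<^sub>1\<close>, is a direct sum of copies of \<open>k\<close>,
  so the first syzygy of \<open>k\<close> is \<open>k\<^sup>e\<close>. On the level of chain maps this produces cocycles \<open>v\<^sub>i\<close> of
  degree 1, the coordinates of the syzygy, and stable cocycles \<open>w\<^sub>i\<close> of degree -1, the inclusions of
  its summands, such that \<open>v\<^sub>i w\<^sub>j = \<delta>\<^sub>i\<^sub>j\<close> and \<open>\<Sum> w\<^sub>i v\<^sub>i = 1\<close> in \<open>S\<close>. Multiplication by the \<open>w\<^sub>i\<close> on the right
  exhibits \<open>E\<close> as the tensor algebra on the \<open>v\<^sub>i\<close>, and \<open>s \<mapsto> (v\<^sub>i s)\<^sub>i\<close> is an isomorphism from \<open>S\<close> to \<open>S\<^sup>e\<close>.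
  Moreover every element of \<open>S\<close> is carried into \<open>\<iota> E\<close> by all elements of \<open>E\<close> of large degree.

  (1) Let \<open>U\<^sup>n\<close> consist of the \<open>s\<close> in \<open>S\<^sup>n\<close> with all \<open>v\<^sub>i s\<close> in \<open>\<iota> E\<close>. Coordinates on \<open>U\<^sup>n / \<iota> E\<^sup>n\<close> extend to
  functionals \<open>\<theta>\<close> on \<open>S\<^sup>n\<close>, and the functionals \<open>b \<mapsto> \<theta> (b s)\<close> are the components of the map to the
  shifted copies of \<open>I\<close>; its kernel is \<open>\<iota> E\<close> because \<open>E\<close> is free on the \<open>v\<^sub>i\<close>. (2) A complement of
  \<open>\<iota> E\<close> is impossible since \<open>v\<^sub>0 w = \<iota> 1\<close> has a solution \<open>w\<close> of degree -1, where \<open>E\<close> vanishes.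
  (3) The augmentation ideal of \<open>E\<close> is free on the \<open>v\<^sub>i\<close>, so all boundaries in a resolution of \<open>k\<close> split
  from degree 1 on, and a homomorphism from the first syzygy to \<open>S\<close> extends because \<open>S \<cong> S\<^sup>e\<close>.\<close>

text \<open>The obstacle is that the \<open>w i\<close> are not cocycles: the boundary of
  \<open>w i\<close> survives in homological degree 0, where it comes from multiplication by the
  generator \<open>c i\<close>. A cochain of positive degree sends \<open>F 0\<close> to a zero
  module and so ignores this defect; hence right multiplication by \<open>w i\<close> still acts on
  E, but only on representatives and after a check in degree 0. The multiplicities are dimensions.
  An element s of U^n is the same as an arbitrary tuple (v_i s) in (E^(n+1))^e, and E^n sits inside
  as the tuples (v_i a). As E^n has dimension e^n, the quotient has dimension e^(n+2) - e^n = e^n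
  (e^2 - 1) for n \<ge> 0, and e for n = -1 because E^(-1) = 0. The functionals have to live on all
  of S^n since b s need not lie in U^n; no finiteness of S^n is at hand, so they are extended by
  Zorn's lemma. In (3) the resolution is arbitrary. Instead of comparing it with the standard one, a
  Schanuel argument produces the splittings inside the given resolution.\<close>

lemma module_homI:
  assumes "\<And>x. x \<in> carrier M \<Longrightarrow> f x \<in> carrier N"
    and "\<And>x y. x \<in> carrier M \<Longrightarrow> y \<in> carrier M \<Longrightarrow> f (x \<oplus>\<^bsub>M\<^esub> y) = f x \<oplus>\<^bsub>N\<^esub> f y"
    and "\<And>r x. r \<in> carrier R \<Longrightarrow> x \<in> carrier M \<Longrightarrow> f (r \<odot>\<^bsub>M\<^esub> x) = r \<odot>\<^bsub>N\<^esub> f x"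
  shows "f \<in> module_hom R M N"
  using assms by (auto simp: module_hom_def hom_def)

lemma module_homD:
  assumes "f \<in> module_hom R M N"
  shows "x \<in> carrier M \<Longrightarrow> f x \<in> carrier N"
    and "x \<in> carrier M \<Longrightarrow> y \<in> carrier M \<Longrightarrow> f (x \<oplus>\<^bsub>M\<^esub> y) = f x \<oplus>\<^bsub>N\<^esub> f y"
    and "r \<in> carrier R \<Longrightarrow> x \<in> carrier M \<Longrightarrow> f (r \<odot>\<^bsub>M\<^esub> x) = r \<odot>\<^bsub>N\<^esub> f x"
  using assms by (auto simp: module_hom_def hom_def)

lemma additive_zero:
  assumes "abelian_group M" "abelian_group N"
    and "\<And>x. x \<in> carrier M \<Longrightarrow> f x \<in> carrier N"
    and "\<And>x y. x \<in> carrier M \<Longrightarrow> y \<in> carrier M \<Longrightarrow> f (x \<oplus>\<^bsub>M\<^esub> y) = f x \<oplus>\<^bsub>N\<^esub> f y"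
  shows "f \<zero>\<^bsub>M\<^esub> = \<zero>\<^bsub>N\<^esub>"
proof -
  interpret M: abelian_group M by fact
  interpret N: abelian_group N by fact
  have "f \<zero>\<^bsub>M\<^esub> \<oplus>\<^bsub>N\<^esub> f \<zero>\<^bsub>M\<^esub> = f \<zero>\<^bsub>M\<^esub>"
    using assms(4)[of "\<zero>\<^bsub>M\<^esub>" "\<zero>\<^bsub>M\<^esub>"] by simp
  then show ?thesis
    using assms(3)[of "\<zero>\<^bsub>M\<^esub>"] by (simp add: N.add.r_cancel_one')
qed

lemma additive_neg:
  assumes "abelian_group M" "abelian_group N"
    and f: "\<And>x. x \<in> carrier M \<Longrightarrow> f x \<in> carrier N"
    and add: "\<And>x y. x \<in> carrier M \<Longrightarrow> y \<in> carrier M \<Longrightarrow> f (x \<oplus>\<^bsub>M\<^esub> y) = f x \<oplus>\<^bsub>N\<^esub> f y"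
    and x: "x \<in> carrier M"
  shows "f (\<ominus>\<^bsub>M\<^esub> x) = \<ominus>\<^bsub>N\<^esub> f x"
proof -
  interpret M: abelian_group M by fact
  interpret N: abelian_group N by fact
  have "f (\<ominus>\<^bsub>M\<^esub> x) \<oplus>\<^bsub>N\<^esub> f x = \<zero>\<^bsub>N\<^esub>"
    using add[of "\<ominus>\<^bsub>M\<^esub> x" x] x additive_zero[OF assms(1,2) f add] by (simp add: M.l_neg)
  then show ?thesis
    using f x by (simp add: N.minus_equality[symmetric])
qed

lemma additive_finsum:
  assumes "abelian_group M" "abelian_group N"
    and f: "\<And>x. x \<in> carrier M \<Longrightarrow> f x \<in> carrier N"
    and add: "\<And>x y. x \<in> carrier M \<Longrightarrow> y \<in> carrier M \<Longrightarrow> f (x \<oplus>\<^bsub>M\<^esub> y) = f x \<oplus>\<^bsub>N\<^esub> f y"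
    and g: "g \<in> A \<rightarrow> carrier M"
  shows "f (finsum M g A) = finsum N (\<lambda>i. f (g i)) A"
proof -
  interpret M: abelian_group M by fact
  interpret N: abelian_group N by fact
  show ?thesis
  proof (cases "finite A")
    case True
    then show ?thesis using g
    proof (induction A rule: finite_induct)
      case empty
      then show ?case using additive_zero[OF assms(1,2) f add] by simp
    next
      case (insert a A)
      then have "g \<in> A \<rightarrow> carrier M" "g a \<in> carrier M" "(\<lambda>i. f (g i)) \<in> A \<rightarrow> carrier N"
        "f (g a) \<in> carrier N"
        using f by auto
      then show ?case using insert add by simp
    qed
  qed (use additive_zero[OF assms(1,2) f add] in \<open>simp add: M.finsum_infinite N.finsum_infinite\<close>)
qed

lemma module_abelian: "module R M \<Longrightarrow> abelian_group M"
  by (simp add: module_def)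

lemma module_cring: "module R M \<Longrightarrow> cring R"
  by (simp add: module_def)

context
  fixes R :: "('a, 'r) ring_scheme" and M :: "('a, 'b) module" and N :: "('a, 'c) module" and f
  assumes M: "module R M" and N: "module R N" and f: "f \<in> module_hom R M N"
begin

lemma module_hom_zero: "f \<zero>\<^bsub>M\<^esub> = \<zero>\<^bsub>N\<^esub>"
  using additive_zero[OF module_abelian[OF M] module_abelian[OF N] module_homD(1,2)[OF f]] .

lemma module_hom_neg: "x \<in> carrier M \<Longrightarrow> f (\<ominus>\<^bsub>M\<^esub> x) = \<ominus>\<^bsub>N\<^esub> f x"
  using additive_neg[OF module_abelian[OF M] module_abelian[OF N] module_homD(1,2)[OF f]] .

lemma module_hom_minus:
  "x \<in> carrier M \<Longrightarrow> y \<in> carrier M \<Longrightarrow> f (x \<ominus>\<^bsub>M\<^esub> y) = f x \<ominus>\<^bsub>N\<^esub> f y"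
  using module_hom_neg module_homD(2)[OF f, of x "\<ominus>\<^bsub>M\<^esub> y"] module_abelian[OF M]
  by (simp add: a_minus_def abelian_group.a_inv_closed)

lemma module_hom_finsum:
  "g \<in> A \<rightarrow> carrier M \<Longrightarrow> f (finsum M g A) = finsum N (\<lambda>i. f (g i)) A"
  using additive_finsum[OF module_abelian[OF M] module_abelian[OF N] module_homD(1,2)[OF f]] .

lemma module_hom_sgn_act: "x \<in> carrier M \<Longrightarrow> f (sgn_act M n x) = sgn_act N n (f x)"
  by (simp add: sgn_act_def module_hom_neg)

end

lemma module_hom_compose:
  "f \<in> module_hom R L M \<Longrightarrow> g \<in> module_hom R M N \<Longrightarrow> (\<lambda>x. g (f x)) \<in> module_hom R L N"
  by (intro module_homI) (auto simp: module_homD)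

lemma module_hom_cong:
  assumes "module R M" "f \<in> module_hom R M N" "\<And>x. x \<in> carrier M \<Longrightarrow> f x = g x"
  shows "g \<in> module_hom R M N"
proof -
  interpret module R M by fact
  show ?thesis
    by (intro module_homI) (use assms(2,3) in \<open>auto simp: module_homD[OF assms(2)] simp flip: assms(3)\<close>)
qed

lemma module_hom_ident: "(\<lambda>x. x) \<in> module_hom R M M"
  by (intro module_homI) auto

lemma module_hom_const_zero:
  assumes "module R N"
  shows "(\<lambda>x. \<zero>\<^bsub>N\<^esub>) \<in> module_hom R M N"
proof -
  interpret module R N by fact
  show ?thesis by (intro module_homI) auto
qed

lemma module_hom_plus:
  assumes "module R M" "module R N" "f \<in> module_hom R M N" "g \<in> module_hom R M N"
  shows "(\<lambda>x. f x \<oplus>\<^bsub>N\<^esub> g x) \<in> module_hom R M N"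
proof -
  interpret M: module R M by fact
  interpret N: module R N by fact
  show ?thesis
    by (intro module_homI)
      (auto simp: module_homD[OF assms(3)] module_homD[OF assms(4)] N.smult_r_distr N.M.a_ac)
qed

lemma module_hom_scale:
  assumes "module R M" "module R N" "f \<in> module_hom R M N" "r \<in> carrier R"
  shows "(\<lambda>x. r \<odot>\<^bsub>N\<^esub> f x) \<in> module_hom R M N"
proof -
  interpret M: module R M by fact
  interpret N: module R N by fact
  show ?thesis
    by (intro module_homI)
      (use assms(4) in \<open>auto simp: module_homD[OF assms(3)] N.smult_r_distr M.R.m_comm simp flip: N.smult_assoc1\<close>)
qed

lemma module_hom_finsum_fun:
  assumes "module R M" "module R N" "\<And>i. i \<in> A \<Longrightarrow> f i \<in> module_hom R M N"
  shows "(\<lambda>x. finsum N (\<lambda>i. f i x) A) \<in> module_hom R M N"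
proof (cases "finite A")
  case True
  interpret N: module R N by fact
  show ?thesis using True assms(3)
  proof (induction A rule: finite_induct)
    case empty
    then show ?case using module_hom_const_zero[OF assms(2)] by simp
  next
    case (insert a A)
    have "(\<lambda>x. f a x \<oplus>\<^bsub>N\<^esub> finsum N (\<lambda>i. f i x) A) \<in> module_hom R M N"
      by (intro module_hom_plus assms(1,2)) (use insert in auto)
    then show ?case
    proof (rule module_hom_cong[OF assms(1)])
      fix x assume "x \<in> carrier M"
      then show "f a x \<oplus>\<^bsub>N\<^esub> finsum N (\<lambda>i. f i x) A = finsum N (\<lambda>i. f i x) (insert a A)"
        using insert by (subst N.M.finsum_insert) (auto intro: module_homD)
    qed
  qed
next
  case False
  interpret N: module R N by fact
  show ?thesis using False module_hom_const_zero[OF assms(2)] by (simp add: N.M.finsum_infinite)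
qed

context
  fixes R :: "('a, 'r) ring_scheme" and M :: "('a, 'b) module"
  assumes M: "module R M"
begin

interpretation M: module R M by (rule M)

lemma sgn_act_closed: "x \<in> carrier M \<Longrightarrow> sgn_act M n x \<in> carrier M"
  by (simp add: sgn_act_def)

lemma sgn_act_hom: "sgn_act M n \<in> module_hom R M M"
  by (intro module_homI) (auto simp: sgn_act_def M.M.minus_add M.smult_r_minus)

lemma sgn_act_sgn_act: "x \<in> carrier M \<Longrightarrow> sgn_act M a (sgn_act M b x) = sgn_act M (a + b) x"
  by (auto simp: sgn_act_def)

lemma sgn_act_zero: "sgn_act M n \<zero>\<^bsub>M\<^esub> = \<zero>\<^bsub>M\<^esub>"
  by (simp add: sgn_act_def)

end

lemma sgn_act_cong: "even (a - b) \<Longrightarrow> sgn_act M a x = sgn_act M b x"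
  by (auto simp: sgn_act_def)

lemma sgn_act_0 [simp]: "sgn_act M 0 x = x"
  by (simp add: sgn_act_def)

text \<open>Each axiom holds for images because it holds for preimages. The scalars may change along
  a surjection at the same time, which is how classes of cocycles become vector spaces over the
  residue field.\<close>

lemma module_image:
  assumes M: "module R M" and K: "cring K"
    and pi: "\<pi> \<in> ring_hom R K" "\<pi> ` carrier R = carrier K"
    and q: "q ` carrier M = carrier N" "q \<zero>\<^bsub>M\<^esub> = \<zero>\<^bsub>N\<^esub>"
    and q_add: "\<And>x y. x \<in> carrier M \<Longrightarrow> y \<in> carrier M \<Longrightarrow> q (x \<oplus>\<^bsub>M\<^esub> y) = q x \<oplus>\<^bsub>N\<^esub> q y"
    and q_smult: "\<And>r x. r \<in> carrier R \<Longrightarrow> x \<in> carrier M \<Longrightarrow> q (r \<odot>\<^bsub>M\<^esub> x) = \<pi> r \<odot>\<^bsub>N\<^esub> q x"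
  shows "module K N"
proof -
  interpret M: module R M by fact
  note [simp] = q(1)[symmetric] pi(2)[symmetric] q_add[symmetric] q_smult[symmetric] q(2)[symmetric]
    ring_hom_add[OF pi(1), symmetric] ring_hom_mult[OF pi(1), symmetric]
    ring_hom_one[OF pi(1), symmetric]
  show ?thesis
  proof (intro moduleI K abelian_groupI)
    fix x assume "x \<in> carrier N"
    then obtain x' where x': "x = q x'" "x' \<in> carrier M" by auto
    then show "\<exists>y\<in>carrier N. y \<oplus>\<^bsub>N\<^esub> x = \<zero>\<^bsub>N\<^esub>"
      by (intro bexI[of _ "q (\<ominus>\<^bsub>M\<^esub> x')"]) (auto simp: M.M.l_neg)
  qed (auto simp: M.M.a_ac M.smult_l_distr M.smult_r_distr M.smult_assoc1)
qed

lemma module_image_id: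
  assumes "module R M"
    and "q ` carrier M = carrier N" "q \<zero>\<^bsub>M\<^esub> = \<zero>\<^bsub>N\<^esub>"
    and "\<And>x y. x \<in> carrier M \<Longrightarrow> y \<in> carrier M \<Longrightarrow> q (x \<oplus>\<^bsub>M\<^esub> y) = q x \<oplus>\<^bsub>N\<^esub> q y"
    and "\<And>r x. r \<in> carrier R \<Longrightarrow> x \<in> carrier M \<Longrightarrow> q (r \<odot>\<^bsub>M\<^esub> x) = r \<odot>\<^bsub>N\<^esub> q x"
  shows "module R N"
  using module_image[OF assms(1) module_cring[OF assms(1)], of "\<lambda>x. x" q N] assms(2-)
  by (auto simp: ring_hom_def)

text \<open>The additive inverse is the multiple by the scalar -1, so stability under addition and
  scalars gives a subgroup.\<close>

lemma module_carrier_update: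
  assumes "module R M" "H \<subseteq> carrier M" "\<zero>\<^bsub>M\<^esub> \<in> H"
    and "\<And>x y. x \<in> H \<Longrightarrow> y \<in> H \<Longrightarrow> x \<oplus>\<^bsub>M\<^esub> y \<in> H"
    and smult: "\<And>r x. r \<in> carrier R \<Longrightarrow> x \<in> H \<Longrightarrow> r \<odot>\<^bsub>M\<^esub> x \<in> H"
  shows "submodule H R M" "module R (M\<lparr>carrier := H\<rparr>)"
proof -
  interpret M: module R M by fact
  show *: "submodule H R M"
  proof (intro M.submoduleI assms)
    fix a assume a: "a \<in> H"
    then have "(\<ominus>\<^bsub>R\<^esub> \<one>\<^bsub>R\<^esub>) \<odot>\<^bsub>M\<^esub> a \<in> H" by (intro smult) auto
    then show "\<ominus>\<^bsub>M\<^esub> a \<in> H" using a assms(2) by (auto simp: M.smult_l_minus subset_iff)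
  qed
  show "module R (M\<lparr>carrier := H\<rparr>)"
    by (rule submodule.submodule_is_module[OF * assms(1)])
qed

section \<open>Products, direct sums and modules of homomorphisms\<close>

lemma make_module_simps [simp]:
  "carrier (make_module C z a s) = C" "zero (make_module C z a s) = z"
  "add (make_module C z a s) = a" "smult (make_module C z a s) = s"
  by (simp_all add: make_module_def)

lemma ring_module_simps [simp]:
  "carrier (ring_module R) = carrier R" "zero (ring_module R) = zero R"
  "add (ring_module R) = add R" "smult (ring_module R) = monoid.mult R"
  by (simp_all add: ring_module_def)

lemma prod_module_simps [simp]:
  "carrier (prod_module J M) = (\<Pi>\<^sub>E j \<in> J. carrier (M j))"
  "zero (prod_module J M) = (\<lambda>j \<in> J. \<zero>\<^bsub>M j\<^esub>)"
  "add (prod_module J M) = (\<lambda>x y. \<lambda>j \<in> J. x j \<oplus>\<^bsub>M j\<^esub> y j)"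
  "smult (prod_module J M) = (\<lambda>r x. \<lambda>j \<in> J. r \<odot>\<^bsub>M j\<^esub> x j)"
  by (simp_all add: prod_module_def)

lemma coprod_module_simps [simp]:
  "carrier (coprod_module J M) =
     {x \<in> \<Pi>\<^sub>E j \<in> J. carrier (M j). finite {j \<in> J. x j \<noteq> \<zero>\<^bsub>M j\<^esub>}}"
  "zero (coprod_module J M) = (\<lambda>j \<in> J. \<zero>\<^bsub>M j\<^esub>)"
  "add (coprod_module J M) = (\<lambda>x y. \<lambda>j \<in> J. x j \<oplus>\<^bsub>M j\<^esub> y j)"
  "smult (coprod_module J M) = (\<lambda>r x. \<lambda>j \<in> J. r \<odot>\<^bsub>M j\<^esub> x j)"
  by (simp_all add: coprod_module_def)

lemma dsum_module_simps [simp]: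
  "carrier (dsum_module M N) = carrier M \<times> carrier N"
  "zero (dsum_module M N) = (\<zero>\<^bsub>M\<^esub>, \<zero>\<^bsub>N\<^esub>)"
  "add (dsum_module M N) = (\<lambda>x y. (fst x \<oplus>\<^bsub>M\<^esub> fst y, snd x \<oplus>\<^bsub>N\<^esub> snd y))"
  "smult (dsum_module M N) = (\<lambda>r x. (r \<odot>\<^bsub>M\<^esub> fst x, r \<odot>\<^bsub>N\<^esub> snd x))"
  by (simp_all add: dsum_module_def)

lemma hom_module_simps [simp]:
  "carrier (hom_module R M N) = module_hom R M N \<inter> extensional (carrier M)"
  "zero (hom_module R M N) = (\<lambda>x \<in> carrier M. \<zero>\<^bsub>N\<^esub>)"
  "add (hom_module R M N) = (\<lambda>f g. \<lambda>x \<in> carrier M. f x \<oplus>\<^bsub>N\<^esub> g x)"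
  "smult (hom_module R M N) = (\<lambda>r f. \<lambda>x \<in> carrier M. r \<odot>\<^bsub>N\<^esub> f x)"
  by (simp_all add: hom_module_def)

lemma ring_module_module:
  assumes "cring R"
  shows "module R (ring_module R)"
proof -
  interpret cring R by fact
  show ?thesis
    by (intro moduleI abelian_groupI assms) (auto simp: a_ac l_distr r_distr m_assoc intro: exI[of _ "\<ominus>\<^bsub>R\<^esub> _"] l_neg)
qed

lemma prod_module_module:
  assumes "cring R" and M: "\<And>j. j \<in> J \<Longrightarrow> module R (M j)"
  shows "module R (prod_module J M)"
proof -
  note ag = module_abelian[OF M]
  note am = abelian_group.axioms(1)[OF ag]
  show ?thesis
  proof (intro moduleI abelian_groupI assms)
    fix x assume x: "x \<in> carrier (prod_module J M)"
    show "\<exists>y\<in>carrier (prod_module J M). y \<oplus>\<^bsub>prod_module J M\<^esub> x = \<zero>\<^bsub>prod_module J M\<^esub>"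
      using x ag by (intro bexI[of _ "\<lambda>j\<in>J. \<ominus>\<^bsub>M j\<^esub> x j"])
        (auto simp: abelian_group.l_neg abelian_group.a_inv_closed PiE_def Pi_def intro!: restrict_ext)
  qed (auto simp: abelian_monoid.a_closed[OF am] abelian_monoid.zero_closed[OF am]
      abelian_monoid.a_assoc[OF am] abelian_monoid.l_zero[OF am] abelian_monoid.r_zero[OF am]
      module.smult_closed[OF M] module.smult_l_distr[OF M]
      module.smult_r_distr[OF M] module.smult_assoc1[OF M] module.smult_one[OF M]
      restrict_def PiE_def Pi_def extensional_def fun_eq_iff intro: abelian_monoid.a_comm[OF am])
qed

lemma hom_module_module:
  assumes "module R M" "module R N"
  shows "submodule (module_hom R M N \<inter> extensional (carrier M)) R (prod_module (carrier M) (\<lambda>_. N))"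
    and "module R (hom_module R M N)"
proof -
  interpret M: module R M by fact
  interpret N: module R N by fact
  have P: "module R (prod_module (carrier M) (\<lambda>_. N))"
    by (intro prod_module_module module_cring[OF assms(1)] assms)
  have sub: "module_hom R M N \<inter> extensional (carrier M) \<subseteq> carrier (prod_module (carrier M) (\<lambda>_. N))"
    by (auto simp: module_homD PiE_def)
  have zero: "\<zero>\<^bsub>prod_module (carrier M) (\<lambda>_. N)\<^esub> \<in> module_hom R M N \<inter> extensional (carrier M)"
    using module_hom_cong[OF assms(1) module_hom_const_zero[OF assms(2), of M], of "restrict (\<lambda>_. \<zero>\<^bsub>N\<^esub>) (carrier M)"]
    by auto
  have add: "x \<oplus>\<^bsub>prod_module (carrier M) (\<lambda>_. N)\<^esub> y \<in> module_hom R M N \<inter> extensional (carrier M)"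
    if "x \<in> module_hom R M N \<inter> extensional (carrier M)" "y \<in> module_hom R M N \<inter> extensional (carrier M)" for x y
    using module_hom_cong[OF assms(1) module_hom_plus[OF assms, of x y], of "\<lambda>j\<in>carrier M. x j \<oplus>\<^bsub>N\<^esub> y j"] that
    by auto
  have smult: "r \<odot>\<^bsub>prod_module (carrier M) (\<lambda>_. N)\<^esub> x \<in> module_hom R M N \<inter> extensional (carrier M)"
    if "r \<in> carrier R" "x \<in> module_hom R M N \<inter> extensional (carrier M)" for r x
    using module_hom_cong[OF assms(1) module_hom_scale[OF assms, of x r], of "\<lambda>j\<in>carrier M. r \<odot>\<^bsub>N\<^esub> x j"] that
    by auto
  show "submodule (module_hom R M N \<inter> extensional (carrier M)) R (prod_module (carrier M) (\<lambda>_. N))"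
    "module R (hom_module R M N)"
    unfolding hom_module_def by (rule module_carrier_update[OF P sub zero add smult]; assumption)+
qed

lemma coprod_module_module:
  assumes "cring R" and M: "\<And>j. j \<in> J \<Longrightarrow> module R (M j)"
  shows "module R (coprod_module J M)"
  unfolding coprod_module_def
proof (rule module_carrier_update(2)[OF prod_module_module[OF assms]])
  note am = abelian_group.axioms(1)[OF module_abelian[OF M]]
  let ?C = "{x \<in> \<Pi>\<^sub>E j \<in> J. carrier (M j). finite {j \<in> J. x j \<noteq> \<zero>\<^bsub>M j\<^esub>}}"
  show "?C \<subseteq> carrier (prod_module J M)" by auto
  show "\<zero>\<^bsub>prod_module J M\<^esub> \<in> ?C"
    by (auto simp: abelian_monoid.zero_closed[OF am] cong: conj_cong)
  fix x y assume x: "x \<in> ?C" and y: "y \<in> ?C"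
  have "{j \<in> J. x j \<oplus>\<^bsub>M j\<^esub> y j \<noteq> \<zero>\<^bsub>M j\<^esub>} \<subseteq> {j \<in> J. x j \<noteq> \<zero>\<^bsub>M j\<^esub>} \<union> {j \<in> J. y j \<noteq> \<zero>\<^bsub>M j\<^esub>}"
    by (auto simp: abelian_monoid.l_zero[OF am] abelian_monoid.zero_closed[OF am])
  then have "finite {j \<in> J. x j \<oplus>\<^bsub>M j\<^esub> y j \<noteq> \<zero>\<^bsub>M j\<^esub>}"
    by (rule finite_subset) (use x y in auto)
  then show "x \<oplus>\<^bsub>prod_module J M\<^esub> y \<in> ?C"
    using x y by (auto intro!: abelian_monoid.a_closed[OF am] simp: PiE_mem cong: conj_cong)
next
  let ?C = "{x \<in> \<Pi>\<^sub>E j \<in> J. carrier (M j). finite {j \<in> J. x j \<noteq> \<zero>\<^bsub>M j\<^esub>}}"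
  fix r x assume r: "r \<in> carrier R" and x: "x \<in> ?C"
  have "{j \<in> J. r \<odot>\<^bsub>M j\<^esub> x j \<noteq> \<zero>\<^bsub>M j\<^esub>} \<subseteq> {j \<in> J. x j \<noteq> \<zero>\<^bsub>M j\<^esub>}"
    using r by (auto simp: module.smult_r_null[OF M])
  then have "finite {j \<in> J. r \<odot>\<^bsub>M j\<^esub> x j \<noteq> \<zero>\<^bsub>M j\<^esub>}"
    by (rule finite_subset) (use x in auto)
  then show "r \<odot>\<^bsub>prod_module J M\<^esub> x \<in> ?C"
    using x r by (auto intro!: module.smult_closed[OF M] simp: PiE_mem cong: conj_cong)
qed

lemma dsum_module_module:
  assumes "module R M" "module R N"
  shows "module R (dsum_module M N)"
proof -
  interpret M: module R M by fact
  interpret N: module R N by fact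
  show ?thesis
  proof (intro moduleI abelian_groupI)
    fix x assume "x \<in> carrier (dsum_module M N)"
    then show "\<exists>y\<in>carrier (dsum_module M N). y \<oplus>\<^bsub>dsum_module M N\<^esub> x = \<zero>\<^bsub>dsum_module M N\<^esub>"
      by (intro bexI[of _ "(\<ominus>\<^bsub>M\<^esub> fst x, \<ominus>\<^bsub>N\<^esub> snd x)"]) (auto simp: M.M.l_neg N.M.l_neg)
  qed (auto simp: module_cring[OF assms(1)] M.M.a_ac N.M.a_ac M.smult_l_distr M.smult_r_distr
      M.smult_assoc1 N.smult_l_distr N.smult_r_distr N.smult_assoc1)
qed

section \<open>Quotients\<close>

lemma quot_module_simps [simp]:
  "carrier (quot_module M U) = a_rcosets\<^bsub>M\<^esub> U" "zero (quot_module M U) = U"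
  "add (quot_module M U) = set_add M"
  "smult (quot_module M U) = (\<lambda>r. quot_map M U (\<lambda>x. r \<odot>\<^bsub>M\<^esub> x))"
  by (simp_all add: quot_module_def)

text \<open>As \<open>f\<close> maps \<open>V\<close> into \<open>U\<close>, another representative
  changes \<open>f x\<close> by an element of \<open>U\<close>, which the summand \<open>U\<close>
  in \<open>quot_map\<close> absorbs. This turns the set formula into a computation rule on
  representatives.\<close>

lemma quot_map_coset:
  assumes N: "abelian_group N" and M: "abelian_group M" and U: "subgroup U (add_monoid N)"
    and V: "subgroup V (add_monoid M)"
    and f: "\<And>x. x \<in> carrier M \<Longrightarrow> f x \<in> carrier N"
    and add: "\<And>x y. x \<in> carrier M \<Longrightarrow> y \<in> carrier M \<Longrightarrow> f (x \<oplus>\<^bsub>M\<^esub> y) = f x \<oplus>\<^bsub>N\<^esub> f y"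
    and fV: "\<And>x. x \<in> V \<Longrightarrow> f x \<in> U" and x: "x \<in> carrier M"
  shows "quot_map N U f (V +>\<^bsub>M\<^esub> x) = U +>\<^bsub>N\<^esub> f x"
proof -
  interpret N: abelian_group N by fact
  interpret M: abelian_group M by fact
  interpret U: additive_subgroup U N using U by (rule additive_subgroupI)
  interpret V: additive_subgroup V M using V by (rule additive_subgroupI)
  show ?thesis
  proof
    show "quot_map N U f (V +>\<^bsub>M\<^esub> x) \<subseteq> U +>\<^bsub>N\<^esub> f x"
    proof
      fix y assume "y \<in> quot_map N U f (V +>\<^bsub>M\<^esub> x)"
      then obtain u v where uv: "u \<in> U" "v \<in> V" "y = u \<oplus>\<^bsub>N\<^esub> f (v \<oplus>\<^bsub>M\<^esub> x)"
        by (auto simp: quot_map_def set_add_def' a_r_coset_def')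
      then have "y = (u \<oplus>\<^bsub>N\<^esub> f v) \<oplus>\<^bsub>N\<^esub> f x"
        using x f fV by (simp add: add N.a_assoc)
      then show "y \<in> U +>\<^bsub>N\<^esub> f x" using uv fV by (auto simp: a_r_coset_def')
    qed
    show "U +>\<^bsub>N\<^esub> f x \<subseteq> quot_map N U f (V +>\<^bsub>M\<^esub> x)"
    proof
      fix y assume "y \<in> U +>\<^bsub>N\<^esub> f x"
      then obtain u where "u \<in> U" "y = u \<oplus>\<^bsub>N\<^esub> f (\<zero>\<^bsub>M\<^esub> \<oplus>\<^bsub>M\<^esub> x)"
        using x by (auto simp: a_r_coset_def')
      moreover have "\<zero>\<^bsub>M\<^esub> \<oplus>\<^bsub>M\<^esub> x \<in> V +>\<^bsub>M\<^esub> x"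
        unfolding a_r_coset_def' by auto
      ultimately show "y \<in> quot_map N U f (V +>\<^bsub>M\<^esub> x)"
        unfolding quot_map_def set_add_def' by blast
    qed
  qed
qed

text \<open>Expanding the product of two cosets leaves \<open>f v (w + y)\<close> and
  \<open>f x w\<close> besides \<open>f x y\<close>; both lie in \<open>U\<close>. The hypotheses
  \<open>fV\<close> and \<open>fW\<close> say that the subgroups behave like a two-sided ideal, as
  coboundaries do among cocycles and bounded maps among all maps.\<close>

lemma quot_map2_coset:
  assumes N: "abelian_group N" and L: "abelian_group L" and M: "abelian_group M"
    and U: "subgroup U (add_monoid N)"
    and V: "subgroup V (add_monoid L)" and W: "subgroup W (add_monoid M)"
    and f: "\<And>x y. x \<in> carrier L \<Longrightarrow> y \<in> carrier M \<Longrightarrow> f x y \<in> carrier N"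
    and addl: "\<And>x x' y. x \<in> carrier L \<Longrightarrow> x' \<in> carrier L \<Longrightarrow> y \<in> carrier M \<Longrightarrow>
      f (x \<oplus>\<^bsub>L\<^esub> x') y = f x y \<oplus>\<^bsub>N\<^esub> f x' y"
    and addr: "\<And>x y y'. x \<in> carrier L \<Longrightarrow> y \<in> carrier M \<Longrightarrow> y' \<in> carrier M \<Longrightarrow>
      f x (y \<oplus>\<^bsub>M\<^esub> y') = f x y \<oplus>\<^bsub>N\<^esub> f x y'"
    and fV: "\<And>x y. x \<in> V \<Longrightarrow> y \<in> carrier M \<Longrightarrow> f x y \<in> U"
    and fW: "\<And>x y. x \<in> carrier L \<Longrightarrow> y \<in> W \<Longrightarrow> f x y \<in> U"
    and x: "x \<in> carrier L" and y: "y \<in> carrier M"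
  shows "quot_map2 N U f (V +>\<^bsub>L\<^esub> x) (W +>\<^bsub>M\<^esub> y) = U +>\<^bsub>N\<^esub> f x y"
proof -
  interpret N: abelian_group N by fact
  interpret L: abelian_group L by fact
  interpret M: abelian_group M by fact
  interpret U: additive_subgroup U N using U by (rule additive_subgroupI)
  interpret V: additive_subgroup V L using V by (rule additive_subgroupI)
  interpret W: additive_subgroup W M using W by (rule additive_subgroupI)
  show ?thesis
  proof
    show "quot_map2 N U f (V +>\<^bsub>L\<^esub> x) (W +>\<^bsub>M\<^esub> y) \<subseteq> U +>\<^bsub>N\<^esub> f x y"
    proof
      fix z assume "z \<in> quot_map2 N U f (V +>\<^bsub>L\<^esub> x) (W +>\<^bsub>M\<^esub> y)"
      then obtain u v w where uv: "u \<in> U" "v \<in> V" "w \<in> W" "z = u \<oplus>\<^bsub>N\<^esub> f (v \<oplus>\<^bsub>L\<^esub> x) (w \<oplus>\<^bsub>M\<^esub> y)"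
        unfolding quot_map2_def set_add_def' a_r_coset_def' by auto
      have wy: "w \<oplus>\<^bsub>M\<^esub> y \<in> carrier M" using uv y by auto
      have c: "f v (w \<oplus>\<^bsub>M\<^esub> y) \<in> U" "f x w \<in> U" using uv x wy by (auto intro: fV fW)
      have "z = u \<oplus>\<^bsub>N\<^esub> (f v (w \<oplus>\<^bsub>M\<^esub> y) \<oplus>\<^bsub>N\<^esub> f x (w \<oplus>\<^bsub>M\<^esub> y))"
        unfolding uv(4) using uv x wy by (subst addl) auto
      also have "f x (w \<oplus>\<^bsub>M\<^esub> y) = f x w \<oplus>\<^bsub>N\<^esub> f x y"
        using uv x y by (auto intro: addr)
      finally have "z = (u \<oplus>\<^bsub>N\<^esub> (f v (w \<oplus>\<^bsub>M\<^esub> y) \<oplus>\<^bsub>N\<^esub> f x w)) \<oplus>\<^bsub>N\<^esub> f x y"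
        using x y f uv(1-3) c by (simp add: N.a_assoc)
      then show "z \<in> U +>\<^bsub>N\<^esub> f x y" using uv(1) c by (auto simp: a_r_coset_def')
    qed
    show "U +>\<^bsub>N\<^esub> f x y \<subseteq> quot_map2 N U f (V +>\<^bsub>L\<^esub> x) (W +>\<^bsub>M\<^esub> y)"
    proof
      fix z assume "z \<in> U +>\<^bsub>N\<^esub> f x y"
      then obtain u where u: "u \<in> U" "z = u \<oplus>\<^bsub>N\<^esub> f (\<zero>\<^bsub>L\<^esub> \<oplus>\<^bsub>L\<^esub> x) (\<zero>\<^bsub>M\<^esub> \<oplus>\<^bsub>M\<^esub> y)"
        using x y by (auto simp: a_r_coset_def')
      moreover have "\<zero>\<^bsub>L\<^esub> \<oplus>\<^bsub>L\<^esub> x \<in> V +>\<^bsub>L\<^esub> x" "\<zero>\<^bsub>M\<^esub> \<oplus>\<^bsub>M\<^esub> y \<in> W +>\<^bsub>M\<^esub> y"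
        unfolding a_r_coset_def' by auto
      ultimately show "z \<in> quot_map2 N U f (V +>\<^bsub>L\<^esub> x) (W +>\<^bsub>M\<^esub> y)"
        unfolding quot_map2_def set_add_def' by blast
    qed
  qed
qed

context
  fixes R :: "('a, 'r) ring_scheme" and M :: "('a, 'b) module" and U
  assumes M: "module R M" and U: "submodule U R M"
begin

interpretation M: module R M by (rule M)
interpretation U: submodule U R M by (rule U)
interpretation A: abelian_subgroup U M
  by (intro abelian_subgroupI3 additive_subgroupI M.M.abelian_group_axioms U.subgroup_axioms)

lemma quot_module_carrier: "carrier (quot_module M U) = (\<lambda>x. U +>\<^bsub>M\<^esub> x) ` carrier M"
  by (auto simp: A_RCOSETS_def')

lemma quot_module_zero: "U +>\<^bsub>M\<^esub> \<zero>\<^bsub>M\<^esub> = U"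
  using A.a_subset by (simp add: M.M.a_coset_add_zero)

lemma quot_module_add:
  "x \<in> carrier M \<Longrightarrow> y \<in> carrier M \<Longrightarrow> U +>\<^bsub>M\<^esub> (x \<oplus>\<^bsub>M\<^esub> y) = (U +>\<^bsub>M\<^esub> x) <+>\<^bsub>M\<^esub> (U +>\<^bsub>M\<^esub> y)"
  by (simp add: A.a_rcos_sum)

lemma quot_module_smult:
  "r \<in> carrier R \<Longrightarrow> x \<in> carrier M \<Longrightarrow> quot_map M U (\<lambda>x. r \<odot>\<^bsub>M\<^esub> x) (U +>\<^bsub>M\<^esub> x) = U +>\<^bsub>M\<^esub> (r \<odot>\<^bsub>M\<^esub> x)"
  by (rule quot_map_coset[of M M])
    (auto simp: M.M.abelian_group_axioms U.subgroup_axioms M.smult_r_distr)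

lemma quot_module_eq_iff:
  assumes "x \<in> carrier M" "y \<in> carrier M"
  shows "U +>\<^bsub>M\<^esub> x = U +>\<^bsub>M\<^esub> y \<longleftrightarrow> x \<ominus>\<^bsub>M\<^esub> y \<in> U"
proof -
  have "U +>\<^bsub>M\<^esub> x = U +>\<^bsub>M\<^esub> y \<longleftrightarrow> x \<in> U +>\<^bsub>M\<^esub> y"
    using assms A.a_repr_independence' A.a_rcos_self by metis
  also have "\<dots> \<longleftrightarrow> x \<ominus>\<^bsub>M\<^esub> y \<in> U"
    using assms A.a_rcos_module[of y x] by (simp add: a_minus_def)
  finally show ?thesis .
qed

end

section \<open>Projective modules\<close>

text \<open>The sum runs over the support, so it is finite on every element of the free module even
  when \<open>J\<close> is infinite.\<close>

definition lin_comb :: "('a, 'r) ring_scheme \<Rightarrow> ('a, 'c) module \<Rightarrow> 'i set \<Rightarrow> ('i \<Rightarrow> 'c) \<Rightarrow> ('i \<Rightarrow> 'a) \<Rightarrow> 'c" where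
  "lin_comb R X J c \<phi> = finsum X (\<lambda>b. \<phi> b \<odot>\<^bsub>X\<^esub> c b) {b \<in> J. \<phi> b \<noteq> \<zero>\<^bsub>R\<^esub>}"

abbreviation free_module :: "('a, 'r) ring_scheme \<Rightarrow> 'i set \<Rightarrow> ('a, 'i \<Rightarrow> 'a) module" where
  "free_module R J \<equiv> coprod_module J (\<lambda>_. ring_module R)"

text \<open>Supports can shrink under addition and scaling. Linearity is therefore checked over a
  common finite index set, where the additional terms vanish.\<close>

lemma lin_comb_superset:
  assumes "module R X" and c: "c \<in> J \<rightarrow> carrier X" and \<phi>: "\<phi> \<in> carrier (free_module R J)"
    and B: "finite B" "{b \<in> J. \<phi> b \<noteq> \<zero>\<^bsub>R\<^esub>} \<subseteq> B" "B \<subseteq> J"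
  shows "lin_comb R X J c \<phi> = finsum X (\<lambda>b. \<phi> b \<odot>\<^bsub>X\<^esub> c b) B"
proof -
  interpret X: module R X by fact
  show ?thesis
    unfolding lin_comb_def
  proof (rule X.M.add.finprod_mono_neutral_cong_left[OF B(1,2)])
    show "\<phi> i \<odot>\<^bsub>X\<^esub> c i = \<zero>\<^bsub>X\<^esub>" if "i \<in> B - {b \<in> J. \<phi> b \<noteq> \<zero>\<^bsub>R\<^esub>}" for i
      using that B c by (auto simp: subset_iff Pi_iff)
    show "(\<lambda>b. \<phi> b \<odot>\<^bsub>X\<^esub> c b) \<in> B \<rightarrow> carrier X"
      using B c \<phi> by (auto simp: PiE_def Pi_def)
  qed auto
qed

lemma lin_comb_hom:
  assumes "module R X" and c: "c \<in> J \<rightarrow> carrier X"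
  shows "lin_comb R X J c \<in> module_hom R (free_module R J) X"
proof -
  interpret X: module R X by fact
  show ?thesis
  proof (intro module_homI)
    fix \<phi> assume \<phi>: "\<phi> \<in> carrier (free_module R J)"
    then show "lin_comb R X J c \<phi> \<in> carrier X"
      unfolding lin_comb_def using c by (intro X.M.finsum_closed) (auto simp: PiE_def Pi_def)
    fix r assume r: "r \<in> carrier R"
    define B where "B = {b \<in> J. \<phi> b \<noteq> \<zero>\<^bsub>R\<^esub>}"
    have B: "finite B" "B \<subseteq> J" using \<phi> by (auto simp: B_def)
    have "lin_comb R X J c (r \<odot>\<^bsub>free_module R J\<^esub> \<phi>)
        = finsum X (\<lambda>b. (r \<odot>\<^bsub>free_module R J\<^esub> \<phi>) b \<odot>\<^bsub>X\<^esub> c b) B"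
    proof (rule lin_comb_superset[OF assms(1) c])
      show "r \<odot>\<^bsub>free_module R J\<^esub> \<phi> \<in> carrier (free_module R J)"
        using coprod_module_module[of R J "\<lambda>_. ring_module R"] r \<phi>
          ring_module_module[OF module_cring[OF assms(1)]] module_cring[OF assms(1)]
        by (intro module.smult_closed) auto
    qed (use B r in \<open>auto simp: B_def\<close>)
    also have "\<dots> = finsum X (\<lambda>b. r \<odot>\<^bsub>X\<^esub> (\<phi> b \<odot>\<^bsub>X\<^esub> c b)) B"
      using B c \<phi> r by (intro X.M.finsum_cong') (auto simp: PiE_def Pi_def X.smult_assoc1)
    also have "\<dots> = r \<odot>\<^bsub>X\<^esub> lin_comb R X J c \<phi>"
      unfolding lin_comb_def B_def[symmetric]
      using B c \<phi> r by (subst X.finsum_smult_ldistr) (auto simp: PiE_def Pi_def)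
    finally show "lin_comb R X J c (r \<odot>\<^bsub>free_module R J\<^esub> \<phi>) = r \<odot>\<^bsub>X\<^esub> lin_comb R X J c \<phi>" .
  next
    fix \<phi> \<psi> assume \<phi>: "\<phi> \<in> carrier (free_module R J)" and \<psi>: "\<psi> \<in> carrier (free_module R J)"
    define B where "B = {b \<in> J. \<phi> b \<noteq> \<zero>\<^bsub>R\<^esub>} \<union> {b \<in> J. \<psi> b \<noteq> \<zero>\<^bsub>R\<^esub>}"
    have B: "finite B" "B \<subseteq> J" using \<phi> \<psi> by (auto simp: B_def)
    have "lin_comb R X J c (\<phi> \<oplus>\<^bsub>free_module R J\<^esub> \<psi>)
        = finsum X (\<lambda>b. (\<phi> \<oplus>\<^bsub>free_module R J\<^esub> \<psi>) b \<odot>\<^bsub>X\<^esub> c b) B"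
    proof (rule lin_comb_superset[OF assms(1) c])
      have "abelian_group (free_module R J)"
        using coprod_module_module[of R J "\<lambda>_. ring_module R"]
          ring_module_module[OF module_cring[OF assms(1)]] module_cring[OF assms(1)]
        by (intro module_abelian) auto
      then show "\<phi> \<oplus>\<^bsub>free_module R J\<^esub> \<psi> \<in> carrier (free_module R J)"
        using \<phi> \<psi> by (rule abelian_groupE)
    qed (use B in \<open>auto simp: B_def\<close>)
    also have "\<dots> = finsum X (\<lambda>b. \<phi> b \<odot>\<^bsub>X\<^esub> c b \<oplus>\<^bsub>X\<^esub> \<psi> b \<odot>\<^bsub>X\<^esub> c b) B"
      using B c \<phi> \<psi> by (intro X.M.finsum_cong') (auto simp: PiE_def Pi_def X.smult_l_distr)
    also have "\<dots> = finsum X (\<lambda>b. \<phi> b \<odot>\<^bsub>X\<^esub> c b) B \<oplus>\<^bsub>X\<^esub> finsum X (\<lambda>b. \<psi> b \<odot>\<^bsub>X\<^esub> c b) B"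
      using B c \<phi> \<psi> by (intro X.M.finsum_addf) (auto simp: PiE_def Pi_def)
    also have "\<dots> = lin_comb R X J c \<phi> \<oplus>\<^bsub>X\<^esub> lin_comb R X J c \<psi>"
      using lin_comb_superset[OF assms(1) c \<phi> B(1)] lin_comb_superset[OF assms(1) c \<psi> B(1)] B(2)
      by (auto simp: B_def)
    finally show "lin_comb R X J c (\<phi> \<oplus>\<^bsub>free_module R J\<^esub> \<psi>) = lin_comb R X J c \<phi> \<oplus>\<^bsub>X\<^esub> lin_comb R X J c \<psi>" .
  qed
qed

lemma hom_lin_comb:
  assumes "module R X" "module R Y" "g \<in> module_hom R X Y"
    and c: "c \<in> J \<rightarrow> carrier X" and \<phi>: "\<phi> \<in> carrier (free_module R J)"
  shows "g (lin_comb R X J c \<phi>) = lin_comb R Y J (\<lambda>b. g (c b)) \<phi>"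
proof -
  interpret X: module R X by fact
  interpret Y: module R Y by fact
  have "(\<lambda>b. \<phi> b \<odot>\<^bsub>X\<^esub> c b) \<in> {b \<in> J. \<phi> b \<noteq> \<zero>\<^bsub>R\<^esub>} \<rightarrow> carrier X"
    using c \<phi> by (auto simp: PiE_def Pi_def)
  from module_hom_finsum[OF assms(1-3) this] show ?thesis
    unfolding lin_comb_def
  proof (rule trans, intro Y.M.finsum_cong')
  qed (use c \<phi> in \<open>auto simp: PiE_def Pi_def module_homD[OF assms(3)]\<close>)
qed

text \<open>The surjection from the free module on the elements of \<open>P\<close> is among the
  permitted tests; lifting the identity through it gives a section \<open>\<sigma>\<close>, that is,
  a dual basis. From here on projectivity is used in this form, which mentions no test
  types.\<close>

lemma projective_dual_basis:
  fixes P :: "('a, 'b) module"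
  assumes "projective_module R P"
  obtains \<sigma> where "\<sigma> \<in> module_hom R P (free_module R (carrier P))"
    and "\<And>x. x \<in> carrier P \<Longrightarrow> lin_comb R P (carrier P) (\<lambda>b. b) (\<sigma> x) = x"
proof -
  have P: "module R P" using assms by (simp add: projective_module_def)
  interpret P: module R P by fact
  let ?J = "carrier P"
  let ?Fr = "free_module R ?J"
  have Fr: "module R ?Fr"
    using module_cring[OF P] by (intro coprod_module_module ring_module_module)
  have hom: "lin_comb R P ?J (\<lambda>b. b) \<in> module_hom R ?Fr P"
    by (rule lin_comb_hom[OF P]) auto
  have "x \<in> lin_comb R P ?J (\<lambda>b. b) ` carrier ?Fr" if x: "x \<in> carrier P" for x
  proof -
    define \<delta> where "\<delta> = (\<lambda>j\<in>?J. if j = x then \<one>\<^bsub>R\<^esub> else \<zero>\<^bsub>R\<^esub>)"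
    have "{j \<in> ?J. \<delta> j \<noteq> \<zero>\<^bsub>R\<^esub>} \<subseteq> {x}" by (auto simp: \<delta>_def)
    moreover from this have \<delta>: "\<delta> \<in> carrier ?Fr"
      by (auto simp: \<delta>_def intro: finite_subset)
    ultimately have "lin_comb R P ?J (\<lambda>b. b) \<delta> = finsum P (\<lambda>b. \<delta> b \<odot>\<^bsub>P\<^esub> b) {x}"
      using x by (intro lin_comb_superset[OF P]) auto
    also have "\<dots> = x" using x by (simp add: P.M.finsum_insert \<delta>_def Pi_def)
    finally show ?thesis using \<delta> by (metis imageI)
  qed
  then have surj: "lin_comb R P ?J (\<lambda>b. b) ` carrier ?Fr = carrier P"
    using module_homD(1)[OF hom] by auto
  have "\<exists>h \<in> module_hom R P ?Fr. \<forall>x \<in> carrier P. lin_comb R P ?J (\<lambda>b. b) (h x) = x"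
    using assms Fr P hom surj module_hom_ident[of R P] unfolding projective_module_def by blast
  with that show thesis by auto
qed

text \<open>Preimages \<open>c\<close> are chosen for the generators of the free cover and extended
  linearly along the dual basis. This works for modules on arbitrary types, and \<open>g\<close>
  only has to reach the values of \<open>f\<close>. The lift is taken extensional so that it can
  serve as a component of a cochain.\<close>

lemma projective_lift:
  assumes P: "projective_module R P" and X: "module R X" and Y: "module R Y"
    and g: "g \<in> module_hom R X Y" and f: "f \<in> module_hom R P Y"
    and fg: "\<And>x. x \<in> carrier P \<Longrightarrow> f x \<in> g ` carrier X"
  obtains h where "h \<in> module_hom R P X" "h \<in> extensional (carrier P)"
    and "\<And>x. x \<in> carrier P \<Longrightarrow> g (h x) = f x"
proof -
  have PM: "module R P" using P by (simp add: projective_module_def)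
  obtain \<sigma> where \<sigma>: "\<sigma> \<in> module_hom R P (free_module R (carrier P))"
    and \<sigma>x: "\<And>x. x \<in> carrier P \<Longrightarrow> lin_comb R P (carrier P) (\<lambda>b. b) (\<sigma> x) = x"
    using projective_dual_basis[OF P] by blast
  have "\<forall>x\<in>carrier P. \<exists>y. y \<in> carrier X \<and> g y = f x" using fg by (metis imageE)
  then obtain c where c: "\<And>x. x \<in> carrier P \<Longrightarrow> c x \<in> carrier X \<and> g (c x) = f x"
    by metis
  define h where "h = restrict (\<lambda>x. lin_comb R X (carrier P) c (\<sigma> x)) (carrier P)"
  have "h \<in> module_hom R P X"
    unfolding h_def
    by (rule module_hom_cong[OF PM module_hom_compose[OF \<sigma> lin_comb_hom[OF X]]]) (use c in auto)
  moreover have "g (h x) = f x" if x: "x \<in> carrier P" for x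
  proof -
    have "g (h x) = lin_comb R Y (carrier P) (\<lambda>b. g (c b)) (\<sigma> x)"
      using x c module_homD(1)[OF \<sigma>] by (auto simp: h_def intro!: hom_lin_comb[OF X Y g])
    also have "\<dots> = lin_comb R Y (carrier P) (\<lambda>b. f b) (\<sigma> x)"
    proof -
      interpret Y: module R Y by fact
      show ?thesis
        unfolding lin_comb_def using module_homD(1)[OF \<sigma> x] c module_homD(1)[OF f]
        by (intro Y.M.finsum_cong') (auto simp: PiE_def Pi_def)
    qed
    also have "\<dots> = f (lin_comb R P (carrier P) (\<lambda>b. b) (\<sigma> x))"
      using module_homD(1)[OF \<sigma> x] by (intro hom_lin_comb[OF PM Y f, symmetric]) auto
    finally show ?thesis using \<sigma>x[OF x] by simp
  qed
  ultimately show thesis using that by (auto simp: h_def)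
qed

section \<open>The endomorphism complex\<close>

locale mod_complex =
  fixes R :: "('a, 'r) ring_scheme" and F :: "int \<Rightarrow> ('a, 'b) module" and d :: "int \<Rightarrow> 'b \<Rightarrow> 'b"
  assumes F_module: "module R (F i)"
    and d_hom: "d i \<in> module_hom R (F i) (F (i - 1))"
    and d_d: "x \<in> carrier (F i) \<Longrightarrow> d (i - 1) (d i x) = \<zero>\<^bsub>F (i - 2)\<^esub>"
begin

abbreviation "FC i \<equiv> carrier (F i)"

sublocale F: module R "F i" for i by (rule F_module)

abbreviation A :: "int \<Rightarrow> ('a, int \<Rightarrow> 'b \<Rightarrow> 'b) module" where
  "A \<equiv> hom_cx R F F"

abbreviation D :: "int \<Rightarrow> (int \<Rightarrow> 'b \<Rightarrow> 'b) \<Rightarrow> (int \<Rightarrow> 'b \<Rightarrow> 'b)" where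
  "D \<equiv> hom_diff F d F d"

abbreviation mul :: "int \<Rightarrow> (int \<Rightarrow> 'b \<Rightarrow> 'b) \<Rightarrow> (int \<Rightarrow> 'b \<Rightarrow> 'b) \<Rightarrow> (int \<Rightarrow> 'b \<Rightarrow> 'b)" where
  "mul n \<alpha> \<beta> \<equiv> (\<lambda>i. compose (FC i) (\<alpha> (i - n)) (\<beta> i))"

abbreviation idA :: "int \<Rightarrow> 'b \<Rightarrow> 'b" where
  "idA \<equiv> (\<lambda>i. \<lambda>x \<in> FC i. x)"

abbreviation "AC n \<equiv> carrier (A n)"

lemma A_module: "module R (A n)"
  unfolding hom_cx_def
  by (intro prod_module_module hom_module_module(2) F_module module_cring[OF F_module[of 0]])

sublocale A: module R "A n" for n by (rule A_module)

lemma A_iff: "\<beta> \<in> AC n \<longleftrightarrow>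
    (\<forall>i. \<beta> i \<in> module_hom R (F i) (F (i - n)) \<and> \<beta> i \<in> extensional (FC i))"
  by (auto simp: hom_cx_def)

lemma A_I: "(\<And>i. \<beta> i \<in> module_hom R (F i) (F (i - n))) \<Longrightarrow>
    (\<And>i. \<beta> i \<in> extensional (FC i)) \<Longrightarrow> \<beta> \<in> AC n"
  by (simp add: A_iff)

lemma A_hom: "\<beta> \<in> AC n \<Longrightarrow> \<beta> i \<in> module_hom R (F i) (F (i - n))"
  by (simp add: A_iff)

lemma A_closed [simp, intro]: "\<beta> \<in> AC n \<Longrightarrow> x \<in> FC i \<Longrightarrow> \<beta> i x \<in> FC (i - n)"
  using module_homD(1)[OF A_hom] .

lemma A_ext: "\<beta> \<in> AC n \<Longrightarrow> x \<notin> FC i \<Longrightarrow> \<beta> i x = undefined"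
  by (auto simp: A_iff extensional_def)

lemma A_eqI:
  assumes "\<beta> \<in> AC n" "\<gamma> \<in> AC n'"
    and "\<And>i x. x \<in> FC i \<Longrightarrow> \<beta> i x = \<gamma> i x"
  shows "\<beta> = \<gamma>"
proof (intro ext)
  fix i x
  show "\<beta> i x = \<gamma> i x"
    using assms by (cases "x \<in> FC i") (auto simp: A_ext)
qed

lemma d_closed [simp, intro]: "x \<in> FC i \<Longrightarrow> d i x \<in> FC (i - 1)"
  using module_homD(1)[OF d_hom] .

lemma A_simps:
  "\<zero>\<^bsub>A n\<^esub> = (\<lambda>i. \<lambda>x \<in> FC i. \<zero>\<^bsub>F (i - n)\<^esub>)"
  "\<beta> \<oplus>\<^bsub>A n\<^esub> \<gamma> = (\<lambda>i. \<lambda>x \<in> FC i. \<beta> i x \<oplus>\<^bsub>F (i - n)\<^esub> \<gamma> i x)"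
  "r \<odot>\<^bsub>A n\<^esub> \<beta> = (\<lambda>i. \<lambda>x \<in> FC i. r \<odot>\<^bsub>F (i - n)\<^esub> \<beta> i x)"
  by (simp_all add: hom_cx_def restrict_def)

lemma A_neg:
  assumes "\<beta> \<in> AC n" "x \<in> FC i"
  shows "(\<ominus>\<^bsub>A n\<^esub> \<beta>) i x = \<ominus>\<^bsub>F (i - n)\<^esub> \<beta> i x"
proof -
  have "\<ominus>\<^bsub>A n\<^esub> \<beta> = (\<ominus>\<^bsub>R\<^esub> \<one>\<^bsub>R\<^esub>) \<odot>\<^bsub>A n\<^esub> \<beta>"
    using assms by (simp add: A.smult_l_minus)
  then show ?thesis using assms by (simp add: A_simps F.smult_l_minus)
qed

lemma A_minus:
  assumes "\<beta> \<in> AC n" "\<gamma> \<in> AC n" "x \<in> FC i"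
  shows "(\<beta> \<ominus>\<^bsub>A n\<^esub> \<gamma>) i x = \<beta> i x \<ominus>\<^bsub>F (i - n)\<^esub> \<gamma> i x"
  using assms by (simp add: a_minus_def A_simps A_neg)

lemma A_sgn_act:
  assumes "\<beta> \<in> AC n" "x \<in> FC i"
  shows "(sgn_act (A n) k \<beta>) i x = sgn_act (F (i - n)) k (\<beta> i x)"
  using assms by (simp add: sgn_act_def A_neg)

lemma A_finsum:
  assumes "finite J" "f \<in> J \<rightarrow> AC n" "x \<in> FC i"
  shows "(finsum (A n) f J) i x = finsum (F (i - n)) (\<lambda>j. f j i x) J"
  by (rule additive_finsum[OF A.M.abelian_group_axioms F.M.abelian_group_axioms, where f = "\<lambda>\<beta>. \<beta> i x"])
    (use assms in \<open>auto simp: A_simps\<close>)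

lemma hom_comp_A:
  assumes "\<beta> \<in> AC n" "f \<in> module_hom R (F (i - n)) N"
  shows "(\<lambda>x. f (\<beta> i x)) \<in> module_hom R (F i) N"
  using module_hom_compose[OF A_hom[OF assms(1)] assms(2)] .

lemma mul_closed [intro]:
  assumes "\<alpha> \<in> AC m" "\<beta> \<in> AC n"
  shows "mul n \<alpha> \<beta> \<in> AC (m + n)"
proof (rule A_I)
  fix i
  have eq: "i - n - m = i - (m + n)" by simp
  have "(\<lambda>x. \<alpha> (i - n) (\<beta> i x)) \<in> module_hom R (F i) (F (i - n - m))"
    by (rule hom_comp_A[OF assms(2) A_hom[OF assms(1)]])
  then show "compose (FC i) (\<alpha> (i - n)) (\<beta> i) \<in> module_hom R (F i) (F (i - (m + n)))"
    unfolding eq by (rule module_hom_cong[OF F_module]) (simp add: compose_eq)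
qed (auto simp: compose_def)

lemma idA_closed [intro, simp]: "idA \<in> AC 0"
proof (rule A_I)
  show "(\<lambda>x \<in> FC i. x) \<in> module_hom R (F i) (F (i - 0))" for i
    by (rule module_hom_cong[OF F_module]) (auto intro: module_hom_ident)
qed auto

lemma D_apply: "x \<in> FC i \<Longrightarrow> D n \<beta> i x =
   d (i - n) (\<beta> i x) \<ominus>\<^bsub>F (i - n - 1)\<^esub> sgn_act (F (i - n - 1)) n (\<beta> (i - 1) (d i x))"
  by (simp add: hom_diff_def)

lemma D_closed [intro, simp]:
  assumes "\<beta> \<in> AC n"
  shows "D n \<beta> \<in> AC (n + 1)"
proof (rule A_I)
  fix i
  have eq: "i - 1 - n = i - n - 1" "i - (n + 1) = i - n - 1" by simp_all
  have 1: "(\<lambda>x. d (i - n) (\<beta> i x)) \<in> module_hom R (F i) (F (i - n - 1))"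
    by (rule hom_comp_A[OF assms d_hom])
  have 2: "(\<lambda>x. \<beta> (i - 1) (d i x)) \<in> module_hom R (F i) (F (i - n - 1))"
    using module_hom_compose[OF d_hom[of i] A_hom[OF assms, of "i - 1"]] unfolding eq .
  have 3: "(\<lambda>x. sgn_act (F (i - n - 1)) (n + 1) (\<beta> (i - 1) (d i x))) \<in> module_hom R (F i) (F (i - n - 1))"
    by (rule module_hom_compose[OF 2 sgn_act_hom[OF F_module]])
  show "D n \<beta> i \<in> module_hom R (F i) (F (i - (n + 1)))"
    unfolding eq
  proof (rule module_hom_cong[OF F_module module_hom_plus[OF F_module F_module 1 3]])
    fix x assume "x \<in> FC i"
    moreover from this have "\<beta> (i - 1) (d i x) \<in> FC (i - n - 1)"
      using A_closed[OF assms d_closed] eq by metis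
    ultimately show "d (i - n) (\<beta> i x) \<oplus>\<^bsub>F (i - n - 1)\<^esub>
          sgn_act (F (i - n - 1)) (n + 1) (\<beta> (i - 1) (d i x)) = D n \<beta> i x"
      by (auto simp: D_apply sgn_act_def a_minus_def)
  qed
qed (auto simp: hom_diff_def)

lemma A_closed_d:
  assumes "\<beta> \<in> AC n" "x \<in> FC i"
  shows "\<beta> (i - 1) (d i x) \<in> FC (i - n - 1)"
  using A_closed[OF assms(1) d_closed[OF assms(2)]] by (simp add: algebra_simps)

lemma D_hom: "D n \<in> module_hom R (A n) (A (n + 1))"
proof (rule module_homI)
  fix \<beta> assume b: "\<beta> \<in> AC n"
  then show "D n \<beta> \<in> AC (n + 1)" ..
  note d' = module_homD[OF d_hom] and s = module_homD[OF sgn_act_hom[OF F_module]]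
  note cl = A_closed_d[OF b] sgn_act_closed[OF F_module]
  have eq: "i - 1 - n = i - n - 1" "i - (n + 1) = i - n - 1" for i by simp_all
  {
    fix r assume r: "r \<in> carrier R"
    show "D n (r \<odot>\<^bsub>A n\<^esub> \<beta>) = r \<odot>\<^bsub>A (n + 1)\<^esub> D n \<beta>"
    proof (rule A_eqI)
      fix i x assume x: "x \<in> FC i"
      show "D n (r \<odot>\<^bsub>A n\<^esub> \<beta>) i x = (r \<odot>\<^bsub>A (n + 1)\<^esub> D n \<beta>) i x"
        using x r b A_closed_d[OF b x]
        by (simp add: D_apply A_simps eq d' s cl a_minus_def F.smult_r_distr F.smult_r_minus)
    qed (use b r in auto)
  }
  fix \<gamma> assume c: "\<gamma> \<in> AC n"
  show "D n (\<beta> \<oplus>\<^bsub>A n\<^esub> \<gamma>) = D n \<beta> \<oplus>\<^bsub>A (n + 1)\<^esub> D n \<gamma>"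
  proof (rule A_eqI)
    fix i x assume x: "x \<in> FC i"
    show "D n (\<beta> \<oplus>\<^bsub>A n\<^esub> \<gamma>) i x = (D n \<beta> \<oplus>\<^bsub>A (n + 1)\<^esub> D n \<gamma>) i x"
      using x b c A_closed_d[OF b x] A_closed_d[OF c x]
      by (simp add: D_apply A_simps eq d' s cl a_minus_def F.M.minus_add F.M.a_ac)
  qed (use b c in auto)
qed

text \<open>The two mixed terms \<open>\<alpha> (d (\<beta> x))\<close> cancel. The rule is kept
  pointwise, with normalised indices, because later the boundary of a factor vanishes only in
  certain homological degrees.\<close>

lemma Leibniz:
  assumes a: "\<alpha> \<in> AC m" and b: "\<beta> \<in> AC n" and x: "x \<in> FC i"
  shows "D (m + n) (mul n \<alpha> \<beta>) i x = D m \<alpha> (i - n) (\<beta> i x) \<oplus>\<^bsub>F (i - n - m - 1)\<^esub>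
     sgn_act (F (i - n - m - 1)) m (\<alpha> (i - n - 1) (D n \<beta> i x))"
proof -
  have eq: "i - (m + n) = i - n - m" "i - 1 - n = i - n - 1" "i - n - 1 - m = i - n - m - 1" by simp_all
  note a' = module_homD[OF A_hom[OF a, of "i - n - 1"], unfolded eq]
  define u where "u = d (i - n) (\<beta> i x)"
  define v where "v = \<beta> (i - 1) (d i x)"
  have u: "u \<in> FC (i - n - 1)" using x b by (auto simp: u_def)
  have v: "v \<in> FC (i - n - 1)" using A_closed_d[OF b x] by (simp add: v_def)
  have w: "d (i - n - m) (\<alpha> (i - n) (\<beta> i x)) \<in> FC (i - n - m - 1)"
    using x a b by auto
  have s: "\<alpha> (i - n - 1) (sgn_act (F (i - n - 1)) n v) = sgn_act (F (i - n - m - 1)) n (\<alpha> (i - n - 1) v)"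
    using module_hom_sgn_act[OF F_module F_module A_hom[OF a] v] by (simp only: eq)
  have neg: "\<alpha> (i - n - 1) (\<ominus>\<^bsub>F (i - n - 1)\<^esub> y) = \<ominus>\<^bsub>F (i - n - m - 1)\<^esub> \<alpha> (i - n - 1) y"
    if "y \<in> FC (i - n - 1)" for y
    using module_hom_neg[OF F_module F_module A_hom[OF a] that] by (simp only: eq)
  have 1: "D (m + n) (mul n \<alpha> \<beta>) i x = d (i - n - m) (\<alpha> (i - n) (\<beta> i x))
      \<ominus>\<^bsub>F (i - n - m - 1)\<^esub> sgn_act (F (i - n - m - 1)) (m + n) (\<alpha> (i - n - 1) v)"
    using x by (simp add: D_apply compose_eq eq v_def)
  have 2: "D m \<alpha> (i - n) (\<beta> i x) = d (i - n - m) (\<alpha> (i - n) (\<beta> i x))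
      \<ominus>\<^bsub>F (i - n - m - 1)\<^esub> sgn_act (F (i - n - m - 1)) m (\<alpha> (i - n - 1) u)"
    using x b by (simp add: D_apply u_def)
  have 3: "\<alpha> (i - n - 1) (D n \<beta> i x) = \<alpha> (i - n - 1) u \<ominus>\<^bsub>F (i - n - m - 1)\<^esub>
      sgn_act (F (i - n - m - 1)) n (\<alpha> (i - n - 1) v)"
    using x u v by (simp add: D_apply a_minus_def a' neg s sgn_act_closed[OF F_module]
      flip: u_def v_def)
  have av: "\<alpha> (i - n - 1) v \<in> FC (i - n - m - 1)" "\<alpha> (i - n - 1) u \<in> FC (i - n - m - 1)"
    using a' u v by auto
  show ?thesis
    unfolding 1 2 3 using w av
    by (auto simp: sgn_act_def a_minus_def F.M.minus_add F.M.a_ac F.M.r_neg F.M.l_neg F.M.r_neg1 F.M.r_neg2)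
qed

text \<open>Terms with two consecutive \<open>d\<close> vanish; what remains are two copies of d
  \<beta> d with opposite signs, from (-1)^n and (-1)^(n+1).\<close>

lemma D_D:
  assumes "\<beta> \<in> AC n"
  shows "D (n + 1) (D n \<beta>) = \<zero>\<^bsub>A (n + 1 + 1)\<^esub>"
proof (rule A_eqI)
  fix i x assume x: "x \<in> FC i"
  have eq: "i - (n + 1) = i - n - 1" "i - (n + 1 + 1) = i - n - 2" "i - 1 - n = i - n - 1" "i - n - 1 - 1 = i - n - 2"
    "i - 1 - 1 = i - 2" "i - 2 - n = i - n - 2" by simp_all
  define u where "u = \<beta> (i - 1) (d i x)"
  have u: "u \<in> FC (i - n - 1)" using A_closed_d[OF assms x] by (simp add: u_def)
  have dd: "d (i - n - 1) (d (i - n) (\<beta> i x)) = \<zero>\<^bsub>F (i - n - 2)\<^esub>" "d (i - 1) (d i x) = \<zero>\<^bsub>F (i - 2)\<^esub>"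
    using d_d[of "\<beta> i x" "i - n"] d_d[OF x] x assms by auto
  have z: "\<beta> (i - 2) \<zero>\<^bsub>F (i - 2)\<^esub> = \<zero>\<^bsub>F (i - n - 2)\<^esub>"
    using module_hom_zero[OF F_module F_module A_hom[OF assms, of "i - 2"]] by (simp only: eq)
  have du: "d (i - n - 1) u \<in> FC (i - n - 2)" using d_closed[OF u] by (simp add: eq)
  have "D (n + 1) (D n \<beta>) i x = d (i - n - 1) (D n \<beta> i x) \<ominus>\<^bsub>F (i - n - 2)\<^esub>
      sgn_act (F (i - n - 2)) (n + 1) (D n \<beta> (i - 1) (d i x))"
    using x by (simp add: D_apply[of x i "n + 1"] eq)
  also have "d (i - n - 1) (D n \<beta> i x) = \<ominus>\<^bsub>F (i - n - 2)\<^esub> sgn_act (F (i - n - 2)) n (d (i - n - 1) u)"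
  proof -
    have "d (i - n - 1) (D n \<beta> i x) = d (i - n - 1) (d (i - n) (\<beta> i x)) \<ominus>\<^bsub>F (i - n - 1 - 1)\<^esub>
       d (i - n - 1) (sgn_act (F (i - n - 1)) n u)"
      using x u assms by (simp add: D_apply sgn_act_closed[OF F_module] module_hom_minus[OF F_module F_module d_hom]
         flip: u_def)
    also have "d (i - n - 1) (sgn_act (F (i - n - 1)) n u) = sgn_act (F (i - n - 2)) n (d (i - n - 1) u)"
      using module_hom_sgn_act[OF F_module F_module d_hom u] by (simp add: eq)
    finally show ?thesis
      using du by (simp add: dd eq a_minus_def sgn_act_closed[OF F_module])
  qed
  also have "D n \<beta> (i - 1) (d i x) = d (i - n - 1) u"
    using x du by (simp add: D_apply eq dd z sgn_act_zero[OF F_module] a_minus_def flip: u_def)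
  finally show "D (n + 1) (D n \<beta>) i x = \<zero>\<^bsub>A (n + 1 + 1)\<^esub> i x"
    using x du arg_cong[of "i - (n + 1 + 1)" "i - n - 2" "\<lambda>k. \<zero>\<^bsub>F k\<^esub>"]
    by (auto simp only: A_simps eq sgn_act_def a_minus_def F.M.l_neg F.M.r_neg restrict_apply'
        F.M.minus_minus even_plus_one_iff split: if_splits)
qed (use assms in auto)

end

section \<open>Presented graded algebras\<close>

lemma (in abelian_group) minus_eq_zero_iff:
  assumes "a \<in> carrier G" "b \<in> carrier G"
  shows "a \<ominus> b = \<zero> \<longleftrightarrow> a = b"
proof
  assume "a \<ominus> b = \<zero>"
  then have "(a \<ominus> b) \<oplus> b = b" using assms by simp
  then show "a = b" using assms by (simp add: a_minus_def a_assoc l_neg)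
qed (use assms in \<open>simp add: a_minus_def r_neg\<close>)

lemma (in abelian_group) minus_zero_right: "a \<in> carrier G \<Longrightarrow> a \<ominus> \<zero> = a"
  by (simp add: a_minus_def flip: minus_unique[of \<zero> \<zero>])

text \<open>A graded algebra of cochains. The endomorphism algebra, Ext and stable Ext are all
  handled as subquotients of one such algebra, so the ring axioms are verified once on cochains and
  inherited by classes.\<close>

locale gr_base =
  fixes R :: "('a, 'r) ring_scheme" and X :: "int \<Rightarrow> ('a, 'x) module"
    and mu :: "int \<Rightarrow> int \<Rightarrow> 'x \<Rightarrow> 'x \<Rightarrow> 'x" and u :: 'x
  assumes X_module: "module R (X n)"
    and mu_l: "y \<in> carrier (X n) \<Longrightarrow> (\<lambda>x. mu m n x y) \<in> module_hom R (X m) (X (m + n))"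
    and mu_r: "x \<in> carrier (X m) \<Longrightarrow> (\<lambda>y. mu m n x y) \<in> module_hom R (X n) (X (m + n))"
    and mu_assoc: "x \<in> carrier (X l) \<Longrightarrow> y \<in> carrier (X m) \<Longrightarrow> z \<in> carrier (X n) \<Longrightarrow>
      mu (l + m) n (mu l m x y) z = mu l (m + n) x (mu m n y z)"
    and u_closed: "u \<in> carrier (X 0)"
    and mu_u_l: "x \<in> carrier (X n) \<Longrightarrow> mu 0 n u x = x"
    and mu_u_r: "x \<in> carrier (X n) \<Longrightarrow> mu n 0 x u = x"

text \<open>In the presentation of \<^term>\<open>A\<close> by cocycles \<^term>\<open>Z\<close> modulo \<^term>\<open>B\<close>, \<^term>\<open>cl n z\<close> is
  the class of \<^term>\<open>z\<close>; scalars are extended along \<^term>\<open>\<pi>\<close>.\<close>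

locale gr_pres = gr_base R X mu u
  for R :: "('a, 'r) ring_scheme" and X :: "int \<Rightarrow> ('a, 'x) module" and mu u +
  fixes K :: "('k, 'q) ring_scheme" and \<pi> :: "'a \<Rightarrow> 'k" and Z :: "int \<Rightarrow> 'x set"
    and A :: "('k, 'e) gr_algebra" and cl :: "int \<Rightarrow> 'x \<Rightarrow> 'e" and B :: "int \<Rightarrow> 'x set"
  assumes K: "cring K" and pi: "\<pi> \<in> ring_hom R K" "\<pi> ` carrier R = carrier K"
    and Z_sub: "submodule (Z n) R (X n)"
    and mu_Z: "x \<in> Z m \<Longrightarrow> y \<in> Z n \<Longrightarrow> mu m n x y \<in> Z (m + n)" and u_Z: "u \<in> Z 0"
    and cl_image: "cl n ` Z n = carrier (acomp A n)"
    and cl_zero: "cl n \<zero>\<^bsub>X n\<^esub> = \<zero>\<^bsub>acomp A n\<^esub>"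
    and cl_add: "x \<in> Z n \<Longrightarrow> y \<in> Z n \<Longrightarrow> cl n (x \<oplus>\<^bsub>X n\<^esub> y) = cl n x \<oplus>\<^bsub>acomp A n\<^esub> cl n y"
    and cl_smult: "r \<in> carrier R \<Longrightarrow> x \<in> Z n \<Longrightarrow> cl n (r \<odot>\<^bsub>X n\<^esub> x) = \<pi> r \<odot>\<^bsub>acomp A n\<^esub> cl n x"
    and cl_mult: "x \<in> Z m \<Longrightarrow> y \<in> Z n \<Longrightarrow> cl (m + n) (mu m n x y) = amult A m n (cl m x) (cl n y)"
    and cl_one: "aone A = cl 0 u"
    and cl_ker: "x \<in> Z n \<Longrightarrow> cl n x = \<zero>\<^bsub>acomp A n\<^esub> \<longleftrightarrow> x \<in> B n"
begin

sublocale X: module R "X n" for n by (rule X_module)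

lemma Z_module: "module R (X n\<lparr>carrier := Z n\<rparr>)"
  by (rule submodule.submodule_is_module[OF Z_sub X_module])

lemma Z_X: "x \<in> Z n \<Longrightarrow> x \<in> carrier (X n)"
  using X.submoduleE(1)[OF Z_sub] by auto

lemma Z_zero: "\<zero>\<^bsub>X n\<^esub> \<in> Z n"
  using Z_sub[of n] by (auto simp: submodule_def dest: subgroup.one_closed)

lemma Z_add: "x \<in> Z n \<Longrightarrow> y \<in> Z n \<Longrightarrow> x \<oplus>\<^bsub>X n\<^esub> y \<in> Z n"
  using X.submoduleE(5)[OF Z_sub] .

lemma Z_smult: "r \<in> carrier R \<Longrightarrow> y \<in> Z n \<Longrightarrow> r \<odot>\<^bsub>X n\<^esub> y \<in> Z n"
  using X.submoduleE(4)[OF Z_sub] .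

lemma Z_neg: "y \<in> Z n \<Longrightarrow> \<ominus>\<^bsub>X n\<^esub> y \<in> Z n"
  using X.submoduleE(3)[OF Z_sub] .

lemma Z_minus: "x \<in> Z n \<Longrightarrow> y \<in> Z n \<Longrightarrow> x \<ominus>\<^bsub>X n\<^esub> y \<in> Z n"
  by (simp add: a_minus_def Z_add Z_neg)

lemma A_module: "module K (acomp A n)"
  by (rule module_image[OF Z_module K pi, of "cl n" n])
    (simp_all add: cl_image cl_zero cl_add cl_smult)

sublocale A: module K "acomp A n" for n by (rule A_module)

lemma cl_closed: "x \<in> Z n \<Longrightarrow> cl n x \<in> carrier (acomp A n)"
  using cl_image by auto

lemma cl_cases:
  assumes "a \<in> carrier (acomp A n)"
  obtains x where "x \<in> Z n" "a = cl n x"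
  using assms cl_image[of n] by auto

lemma pi_cases:
  assumes "c \<in> carrier K"
  obtains r where "r \<in> carrier R" "c = \<pi> r"
  using assms pi(2) by auto

lemma pi_neg_one: "\<pi> (\<ominus>\<^bsub>R\<^esub> \<one>\<^bsub>R\<^esub>) = \<ominus>\<^bsub>K\<^esub> \<one>\<^bsub>K\<^esub>"
proof -
  interpret K: cring K by (rule K)
  interpret h: ring_hom_cring R K \<pi>
    by unfold_locales (rule pi(1))
  show ?thesis by (simp add: h.hom_one)
qed

lemma cl_neg: "x \<in> Z n \<Longrightarrow> cl n (\<ominus>\<^bsub>X n\<^esub> x) = \<ominus>\<^bsub>acomp A n\<^esub> cl n x"
  using cl_smult[of "\<ominus>\<^bsub>R\<^esub> \<one>\<^bsub>R\<^esub>" x n] Z_X[of x n] cl_closed[of x n]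
  by (simp add: X.smult_l_minus A.smult_l_minus pi_neg_one)

lemma cl_minus: "x \<in> Z n \<Longrightarrow> y \<in> Z n \<Longrightarrow> cl n (x \<ominus>\<^bsub>X n\<^esub> y) = cl n x \<ominus>\<^bsub>acomp A n\<^esub> cl n y"
  by (simp add: a_minus_def cl_add cl_neg Z_neg)

lemma cl_eq_iff: "x \<in> Z n \<Longrightarrow> y \<in> Z n \<Longrightarrow> cl n x = cl n y \<longleftrightarrow> x \<ominus>\<^bsub>X n\<^esub> y \<in> B n"
  by (simp add: cl_closed Z_minus cl_minus A.M.minus_eq_zero_iff flip: cl_ker)

lemma cl_finsum:
  assumes "finite J" "f \<in> J \<rightarrow> Z n"
  shows "finsum (X n) f J \<in> Z n" "cl n (finsum (X n) f J) = finsum (acomp A n) (\<lambda>j. cl n (f j)) J"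
proof -
  have "finsum (X n) f J \<in> Z n \<and> cl n (finsum (X n) f J) = finsum (acomp A n) (\<lambda>j. cl n (f j)) J"
    using assms
  proof (induction J rule: finite_induct)
    case (insert a J)
    then have f: "f a \<in> Z n" "f \<in> J \<rightarrow> Z n" by auto
    then have "f \<in> J \<rightarrow> carrier (X n)" "f a \<in> carrier (X n)"
      "(\<lambda>j. cl n (f j)) \<in> J \<rightarrow> carrier (acomp A n)" "cl n (f a) \<in> carrier (acomp A n)"
      by (auto simp: Z_X cl_closed Pi_def)
    then show ?case using insert f by (simp add: Z_add cl_add)
  qed (simp add: Z_zero cl_zero)
  then show "finsum (X n) f J \<in> Z n" "cl n (finsum (X n) f J) = finsum (acomp A n) (\<lambda>j. cl n (f j)) J"
    by auto
qed

lemma mu_simps: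
  assumes "x \<in> carrier (X m)" "y \<in> carrier (X n)"
  shows "mu m n x y \<in> carrier (X (m + n))"
    and "x' \<in> carrier (X m) \<Longrightarrow> mu m n (x \<oplus>\<^bsub>X m\<^esub> x') y = mu m n x y \<oplus>\<^bsub>X (m + n)\<^esub> mu m n x' y"
    and "y' \<in> carrier (X n) \<Longrightarrow> mu m n x (y \<oplus>\<^bsub>X n\<^esub> y') = mu m n x y \<oplus>\<^bsub>X (m + n)\<^esub> mu m n x y'"
    and "r \<in> carrier R \<Longrightarrow> mu m n (r \<odot>\<^bsub>X m\<^esub> x) y = r \<odot>\<^bsub>X (m + n)\<^esub> mu m n x y"
    and "r \<in> carrier R \<Longrightarrow> mu m n x (r \<odot>\<^bsub>X n\<^esub> y) = r \<odot>\<^bsub>X (m + n)\<^esub> mu m n x y"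
  using module_homD[OF mu_l[OF assms(2), of m]] module_homD[OF mu_r[OF assms(1), of n]] assms
  by auto

lemma amult_l: "b \<in> carrier (acomp A n) \<Longrightarrow>
    (\<lambda>a. amult A m n a b) \<in> module_hom K (acomp A m) (acomp A (m + n))"
proof (elim cl_cases, intro module_homI)
  fix y a assume y: "y \<in> Z n" "b = cl n y" and "a \<in> carrier (acomp A m)"
  then obtain x where x: "x \<in> Z m" "a = cl m x" by (elim cl_cases)
  show "amult A m n a b \<in> carrier (acomp A (m + n))"
    unfolding x y cl_mult[OF x(1) y(1), symmetric] using x y by (intro cl_closed mu_Z)
  {
    fix c assume "c \<in> carrier K"
    then obtain r where r: "r \<in> carrier R" "c = \<pi> r" by (elim pi_cases)
    show "amult A m n (c \<odot>\<^bsub>acomp A m\<^esub> a) b = c \<odot>\<^bsub>acomp A (m + n)\<^esub> amult A m n a b"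
      unfolding x y r cl_mult[OF x(1) y(1), symmetric] cl_smult[OF r(1) x(1), symmetric]
        cl_mult[OF Z_smult[OF r(1) x(1)] y(1), symmetric]
      using x y r by (simp add: mu_simps Z_X cl_smult mu_Z)
  }
  fix a' assume "a' \<in> carrier (acomp A m)"
  then obtain x' where x': "x' \<in> Z m" "a' = cl m x'" by (elim cl_cases)
  show "amult A m n (a \<oplus>\<^bsub>acomp A m\<^esub> a') b = amult A m n a b \<oplus>\<^bsub>acomp A (m + n)\<^esub> amult A m n a' b"
    unfolding x x' y cl_mult[OF x(1) y(1), symmetric] cl_mult[OF x'(1) y(1), symmetric]
      cl_add[OF x(1) x'(1), symmetric] cl_mult[OF Z_add[OF x(1) x'(1)] y(1), symmetric]
    using x y x' by (simp add: mu_simps Z_X cl_add mu_Z)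
qed

lemma amult_r: "a \<in> carrier (acomp A m) \<Longrightarrow>
    (\<lambda>b. amult A m n a b) \<in> module_hom K (acomp A n) (acomp A (m + n))"
proof (elim cl_cases, intro module_homI)
  fix y b assume y: "y \<in> Z m" "a = cl m y" and "b \<in> carrier (acomp A n)"
  then obtain x where x: "x \<in> Z n" "b = cl n x" by (elim cl_cases)
  show "amult A m n a b \<in> carrier (acomp A (m + n))"
    unfolding x y cl_mult[OF y(1) x(1), symmetric] using x y by (intro cl_closed mu_Z)
  {
    fix c assume "c \<in> carrier K"
    then obtain r where r: "r \<in> carrier R" "c = \<pi> r" by (elim pi_cases)
    show "amult A m n a (c \<odot>\<^bsub>acomp A n\<^esub> b) = c \<odot>\<^bsub>acomp A (m + n)\<^esub> amult A m n a b"
      unfolding x y r cl_mult[OF y(1) x(1), symmetric] cl_smult[OF r(1) x(1), symmetric]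
        cl_mult[OF y(1) Z_smult[OF r(1) x(1)], symmetric]
      using x y r by (simp add: mu_simps Z_X cl_smult mu_Z)
  }
  fix b' assume "b' \<in> carrier (acomp A n)"
  then obtain x' where x': "x' \<in> Z n" "b' = cl n x'" by (elim cl_cases)
  show "amult A m n a (b \<oplus>\<^bsub>acomp A n\<^esub> b') = amult A m n a b \<oplus>\<^bsub>acomp A (m + n)\<^esub> amult A m n a b'"
    unfolding x x' y cl_mult[OF y(1) x(1), symmetric] cl_mult[OF y(1) x'(1), symmetric]
      cl_add[OF x(1) x'(1), symmetric] cl_mult[OF y(1) Z_add[OF x(1) x'(1)], symmetric]
    using x y x' by (simp add: mu_simps Z_X cl_add mu_Z)
qed

lemma amult_simps:
  assumes "x \<in> carrier (acomp A m)" "y \<in> carrier (acomp A n)"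
  shows "amult A m n x y \<in> carrier (acomp A (m + n))"
    and "x' \<in> carrier (acomp A m) \<Longrightarrow> amult A m n (x \<oplus>\<^bsub>acomp A m\<^esub> x') y = amult A m n x y \<oplus>\<^bsub>acomp A (m + n)\<^esub> amult A m n x' y"
    and "y' \<in> carrier (acomp A n) \<Longrightarrow> amult A m n x (y \<oplus>\<^bsub>acomp A n\<^esub> y') = amult A m n x y \<oplus>\<^bsub>acomp A (m + n)\<^esub> amult A m n x y'"
  using module_homD[OF amult_l[OF assms(2), of m]] module_homD[OF amult_r[OF assms(1), of n]] assms
  by auto

text \<open>Passing to a subalgebra, such as the cocycles, leaves the class map and its kernel alone
  and merely reduces the set of representatives.\<close>

lemma pres_restrict:
  assumes "\<And>n. C n \<subseteq> carrier (acomp A n)"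
    and Z': "\<And>n. Z' n = {z \<in> Z n. cl n z \<in> C n}"
    and sub: "\<And>n. submodule (Z' n) R (X n)"
    and mu: "\<And>m n x y. x \<in> Z' m \<Longrightarrow> y \<in> Z' n \<Longrightarrow> mu m n x y \<in> Z' (m + n)"
    and u: "u \<in> Z' 0"
  shows "gr_pres R X mu u K \<pi> Z' (A\<lparr>acomp := \<lambda>n. (acomp A n)\<lparr>carrier := C n\<rparr>\<rparr>) cl B"
proof (intro gr_pres.intro gr_base_axioms gr_pres_axioms.intro K pi sub u; (rule mu; assumption)?)
  fix n
  show "cl n ` Z' n = carrier (acomp (A\<lparr>acomp := \<lambda>n. (acomp A n)\<lparr>carrier := C n\<rparr>\<rparr>) n)"
    using assms(1)[of n] unfolding Z' cl_image[symmetric] by auto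
qed (auto simp: Z' cl_zero cl_add cl_smult cl_mult cl_one cl_ker)

text \<open>Dividing by \<open>J\<close> composes the class map with the coset map. On
  representatives \<open>J\<close> becomes \<open>B'\<close>, and the conditions \<open>l\<close>
  and \<open>r\<close>, that \<open>B'\<close> absorbs products with \<open>Z\<close> from both
  sides, are what makes \<open>quot_map2\<close> compute the product.\<close>

lemma pres_quot:
  assumes J: "\<And>n. submodule (J n) K (acomp A n)"
    and B': "\<And>n x. x \<in> Z n \<Longrightarrow> cl n x \<in> J n \<longleftrightarrow> x \<in> B' n"
    and l: "\<And>m n x y. x \<in> Z m \<Longrightarrow> x \<in> B' m \<Longrightarrow> y \<in> Z n \<Longrightarrow> mu m n x y \<in> B' (m + n)"
    and r: "\<And>m n x y. x \<in> Z m \<Longrightarrow> y \<in> Z n \<Longrightarrow> y \<in> B' n \<Longrightarrow> mu m n x y \<in> B' (m + n)"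
  shows "gr_pres R X mu u K \<pi> Z (quot_algebra A J) (\<lambda>n z. J n +>\<^bsub>acomp A n\<^esub> cl n z) B'"
proof (intro gr_pres.intro gr_base_axioms gr_pres_axioms.intro K pi Z_sub u_Z; (rule mu_Z; assumption)?)
  note Q = quot_module_zero[OF A_module J] quot_module_add[OF A_module J]
    quot_module_smult[OF A_module J] quot_module_eq_iff[OF A_module J]
  fix n
  show "(\<lambda>z. J n +>\<^bsub>acomp A n\<^esub> cl n z) ` Z n = carrier (acomp (quot_algebra A J) n)"
    using quot_module_carrier[OF A_module J, of n]
    by (simp add: quot_algebra_def cl_image[symmetric] image_image del: quot_module_simps)
  show "J n +>\<^bsub>acomp A n\<^esub> cl n \<zero>\<^bsub>X n\<^esub> = \<zero>\<^bsub>acomp (quot_algebra A J) n\<^esub>"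
    by (simp add: quot_algebra_def cl_zero Q)
  {
    fix x assume x: "x \<in> Z n"
    have "J n +>\<^bsub>acomp A n\<^esub> cl n x = J n \<longleftrightarrow> cl n x \<ominus>\<^bsub>acomp A n\<^esub> \<zero>\<^bsub>acomp A n\<^esub> \<in> J n"
      using Q(4)[of "cl n x" n "\<zero>\<^bsub>acomp A n\<^esub>"] x by (simp add: Q(1) cl_closed)
    then show "(J n +>\<^bsub>acomp A n\<^esub> cl n x = \<zero>\<^bsub>acomp (quot_algebra A J) n\<^esub>) = (x \<in> B' n)"
      using x by (simp add: quot_algebra_def B' A.M.minus_zero_right cl_closed)
    fix y m assume y: "y \<in> Z m"
    show "J (n + m) +>\<^bsub>acomp A (n + m)\<^esub> cl (n + m) (mu n m x y) =
       amult (quot_algebra A J) n m (J n +>\<^bsub>acomp A n\<^esub> cl n x) (J m +>\<^bsub>acomp A m\<^esub> cl m y)"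
    proof -
      have "quot_map2 (acomp A (n + m)) (J (n + m)) (amult A n m)
          (J n +>\<^bsub>acomp A n\<^esub> cl n x) (J m +>\<^bsub>acomp A m\<^esub> cl m y)
        = J (n + m) +>\<^bsub>acomp A (n + m)\<^esub> amult A n m (cl n x) (cl m y)"
      proof (rule quot_map2_coset)
        show "amult A n m a b \<in> J (n + m)" if "a \<in> J n" "b \<in> carrier (acomp A m)" for a b
        proof -
          have "a \<in> carrier (acomp A n)" using that A.submoduleE(1)[OF J] by auto
          then obtain a' where "a' \<in> Z n" "a = cl n a'" by (elim cl_cases)
          moreover obtain b' where "b' \<in> Z m" "b = cl m b'" using cl_cases[OF \<open>b \<in> carrier (acomp A m)\<close>] by blast
          ultimately show ?thesis using that l[of a' n b' m] by (simp add: B' mu_Z flip: cl_mult)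
        qed
        show "amult A n m a b \<in> J (n + m)" if "a \<in> carrier (acomp A n)" "b \<in> J m" for a b
        proof -
          have "b \<in> carrier (acomp A m)" using that A.submoduleE(1)[OF J] by auto
          then obtain b' where "b' \<in> Z m" "b = cl m b'" by (elim cl_cases)
          moreover obtain a' where "a' \<in> Z n" "a = cl n a'" using cl_cases[OF \<open>a \<in> carrier (acomp A n)\<close>] by blast
          ultimately show ?thesis using that r[of a' n b' m] by (simp add: B' mu_Z flip: cl_mult)
        qed
      qed (use x y J in \<open>auto simp: A.abelian_group_axioms cl_closed amult_simps submodule_def\<close>)
      then show ?thesis using x y by (simp add: quot_algebra_def cl_mult)
    qed
  }
qed (simp_all add: quot_algebra_def cl_add cl_smult cl_one cl_closed
      quot_module_add[OF A_module J] quot_module_smult[OF A_module J] ring_hom_closed[OF pi(1)])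

lemma graded_regular: "graded_left_module K A (regular_module A)"
  unfolding graded_left_module_def regular_module_def gr_module.simps
proof (intro conjI allI ballI)
  fix n x assume "x \<in> carrier (acomp A n)"
  then show "amult A 0 n (aone A) x = x"
    using cl_mult[OF u_Z, of _ n] mu_u_l Z_X by (auto simp: cl_one elim!: cl_cases)
next
  fix l m n a b x
  assume "a \<in> carrier (acomp A l)" "b \<in> carrier (acomp A m)" "x \<in> carrier (acomp A n)"
  then obtain a' b' x' where "a' \<in> Z l" "a = cl l a'" "b' \<in> Z m" "b = cl m b'" "x' \<in> Z n" "x = cl n x'"
    by (metis cl_cases)
  then show "amult A (l + m) n (amult A l m a b) x = amult A l (m + n) a (amult A m n b x)"
    using mu_assoc[of a' l b' m x' n] by (simp add: Z_X mu_Z add.assoc flip: cl_mult)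
qed (use A_module amult_l amult_r in auto)

lemma amult_one_r: "a \<in> carrier (acomp A n) \<Longrightarrow> amult A n 0 a (aone A) = a"
  using cl_mult[OF _ u_Z, of _ n] mu_u_r Z_X by (auto simp: cl_one elim!: cl_cases)

lemma one_closed: "aone A \<in> carrier (acomp A 0)"
  by (simp add: cl_one cl_closed u_Z)

end

text \<open>A coset of scalars acts through an arbitrarily selected representative. As
  \<open>I\<close> multiplies \<open>Z\<close> into \<open>B\<close>, the choice does not affect
  classes, and the same class map presents the algebra over the quotient ring.\<close>

lemma pres_residue:
  assumes "gr_pres R X mu u R (\<lambda>r. r) Z A cl B" and I: "ideal I R"
    and kill: "\<And>n r x. r \<in> I \<Longrightarrow> x \<in> Z n \<Longrightarrow> r \<odot>\<^bsub>X n\<^esub> x \<in> B n"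
  shows "gr_pres R X mu u (R Quot I) (\<lambda>r. I +>\<^bsub>R\<^esub> r) Z (residue_algebra A) cl B"
proof -
  interpret gr_pres R X mu u R "\<lambda>r. r" Z A cl B by fact
  interpret I: ideal I R by fact
  have ac: "acomp (residue_algebra A) n = residue_scalars (acomp A n)"
    "amult (residue_algebra A) = amult A" "aone (residue_algebra A) = aone A" for n
    by (simp_all add: residue_algebra_def)
  have rs: "carrier (residue_scalars M) = carrier M" "zero (residue_scalars M) = zero M"
    "add (residue_scalars M) = add M"
    "smult (residue_scalars M) = (\<lambda>c x. (SOME r. r \<in> c) \<odot>\<^bsub>M\<^esub> x)" for M :: "('a, 'e) module"
    by (simp_all add: residue_scalars_def)
  have kill': "(SOME r'. r' \<in> I +>\<^bsub>R\<^esub> r) \<odot>\<^bsub>acomp A n\<^esub> cl n x = r \<odot>\<^bsub>acomp A n\<^esub> cl n x"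
    if r: "r \<in> carrier R" and x: "x \<in> Z n" for r x n
  proof -
    have "(SOME r'. r' \<in> I +>\<^bsub>R\<^esub> r) \<in> I +>\<^bsub>R\<^esub> r"
      using I.a_rcos_self[OF r] by (rule someI)
    then obtain i where i: "i \<in> I" "(SOME r'. r' \<in> I +>\<^bsub>R\<^esub> r) = i \<oplus>\<^bsub>R\<^esub> r"
      by (auto simp: a_r_coset_def')
    have "i \<odot>\<^bsub>acomp A n\<^esub> cl n x = \<zero>\<^bsub>acomp A n\<^esub>"
      using kill[OF i(1) x] i(1) x by (simp add: Z_smult cl_ker flip: cl_smult)
    then show ?thesis
      using i r x by (simp add: A.smult_l_distr cl_closed)
  qed
  have "carrier (R Quot I) = (\<lambda>r. I +>\<^bsub>R\<^esub> r) ` carrier R"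
    by (auto simp: FactRing_def A_RCOSETS_def')
  then show ?thesis
    using I.rcos_ring_hom
    by (intro gr_pres.intro gr_base_axioms gr_pres_axioms.intro) (auto simp: ac rs kill' cl_image cl_zero cl_add cl_smult cl_mult cl_one cl_ker
        Z_sub mu_Z u_Z I.quotient_is_cring[OF K] K)
qed

text \<open>Both algebras are presented by the same cochains and \<open>\<iota>\<close> is the
  identity on representatives. Linearity, multiplicativity and compatibility with the units then
  hold because they hold for the two class maps.\<close>

locale gr_pres_pair = E: gr_pres R X mu u K \<pi> ZE E clE BE + S: gr_pres R X mu u K \<pi> ZS S clS BS
  for R :: "('a, 'r) ring_scheme" and X :: "int \<Rightarrow> ('a, 'x) module" and mu u
    and K :: "('k, 'q) ring_scheme" and \<pi> :: "'a \<Rightarrow> 'k" and ZE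
    and E :: "('k, 'e) gr_algebra" and clE BE ZS and S :: "('k, 'f) gr_algebra" and clS BS +
  fixes \<iota> :: "int \<Rightarrow> 'e \<Rightarrow> 'f"
  assumes ZE_ZS: "x \<in> ZE n \<Longrightarrow> x \<in> ZS n"
    and iota: "x \<in> ZE n \<Longrightarrow> \<iota> n (clE n x) = clS n x"
begin

lemma iota_closed: "a \<in> carrier (acomp E n) \<Longrightarrow> \<iota> n a \<in> carrier (acomp S n)"
  by (auto elim!: E.cl_cases simp: iota S.cl_closed ZE_ZS)

lemma iota_hom: "\<iota> n \<in> module_hom K (acomp E n) (acomp S n)"
proof (intro module_homI)
  fix a assume a: "a \<in> carrier (acomp E n)"
  then show "\<iota> n a \<in> carrier (acomp S n)" by (rule iota_closed)
  obtain x where x: "x \<in> ZE n" "a = clE n x" using a by (elim E.cl_cases)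
  {
    fix c assume "c \<in> carrier K"
    then obtain r where r: "r \<in> carrier R" "c = \<pi> r" by (elim E.pi_cases)
    show "\<iota> n (c \<odot>\<^bsub>acomp E n\<^esub> a) = c \<odot>\<^bsub>acomp S n\<^esub> \<iota> n a"
      unfolding x r E.cl_smult[OF r(1) x(1), symmetric]
      using x r by (simp add: iota ZE_ZS E.Z_smult S.cl_smult)
  }
  fix b assume b: "b \<in> carrier (acomp E n)"
  obtain y where y: "y \<in> ZE n" "b = clE n y" using b by (elim E.cl_cases)
  show "\<iota> n (a \<oplus>\<^bsub>acomp E n\<^esub> b) = \<iota> n a \<oplus>\<^bsub>acomp S n\<^esub> \<iota> n b"
    unfolding x y E.cl_add[OF x(1) y(1), symmetric]
    using x y by (simp add: iota ZE_ZS E.Z_add S.cl_add)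
qed

lemma iota_mult: "a \<in> carrier (acomp E m) \<Longrightarrow> b \<in> carrier (acomp E n) \<Longrightarrow>
    \<iota> (m + n) (amult E m n a b) = amult S m n (\<iota> m a) (\<iota> n b)"
proof (elim E.cl_cases)
  fix x y assume x: "x \<in> ZE m" "a = clE m x" and y: "y \<in> ZE n" "b = clE n y"
  show ?thesis
    unfolding x y E.cl_mult[OF x(1) y(1), symmetric]
    using x y by (simp add: iota ZE_ZS E.mu_Z S.cl_mult)
qed

lemma iota_one: "\<iota> 0 (aone E) = aone S"
  by (simp add: E.cl_one S.cl_one iota E.u_Z)

lemma graded_via: "graded_left_module K E (module_via \<iota> S)"
  unfolding graded_left_module_def module_via_def gr_module.simps
proof (intro conjI allI ballI)
  fix m n x assume x: "x \<in> carrier (acomp S n)"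
  show "(\<lambda>a. amult S m n (\<iota> m a) x) \<in> module_hom K (acomp E m) (acomp S (m + n))"
    by (rule module_hom_compose[OF iota_hom S.amult_l[OF x]])
next
  fix l m n a b x
  assume "a \<in> carrier (acomp E l)" "b \<in> carrier (acomp E m)" "x \<in> carrier (acomp S n)"
  then show "amult S (l + m) n (\<iota> (l + m) (amult E l m a b)) x =
      amult S l (m + n) (\<iota> l a) (amult S m n (\<iota> m b) x)"
    using S.graded_regular iota_closed
    by (simp add: iota_mult graded_left_module_def regular_module_def)
next
  fix n x assume "x \<in> carrier (acomp S n)"
  then show "amult S 0 n (\<iota> 0 (aone E)) x = x"
    using S.graded_regular by (simp add: iota_one graded_left_module_def regular_module_def)
qed (auto simp: S.A_module iota_closed intro: S.amult_r)

lemma iota_gr_hom: "\<iota> \<in> gr_hom K E 0 (regular_module E) (module_via \<iota> S)"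
  by (auto simp: gr_hom_def regular_module_def module_via_def iota_hom iota_mult)

end

section \<open>Cohomology algebras of the endomorphism complex\<close>

lemma submodule_vimage:
  assumes "module R M" "module R N" "f \<in> module_hom R M N" "submodule U R N"
  shows "submodule {x \<in> carrier M. f x \<in> U} R M"
proof (rule module_carrier_update(1)[OF assms(1)])
  interpret M: module R M by fact
  interpret N: module R N by fact
  show "\<zero>\<^bsub>M\<^esub> \<in> {x \<in> carrier M. f x \<in> U}"
    using module_hom_zero[OF assms(1-3)] assms(4) by (auto simp: submodule_def dest: subgroup.one_closed)
qed (use assms module.submoduleE[OF assms(2,4)] in \<open>auto simp: module_homD[OF assms(3)] module.smult_closed
    abelian_groupE(1)[OF module_abelian]\<close>)

lemma submodule_image:
  assumes "module R M" "module R N" "f \<in> module_hom R M N" "submodule V R M"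
  shows "submodule (f ` V) R N"
proof (rule module_carrier_update(1)[OF assms(2)])
  interpret M: module R M by fact
  have sub: "V \<subseteq> carrier M" using M.submoduleE(1)[OF assms(4)] .
  have z: "\<zero>\<^bsub>M\<^esub> \<in> V" using assms(4) by (auto simp: submodule_def dest: subgroup.one_closed)
  show "f ` V \<subseteq> carrier N" using sub module_homD(1)[OF assms(3)] by auto
  show "\<zero>\<^bsub>N\<^esub> \<in> f ` V" using z module_hom_zero[OF assms(1-3)] by (metis imageI)
  fix x y assume "x \<in> f ` V" "y \<in> f ` V"
  then obtain x' y' where "x' \<in> V" "y' \<in> V" "x = f x'" "y = f y'" by auto
  moreover from this have "x \<oplus>\<^bsub>N\<^esub> y = f (x' \<oplus>\<^bsub>M\<^esub> y')"
    using subsetD[OF sub, of x'] subsetD[OF sub, of y'] module_homD(2)[OF assms(3), of x' y'] by simp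
  ultimately show "x \<oplus>\<^bsub>N\<^esub> y \<in> f ` V" using M.submoduleE(5)[OF assms(4)] by simp
next
  interpret M: module R M by fact
  have sub: "V \<subseteq> carrier M" using M.submoduleE(1)[OF assms(4)] .
  fix r x assume "r \<in> carrier R" "x \<in> f ` V"
  moreover from this obtain x' where "x' \<in> V" "x = f x'" by auto
  moreover from calculation have "r \<odot>\<^bsub>N\<^esub> x = f (r \<odot>\<^bsub>M\<^esub> x')"
    using subsetD[OF sub, of x'] module_homD(3)[OF assms(3), of r x'] by simp
  ultimately show "r \<odot>\<^bsub>N\<^esub> x \<in> f ` V" using M.submoduleE(4)[OF assms(4)] by simp
qed

lemma submodule_zero: "module R M \<Longrightarrow> submodule {\<zero>\<^bsub>M\<^esub>} R M"
  by (rule module_carrier_update(1))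
    (auto simp: module.smult_r_null abelian_groupE(1,2,5) dest!: module_abelian intro: abelian_groupE)

lemma submodule_restrict:
  assumes "module R M" "submodule U R M" "U \<subseteq> Z" "submodule Z R M"
  shows "submodule U R (M\<lparr>carrier := Z\<rparr>)"
proof (rule module_carrier_update(1)[OF submodule.submodule_is_module[OF assms(4,1)]])
  show "\<zero>\<^bsub>M\<lparr>carrier := Z\<rparr>\<^esub> \<in> U"
    using assms(2) by (auto simp: submodule_def dest: subgroup.one_closed)
qed (use assms module.submoduleE(4,5)[OF assms(1,2)] in auto)

context mod_complex
begin

abbreviation bd :: "int \<Rightarrow> (int \<Rightarrow> 'b \<Rightarrow> 'b) set" where
  "bd \<equiv> hom_bounded R F F"

lemma bd_iff: "\<beta> \<in> bd n \<longleftrightarrow> \<beta> \<in> AC n \<and> (\<exists>N. \<forall>i\<ge>N. \<forall>x\<in>FC i. \<beta> i x = \<zero>\<^bsub>F (i - n)\<^esub>)"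
proof -
  have "\<beta> i = \<zero>\<^bsub>hom_module R (F i) (F (i - n))\<^esub> \<longleftrightarrow> (\<forall>x\<in>FC i. \<beta> i x = \<zero>\<^bsub>F (i - n)\<^esub>)"
    if "\<beta> \<in> AC n" for i
    using A_ext[OF that] by (auto simp: fun_eq_iff restrict_def)
  then show ?thesis unfolding hom_bounded_def by blast
qed

lemma bd_sub: "submodule (bd n) R (A n)"
proof (rule module_carrier_update(1)[OF A_module])
  fix \<beta> \<gamma> assume "\<beta> \<in> bd n" "\<gamma> \<in> bd n"
  then obtain N N' where "\<forall>i\<ge>N. \<forall>x\<in>FC i. \<beta> i x = \<zero>\<^bsub>F (i - n)\<^esub>"
    "\<forall>i\<ge>N'. \<forall>x\<in>FC i. \<gamma> i x = \<zero>\<^bsub>F (i - n)\<^esub>" "\<beta> \<in> AC n" "\<gamma> \<in> AC n"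
    by (auto simp: bd_iff)
  moreover from this have "\<beta> \<oplus>\<^bsub>A n\<^esub> \<gamma> \<in> AC n" by simp
  ultimately show "\<beta> \<oplus>\<^bsub>A n\<^esub> \<gamma> \<in> bd n"
    unfolding bd_iff by (intro conjI exI[of _ "max N N'"]) (auto simp: A_simps(2))
next
  fix r \<beta> assume r: "r \<in> carrier R" and "\<beta> \<in> bd n"
  then obtain N where "\<forall>i\<ge>N. \<forall>x\<in>FC i. \<beta> i x = \<zero>\<^bsub>F (i - n)\<^esub>" "\<beta> \<in> AC n"
    by (auto simp: bd_iff)
  moreover from this have "r \<odot>\<^bsub>A n\<^esub> \<beta> \<in> AC n" using r by simp
  ultimately show "r \<odot>\<^bsub>A n\<^esub> \<beta> \<in> bd n"
    unfolding bd_iff using r by (intro conjI exI[of _ N]) (auto simp: A_simps(3))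
next
  have "\<zero>\<^bsub>A n\<^esub> \<in> AC n" by simp
  then show "\<zero>\<^bsub>A n\<^esub> \<in> bd n" unfolding bd_iff by (auto simp: A_simps(1))
qed (auto simp: bd_iff)

section \<open>Composition product of cochains\<close>

lemma gr_base_A: "gr_base R A (\<lambda>m n. mul n) idA"
proof
  fix m n y assume y: "y \<in> AC n"
  have eq: "i - n - m = i - (m + n)" for i by simp
  show "(\<lambda>x. mul n x y) \<in> module_hom R (A m) (A (m + n))"
  proof (intro module_homI)
    fix x assume x: "x \<in> AC m"
    show "mul n x y \<in> AC (m + n)" using x y by (rule mul_closed)
    {
      fix r assume r: "r \<in> carrier R"
      show "mul n (r \<odot>\<^bsub>A m\<^esub> x) y = r \<odot>\<^bsub>A (m + n)\<^esub> mul n x y"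
      proof (rule A_eqI)
        show "mul n (r \<odot>\<^bsub>A m\<^esub> x) y \<in> AC (m + n)" using x y r by (intro mul_closed) auto
        show "r \<odot>\<^bsub>A (m + n)\<^esub> mul n x y \<in> AC (m + n)" using mul_closed[OF x y] r by simp
      qed (use x y r in \<open>auto simp: A_simps(3) compose_eq eq\<close>)
    }
    fix x' assume x': "x' \<in> AC m"
    show "mul n (x \<oplus>\<^bsub>A m\<^esub> x') y = mul n x y \<oplus>\<^bsub>A (m + n)\<^esub> mul n x' y"
    proof (rule A_eqI)
      show "mul n x y \<oplus>\<^bsub>A (m + n)\<^esub> mul n x' y \<in> AC (m + n)"
        using mul_closed[OF x y] mul_closed[OF x' y] by simp
      show "mul n (x \<oplus>\<^bsub>A m\<^esub> x') y \<in> AC (m + n)" using x y x' by (intro mul_closed) auto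
    qed (use x y x' in \<open>auto simp: A_simps(2) compose_eq eq\<close>)
  qed
next
  fix m n x assume x: "x \<in> AC m"
  have eq: "i - (m + n) = i - n - m" for i by simp
  show "mul n x \<in> module_hom R (A n) (A (m + n))"
  proof (intro module_homI)
    fix y assume y: "y \<in> AC n"
    show "mul n x y \<in> AC (m + n)" using x y by (rule mul_closed)
    {
      fix r assume r: "r \<in> carrier R"
      show "mul n x (r \<odot>\<^bsub>A n\<^esub> y) = r \<odot>\<^bsub>A (m + n)\<^esub> mul n x y"
      proof (rule A_eqI)
        show "mul n x (r \<odot>\<^bsub>A n\<^esub> y) \<in> AC (m + n)" using x y r by (intro mul_closed) auto
        show "r \<odot>\<^bsub>A (m + n)\<^esub> mul n x y \<in> AC (m + n)" using mul_closed[OF x y] r by simp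
      qed (use x y r in \<open>auto simp: A_simps(3) compose_eq eq module_homD[OF A_hom[OF x]]\<close>)
    }
    fix y' assume y': "y' \<in> AC n"
    show "mul n x (y \<oplus>\<^bsub>A n\<^esub> y') = mul n x y \<oplus>\<^bsub>A (m + n)\<^esub> mul n x y'"
    proof (rule A_eqI)
      show "mul n x (y \<oplus>\<^bsub>A n\<^esub> y') \<in> AC (m + n)" using x y y' by (intro mul_closed) auto
      show "mul n x y \<oplus>\<^bsub>A (m + n)\<^esub> mul n x y' \<in> AC (m + n)"
        using mul_closed[OF x y] mul_closed[OF x y'] by simp
    qed (use x y y' in \<open>auto simp: A_simps(2) compose_eq eq module_homD[OF A_hom[OF x]]\<close>)
  qed
next
  fix l m n x y z assume "x \<in> AC l" "y \<in> AC m" "z \<in> AC n"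
  then show "mul n (mul m x y) z = mul (m + n) x (mul n y z)"
    by (intro ext) (auto simp: compose_def fun_eq_iff restrict_def A_closed algebra_simps)
next
  fix n x assume x: "x \<in> AC n"
  show "mul n idA x = x"
    using x A_ext[OF x] by (auto simp: compose_def fun_eq_iff restrict_def)
  show "mul 0 x idA = x"
    using x A_ext[OF x] by (auto simp: compose_def fun_eq_iff restrict_def)
qed (auto simp: A_module)

sublocale B: gr_base R A "\<lambda>m n. mul n" idA by (rule gr_base_A)

lemma pres_endo: "gr_pres R A (\<lambda>m n. mul n) idA R (\<lambda>r. r) (\<lambda>n. AC n) (endo_algebra R F) (\<lambda>n z. z) (\<lambda>n. {\<zero>\<^bsub>A n\<^esub>})"
  by (intro gr_pres.intro gr_base_A gr_pres_axioms.intro)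
    (auto simp: endo_algebra_def A.carrier_is_submodule module_cring[OF A_module] ring_hom_def)

interpretation P0: gr_pres R A "\<lambda>m n. mul n" idA R "\<lambda>r. r" "\<lambda>n. AC n" "endo_algebra R F" "\<lambda>n z. z" "\<lambda>n. {\<zero>\<^bsub>A n\<^esub>}"
  by (rule pres_endo)

lemma Leibniz_mul:
  assumes a: "\<alpha> \<in> AC m" and b: "\<beta> \<in> AC n"
  shows "D (m + n) (mul n \<alpha> \<beta>) = mul n (D m \<alpha>) \<beta> \<oplus>\<^bsub>A (m + n + 1)\<^esub>
     sgn_act (A (m + n + 1)) m (mul (n + 1) \<alpha> (D n \<beta>))"
proof (rule A_eqI)
  have 1: "mul n (D m \<alpha>) \<beta> \<in> AC (m + n + 1)"
    using mul_closed[OF D_closed[OF a] b] by (simp add: algebra_simps)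
  have 2: "mul (n + 1) \<alpha> (D n \<beta>) \<in> AC (m + n + 1)"
    using mul_closed[OF a D_closed[OF b]] by (simp add: algebra_simps)
  show "mul n (D m \<alpha>) \<beta> \<oplus>\<^bsub>A (m + n + 1)\<^esub> sgn_act (A (m + n + 1)) m (mul (n + 1) \<alpha> (D n \<beta>)) \<in> AC (m + n + 1)"
    using 1 2 by (auto intro: sgn_act_closed[OF A_module])
  fix i x assume x: "x \<in> FC i"
  have eq: "i - (m + n + 1) = i - n - m - 1" "i - (n + 1) = i - n - 1" by simp_all
  show "D (m + n) (mul n \<alpha> \<beta>) i x = (mul n (D m \<alpha>) \<beta> \<oplus>\<^bsub>A (m + n + 1)\<^esub>
     sgn_act (A (m + n + 1)) m (mul (n + 1) \<alpha> (D n \<beta>))) i x"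
    unfolding Leibniz[OF a b x]
    using x 1 2 by (simp add: A_simps(2) A_sgn_act compose_eq eq)
qed (use mul_closed[OF a b] in auto)

lemma bd_mul_l:
  assumes "\<alpha> \<in> bd m" "\<beta> \<in> AC n"
  shows "mul n \<alpha> \<beta> \<in> bd (m + n)"
proof -
  obtain N where N: "\<forall>i\<ge>N. \<forall>x\<in>FC i. \<alpha> i x = \<zero>\<^bsub>F (i - m)\<^esub>" and a: "\<alpha> \<in> AC m"
    using assms(1) by (auto simp: bd_iff)
  have "compose (FC i) (\<alpha> (i - n)) (\<beta> i) x = \<zero>\<^bsub>F (i - (m + n))\<^esub>"
    if "i \<ge> N + n" "x \<in> FC i" for i x
  proof -
    have "\<alpha> (i - n) (\<beta> i x) = \<zero>\<^bsub>F (i - n - m)\<^esub>" using N that assms by auto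
    then show ?thesis using that by (simp add: compose_eq algebra_simps)
  qed
  then show ?thesis unfolding bd_iff using mul_closed[OF a assms(2)] by blast
qed

lemma bd_mul_r:
  assumes "\<alpha> \<in> AC m" "\<beta> \<in> bd n"
  shows "mul n \<alpha> \<beta> \<in> bd (m + n)"
proof -
  obtain N where N: "\<forall>i\<ge>N. \<forall>x\<in>FC i. \<beta> i x = \<zero>\<^bsub>F (i - n)\<^esub>" and b: "\<beta> \<in> AC n"
    using assms(2) by (auto simp: bd_iff)
  have "compose (FC i) (\<alpha> (i - n)) (\<beta> i) x = \<zero>\<^bsub>F (i - (m + n))\<^esub>"
    if "i \<ge> N" "x \<in> FC i" for i x
  proof -
    have "\<alpha> (i - n) (\<beta> i x) = \<zero>\<^bsub>F (i - n - m)\<^esub>"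
      using N that module_hom_zero[OF F_module F_module A_hom[OF assms(1)]] by auto
    then show ?thesis using that by (simp add: compose_eq algebra_simps)
  qed
  then show ?thesis unfolding bd_iff using mul_closed[OF assms(1) b] by blast
qed

definition ZE :: "int \<Rightarrow> (int \<Rightarrow> 'b \<Rightarrow> 'b) set" where
  "ZE n = {z \<in> AC n. D n z = \<zero>\<^bsub>A (n + 1)\<^esub>}"

definition BE :: "int \<Rightarrow> (int \<Rightarrow> 'b \<Rightarrow> 'b) set" where
  "BE n = D (n - 1) ` AC (n - 1)"

text \<open>Cocycles and coboundaries of the quotient complex, described by cochains in
  \<open>A\<close> instead of cosets: equations between cochains are only required up to bounded
  maps.\<close>

definition ZS :: "int \<Rightarrow> (int \<Rightarrow> 'b \<Rightarrow> 'b) set" where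
  "ZS n = {z \<in> AC n. D n z \<in> bd (n + 1)}"

definition BS :: "int \<Rightarrow> (int \<Rightarrow> 'b \<Rightarrow> 'b) set" where
  "BS n = {z \<in> AC n. \<exists>\<gamma>\<in>AC (n - 1). z \<ominus>\<^bsub>A n\<^esub> D (n - 1) \<gamma> \<in> bd n}"

lemma D_hom': "D (n - 1) \<in> module_hom R (A (n - 1)) (A n)"
  using D_hom[of "n - 1"] by simp

lemma D_closed' [intro]: "\<gamma> \<in> AC (n - 1) \<Longrightarrow> D (n - 1) \<gamma> \<in> AC n"
  using D_closed[of \<gamma> "n - 1"] by simp

lemma ZE_sub: "submodule (ZE n) R (A n)"
  unfolding ZE_def using submodule_vimage[OF A_module A_module D_hom submodule_zero[OF A_module], of n] by simp

lemma ZS_sub: "submodule (ZS n) R (A n)"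
  unfolding ZS_def by (rule submodule_vimage[OF A_module A_module D_hom bd_sub])

lemma BE_sub: "submodule (BE n) R (A n)"
  unfolding BE_def by (rule submodule_image[OF A_module A_module D_hom' A.carrier_is_submodule])

lemma BE_ZE: "BE n \<subseteq> ZE n"
  using D_D[of _ "n - 1"] by (auto simp: BE_def ZE_def)

lemma BE_I: "\<beta> \<in> AC n \<Longrightarrow> n = k - 1 \<Longrightarrow> D n \<beta> \<in> BE k"
  by (auto simp: BE_def)

lemma sgn_act_submodule:
  assumes "module R M" "submodule U R M" "x \<in> U"
  shows "sgn_act M k x \<in> U"
  using module.submoduleE(3)[OF assms(1,2)] assms(3) by (auto simp: sgn_act_def)

lemma mul_zero_l: "\<beta> \<in> AC n \<Longrightarrow> mul n \<zero>\<^bsub>A m\<^esub> \<beta> = \<zero>\<^bsub>A (m + n)\<^esub>"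
  using module_hom_zero[OF A_module A_module B.mu_l] .

lemma mul_zero_r: "\<alpha> \<in> AC m \<Longrightarrow> mul n \<alpha> \<zero>\<^bsub>A n\<^esub> = \<zero>\<^bsub>A (m + n)\<^esub>"
  using module_hom_zero[OF A_module A_module B.mu_r] .

lemma ZE_mul:
  assumes "\<alpha> \<in> ZE m" "\<beta> \<in> ZE n"
  shows "mul n \<alpha> \<beta> \<in> ZE (m + n)"
proof -
  have "D (m + n) (mul n \<alpha> \<beta>) = \<zero>\<^bsub>A (m + n + 1)\<^esub>"
    using assms mul_zero_l[of \<beta> n "m + 1"] mul_zero_r[of \<alpha> m "n + 1"]
    by (subst Leibniz_mul) (auto simp: ZE_def sgn_act_zero[OF A_module] algebra_simps)
  then show ?thesis using assms by (auto simp: ZE_def)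
qed

lemma mul_D_l:
  assumes "\<gamma> \<in> AC (m - 1)" "\<beta> \<in> ZE n"
  shows "mul n (D (m - 1) \<gamma>) \<beta> = D (m + n - 1) (mul n \<gamma> \<beta>)"
proof -
  have eq: "m - 1 + n = m + n - 1" "m + n - 1 + 1 = m + n" by simp_all
  have "D (m + n - 1) (mul n \<gamma> \<beta>) = mul n (D (m - 1) \<gamma>) \<beta> \<oplus>\<^bsub>A (m + n)\<^esub> \<zero>\<^bsub>A (m + n)\<^esub>"
    using Leibniz_mul[of \<gamma> "m - 1" \<beta> n] assms mul_zero_r[of \<gamma> "m - 1" "n + 1"]
    by (simp add: ZE_def eq sgn_act_zero[OF A_module])
  moreover have "mul n (D (m - 1) \<gamma>) \<beta> \<in> AC (m + n)"
    using assms by (intro mul_closed) (auto simp: ZE_def)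
  ultimately show ?thesis by simp
qed

lemma mul_D_r:
  assumes "\<alpha> \<in> ZE m" "\<gamma> \<in> AC (n - 1)"
  shows "mul n \<alpha> (D (n - 1) \<gamma>) = D (m + n - 1) (sgn_act (A (m + n - 1)) m (mul (n - 1) \<alpha> \<gamma>))"
proof -
  have eq: "m + (n - 1) = m + n - 1" "m + n - 1 + 1 = m + n" by simp_all
  have c: "mul n \<alpha> (D (n - 1) \<gamma>) \<in> AC (m + n)"
    using assms by (intro mul_closed) (auto simp: ZE_def)
  have g: "mul (n - 1) \<alpha> \<gamma> \<in> AC (m + n - 1)"
    using mul_closed[of \<alpha> m \<gamma> "n - 1"] assms by (simp add: eq ZE_def)
  have "D (m + n - 1) (mul (n - 1) \<alpha> \<gamma>) = \<zero>\<^bsub>A (m + n)\<^esub> \<oplus>\<^bsub>A (m + n)\<^esub> sgn_act (A (m + n)) m (mul n \<alpha> (D (n - 1) \<gamma>))"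
    using Leibniz_mul[of \<alpha> m \<gamma> "n - 1"] assms mul_zero_l[of \<gamma> "n - 1" "m + 1"]
    by (simp add: ZE_def eq)
  then have "D (m + n - 1) (mul (n - 1) \<alpha> \<gamma>) = sgn_act (A (m + n)) m (mul n \<alpha> (D (n - 1) \<gamma>))"
    using c by (simp add: sgn_act_closed[OF A_module])
  moreover have "D (m + n - 1) (sgn_act (A (m + n - 1)) m (mul (n - 1) \<alpha> \<gamma>)) =
      sgn_act (A (m + n)) m (D (m + n - 1) (mul (n - 1) \<alpha> \<gamma>))"
    by (rule module_hom_sgn_act[OF A_module A_module D_hom' g])
  ultimately show ?thesis using c by (simp add: sgn_act_sgn_act[OF A_module] sgn_act_def)
qed

lemma BE_mul_l:
  assumes "\<alpha> \<in> BE m" "\<beta> \<in> ZE n"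
  shows "mul n \<alpha> \<beta> \<in> BE (m + n)"
proof -
  obtain \<gamma> where "\<gamma> \<in> AC (m - 1)" "\<alpha> = D (m - 1) \<gamma>" using assms by (auto simp: BE_def)
  moreover from this have "mul n \<gamma> \<beta> \<in> AC (m + n - 1)"
    using mul_closed[of \<gamma> "m - 1" \<beta> n] assms by (simp add: ZE_def algebra_simps)
  ultimately show ?thesis using assms by (simp add: mul_D_l BE_I)
qed

lemma BE_mul_r:
  assumes "\<alpha> \<in> ZE m" "\<beta> \<in> BE n"
  shows "mul n \<alpha> \<beta> \<in> BE (m + n)"
proof -
  obtain \<gamma> where "\<gamma> \<in> AC (n - 1)" "\<beta> = D (n - 1) \<gamma>" using assms by (auto simp: BE_def)
  moreover from this have "mul (n - 1) \<alpha> \<gamma> \<in> AC (m + n - 1)"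
    using mul_closed[of \<alpha> m \<gamma> "n - 1"] assms by (simp add: ZE_def algebra_simps)
  ultimately show ?thesis using assms by (simp add: mul_D_r BE_I sgn_act_closed[OF A_module])
qed

lemma idA_ZE: "idA \<in> ZE 0"
proof -
  have "D 0 idA = \<zero>\<^bsub>A (0 + 1)\<^esub>"
  proof (rule A_eqI[OF D_closed[OF idA_closed] A.M.zero_closed])
    show "D 0 idA i x = \<zero>\<^bsub>A (0 + 1)\<^esub> i x" if "x \<in> FC i" for i x
      using that by (simp add: D_apply A_simps(1) F.M.minus_eq_zero_iff)
  qed
  then show ?thesis by (simp add: ZE_def)
qed

lemma bd_minus: "\<beta> \<in> bd n \<Longrightarrow> \<gamma> \<in> bd n \<Longrightarrow> \<beta> \<ominus>\<^bsub>A n\<^esub> \<gamma> \<in> bd n"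
  using A.submoduleE(3,5)[OF bd_sub] by (simp add: a_minus_def)

lemma bd_zero: "\<zero>\<^bsub>A n\<^esub> \<in> bd n"
  using bd_sub[of n] by (auto simp: submodule_def dest: subgroup.one_closed)

lemma D_bd:
  assumes "\<beta> \<in> bd n"
  shows "D n \<beta> \<in> bd (n + 1)"
proof -
  obtain N where N: "\<forall>i\<ge>N. \<forall>x\<in>FC i. \<beta> i x = \<zero>\<^bsub>F (i - n)\<^esub>" and b: "\<beta> \<in> AC n"
    using assms by (auto simp: bd_iff)
  have "D n \<beta> i x = \<zero>\<^bsub>F (i - (n + 1))\<^esub>" if "i \<ge> N + 1" "x \<in> FC i" for i x
  proof -
    have eq: "i - 1 - n = i - n - 1" "i - (n + 1) = i - n - 1" by simp_all
    have "\<beta> i x = \<zero>\<^bsub>F (i - n)\<^esub>" "\<beta> (i - 1) (d i x) = \<zero>\<^bsub>F (i - n - 1)\<^esub>"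
      using N that by (auto simp flip: eq)
    then show ?thesis
      using that module_hom_zero[OF F_module F_module d_hom, of "i - n"]
      by (simp add: D_apply eq sgn_act_zero[OF F_module] F.M.minus_zero_right)
  qed
  then show ?thesis unfolding bd_iff using b by blast
qed

lemma ZE_ZS: "\<alpha> \<in> ZE n \<Longrightarrow> \<alpha> \<in> ZS n"
  by (auto simp: ZE_def ZS_def bd_zero)

lemma ZS_mul:
  assumes "\<alpha> \<in> ZS m" "\<beta> \<in> ZS n"
  shows "mul n \<alpha> \<beta> \<in> ZS (m + n)"
proof -
  have 1: "mul n (D m \<alpha>) \<beta> \<in> bd (m + n + 1)"
    using bd_mul_l[of "D m \<alpha>" "m + 1" \<beta> n] assms by (simp add: ZS_def algebra_simps)
  have 2: "mul (n + 1) \<alpha> (D n \<beta>) \<in> bd (m + n + 1)"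
    using bd_mul_r[of \<alpha> m "D n \<beta>" "n + 1"] assms by (simp add: ZS_def algebra_simps)
  have "D (m + n) (mul n \<alpha> \<beta>) \<in> bd (m + n + 1)"
    using assms 1 sgn_act_submodule[OF A_module bd_sub 2]
    by (subst Leibniz_mul) (auto simp: ZS_def intro: A.submoduleE(5)[OF bd_sub])
  then show ?thesis using assms by (auto simp: ZS_def)
qed

text \<open>Since \<open>\<beta>\<close> is a cocycle only up to bounded maps,
  \<open>D (\<gamma> \<beta>)\<close> has the additional term \<gamma> D\<beta>, up to sign. It is
  bounded because D\<beta> is.\<close>

lemma BS_mul_l:
  assumes "\<alpha> \<in> BS m" "\<beta> \<in> ZS n"
  shows "mul n \<alpha> \<beta> \<in> BS (m + n)"
proof -
  obtain \<gamma> where g: "\<gamma> \<in> AC (m - 1)" "\<alpha> \<ominus>\<^bsub>A m\<^esub> D (m - 1) \<gamma> \<in> bd m"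
    using assms by (auto simp: BS_def)
  have a: "\<alpha> \<in> AC m" and b: "\<beta> \<in> AC n" using assms by (auto simp: BS_def ZS_def)
  have eq: "m - 1 + n = m + n - 1" "m + n - 1 + 1 = m + n" by simp_all
  define s where "s = sgn_act (A (m + n)) (m - 1) (mul (n + 1) \<gamma> (D n \<beta>))"
  have s: "s \<in> bd (m + n)"
    using bd_mul_r[of \<gamma> "m - 1" "D n \<beta>" "n + 1"] assms g unfolding s_def
    by (intro sgn_act_submodule[OF A_module bd_sub]) (simp add: ZS_def algebra_simps)
  have x: "mul n (D (m - 1) \<gamma>) \<beta> \<in> AC (m + n)" using g b by auto
  have gb: "mul n \<gamma> \<beta> \<in> AC (m + n - 1)" using mul_closed[OF g(1) b] by (simp add: eq)
  have "D (m + n - 1) (mul n \<gamma> \<beta>) = mul n (D (m - 1) \<gamma>) \<beta> \<oplus>\<^bsub>A (m + n)\<^esub> s"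
    using Leibniz_mul[OF g(1) b] by (simp add: eq s_def)
  moreover have "mul n (\<alpha> \<ominus>\<^bsub>A m\<^esub> D (m - 1) \<gamma>) \<beta> = mul n \<alpha> \<beta> \<ominus>\<^bsub>A (m + n)\<^esub> mul n (D (m - 1) \<gamma>) \<beta>"
    by (rule module_hom_minus[OF A_module A_module B.mu_l]) (use a b g in auto)
  ultimately have "mul n \<alpha> \<beta> \<ominus>\<^bsub>A (m + n)\<^esub> D (m + n - 1) (mul n \<gamma> \<beta>) =
      mul n (\<alpha> \<ominus>\<^bsub>A m\<^esub> D (m - 1) \<gamma>) \<beta> \<ominus>\<^bsub>A (m + n)\<^esub> s"
    using mul_closed[OF a b] x s by (simp add: a_minus_def A.M.minus_add A.M.a_assoc bd_iff)
  also have "\<dots> \<in> bd (m + n)" by (intro bd_minus bd_mul_l g b s)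
  finally show ?thesis unfolding BS_def using gb mul_closed[OF a b] by auto
qed

text \<open>Here the additional term is (D\<alpha>) \<gamma>, again bounded; the sign (-1)^m is
  moved into the new homotopy \<open>\<gamma>'\<close>.\<close>

lemma BS_mul_r:
  assumes "\<alpha> \<in> ZS m" "\<beta> \<in> BS n"
  shows "mul n \<alpha> \<beta> \<in> BS (m + n)"
proof -
  obtain \<gamma> where g: "\<gamma> \<in> AC (n - 1)" "\<beta> \<ominus>\<^bsub>A n\<^esub> D (n - 1) \<gamma> \<in> bd n"
    using assms by (auto simp: BS_def)
  have a: "\<alpha> \<in> AC m" and b: "\<beta> \<in> AC n" using assms by (auto simp: BS_def ZS_def)
  have eq: "m + (n - 1) = m + n - 1" "m + n - 1 + 1 = m + n" by simp_all
  define s where "s = mul (n - 1) (D m \<alpha>) \<gamma>"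
  have s: "s \<in> bd (m + n)"
    using bd_mul_l[of "D m \<alpha>" "m + 1" \<gamma> "n - 1"] assms g by (simp add: s_def ZS_def algebra_simps)
  define s' where "s' = sgn_act (A (m + n)) m s"
  have s': "s' \<in> bd (m + n)" unfolding s'_def by (rule sgn_act_submodule[OF A_module bd_sub s])
  have x: "mul n \<alpha> (D (n - 1) \<gamma>) \<in> AC (m + n)" using g a by auto
  have sc: "s \<in> AC (m + n)" using s by (simp add: bd_iff)
  define \<gamma>' where "\<gamma>' = sgn_act (A (m + n - 1)) m (mul (n - 1) \<alpha> \<gamma>)"
  have gb: "mul (n - 1) \<alpha> \<gamma> \<in> AC (m + n - 1)" using mul_closed[OF a g(1)] by (simp add: eq)
  have g': "\<gamma>' \<in> AC (m + n - 1)" unfolding \<gamma>'_def by (rule sgn_act_closed[OF A_module gb])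
  have "D (m + n - 1) \<gamma>' = sgn_act (A (m + n)) m (s \<oplus>\<^bsub>A (m + n)\<^esub> sgn_act (A (m + n)) m (mul n \<alpha> (D (n - 1) \<gamma>)))"
    unfolding \<gamma>'_def module_hom_sgn_act[OF A_module A_module D_hom' gb] s_def
    using Leibniz_mul[OF a g(1)] by (simp add: eq)
  also have "\<dots> = s' \<oplus>\<^bsub>A (m + n)\<^esub> mul n \<alpha> (D (n - 1) \<gamma>)"
    using sc x by (auto simp: s'_def sgn_act_def A.M.minus_add)
  finally have "D (m + n - 1) \<gamma>' = s' \<oplus>\<^bsub>A (m + n)\<^esub> mul n \<alpha> (D (n - 1) \<gamma>)" .
  moreover have "mul n \<alpha> (\<beta> \<ominus>\<^bsub>A n\<^esub> D (n - 1) \<gamma>) = mul n \<alpha> \<beta> \<ominus>\<^bsub>A (m + n)\<^esub> mul n \<alpha> (D (n - 1) \<gamma>)"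
    by (rule module_hom_minus[OF A_module A_module B.mu_r]) (use a b g in auto)
  ultimately have "mul n \<alpha> \<beta> \<ominus>\<^bsub>A (m + n)\<^esub> D (m + n - 1) \<gamma>' =
      mul n \<alpha> (\<beta> \<ominus>\<^bsub>A n\<^esub> D (n - 1) \<gamma>) \<ominus>\<^bsub>A (m + n)\<^esub> s'"
    using mul_closed[OF a b] x s' by (simp add: a_minus_def A.M.minus_add A.M.a_ac bd_iff)
  also have "\<dots> \<in> bd (m + n)" by (intro bd_minus bd_mul_r g a s')
  finally show ?thesis unfolding BS_def using g' mul_closed[OF a b] by auto
qed

section \<open>Presentations of Ext and stable Ext by cochains\<close>

abbreviation E0 where
  "E0 \<equiv> cohomology_algebra (endo_algebra R F) D"

abbreviation S1 where
  "S1 \<equiv> stable_endo_algebra R F"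

abbreviation S0 where
  "S0 \<equiv> cohomology_algebra S1 (stable_hom_diff R F d)"

definition clE :: "int \<Rightarrow> (int \<Rightarrow> 'b \<Rightarrow> 'b) \<Rightarrow> (int \<Rightarrow> 'b \<Rightarrow> 'b) set" where
  "clE n z = BE n +>\<^bsub>A n\<^esub> z"

definition cl1 :: "int \<Rightarrow> (int \<Rightarrow> 'b \<Rightarrow> 'b) \<Rightarrow> (int \<Rightarrow> 'b \<Rightarrow> 'b) set" where
  "cl1 n z = bd n +>\<^bsub>A n\<^esub> z"

definition clS :: "int \<Rightarrow> (int \<Rightarrow> 'b \<Rightarrow> 'b) \<Rightarrow> (int \<Rightarrow> 'b \<Rightarrow> 'b) set set" where
  "clS n z = coboundaries (acomp S1) (stable_hom_diff R F d) n +>\<^bsub>acomp S1 n\<^esub> cl1 n z"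

lemma a_r_coset_carrier_update [simp]: "U +>\<^bsub>M\<lparr>carrier := C\<rparr>\<^esub> x = U +>\<^bsub>M\<^esub> x"
  by (simp add: a_r_coset_def')

lemma a_r_coset_carrier_update' [simp]: "(+>\<^bsub>M\<lparr>carrier := C\<rparr>\<^esub>) = (+>\<^bsub>M\<^esub>)"
  by (simp add: fun_eq_iff)

lemma acomp_update: "acomp (B\<lparr>acomp := f\<rparr>) = f"
  by simp

lemma cocycle_eq: "cocycle_module C \<delta> = (\<lambda>n. (C n)\<lparr>carrier := a_kernel (C n) (C (n + 1)) (\<delta> n)\<rparr>)"
  by (simp add: fun_eq_iff cocycle_module_def)

text \<open>The trivial presentation of the endomorphism algebra is cut down to cocycles and then
  divided by coboundaries. Cosets do not depend on the carrier field of a module, which reconciles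
  the resulting class map with \<open>clE\<close>.\<close>

lemma pres_E0: "gr_pres R A (\<lambda>m n. mul n) idA R (\<lambda>r. r) ZE E0 clE BE"
proof -
  have ac: "acomp (endo_algebra R F) = A" by (simp add: endo_algebra_def)
  have 1: "gr_pres R A (\<lambda>m n. mul n) idA R (\<lambda>r. r) ZE
     ((endo_algebra R F)\<lparr>acomp := cocycle_module A D\<rparr>) (\<lambda>n z. z) (\<lambda>n. {\<zero>\<^bsub>A n\<^esub>})"
  proof -
    have ZE': "ZE n = {z \<in> AC n. z \<in> a_kernel (A n) (A (n + 1)) (D n)}" for n
      by (auto simp: ZE_def a_kernel_def')
    have "gr_pres R A (\<lambda>m n. mul n) idA R (\<lambda>r. r) ZE
      ((endo_algebra R F)\<lparr>acomp := \<lambda>n. (acomp (endo_algebra R F) n)\<lparr>carrier := a_kernel (A n) (A (n + 1)) (D n)\<rparr>\<rparr>)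
      (\<lambda>n z. z) (\<lambda>n. {\<zero>\<^bsub>A n\<^esub>})"
    proof (rule P0.pres_restrict[OF _ ZE' ZE_sub _ idA_ZE])
      show "mul n x y \<in> ZE (m + n)" if "x \<in> ZE m" "y \<in> ZE n" for m n x y
        using ZE_mul[OF that] .
    qed (auto simp: a_kernel_def' ac)
    then show ?thesis unfolding cocycle_eq by (simp only: ac)
  qed
  interpret P1: gr_pres R A "\<lambda>m n. mul n" idA R "\<lambda>r. r" ZE
    "(endo_algebra R F)\<lparr>acomp := cocycle_module A D\<rparr>" "\<lambda>n z. z" "\<lambda>n. {\<zero>\<^bsub>A n\<^esub>}" by (rule 1)
  have "gr_pres R A (\<lambda>m n. mul n) idA R (\<lambda>r. r) ZE
     (quot_algebra ((endo_algebra R F)\<lparr>acomp := cocycle_module A D\<rparr>) BE)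
     (\<lambda>n z. BE n +>\<^bsub>acomp ((endo_algebra R F)\<lparr>acomp := cocycle_module A D\<rparr>) n\<^esub> z) BE"
  proof (rule P1.pres_quot[of BE BE])
    fix n
    have "a_kernel (A n) (A (n + 1)) (D n) = ZE n" by (auto simp: a_kernel_def' ZE_def)
    then show "submodule (BE n) R (acomp ((endo_algebra R F)\<lparr>acomp := cocycle_module A D\<rparr>) n)"
      using submodule_restrict[OF A_module BE_sub BE_ZE ZE_sub] by (simp add: cocycle_module_def)
  qed (auto simp: BE_mul_l BE_mul_r)
  moreover have "coboundaries A D = BE" by (simp add: fun_eq_iff coboundaries_def BE_def)
  ultimately show ?thesis
    by (simp only: cohomology_algebra_def ac clE_def[abs_def] acomp_update cocycle_module_def
        a_r_coset_carrier_update a_r_coset_carrier_update')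
qed

lemma pres_S1: "gr_pres R A (\<lambda>m n. mul n) idA R (\<lambda>r. r) (\<lambda>n. AC n) S1 cl1 bd"
proof -
  have ac: "acomp (endo_algebra R F) = A" by (simp add: endo_algebra_def)
  have "gr_pres R A (\<lambda>m n. mul n) idA R (\<lambda>r. r) (\<lambda>n. AC n) (quot_algebra (endo_algebra R F) bd)
    (\<lambda>n z. bd n +>\<^bsub>acomp (endo_algebra R F) n\<^esub> z) bd"
  proof (rule P0.pres_quot[of bd bd])
    show "submodule (bd n) R (acomp (endo_algebra R F) n)" for n
      unfolding ac by (rule bd_sub)
    show "mul n x y \<in> bd (m + n)" if "x \<in> bd m" "y \<in> AC n" for m n x y
      using bd_mul_l[OF that] .
    show "mul n x y \<in> bd (m + n)" if "x \<in> AC m" "y \<in> bd n" for m n x y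
      using bd_mul_r[OF that] .
  qed simp
  then show ?thesis
    by (simp only: ac stable_endo_algebra_def cl1_def[abs_def])
qed

interpretation P1: gr_pres R A "\<lambda>m n. mul n" idA R "\<lambda>r. r" "\<lambda>n. AC n" S1 cl1 bd
  by (rule pres_S1)

lemma stable_diff_cl1:
  assumes "z \<in> AC n"
  shows "stable_hom_diff R F d n (cl1 n z) = cl1 (n + 1) (D n z)"
  unfolding stable_hom_diff_def cl1_def
  by (rule quot_map_coset)
    (use assms bd_sub in \<open>auto simp: module_homD[OF D_hom] D_bd A.M.abelian_group_axioms submodule_def\<close>)

lemma stable_diff_hom: "stable_hom_diff R F d n \<in> module_hom R (acomp S1 n) (acomp S1 (n + 1))"
proof (intro module_homI)
  fix a assume "a \<in> carrier (acomp S1 n)"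
  then obtain z where z: "z \<in> AC n" "a = cl1 n z" by (elim P1.cl_cases)
  show "stable_hom_diff R F d n a \<in> carrier (acomp S1 (n + 1))"
    using z by (auto simp: stable_diff_cl1 intro: P1.cl_closed)
  {
    fix r assume r: "r \<in> carrier R"
    show "stable_hom_diff R F d n (r \<odot>\<^bsub>acomp S1 n\<^esub> a) = r \<odot>\<^bsub>acomp S1 (n + 1)\<^esub> stable_hom_diff R F d n a"
      unfolding z P1.cl_smult[OF r z(1), symmetric] stable_diff_cl1[OF z(1)]
        stable_diff_cl1[OF A.smult_closed[OF r z(1)]] module_homD(3)[OF D_hom r z(1)]
      using z r by (intro P1.cl_smult) auto
  }
  fix b assume "b \<in> carrier (acomp S1 n)"
  then obtain y where y: "y \<in> AC n" "b = cl1 n y" by (elim P1.cl_cases)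
  show "stable_hom_diff R F d n (a \<oplus>\<^bsub>acomp S1 n\<^esub> b) =
      stable_hom_diff R F d n a \<oplus>\<^bsub>acomp S1 (n + 1)\<^esub> stable_hom_diff R F d n b"
    unfolding z y P1.cl_add[OF z(1) y(1), symmetric] stable_diff_cl1[OF z(1)] stable_diff_cl1[OF y(1)]
      stable_diff_cl1[OF A.M.a_closed[OF z(1) y(1)]] module_homD(2)[OF D_hom z(1) y(1)]
    using z y by (intro P1.cl_add) auto
qed

lemma stable_cob_sub: "submodule (coboundaries (acomp S1) (stable_hom_diff R F d) n) R (acomp S1 n)"
  unfolding coboundaries_def
  by (rule submodule_image[OF P1.A_module P1.A_module _ P1.A.carrier_is_submodule])
    (use stable_diff_hom[of "n - 1"] in simp)

text \<open>Every cochain of the quotient complex is the class of some \<open>\<gamma>\<close>, and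
  two classes agree exactly when their representatives differ by a bounded map.\<close>

lemma stable_cob_iff:
  assumes "z \<in> AC n"
  shows "cl1 n z \<in> coboundaries (acomp S1) (stable_hom_diff R F d) n \<longleftrightarrow> z \<in> BS n"
proof -
  have "cl1 n z \<in> coboundaries (acomp S1) (stable_hom_diff R F d) n \<longleftrightarrow>
      (\<exists>\<gamma>\<in>AC (n - 1). cl1 n z = cl1 n (D (n - 1) \<gamma>))"
    using stable_diff_cl1[of _ "n - 1"]
    by (auto simp: coboundaries_def P1.cl_image[symmetric] image_iff)
  also have "\<dots> \<longleftrightarrow> z \<in> BS n"
    using assms D_closed'[of _ n] by (auto simp: BS_def P1.cl_eq_iff)
  finally show ?thesis .
qed

text \<open>The passage to cocycles modulo coboundaries is repeated, now starting from the algebra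
  modulo bounded maps; the two layers of cosets are flattened into the single relation
  \<open>BS\<close>.\<close>

lemma pres_S0: "gr_pres R A (\<lambda>m n. mul n) idA R (\<lambda>r. r) ZS S0 clS BS"
proof -
  have ZS': "ZS n = {z \<in> AC n. cl1 n z \<in> a_kernel (acomp S1 n) (acomp S1 (n + 1)) (stable_hom_diff R F d n)}" for n
    unfolding ZS_def
    by (intro Collect_cong conj_cong refl)
      (simp add: a_kernel_def' stable_diff_cl1 P1.cl_closed P1.cl_ker)
  have 1: "gr_pres R A (\<lambda>m n. mul n) idA R (\<lambda>r. r) ZS
     (S1\<lparr>acomp := cocycle_module (acomp S1) (stable_hom_diff R F d)\<rparr>) cl1 bd"
    unfolding cocycle_eq
  proof (rule P1.pres_restrict[OF _ ZS' ZS_sub _ ZE_ZS[OF idA_ZE]])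
    show "mul n x y \<in> ZS (m + n)" if "x \<in> ZS m" "y \<in> ZS n" for m n x y
      using ZS_mul[OF that] .
  qed (auto simp: a_kernel_def')
  interpret P2: gr_pres R A "\<lambda>m n. mul n" idA R "\<lambda>r. r" ZS
     "S1\<lparr>acomp := cocycle_module (acomp S1) (stable_hom_diff R F d)\<rparr>" cl1 bd by (rule 1)
  let ?J = "coboundaries (acomp S1) (stable_hom_diff R F d)"
  have "gr_pres R A (\<lambda>m n. mul n) idA R (\<lambda>r. r) ZS
     (quot_algebra (S1\<lparr>acomp := cocycle_module (acomp S1) (stable_hom_diff R F d)\<rparr>) ?J)
     (\<lambda>n z. ?J n +>\<^bsub>acomp (S1\<lparr>acomp := cocycle_module (acomp S1) (stable_hom_diff R F d)\<rparr>) n\<^esub> cl1 n z) BS"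
  proof (rule P2.pres_quot[of ?J BS])
    fix n
    let ?Z = "a_kernel (acomp S1 n) (acomp S1 (n + 1)) (stable_hom_diff R F d n)"
    have Zsub: "submodule ?Z R (acomp S1 n)"
      using submodule_vimage[OF P1.A_module P1.A_module stable_diff_hom submodule_zero[OF P1.A_module], of n]
      by (simp add: a_kernel_def')
    have "?J n \<subseteq> ?Z"
    proof
      fix x assume "x \<in> ?J n"
      then obtain \<gamma> where g: "\<gamma> \<in> AC (n - 1)" "x = cl1 n (D (n - 1) \<gamma>)"
        using stable_diff_cl1[of _ "n - 1"] by (auto simp: coboundaries_def P1.cl_image[symmetric])
      have "D n (D (n - 1) \<gamma>) = \<zero>\<^bsub>A (n + 1)\<^esub>" using D_D[OF g(1)] by simp
      then show "x \<in> ?Z" using g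
        by (auto simp: a_kernel_def' stable_diff_cl1 D_closed' P1.cl_zero P1.cl_closed)
    qed
    then show "submodule (?J n) R (acomp (S1\<lparr>acomp := cocycle_module (acomp S1) (stable_hom_diff R F d)\<rparr>) n)"
      using submodule_restrict[OF P1.A_module stable_cob_sub _ Zsub] by (simp add: cocycle_module_def)
  qed (auto simp: BS_mul_l BS_mul_r stable_cob_iff ZS_def)
  then show ?thesis
    by (simp only: cohomology_algebra_def clS_def[abs_def] acomp_update cocycle_module_def
        a_r_coset_carrier_update a_r_coset_carrier_update')
qed

text \<open>Coboundaries stay coboundaries modulo bounded maps, so \<open>quot_map_coset\<close>
  applies. This is the compatibility that \<open>gr_pres_pair\<close> asks for.\<close>

lemma Ext_to_stable_Ext_cl:
  assumes "z \<in> ZE n"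
  shows "Ext_to_stable_Ext R F d n (clE n z) = clS n z"
proof -
  have "quot_map (acomp S1 n) (coboundaries (acomp S1) (stable_hom_diff R F d) n) (cl1 n)
      (BE n +>\<^bsub>(A n)\<lparr>carrier := ZE n\<rparr>\<^esub> z) = clS n z"
    unfolding clS_def
  proof (rule quot_map_coset)
    show "subgroup (BE n) (add_monoid (A n\<lparr>carrier := ZE n\<rparr>))"
      using submodule_restrict[OF A_module BE_sub BE_ZE ZE_sub] by (simp add: submodule_def)
    show "abelian_group (A n\<lparr>carrier := ZE n\<rparr>)"
      by (rule module_abelian[OF submodule.submodule_is_module[OF ZE_sub A_module]])
    show "cl1 n x \<in> coboundaries (acomp S1) (stable_hom_diff R F d) n" if "x \<in> BE n" for x
      using that D_closed'[of _ n] stable_diff_cl1[of _ "n - 1"] P1.cl_closed[of _ "n - 1"]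
      by (force simp: BE_def coboundaries_def)
  qed (use assms stable_cob_sub[of n] P1.cl_closed[of _ n] in \<open>auto simp: ZE_def P1.cl_add P1.A.abelian_group_axioms submodule_def\<close>)
  then show ?thesis
    by (simp add: Ext_to_stable_Ext_def clE_def cl1_def[abs_def])
qed

end

section \<open>Resolutions of the residue field when the square of the maximal ideal vanishes\<close>

text \<open>The augmentation enters only through a lift \<^term>\<open>lam\<close> of it to \<^term>\<open>R\<close>;
  \<^term>\<open>f0\<close> lifts the unit of the residue field, \<^term>\<open>c\<close> is a minimal system of generators
  of \<^term>\<open>m\<close>, and \<^term>\<open>psi\<close> expresses \<^term>\<open>lam (d 1 x)\<close> in these generators.\<close>

locale resolution_data = mod_complex R F d
  for R :: "('a, 'r) ring_scheme" and F :: "int \<Rightarrow> ('a, 'b) module" and d :: "int \<Rightarrow> 'b \<Rightarrow> 'b" +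
  fixes m :: "'a set" and e :: nat and c :: "nat \<Rightarrow> 'a" and lam :: "'b \<Rightarrow> 'a" and f0 :: 'b
    and psi :: "'b \<Rightarrow> nat \<Rightarrow> 'a"
  assumes m_ideal: "ideal m R" and one_m: "\<one>\<^bsub>R\<^esub> \<notin> m"
    and m_m: "a \<in> m \<Longrightarrow> b \<in> m \<Longrightarrow> a \<otimes>\<^bsub>R\<^esub> b = \<zero>\<^bsub>R\<^esub>"
    and F_proj: "projective_module R (F k)"
    and F_neg: "k < 0 \<Longrightarrow> x \<in> carrier (F k) \<Longrightarrow> x = \<zero>\<^bsub>F k\<^esub>"
    and d_exact: "k \<ge> 1 \<Longrightarrow> x \<in> carrier (F k) \<Longrightarrow> d k x = \<zero>\<^bsub>F (k - 1)\<^esub> \<Longrightarrow> x \<in> d (k + 1) ` carrier (F (k + 1))"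
    and c_m: "i < e \<Longrightarrow> c i \<in> m"
    and c_indep: "(\<And>i. i < e \<Longrightarrow> r i \<in> carrier R) \<Longrightarrow>
      finsum R (\<lambda>i. r i \<otimes>\<^bsub>R\<^esub> c i) {..<e} = \<zero>\<^bsub>R\<^esub> \<Longrightarrow> i < e \<Longrightarrow> r i \<in> m"
    and lam_hom: "lam \<in> module_hom R (F 0) (ring_module R)"
    and lam_ker: "x \<in> carrier (F 0) \<Longrightarrow> lam x \<in> m \<longleftrightarrow> x \<in> d 1 ` carrier (F 1)"
    and f0: "f0 \<in> carrier (F 0)" and lam_f0: "lam f0 \<ominus>\<^bsub>R\<^esub> \<one>\<^bsub>R\<^esub> \<in> m"
    and psi_hom: "i < e \<Longrightarrow> (\<lambda>x. psi x i) \<in> module_hom R (F 1) (ring_module R)"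
    and psi_sum: "x \<in> carrier (F 1) \<Longrightarrow> finsum R (\<lambda>i. psi x i \<otimes>\<^bsub>R\<^esub> c i) {..<e} = lam (d 1 x)"
begin

sublocale m: ideal m R by (rule m_ideal)

lemma F_neg': "i < 0 \<Longrightarrow> x \<in> FC i \<Longrightarrow> y \<in> FC i \<Longrightarrow> x = y"
  using F_neg by blast

section \<open>Cochains with prescribed boundary\<close>

lemma A_eqI':
  assumes "\<beta> \<in> AC n" "\<gamma> \<in> AC n"
    and "\<And>i x. i \<ge> 0 \<Longrightarrow> i \<ge> n \<Longrightarrow> x \<in> FC i \<Longrightarrow> \<beta> i x = \<gamma> i x"
  shows "\<beta> = \<gamma>"
proof (rule A_eqI[OF assms(1,2)])
  fix i x assume x: "x \<in> FC i"
  consider "i < 0" | "i < n" | "i \<ge> 0" "i \<ge> n" by linarith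
  then show "\<beta> i x = \<gamma> i x"
  proof cases
    case 1
    then show ?thesis
      using F_neg[OF 1 x] module_hom_zero[OF F_module F_module A_hom[OF assms(1)]]
        module_hom_zero[OF F_module F_module A_hom[OF assms(2)]] by simp
  next
    case 2
    then show ?thesis using F_neg'[of "i - n"] assms x by auto
  qed (use assms x in auto)
qed

lemma ZE_I:
  assumes "z \<in> AC n"
    and "\<And>i x. i \<ge> 0 \<Longrightarrow> i \<ge> n + 1 \<Longrightarrow> x \<in> FC i \<Longrightarrow> D n z i x = \<zero>\<^bsub>F (i - n - 1)\<^esub>"
  shows "z \<in> ZE n"
proof -
  have "D n z = \<zero>\<^bsub>A (n + 1)\<^esub>"
  proof (rule A_eqI'[of _ "n + 1"])
    fix i x assume "i \<ge> 0" "i \<ge> n + 1" "x \<in> FC i"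
    then show "D n z i x = \<zero>\<^bsub>A (n + 1)\<^esub> i x"
      using assms(2) arg_cong[of "i - (n + 1)" "i - n - 1" "\<lambda>k. \<zero>\<^bsub>F k\<^esub>"] by (simp add: A_simps(1))
  qed (use assms in auto)
  then show ?thesis using assms by (simp add: ZE_def)
qed

lemma ZE_D: "z \<in> ZE n \<Longrightarrow> x \<in> FC i \<Longrightarrow> D n z i x = \<zero>\<^bsub>F (i - n - 1)\<^esub>"
  using arg_cong[of "i - (n + 1)" "i - n - 1" "\<lambda>k. \<zero>\<^bsub>F k\<^esub>"] by (simp add: ZE_def A_simps(1))

lemma ZE_A: "z \<in> ZE n \<Longrightarrow> z \<in> AC n"
  by (simp add: ZE_def)

lemma ZS_A: "z \<in> ZS n \<Longrightarrow> z \<in> AC n"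
  by (simp add: ZS_def)

lemma BE_BS: "z \<in> BE n \<Longrightarrow> z \<in> BS n"
  unfolding BE_def BS_def by (auto simp: a_minus_def A.M.r_neg bd_zero D_closed' intro!: bexI)

text \<open>The value that \<open>d\<close> must take on \<gamma>_i(x) if D\<gamma> = \<alpha> is to
  hold in homological degree \<open>i\<close> and the preceding component of \<gamma> is
  \<open>f\<close>.\<close>

definition rhs :: "(int \<Rightarrow> 'b \<Rightarrow> 'b) \<Rightarrow> int \<Rightarrow> int \<Rightarrow> ('b \<Rightarrow> 'b) \<Rightarrow> 'b \<Rightarrow> 'b" where
  "rhs \<alpha> n i f x = \<alpha> i x \<oplus>\<^bsub>F (i - n - 1)\<^esub> sgn_act (F (i - n - 1)) n (f (d i x))"

lemma rhs_hom:
  assumes "\<alpha> \<in> AC (n + 1)" "f \<in> module_hom R (F (i - 1)) (F (i - 1 - n))"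
  shows "rhs \<alpha> n i f \<in> module_hom R (F i) (F (i - n - 1))"
proof -
  have eq: "i - 1 - n = i - n - 1" "i - (n + 1) = i - n - 1" by simp_all
  show ?thesis
    unfolding rhs_def[abs_def]
    by (intro module_hom_plus F_module module_hom_compose[OF module_hom_compose[OF d_hom] sgn_act_hom])
      (use assms A_hom[OF assms(1), of i] in \<open>simp_all add: eq F_module\<close>)
qed

text \<open>If the right-hand side consists of boundaries, projectivity of \<open>F i\<close> solves
  for the next component. The following right-hand side is then a cycle because D\<alpha> = 0, hence
  a boundary since \<open>i \<ge> n + 1\<close> puts it in positive degree \<open>i - n\<close>,
  where the resolution is exact. The invariant speaks of boundaries, not cycles, as exactness fails
  in degree 0.\<close>

lemma solve_step:
  assumes a: "\<alpha> \<in> AC (n + 1)" and i: "i \<ge> n + 1"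
    and f: "f \<in> module_hom R (F (i - 1)) (F (i - 1 - n))"
    and good: "\<And>x. x \<in> FC i \<Longrightarrow> rhs \<alpha> n i f x \<in> d (i - n) ` FC (i - n)"
    and Da: "\<And>x. x \<in> FC (i + 1) \<Longrightarrow> D (n + 1) \<alpha> (i + 1) x = \<zero>\<^bsub>F (i - n - 1)\<^esub>"
  obtains g where "g \<in> module_hom R (F i) (F (i - n))" "g \<in> extensional (FC i)"
    "\<And>x. x \<in> FC i \<Longrightarrow> d (i - n) (g x) = rhs \<alpha> n i f x"
    "\<And>x. x \<in> FC (i + 1) \<Longrightarrow> rhs \<alpha> n (i + 1) g x \<in> d (i + 1 - n) ` FC (i + 1 - n)"
proof -
  have eq: "i + 1 - n - 1 = i - n" "i + 1 - 1 = i" "i + 1 - (n + 1) = i - n" "i + 1 - n = i - n + 1"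
    "i - n + 1 - 1 = i - n" "i - 1 - n = i - n - 1" "i + 1 - (n + 1) - 1 = i - n - 1" "i - (n + 1) = i - n - 1" by simp_all
  obtain g where g: "g \<in> module_hom R (F i) (F (i - n))" "g \<in> extensional (FC i)"
    and dg: "\<And>x. x \<in> FC i \<Longrightarrow> d (i - n) (g x) = rhs \<alpha> n i f x"
    using projective_lift[OF F_proj F_module F_module d_hom rhs_hom[OF a f] good] by blast
  have "rhs \<alpha> n (i + 1) g x \<in> d (i + 1 - n) ` FC (i + 1 - n)" if x: "x \<in> FC (i + 1)" for x
  proof -
    have dx: "d (i + 1) x \<in> FC i" using d_closed[OF x] by simp
    have gx: "g (d (i + 1) x) \<in> FC (i - n)" using module_homD(1)[OF g(1) dx] .
    have ax: "\<alpha> (i + 1) x \<in> FC (i - n)" using A_closed[OF a x] by (simp only: eq)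
    have adx: "\<alpha> i (d (i + 1) x) \<in> FC (i - n - 1)" using A_closed[OF a dx] by (simp only: eq)
    have ddx: "d i (d (i + 1) x) = \<zero>\<^bsub>F (i - 1)\<^esub>" using d_d[OF x] by simp
    have "f \<zero>\<^bsub>F (i - 1)\<^esub> = \<zero>\<^bsub>F (i - n - 1)\<^esub>"
      using module_hom_zero[OF F_module F_module f] by (simp only: eq)
    then have "d (i - n) (g (d (i + 1) x)) = \<alpha> i (d (i + 1) x)"
      using dg[OF dx] adx by (simp add: rhs_def ddx sgn_act_zero[OF F_module])
    moreover have "D (n + 1) \<alpha> (i + 1) x = d (i - n) (\<alpha> (i + 1) x) \<ominus>\<^bsub>F (i - n - 1)\<^esub>
        sgn_act (F (i - n - 1)) (n + 1) (\<alpha> i (d (i + 1) x))"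
      using x by (simp only: D_apply eq)
    moreover have "d (i - n) (rhs \<alpha> n (i + 1) g x) = d (i - n) (\<alpha> (i + 1) x) \<oplus>\<^bsub>F (i - n - 1)\<^esub>
        sgn_act (F (i - n - 1)) n (d (i - n) (g (d (i + 1) x)))"
      unfolding rhs_def eq module_homD(2)[OF d_hom ax sgn_act_closed[OF F_module gx]]
        module_hom_sgn_act[OF F_module F_module d_hom gx] ..
    ultimately have "d (i - n) (rhs \<alpha> n (i + 1) g x) = \<zero>\<^bsub>F (i - n - 1)\<^esub>"
      using Da[OF x] adx by (auto simp: sgn_act_def a_minus_def)
    moreover have "rhs \<alpha> n (i + 1) g x \<in> FC (i - n)"
      unfolding rhs_def eq using ax sgn_act_closed[OF F_module gx] by simp
    ultimately show ?thesis
      using d_exact[of "i - n" "rhs \<alpha> n (i + 1) g x"] i by (simp only: eq)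
  qed
  with g dg that show thesis by blast
qed

text \<open>The comparison theorem for resolutions, started in an arbitrary homological degree
  \<open>a\<close> with a given component \<open>g0\<close>. The first extension is granted by
  \<open>good\<close>, all later ones by exactness. Components below \<open>a\<close> are zero, and
  the boundary is controlled strictly above \<open>a\<close> only: this is the freedom that produces
  stable cocycles.\<close>

lemma solve:
  assumes \<alpha>: "\<alpha> \<in> AC (n + 1)" and a: "n \<le> a"
    and g0: "g0 \<in> module_hom R (F a) (F (a - n))"
    and Da: "\<And>i x. i > a + 1 \<Longrightarrow> x \<in> FC i \<Longrightarrow> D (n + 1) \<alpha> i x = \<zero>\<^bsub>F (i - n - 2)\<^esub>"
    and good: "\<And>x. x \<in> FC (a + 1) \<Longrightarrow> rhs \<alpha> n (a + 1) g0 x \<in> d (a + 1 - n) ` FC (a + 1 - n)"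
  obtains \<gamma> where "\<gamma> \<in> AC n" "\<And>x. x \<in> FC a \<Longrightarrow> \<gamma> a x = g0 x"
    "\<And>i x. i < a \<Longrightarrow> x \<in> FC i \<Longrightarrow> \<gamma> i x = \<zero>\<^bsub>F (i - n)\<^esub>"
    "\<And>i x. i > a \<Longrightarrow> x \<in> FC i \<Longrightarrow> D n \<gamma> i x = \<alpha> i x"
proof -
  define P where "P = (\<lambda>k g. g \<in> module_hom R (F (a + int k)) (F (a + int k - n)) \<and>
     g \<in> extensional (FC (a + int k)) \<and>
     (\<forall>x\<in>FC (a + int k + 1). rhs \<alpha> n (a + int k + 1) g x \<in> d (a + int k + 1 - n) ` FC (a + int k + 1 - n)) \<and>
     (k = 0 \<longrightarrow> g = restrict g0 (FC a)))"
  define Q where "Q = (\<lambda>k f g. \<forall>x\<in>FC (a + int k + 1).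
     d (a + int k + 1 - n) (g x) = rhs \<alpha> n (a + int k + 1) f x)"
  have "\<exists>g. \<forall>k. P k (g k) \<and> Q k (g k) (g (Suc k))"
  \<comment> \<open>Each component depends on its predecessor through \<open>Q\<close>, and
    \<open>P\<close> carries the invariant of \<open>solve_step\<close> along.\<close>
  proof (rule dependent_nat_choice)
    have "rhs \<alpha> n (a + 1) (restrict g0 (FC a)) x = rhs \<alpha> n (a + 1) g0 x"
      if "x \<in> FC (a + 1)" for x
      using d_closed[OF that] by (simp add: rhs_def)
    then have "P 0 (restrict g0 (FC a))"
      unfolding P_def using good module_hom_cong[OF F_module g0] by auto
    then show "\<exists>g. P 0 g" by blast
  next
    fix f k assume P: "P k f"
    have eq: "a + int k + 1 - 1 = a + int k" "a + int (Suc k) = a + int k + 1" by simp_all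
    have Da': "D (n + 1) \<alpha> (a + int k + 1 + 1) x = \<zero>\<^bsub>F (a + int k + 1 - n - 1)\<^esub>"
      if "x \<in> FC (a + int k + 1 + 1)" for x
      using Da[OF _ that] arg_cong[of "a + int k + 1 + 1 - n - 2" "a + int k + 1 - n - 1" "\<lambda>k. \<zero>\<^bsub>F k\<^esub>"] by simp
    obtain g where "g \<in> module_hom R (F (a + int k + 1)) (F (a + int k + 1 - n))"
      "g \<in> extensional (FC (a + int k + 1))"
      "\<And>x. x \<in> FC (a + int k + 1) \<Longrightarrow> d (a + int k + 1 - n) (g x) = rhs \<alpha> n (a + int k + 1) f x"
      "\<And>x. x \<in> FC (a + int k + 1 + 1) \<Longrightarrow> rhs \<alpha> n (a + int k + 1 + 1) g x \<in>
         d (a + int k + 1 + 1 - n) ` FC (a + int k + 1 + 1 - n)"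
      by (rule solve_step[OF \<alpha>, of "a + int k + 1" f]) (use P a Da' in \<open>auto simp: P_def\<close>)
    then have "P (Suc k) g \<and> Q k f g" unfolding P_def Q_def eq by auto
    then show "\<exists>g. P (Suc k) g \<and> Q k f g" by blast
  qed
  then obtain g where g: "\<And>k. P k (g k)" "\<And>k. Q k (g k) (g (Suc k))" by blast
  define \<gamma> where "\<gamma> = (\<lambda>i. if i \<ge> a then g (nat (i - a)) else (\<lambda>x\<in>FC i. \<zero>\<^bsub>F (i - n)\<^esub>))"
  have \<gamma>: "\<gamma> \<in> AC n"
  proof (rule A_I)
    fix i
    show "\<gamma> i \<in> module_hom R (F i) (F (i - n))"
      using g(1)[of "nat (i - a)"]
        module_hom_cong[OF F_module module_hom_const_zero[OF F_module], of i "i - n" "\<lambda>x\<in>FC i. \<zero>\<^bsub>F (i - n)\<^esub>"]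
      by (auto simp: \<gamma>_def P_def)
    show "\<gamma> i \<in> extensional (FC i)"
      using g(1)[of "nat (i - a)"] by (auto simp: \<gamma>_def P_def)
  qed
  show thesis
  proof (rule that[OF \<gamma>])
    show "\<gamma> a x = g0 x" if "x \<in> FC a" for x
      using g(1)[of 0] that by (auto simp: \<gamma>_def P_def)
    show "\<gamma> i x = \<zero>\<^bsub>F (i - n)\<^esub>" if "i < a" "x \<in> FC i" for i x
      using that by (auto simp: \<gamma>_def)
    fix i x assume i: "i > a" and x: "x \<in> FC i"
    define k where "k = nat (i - a - 1)"
    have k: "a + int k + 1 = i" "nat (i - a) = Suc k" "nat (i - 1 - a) = k" using i by (auto simp: k_def)
    have "d (i - n) (\<gamma> i x) = rhs \<alpha> n i (\<gamma> (i - 1)) x"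
      using g(2)[of k] x i k unfolding Q_def \<gamma>_def by auto
    moreover have "\<alpha> i x \<in> FC (i - n - 1)" "\<gamma> (i - 1) (d i x) \<in> FC (i - n - 1)"
      using A_closed[OF \<alpha> x] A_closed_d[OF \<gamma> x] by (simp_all add: algebra_simps)
    ultimately show "D n \<gamma> i x = \<alpha> i x"
      using x by (auto simp: D_apply rhs_def sgn_act_def a_minus_def F.M.a_assoc F.M.r_neg F.M.l_neg)
  qed
qed

section \<open>Ext in degrees at most zero\<close>

lemma lam_simps:
  "x \<in> FC 0 \<Longrightarrow> lam x \<in> carrier R"
  "x \<in> FC 0 \<Longrightarrow> y \<in> FC 0 \<Longrightarrow> lam (x \<oplus>\<^bsub>F 0\<^esub> y) = lam x \<oplus>\<^bsub>R\<^esub> lam y"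
  "r \<in> carrier R \<Longrightarrow> x \<in> FC 0 \<Longrightarrow> lam (r \<odot>\<^bsub>F 0\<^esub> x) = r \<otimes>\<^bsub>R\<^esub> lam x"
  using module_homD[OF lam_hom] by auto

lemma lam_neg: "x \<in> FC 0 \<Longrightarrow> lam (\<ominus>\<^bsub>F 0\<^esub> x) = \<ominus>\<^bsub>R\<^esub> lam x"
  using additive_neg[OF F.M.abelian_group_axioms[of 0] F.R.is_abelian_group lam_simps(1,2)] .

lemma lam_minus: "x \<in> FC 0 \<Longrightarrow> y \<in> FC 0 \<Longrightarrow> lam (x \<ominus>\<^bsub>F 0\<^esub> y) = lam x \<ominus>\<^bsub>R\<^esub> lam y"
  by (simp add: a_minus_def lam_simps lam_neg)

lemma lam_d: "x \<in> FC 1 \<Longrightarrow> lam (d 1 x) \<in> m"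
  using lam_ker[of "d 1 x"] d_closed[of x 1] by simp

lemma d_closed_1: "x \<in> FC 1 \<Longrightarrow> d 1 x \<in> FC 0"
  using d_closed[of x 1] by simp

text \<open>The factor \<open>lam f0\<close> differs from one by an element of \<open>m\<close>, and
  the square of \<open>m\<close> vanishes.\<close>

lemma m_lam_f0:
  assumes x: "x \<in> m"
  shows "x \<otimes>\<^bsub>R\<^esub> lam f0 = x"
proof -
  have "x \<otimes>\<^bsub>R\<^esub> (lam f0 \<ominus>\<^bsub>R\<^esub> \<one>\<^bsub>R\<^esub>) = x \<otimes>\<^bsub>R\<^esub> lam f0 \<ominus>\<^bsub>R\<^esub> x"
    using lam_simps(1)[OF f0] m.a_Hcarr[OF x] by algebra
  then have "x \<otimes>\<^bsub>R\<^esub> lam f0 \<ominus>\<^bsub>R\<^esub> x = \<zero>\<^bsub>R\<^esub>" using m_m[OF x lam_f0] by simp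
  then show ?thesis
    using abelian_group.minus_eq_zero_iff[OF F.R.is_abelian_group] lam_simps(1)[OF f0] m.a_Hcarr[OF x]
    by simp
qed

text \<open>A chain map inducing zero on the residue field is null-homotopic. In
  \<open>solve\<close> the homotopy starts as the zero map in degree -1; the condition on
  \<open>lam\<close> says that \<open>z 0\<close> takes values in boundaries.\<close>

lemma BE_0:
  assumes z: "z \<in> ZE 0" and lz: "\<And>x. x \<in> FC 0 \<Longrightarrow> lam (z 0 x) \<in> m"
  shows "z \<in> BE 0"
proof -
  have zA: "z \<in> AC 0" using z by (rule ZE_A)
  obtain \<gamma> where g: "\<gamma> \<in> AC (-1)" "\<And>i x. i > -1 \<Longrightarrow> x \<in> FC i \<Longrightarrow> D (-1) \<gamma> i x = z i x"
  proof (rule solve[of z "-1" "-1" "\<lambda>x. \<zero>\<^bsub>F 0\<^esub>"])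
    show "(\<lambda>x. \<zero>\<^bsub>F 0\<^esub>) \<in> module_hom R (F (- 1)) (F (- 1 - - 1))"
      using module_hom_const_zero[OF F_module] by simp
    show "D (- 1 + 1) z i x = \<zero>\<^bsub>F (i - - 1 - 2)\<^esub>" if "x \<in> FC i" for i x
      using ZE_D[OF z that] by simp
    show "rhs z (- 1) (- 1 + 1) (\<lambda>x. \<zero>\<^bsub>F 0\<^esub>) x \<in> d (- 1 + 1 - - 1) ` FC (- 1 + 1 - - 1)"
      if "x \<in> FC (- 1 + 1)" for x
      using that lz[of x] lam_ker[of "z 0 x"] A_closed[OF zA, of x 0]
      by (simp add: rhs_def sgn_act_zero[OF F_module])
  qed (use zA in auto)
  have "D (0 - 1) \<gamma> = z"
    by (rule A_eqI'[of _ 0]) (use g zA D_closed'[of \<gamma> 0] in auto)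
  then show ?thesis using g(1) by (auto simp: BE_def)
qed

text \<open>Multiplication by \<open>r\<close> lifts the zero map of the residue field. Multiplying
  this homotopy by cocycles shows that \<open>m\<close> annihilates both cohomology
  algebras.\<close>

lemma m_smult_idA: "r \<in> m \<Longrightarrow> r \<odot>\<^bsub>A 0\<^esub> idA \<in> BE 0"
proof (rule BE_0)
  assume r: "r \<in> m"
  then have rc: "r \<in> carrier R" using m.a_Hcarr by simp
  then show "r \<odot>\<^bsub>A 0\<^esub> idA \<in> ZE 0"
    using A.submoduleE(4)[OF ZE_sub _ idA_ZE] by simp
  show "lam ((r \<odot>\<^bsub>A 0\<^esub> idA) 0 x) \<in> m" if "x \<in> FC 0" for x
    using that r rc by (simp add: A_simps(3) lam_simps m.I_r_closed)
qed

lemma smult_mul: 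
  assumes "r \<in> carrier R" "z \<in> AC n"
  shows "mul n (r \<odot>\<^bsub>A 0\<^esub> idA) z = r \<odot>\<^bsub>A n\<^esub> z"
  using module_homD(3)[OF B.mu_l[OF assms(2), of 0] assms(1) idA_closed] B.mu_u_l[OF assms(2)] by simp

lemma kill_E: "r \<in> m \<Longrightarrow> z \<in> ZE n \<Longrightarrow> r \<odot>\<^bsub>A n\<^esub> z \<in> BE n"
  using BE_mul_l[OF m_smult_idA, of r z n] smult_mul[of r z n] m.a_Hcarr by (simp add: ZE_A)

lemma kill_S: "r \<in> m \<Longrightarrow> z \<in> ZS n \<Longrightarrow> r \<odot>\<^bsub>A n\<^esub> z \<in> BS n"
  using BS_mul_l[OF BE_BS[OF m_smult_idA], of r z n] smult_mul[of r z n] m.a_Hcarr by (simp add: ZS_A)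

text \<open>In homological degree 0 a cocycle maps \<open>F 0\<close> into cycles of the positive
  degree \<open>- n\<close>, because \<open>F (-1)\<close> is zero. Those cycles are boundaries, so
  the homotopy can start from zero in degree -1.\<close>

lemma ZE_neg:
  assumes n: "n < 0" and z: "z \<in> ZE n"
  shows "z \<in> BE n"
proof -
  have zA: "z \<in> AC n" using z by (rule ZE_A)
  obtain \<gamma> where g: "\<gamma> \<in> AC (n - 1)" "\<And>i x. i > -1 \<Longrightarrow> x \<in> FC i \<Longrightarrow> D (n - 1) \<gamma> i x = z i x"
  proof (rule solve[of z "n - 1" "-1" "\<lambda>x. \<zero>\<^bsub>F (-n)\<^esub>"])
    show "(\<lambda>x. \<zero>\<^bsub>F (- n)\<^esub>) \<in> module_hom R (F (- 1)) (F (- 1 - (n - 1)))"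
      using module_hom_const_zero[OF F_module] by simp
    show "D (n - 1 + 1) z i x = \<zero>\<^bsub>F (i - (n - 1) - 2)\<^esub>" if "x \<in> FC i" for i x
      using ZE_D[OF z that] arg_cong[of "i - (n - 1) - 2" "i - n - 1" "\<lambda>k. \<zero>\<^bsub>F k\<^esub>"] by simp
    show "rhs z (n - 1) (- 1 + 1) (\<lambda>x. \<zero>\<^bsub>F (- n)\<^esub>) x \<in> d (- 1 + 1 - (n - 1)) ` FC (- 1 + 1 - (n - 1))"
      if "x \<in> FC (- 1 + 1)" for x
    proof -
      have x: "x \<in> FC 0" using that by simp
      have zx: "z 0 x \<in> FC (- n)" using A_closed[OF zA x] by simp
      have "d 0 x = \<zero>\<^bsub>F (-1)\<^esub>" using F_neg[of "-1" "d 0 x"] d_closed[OF x] by simp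
      then have "z (-1) (d 0 x) = \<zero>\<^bsub>F (- n - 1)\<^esub>"
        using module_hom_zero[OF F_module F_module A_hom[OF zA, of "-1"]]
          arg_cong[of "- 1 - n" "- n - 1" "\<lambda>k. \<zero>\<^bsub>F k\<^esub>"] by simp
      then have "d (- n) (z 0 x) = \<zero>\<^bsub>F (- n - 1)\<^esub>"
        using ZE_D[OF z x] x d_closed[OF zx] by (simp add: D_apply sgn_act_zero[OF F_module] F.M.minus_zero_right)
      then show ?thesis
        using d_exact[OF _ zx] n zx by (simp add: rhs_def sgn_act_zero[OF F_module] algebra_simps)
    qed
  qed (use zA n in auto)
  have "D (n - 1) \<gamma> = z"
    by (rule A_eqI'[of _ n]) (use g zA D_closed'[of \<gamma> n] in auto)
  then show ?thesis using g(1) by (auto simp: BE_def)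
qed

text \<open>The scalar \<open>r = lam (z 0 f0)\<close> lifts the one by which the chain map acts on
  the residue field; the difference of \<open>z\<close> and \<open>r\<close> times the identity
  induces zero there.\<close>

lemma ZE_0:
  assumes z: "z \<in> ZE 0"
  obtains r where "r \<in> carrier R" "z \<ominus>\<^bsub>A 0\<^esub> r \<odot>\<^bsub>A 0\<^esub> idA \<in> BE 0"
proof -
  define r where "r = lam (z 0 f0)"
  have zA: "z \<in> AC 0" using z by (rule ZE_A)
  have z0: "z 0 x \<in> FC 0" if "x \<in> FC 0" for x using A_closed[OF zA that] by simp
  have r: "r \<in> carrier R" unfolding r_def by (intro lam_simps z0 f0)
  have rI: "r \<odot>\<^bsub>A 0\<^esub> idA \<in> ZE 0" using A.submoduleE(4)[OF ZE_sub r idA_ZE] .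
  have zr: "z \<ominus>\<^bsub>A 0\<^esub> r \<odot>\<^bsub>A 0\<^esub> idA \<in> ZE 0"
    using A.submoduleE(3,5)[OF ZE_sub] z rI by (simp add: a_minus_def)
  have "z \<ominus>\<^bsub>A 0\<^esub> r \<odot>\<^bsub>A 0\<^esub> idA \<in> BE 0"
  proof (rule BE_0[OF zr])
    fix x assume x: "x \<in> FC 0"
    \<comment> \<open>\<open>y\<close> is the part of \<open>x\<close> that the augmentation kills.
      It is a boundary, and \<open>z 0\<close> maps boundaries to boundaries.\<close>
    define y where "y = x \<ominus>\<^bsub>F 0\<^esub> lam x \<odot>\<^bsub>F 0\<^esub> f0"
    have y: "y \<in> FC 0" using x f0 lam_simps(1)[OF x] by (simp add: y_def)
    have "lam y = lam x \<ominus>\<^bsub>R\<^esub> lam x \<otimes>\<^bsub>R\<^esub> lam f0"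
      using x f0 lam_simps(1)[OF x] by (simp add: y_def lam_minus lam_simps)
    also have "\<dots> = \<ominus>\<^bsub>R\<^esub> (lam x \<otimes>\<^bsub>R\<^esub> (lam f0 \<ominus>\<^bsub>R\<^esub> \<one>\<^bsub>R\<^esub>))"
      using lam_simps(1)[OF x] lam_simps(1)[OF f0] by algebra
    also have "\<dots> \<in> m" using lam_f0 lam_simps(1)[OF x] by (simp add: m.I_l_closed m.a_inv_closed)
    finally obtain u where u: "u \<in> FC 1" "y = d 1 u" using lam_ker[OF y] by auto
    have "z 0 (d 1 u) = d 1 (z 1 u)"
      using ZE_D[OF z u(1)] u(1) A_closed[OF zA u(1)] z0[OF d_closed_1[OF u(1)]] d_closed[of "z 1 u" 1]
      by (simp add: D_apply F.M.minus_eq_zero_iff)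
    then have "lam (z 0 y) \<in> m" using lam_d[of "z 1 u"] A_closed[OF zA u(1)] u(2) by simp
    moreover have "z 0 y = z 0 x \<ominus>\<^bsub>F 0\<^esub> lam x \<odot>\<^bsub>F 0\<^esub> z 0 f0"
    proof -
      have h: "z 0 \<in> module_hom R (F 0) (F 0)" using A_hom[OF zA, of 0] by simp
      show ?thesis
        unfolding y_def using x f0 lam_simps(1)[OF x]
        by (simp add: module_hom_minus[OF F_module F_module h] module_homD[OF h])
    qed
    ultimately have *: "lam (z 0 x) \<ominus>\<^bsub>R\<^esub> lam x \<otimes>\<^bsub>R\<^esub> r \<in> m"
      using x f0 z0 lam_simps(1)[OF x] by (simp add: lam_minus lam_simps r_def)
    have "(z \<ominus>\<^bsub>A 0\<^esub> r \<odot>\<^bsub>A 0\<^esub> idA) 0 x = z 0 x \<ominus>\<^bsub>F 0\<^esub> r \<odot>\<^bsub>F 0\<^esub> x"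
    proof -
      have "(r \<odot>\<^bsub>A 0\<^esub> idA) 0 x = r \<odot>\<^bsub>F 0\<^esub> x" using x by (simp add: A_simps(3))
      then show ?thesis using A_minus[OF zA ZE_A[OF rI] x] by simp
    qed
    then show "lam ((z \<ominus>\<^bsub>A 0\<^esub> r \<odot>\<^bsub>A 0\<^esub> idA) 0 x) \<in> m"
      using * x r z0[OF x] lam_simps(1)[OF x] by (simp add: lam_minus lam_simps F.R.m_comm)
  qed
  then show thesis using that r by blast
qed

text \<open>Evaluating a contraction at \<open>f0\<close> would make \<open>f0\<close> a boundary,
  forcing \<open>lam f0\<close> and with it the unit into \<open>m\<close>.\<close>

lemma idA_not_BE: "idA \<notin> BE 0"
proof
  assume "idA \<in> BE 0"
  then obtain \<gamma> where g: "\<gamma> \<in> AC (-1)" "D (-1) \<gamma> = idA" by (auto simp: BE_def)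
  have "d 0 f0 = \<zero>\<^bsub>F (-1)\<^esub>" using F_neg[of "-1" "d 0 f0"] d_closed[OF f0] by simp
  then have "\<gamma> (-1) (d 0 f0) = \<zero>\<^bsub>F 0\<^esub>"
    using module_hom_zero[OF F_module F_module A_hom[OF g(1), of "-1"]] by simp
  moreover have "\<gamma> 0 f0 \<in> FC 1" using A_closed[OF g(1) f0] by simp
  moreover have "D (-1) \<gamma> 0 f0 = f0" using g(2) f0 by simp
  ultimately have "d 1 (\<gamma> 0 f0) = f0"
    using f0 d_closed_1 by (simp add: D_apply sgn_act_zero[OF F_module] F.M.minus_zero_right)
  then have "lam f0 \<in> m" using lam_ker[OF f0] \<open>\<gamma> 0 f0 \<in> FC 1\<close> by force
  moreover have "\<one>\<^bsub>R\<^esub> = lam f0 \<ominus>\<^bsub>R\<^esub> (lam f0 \<ominus>\<^bsub>R\<^esub> \<one>\<^bsub>R\<^esub>)"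
    using lam_simps(1)[OF f0] by algebra
  ultimately have "\<one>\<^bsub>R\<^esub> \<in> m" using lam_f0 by (metis m.a_closed m.a_inv_closed a_minus_def)
  then show False using one_m by simp
qed

end

lemma finsum_ring_module: "finsum (ring_module R) = finsum R"
  by (simp add: fun_eq_iff finsum_def finprod_def)

lemma finsum_smult_right:
  fixes M :: "('a, 'c) module"
  assumes "module R M" "f \<in> I \<rightarrow> carrier R" "x \<in> carrier M"
  shows "finsum R f I \<odot>\<^bsub>M\<^esub> x = finsum M (\<lambda>i. f i \<odot>\<^bsub>M\<^esub> x) I"
proof -
  interpret M: module R M by fact
  have h: "(\<lambda>r. r \<odot>\<^bsub>M\<^esub> x) \<in> module_hom R (ring_module R) M"
    by (intro module_homI) (use assms in \<open>auto simp: M.smult_l_distr M.smult_assoc1\<close>)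
  show ?thesis
    using module_hom_finsum[OF ring_module_module[OF module_cring[OF assms(1)]] assms(1) h, of f I] assms(2)
    by (simp add: finsum_ring_module)
qed

section \<open>The cocycles v and the stable cocycles w\<close>

context resolution_data
begin

lemma lam_zero: "lam \<zero>\<^bsub>F 0\<^esub> = \<zero>\<^bsub>R\<^esub>"
  using additive_zero[OF F.M.abelian_group_axioms[of 0] F.R.is_abelian_group lam_simps(1,2)] .

lemma psi_closed: "i < e \<Longrightarrow> x \<in> FC 1 \<Longrightarrow> psi x i \<in> carrier R"
  using module_homD(1)[OF psi_hom, of i x] by simp

lemma c_closed: "i < e \<Longrightarrow> c i \<in> carrier R"
  using c_m m.a_Hcarr by auto

text \<open>Minimality of the generators enters here: d d = 0 gives a relation among the
  \<open>c i\<close>, whose coefficients then lie in \<open>m\<close>. Modulo \<open>m\<close> the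
  coordinates therefore vanish on the image of \<open>d 2\<close>.\<close>

lemma psi_d: "i < e \<Longrightarrow> x \<in> FC 2 \<Longrightarrow> psi (d 2 x) i \<in> m"
proof (rule c_indep)
  assume x: "x \<in> FC 2"
  have dx: "d 2 x \<in> FC 1" using d_closed[OF x] by simp
  then show "psi (d 2 x) i \<in> carrier R" if "i < e" for i using psi_closed that by simp
  show "finsum R (\<lambda>i. psi (d 2 x) i \<otimes>\<^bsub>R\<^esub> c i) {..<e} = \<zero>\<^bsub>R\<^esub>"
    using psi_sum[OF dx] d_d[OF x] by (simp add: lam_zero)
qed

lemma lam_proj:
  assumes x: "x \<in> FC 0"
  shows "lam (x \<ominus>\<^bsub>F 0\<^esub> lam x \<odot>\<^bsub>F 0\<^esub> f0) \<in> m"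
proof -
  have "lam (x \<ominus>\<^bsub>F 0\<^esub> lam x \<odot>\<^bsub>F 0\<^esub> f0) = lam x \<ominus>\<^bsub>R\<^esub> lam x \<otimes>\<^bsub>R\<^esub> lam f0"
    using x f0 lam_simps(1)[OF x] by (simp add: lam_minus lam_simps)
  also have "\<dots> = \<ominus>\<^bsub>R\<^esub> (lam x \<otimes>\<^bsub>R\<^esub> (lam f0 \<ominus>\<^bsub>R\<^esub> \<one>\<^bsub>R\<^esub>))"
    using lam_simps(1)[OF x] lam_simps(1)[OF f0] by algebra
  also have "\<dots> \<in> m" using lam_f0 lam_simps(1)[OF x] by (simp add: m.I_l_closed m.a_inv_closed)
  finally show ?thesis .
qed

lemma D_zero: "x \<in> FC i \<Longrightarrow> D n \<zero>\<^bsub>A n\<^esub> i x = \<zero>\<^bsub>F (i - n - 1)\<^esub>"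
  using module_hom_zero[OF A_module A_module D_hom, of n] arg_cong[of "i - (n + 1)" "i - n - 1" "\<lambda>k. \<zero>\<^bsub>F k\<^esub>"]
  by (simp add: A_simps(1))

text \<open>The lowest component is the \<open>i\<close>-th coordinate of the syzygy, placed at
  \<open>f0\<close>. By \<open>psi_d\<close> its composite with \<open>d 2\<close> has values in m
  times \<open>f0\<close>, which are boundaries, so the construction can begin in homological degree
  1; below that, the target vanishes.\<close>

lemma v_ex:
  assumes i: "i < e"
  shows "\<exists>\<beta>. \<beta> \<in> ZE 1 \<and> (\<forall>x\<in>FC 1. \<beta> 1 x = psi x i \<odot>\<^bsub>F 0\<^esub> f0)"
proof -
  obtain \<gamma> where g: "\<gamma> \<in> AC 1" "\<And>x. x \<in> FC 1 \<Longrightarrow> \<gamma> 1 x = psi x i \<odot>\<^bsub>F 0\<^esub> f0"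
    "\<And>k x. k > 1 \<Longrightarrow> x \<in> FC k \<Longrightarrow> D 1 \<gamma> k x = \<zero>\<^bsub>A 2\<^esub> k x"
  proof (rule solve[of "\<zero>\<^bsub>A 2\<^esub>" 1 1 "\<lambda>x. psi x i \<odot>\<^bsub>F 0\<^esub> f0"])
    show "(\<lambda>x. psi x i \<odot>\<^bsub>F 0\<^esub> f0) \<in> module_hom R (F 1) (F (1 - 1))"
    proof (intro module_homI)
      fix x assume x: "x \<in> FC 1"
      show "psi x i \<odot>\<^bsub>F 0\<^esub> f0 \<in> FC (1 - 1)" using psi_closed[OF i x] f0 by simp
      {
        fix r assume "r \<in> carrier R"
        then show "psi (r \<odot>\<^bsub>F 1\<^esub> x) i \<odot>\<^bsub>F 0\<^esub> f0 = r \<odot>\<^bsub>F (1 - 1)\<^esub> (psi x i \<odot>\<^bsub>F 0\<^esub> f0)"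
          using module_homD(3)[OF psi_hom[OF i] _ x] psi_closed[OF i x] f0 by (simp add: F.smult_assoc1)
      }
      fix y assume y: "y \<in> FC 1"
      show "psi (x \<oplus>\<^bsub>F 1\<^esub> y) i \<odot>\<^bsub>F 0\<^esub> f0 = psi x i \<odot>\<^bsub>F 0\<^esub> f0 \<oplus>\<^bsub>F (1 - 1)\<^esub> psi y i \<odot>\<^bsub>F 0\<^esub> f0"
        using module_homD(2)[OF psi_hom[OF i] x y] psi_closed[OF i x] psi_closed[OF i y] f0
        by (simp add: F.smult_l_distr)
    qed
    show "D (1 + 1) \<zero>\<^bsub>A 2\<^esub> k x = \<zero>\<^bsub>F (k - 1 - 2)\<^esub>" if "x \<in> FC k" for k x
      using D_zero[OF that, of 2] arg_cong[of "k - 2 - 1" "k - 1 - 2" "\<lambda>k. \<zero>\<^bsub>F k\<^esub>"] by simp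
    show "rhs \<zero>\<^bsub>A 2\<^esub> 1 (1 + 1) (\<lambda>x. psi x i \<odot>\<^bsub>F 0\<^esub> f0) x \<in> d (1 + 1 - 1) ` FC (1 + 1 - 1)"
      if "x \<in> FC (1 + 1)" for x
    proof -
      have x: "x \<in> FC 2" using that by simp
      have p: "psi (d 2 x) i \<in> m" by (rule psi_d[OF i x])
      then have pc: "psi (d 2 x) i \<in> carrier R" by (rule m.a_Hcarr)
      have "lam (\<ominus>\<^bsub>F 0\<^esub> (psi (d 2 x) i \<odot>\<^bsub>F 0\<^esub> f0)) \<in> m"
        using p pc f0 by (simp add: lam_neg lam_simps m.a_inv_closed m.I_r_closed)
      moreover have y: "\<ominus>\<^bsub>F 0\<^esub> (psi (d 2 x) i \<odot>\<^bsub>F 0\<^esub> f0) \<in> FC 0" using pc f0 by simp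
      ultimately have "\<ominus>\<^bsub>F 0\<^esub> (psi (d 2 x) i \<odot>\<^bsub>F 0\<^esub> f0) \<in> d 1 ` FC 1" using lam_ker by blast
      moreover have "rhs \<zero>\<^bsub>A 2\<^esub> 1 2 (\<lambda>x. psi x i \<odot>\<^bsub>F 0\<^esub> f0) x = \<ominus>\<^bsub>F 0\<^esub> (psi (d 2 x) i \<odot>\<^bsub>F 0\<^esub> f0)"
        using x y by (simp add: rhs_def A_simps(1) sgn_act_def)
      ultimately show ?thesis by simp
    qed
  next
    fix \<gamma> assume "\<gamma> \<in> AC 1" "\<And>x. x \<in> FC 1 \<Longrightarrow> \<gamma> 1 x = psi x i \<odot>\<^bsub>F 0\<^esub> f0"
      "\<And>k x. k > 1 \<Longrightarrow> x \<in> FC k \<Longrightarrow> D 1 \<gamma> k x = \<zero>\<^bsub>A 2\<^esub> k x"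
    then show thesis by (rule that)
  qed simp_all
  have "\<gamma> \<in> ZE 1"
  proof (rule ZE_I[OF g(1)])
    show "D 1 \<gamma> k x = \<zero>\<^bsub>F (k - 1 - 1)\<^esub>" if "k \<ge> 1 + 1" "x \<in> FC k" for k x
      using g(3)[of k x] that by (simp add: A_simps(1))
  qed
  then show ?thesis using g(2) by blast
qed

definition v :: "nat \<Rightarrow> int \<Rightarrow> 'b \<Rightarrow> 'b" where
  "v i = (SOME \<beta>. \<beta> \<in> ZE 1 \<and> (\<forall>x\<in>FC 1. \<beta> 1 x = psi x i \<odot>\<^bsub>F 0\<^esub> f0))"

lemma v: "i < e \<Longrightarrow> v i \<in> ZE 1" "i < e \<Longrightarrow> x \<in> FC 1 \<Longrightarrow> v i 1 x = psi x i \<odot>\<^bsub>F 0\<^esub> f0"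
  using someI_ex[OF v_ex] unfolding v_def by blast+

text \<open>The inclusion of the \<open>i\<close>-th summand of \<open>m\<close>, lifted to the
  resolution: the multiple of \<open>f0\<close> by \<open>c i\<close> times \<open>lam x\<close> is
  killed by the augmentation and lifts to \<open>F 1\<close>. The boundary of the cochain vanishes
  only in positive homological degrees; in degree 0 it is that multiple of
  \<open>f0\<close>.\<close>

lemma w_ex:
  assumes i: "i < e"
  shows "\<exists>\<beta>. \<beta> \<in> AC (-1) \<and> (\<forall>x\<in>FC 0. d 1 (\<beta> 0 x) = (c i \<otimes>\<^bsub>R\<^esub> lam x) \<odot>\<^bsub>F 0\<^esub> f0) \<and>
    (\<forall>k x. k > 0 \<longrightarrow> x \<in> FC k \<longrightarrow> D (-1) \<beta> k x = \<zero>\<^bsub>F k\<^esub>)"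
proof -
  have cl: "c i \<otimes>\<^bsub>R\<^esub> lam x \<in> carrier R" if "x \<in> FC 0" for x
    using c_closed[OF i] lam_simps(1)[OF that] by simp
  have H: "(\<lambda>x. (c i \<otimes>\<^bsub>R\<^esub> lam x) \<odot>\<^bsub>F 0\<^esub> f0) \<in> module_hom R (F 0) (F (1 - 1))"
    by (intro module_homI)
      (use c_closed[OF i] lam_simps f0 in \<open>auto simp: F.smult_l_distr F.smult_assoc1 F.R.r_distr F.R.m_lcomm F.R.m_comm
        simp flip: F.smult_assoc1\<close>)
  have G: "(c i \<otimes>\<^bsub>R\<^esub> lam x) \<odot>\<^bsub>F 0\<^esub> f0 \<in> d 1 ` FC 1" if x: "x \<in> FC 0" for x
  proof -
    have "lam ((c i \<otimes>\<^bsub>R\<^esub> lam x) \<odot>\<^bsub>F 0\<^esub> f0) \<in> m"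
      using c_m[OF i] cl[OF x] f0 lam_simps(1)[OF x] lam_simps(1)[OF f0]
      by (simp add: lam_simps m.I_r_closed)
    then show ?thesis using lam_ker cl[OF x] f0 by simp
  qed
  obtain w0 where w0: "w0 \<in> module_hom R (F 0) (F 1)" "w0 \<in> extensional (FC 0)"
    "\<And>x. x \<in> FC 0 \<Longrightarrow> d 1 (w0 x) = (c i \<otimes>\<^bsub>R\<^esub> lam x) \<odot>\<^bsub>F 0\<^esub> f0"
    using projective_lift[OF F_proj F_module F_module d_hom H G] by blast
  obtain \<gamma> where g: "\<gamma> \<in> AC (-1)" "\<And>x. x \<in> FC 0 \<Longrightarrow> \<gamma> 0 x = w0 x"
    "\<And>k x. k > 0 \<Longrightarrow> x \<in> FC k \<Longrightarrow> D (-1) \<gamma> k x = \<zero>\<^bsub>A 0\<^esub> k x"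
  proof (rule solve[of "\<zero>\<^bsub>A 0\<^esub>" "-1" 0 w0])
    show "D (- 1 + 1) \<zero>\<^bsub>A 0\<^esub> k x = \<zero>\<^bsub>F (k - - 1 - 2)\<^esub>" if "x \<in> FC k" for k x
      using D_zero[OF that, of 0] by simp
    show "rhs \<zero>\<^bsub>A 0\<^esub> (- 1) (0 + 1) w0 x \<in> d (0 + 1 - - 1) ` FC (0 + 1 - - 1)"
      if "x \<in> FC (0 + 1)" for x
    proof -
      have x: "x \<in> FC 1" using that by simp
      have wx: "w0 (d 1 x) \<in> FC 1" using module_homD(1)[OF w0(1)] d_closed_1[OF x] by simp
      \<comment> \<open>\<open>lam (d 1 x)\<close> and \<open>c i\<close> both lie in
        \<open>m\<close>, and the square of \<open>m\<close> is zero.\<close>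
      have "d 1 (w0 (d 1 x)) = \<zero>\<^bsub>F 0\<^esub>"
        using w0(3)[OF d_closed_1[OF x]] m_m[OF c_m[OF i] lam_d[OF x]] f0 by simp
      then have "d 1 (\<ominus>\<^bsub>F 1\<^esub> w0 (d 1 x)) = \<zero>\<^bsub>F (1 - 1)\<^esub>"
        using module_hom_neg[OF F_module F_module d_hom wx] by simp
      then have "\<ominus>\<^bsub>F 1\<^esub> w0 (d 1 x) \<in> d 2 ` FC 2"
        using d_exact[of 1 "\<ominus>\<^bsub>F 1\<^esub> w0 (d 1 x)"] wx by simp
      moreover have "rhs \<zero>\<^bsub>A 0\<^esub> (-1) 1 w0 x = \<ominus>\<^bsub>F 1\<^esub> w0 (d 1 x)"
        using x wx by (simp add: rhs_def A_simps(1) sgn_act_def)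
      ultimately show ?thesis by simp
    qed
  next
    fix \<gamma> assume "\<gamma> \<in> AC (-1)" "\<And>x. x \<in> FC 0 \<Longrightarrow> \<gamma> 0 x = w0 x"
      "\<And>k x. k > 0 \<Longrightarrow> x \<in> FC k \<Longrightarrow> D (-1) \<gamma> k x = \<zero>\<^bsub>A 0\<^esub> k x"
    then show thesis by (rule that)
  qed (use w0(1) in simp_all)
  then show ?thesis using w0(3) by (intro exI[of _ \<gamma>]) (auto simp: A_simps(1))
qed

definition w :: "nat \<Rightarrow> int \<Rightarrow> 'b \<Rightarrow> 'b" where
  "w i = (SOME \<beta>. \<beta> \<in> AC (-1) \<and> (\<forall>x\<in>FC 0. d 1 (\<beta> 0 x) = (c i \<otimes>\<^bsub>R\<^esub> lam x) \<odot>\<^bsub>F 0\<^esub> f0) \<and>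
    (\<forall>k x. k > 0 \<longrightarrow> x \<in> FC k \<longrightarrow> D (-1) \<beta> k x = \<zero>\<^bsub>F k\<^esub>))"

lemma w: "i < e \<Longrightarrow> w i \<in> AC (-1)"
  "i < e \<Longrightarrow> x \<in> FC 0 \<Longrightarrow> d 1 (w i 0 x) = (c i \<otimes>\<^bsub>R\<^esub> lam x) \<odot>\<^bsub>F 0\<^esub> f0"
  "i < e \<Longrightarrow> k > 0 \<Longrightarrow> x \<in> FC k \<Longrightarrow> D (-1) (w i) k x = \<zero>\<^bsub>F k\<^esub>"
  using someI_ex[OF w_ex] unfolding w_def by blast+

lemma w_ZS: "i < e \<Longrightarrow> w i \<in> ZS (-1)"
  using w(1,3) D_closed[OF w(1), of i] unfolding ZS_def bd_iff
  by (auto intro!: exI[of _ 1])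

text \<open>The defect of \<open>w i\<close> is confined to homological degree 0, and a cochain of
  degree \<open>n + 1 > 0\<close> maps \<open>F 0\<close> into a zero module. Hence the product is
  an honest cocycle although \<open>w i\<close> is not.\<close>

lemma ZE_mul_w:
  assumes f: "f \<in> ZE (n + 1)" and n: "n \<ge> 0" and i: "i < e"
  shows "mul (-1) f (w i) \<in> ZE n"
proof (rule ZE_I)
  have fA: "f \<in> AC (n + 1)" by (rule ZE_A[OF f])
  show "mul (-1) f (w i) \<in> AC n" using mul_closed[OF fA w(1)[OF i]] by simp
  fix k x assume k: "k \<ge> 0" "k \<ge> n + 1" and x: "x \<in> FC k"
  have wx: "w i k x \<in> FC (k - -1)" using A_closed[OF w(1)[OF i] x] by simp
  have "D n (mul (-1) f (w i)) k x = D (n + 1) f (k - -1) (w i k x) \<oplus>\<^bsub>F (k - -1 - (n + 1) - 1)\<^esub>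
      sgn_act (F (k - -1 - (n + 1) - 1)) (n + 1) (f (k - -1 - 1) (D (-1) (w i) k x))"
    using Leibniz[OF fA w(1)[OF i] x] by simp
  also have "D (n + 1) f (k - -1) (w i k x) = \<zero>\<^bsub>F (k - -1 - (n + 1) - 1)\<^esub>"
    by (rule ZE_D[OF f wx])
  also have "D (-1) (w i) k x = \<zero>\<^bsub>F k\<^esub>" using w(3)[OF i _ x] k n by simp
  also have "f (k - -1 - 1) \<zero>\<^bsub>F k\<^esub> = \<zero>\<^bsub>F (k - (n + 1))\<^esub>"
    using module_hom_zero[OF F_module F_module A_hom[OF fA, of k]] by simp
  finally show "D n (mul (-1) f (w i)) k x = \<zero>\<^bsub>F (k - n - 1)\<^esub>"
    using arg_cong[of "k - (n + 1)" "k - n - 1" "\<lambda>k. \<zero>\<^bsub>F k\<^esub>"] by (simp add: sgn_act_zero[OF F_module])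
qed

text \<open>Applying \<open>lam\<close> to \<open>d 1 (w i 0 x)\<close> gives \<open>c i\<close>
  times \<open>lam x\<close>. Comparing coefficients of the generators is possible modulo
  \<open>m\<close> by \<open>c_indep\<close>.\<close>

lemma psi_w:
  assumes i: "i < e" and j: "j < e" and x: "x \<in> FC 0"
  shows "psi (w i 0 x) j \<ominus>\<^bsub>R\<^esub> (if i = j then lam x else \<zero>\<^bsub>R\<^esub>) \<in> m"
proof -
  have wx: "w i 0 x \<in> FC 1" using A_closed[OF w(1)[OF i] x] by simp
  have lx: "lam x \<in> carrier R" by (rule lam_simps(1)[OF x])
  let ?r = "\<lambda>j. psi (w i 0 x) j \<ominus>\<^bsub>R\<^esub> (if i = j then lam x else \<zero>\<^bsub>R\<^esub>)"
  have "finsum R (\<lambda>j. ?r j \<otimes>\<^bsub>R\<^esub> c j) {..<e} =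
      finsum R (\<lambda>j. psi (w i 0 x) j \<otimes>\<^bsub>R\<^esub> c j \<oplus>\<^bsub>R\<^esub> (if i = j then \<ominus>\<^bsub>R\<^esub> (lam x \<otimes>\<^bsub>R\<^esub> c j) else \<zero>\<^bsub>R\<^esub>)) {..<e}"
  proof (rule F.R.finsum_cong')
    fix j assume "j \<in> {..<e}"
    then have "psi (w i 0 x) j \<in> carrier R" "c j \<in> carrier R" using psi_closed[OF _ wx] c_closed by auto
    then show "?r j \<otimes>\<^bsub>R\<^esub> c j = psi (w i 0 x) j \<otimes>\<^bsub>R\<^esub> c j \<oplus>\<^bsub>R\<^esub> (if i = j then \<ominus>\<^bsub>R\<^esub> (lam x \<otimes>\<^bsub>R\<^esub> c j) else \<zero>\<^bsub>R\<^esub>)"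
      using lx by (auto simp: a_minus_def F.R.l_distr F.R.l_minus)
  qed (use psi_closed[OF _ wx] c_closed lx in auto)
  also have "\<dots> = finsum R (\<lambda>j. psi (w i 0 x) j \<otimes>\<^bsub>R\<^esub> c j) {..<e} \<oplus>\<^bsub>R\<^esub>
      finsum R (\<lambda>j. if i = j then \<ominus>\<^bsub>R\<^esub> (lam x \<otimes>\<^bsub>R\<^esub> c j) else \<zero>\<^bsub>R\<^esub>) {..<e}"
    by (rule F.R.finsum_addf) (use psi_closed[OF _ wx] c_closed lx in auto)
  also have "finsum R (\<lambda>j. if i = j then \<ominus>\<^bsub>R\<^esub> (lam x \<otimes>\<^bsub>R\<^esub> c j) else \<zero>\<^bsub>R\<^esub>) {..<e} = \<ominus>\<^bsub>R\<^esub> (lam x \<otimes>\<^bsub>R\<^esub> c i)"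
    by (rule F.R.finsum_singleton) (use i c_closed lx in auto)
  also have "finsum R (\<lambda>j. psi (w i 0 x) j \<otimes>\<^bsub>R\<^esub> c j) {..<e} = lam x \<otimes>\<^bsub>R\<^esub> c i"
  proof -
    have cl: "c i \<otimes>\<^bsub>R\<^esub> lam x \<in> m" using c_m[OF i] lx by (simp add: m.I_r_closed)
    have "finsum R (\<lambda>j. psi (w i 0 x) j \<otimes>\<^bsub>R\<^esub> c j) {..<e} = lam (d 1 (w i 0 x))" by (rule psi_sum[OF wx])
    also have "\<dots> = (c i \<otimes>\<^bsub>R\<^esub> lam x) \<otimes>\<^bsub>R\<^esub> lam f0"
      using w(2)[OF i x] f0 m.a_Hcarr[OF cl] by (simp add: lam_simps)
    also have "\<dots> = c i \<otimes>\<^bsub>R\<^esub> lam x" by (rule m_lam_f0[OF cl])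
    finally show ?thesis using lx c_closed[OF i] by (simp add: F.R.m_comm)
  qed
  finally have "finsum R (\<lambda>j. ?r j \<otimes>\<^bsub>R\<^esub> c j) {..<e} = \<zero>\<^bsub>R\<^esub>"
    using lx c_closed[OF i] by (simp add: F.R.r_neg)
  then show ?thesis
    using c_indep[of ?r j] psi_closed[OF _ wx] lx j by simp
qed

text \<open>The difference is a chain map of degree 0, and by \<open>psi_w\<close> it induces zero
  on the residue field, so \<open>BE_0\<close> applies.\<close>

lemma v_w:
  assumes i: "i < e" and j: "j < e"
  shows "mul (-1) (v j) (w i) \<ominus>\<^bsub>A 0\<^esub> (if i = j then idA else \<zero>\<^bsub>A 0\<^esub>) \<in> BE 0"
proof (rule BE_0)
  let ?I = "if i = j then idA else \<zero>\<^bsub>A 0\<^esub>"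
  have vw: "mul (-1) (v j) (w i) \<in> ZE 0"
    using ZE_mul_w[of "v j" 0 i] v(1)[OF j] i by simp
  have I: "?I \<in> ZE 0" using idA_ZE ZE_sub[of 0] by (auto simp: submodule_def dest: subgroup.one_closed)
  show "mul (-1) (v j) (w i) \<ominus>\<^bsub>A 0\<^esub> ?I \<in> ZE 0"
    using A.submoduleE(3,5)[OF ZE_sub] vw I unfolding a_minus_def by blast
  fix x assume x: "x \<in> FC 0"
  have wx: "w i 0 x \<in> FC 1" using A_closed[OF w(1)[OF i] x] by simp
  have p: "psi (w i 0 x) j \<in> carrier R" by (rule psi_closed[OF j wx])
  have "?I 0 x = (if i = j then \<one>\<^bsub>R\<^esub> else \<zero>\<^bsub>R\<^esub>) \<odot>\<^bsub>F 0\<^esub> x" using x by (auto simp: A_simps(1))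
  then have "(mul (-1) (v j) (w i) \<ominus>\<^bsub>A 0\<^esub> ?I) 0 x =
      psi (w i 0 x) j \<odot>\<^bsub>F 0\<^esub> f0 \<ominus>\<^bsub>F 0\<^esub> (if i = j then \<one>\<^bsub>R\<^esub> else \<zero>\<^bsub>R\<^esub>) \<odot>\<^bsub>F 0\<^esub> x"
    using A_minus[OF ZE_A[OF vw] ZE_A[OF I] x] x wx v(2)[OF j wx] by (simp add: compose_eq)
  then have "lam ((mul (-1) (v j) (w i) \<ominus>\<^bsub>A 0\<^esub> ?I) 0 x) =
     psi (w i 0 x) j \<otimes>\<^bsub>R\<^esub> lam f0 \<ominus>\<^bsub>R\<^esub> (if i = j then lam x else \<zero>\<^bsub>R\<^esub>)"
    using x f0 p lam_simps(1)[OF x] by (simp add: lam_minus lam_simps)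
  also have "\<dots> = psi (w i 0 x) j \<otimes>\<^bsub>R\<^esub> (lam f0 \<ominus>\<^bsub>R\<^esub> \<one>\<^bsub>R\<^esub>) \<oplus>\<^bsub>R\<^esub> (psi (w i 0 x) j \<ominus>\<^bsub>R\<^esub> (if i = j then lam x else \<zero>\<^bsub>R\<^esub>))"
    using p lam_simps(1)[OF x] lam_simps(1)[OF f0] by (cases "i = j"; simp; algebra)
  also have "\<dots> \<in> m" using lam_f0 p psi_w[OF i j x] by (simp add: m.I_l_closed m.a_closed)
  finally show "lam ((mul (-1) (v j) (w i) \<ominus>\<^bsub>A 0\<^esub> ?I) 0 x) \<in> m" .
qed

definition W :: "int \<Rightarrow> 'b \<Rightarrow> 'b" where
  "W = finsum (A 0) (\<lambda>i. mul 1 (w i) (v i)) {..<e}"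

lemma wv_closed: "i < e \<Longrightarrow> mul 1 (w i) (v i) \<in> AC 0"
  using mul_closed[OF w(1) ZE_A[OF v(1)], of i i] by simp

lemma W_closed: "W \<in> AC 0"
  unfolding W_def by (rule A.M.finsum_closed) (auto intro: wv_closed)

text \<open>The bound is 1 and not 0: \<open>v i\<close> lowers the homological degree by one before
  the boundary of \<open>w i\<close> is met, and that boundary vanishes in positive degrees.\<close>

lemma D_W:
  assumes "k > 1" "x \<in> FC k"
  shows "D 0 W k x = \<zero>\<^bsub>F (k - 1)\<^esub>"
proof -
  have "D 0 W = finsum (A (0 + 1)) (\<lambda>i. D 0 (mul 1 (w i) (v i))) {..<e}"
    unfolding W_def by (rule module_hom_finsum[OF A_module A_module D_hom]) (auto intro: wv_closed)
  then have "D 0 W k x = finsum (F (k - 1)) (\<lambda>i. D 0 (mul 1 (w i) (v i)) k x) {..<e}"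
    using assms(2) A_finsum[of "{..<e}" "\<lambda>i. D 0 (mul 1 (w i) (v i))" 1 x k] D_closed[OF wv_closed] by (auto simp: Pi_def)
  also have "\<dots> = finsum (F (k - 1)) (\<lambda>i. \<zero>\<^bsub>F (k - 1)\<^esub>) {..<e}"
  proof (rule F.M.finsum_cong')
    fix i assume "i \<in> {..<e}"
    then have i: "i < e" by simp
    have vA: "v i \<in> AC 1" by (rule ZE_A[OF v(1)[OF i]])
    have vx: "v i k x \<in> FC (k - 1)" using A_closed[OF vA assms(2)] .
    have "D 0 (mul 1 (w i) (v i)) k x = D (-1) (w i) (k - 1) (v i k x) \<oplus>\<^bsub>F (k - 1)\<^esub>
       sgn_act (F (k - 1)) (-1) (w i (k - 1 - 1) (D 1 (v i) k x))"
      using Leibniz[OF w(1)[OF i] vA assms(2)] by simp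
    also have "D (-1) (w i) (k - 1) (v i k x) = \<zero>\<^bsub>F (k - 1)\<^esub>"
      using w(3)[OF i _ vx] assms(1) by simp
    also have "w i (k - 1 - 1) (D 1 (v i) k x) = \<zero>\<^bsub>F (k - 1)\<^esub>"
      using ZE_D[OF v(1)[OF i] assms(2)] module_hom_zero[OF F_module F_module A_hom[OF w(1)[OF i], of "k - 1 - 1"]]
        arg_cong[of "k - 1 - 1 - -1" "k - 1" "\<lambda>k. \<zero>\<^bsub>F k\<^esub>"] by simp
    finally show "D 0 (mul 1 (w i) (v i)) k x = \<zero>\<^bsub>F (k - 1)\<^esub>" by (simp add: sgn_act_zero[OF F_module])
  qed auto
  finally show ?thesis by simp
qed

text \<open>\<open>psi_sum\<close> reassembles \<open>lam (d 1 x)\<close> from its coordinates; the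
  stray factors \<open>lam f0\<close> disappear by \<open>m_lam_f0\<close>.\<close>

lemma d_W:
  assumes x: "x \<in> FC 1"
  shows "d 1 (W 1 x) = lam (d 1 x) \<odot>\<^bsub>F 0\<^esub> f0"
proof -
  have vA: "v i \<in> AC 1" if "i < e" for i by (rule ZE_A[OF v(1)[OF that]])
  have wv: "w i 0 (v i 1 x) \<in> FC 1" if i: "i < e" for i
    using A_closed[OF w(1)[OF i], of "v i 1 x" 0] A_closed[OF vA[OF i] x] by simp
  have "W 1 x = finsum (F 1) (\<lambda>i. w i 0 (v i 1 x)) {..<e}"
    unfolding W_def using x A_finsum[of "{..<e}" "\<lambda>i. mul 1 (w i) (v i)" 0 x 1] wv_closed
    by (simp add: Pi_def compose_eq)
  then have "d 1 (W 1 x) = finsum (F 0) (\<lambda>i. d 1 (w i 0 (v i 1 x))) {..<e}"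
    using module_hom_finsum[OF F_module F_module d_hom[of 1], of "\<lambda>i. w i 0 (v i 1 x)" "{..<e}"] wv
    by (simp add: Pi_def)
  also have "\<dots> = finsum (F 0) (\<lambda>i. (psi x i \<otimes>\<^bsub>R\<^esub> c i) \<odot>\<^bsub>F 0\<^esub> f0) {..<e}"
  proof (rule F.M.finsum_cong')
    fix i assume "i \<in> {..<e}"
    then have i: "i < e" by simp
    have p: "psi x i \<in> carrier R" and c: "c i \<in> carrier R" using psi_closed[OF i x] c_closed[OF i] .
    have "d 1 (w i 0 (v i 1 x)) = (c i \<otimes>\<^bsub>R\<^esub> (psi x i \<otimes>\<^bsub>R\<^esub> lam f0)) \<odot>\<^bsub>F 0\<^esub> f0"
      using w(2)[OF i, of "v i 1 x"] v(2)[OF i x] p f0 by (simp add: lam_simps)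
    also have "c i \<otimes>\<^bsub>R\<^esub> (psi x i \<otimes>\<^bsub>R\<^esub> lam f0) = (psi x i \<otimes>\<^bsub>R\<^esub> c i) \<otimes>\<^bsub>R\<^esub> lam f0"
      using p c lam_simps(1)[OF f0] by algebra
    also have "\<dots> = psi x i \<otimes>\<^bsub>R\<^esub> c i" by (rule m_lam_f0) (use p c_m[OF i] in \<open>simp add: m.I_l_closed\<close>)
    finally show "d 1 (w i 0 (v i 1 x)) = (psi x i \<otimes>\<^bsub>R\<^esub> c i) \<odot>\<^bsub>F 0\<^esub> f0" .
  qed (use psi_closed[OF _ x] c_closed f0 in auto)
  also have "\<dots> = finsum R (\<lambda>i. psi x i \<otimes>\<^bsub>R\<^esub> c i) {..<e} \<odot>\<^bsub>F 0\<^esub> f0"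
    by (rule finsum_smult_right[OF F_module, symmetric]) (use psi_closed[OF _ x] c_closed f0 in auto)
  finally show ?thesis by (simp add: psi_sum[OF x])
qed

text \<open>The homotopy behind the relation that the sum of all w_i v_i is 1. In degree 0 the
  component \<open>h0\<close> contracts \<open>F 0\<close> onto the multiples of \<open>f0\<close>;
  those multiples are what \<open>d_W\<close> accounts for in degree 1. Equality with D h is
  obtained in positive homological degrees only.\<close>

lemma h_ex:
  obtains h where "h \<in> AC (-1)"
    "\<And>k x. k > 0 \<Longrightarrow> x \<in> FC k \<Longrightarrow> D (-1) h k x = (idA \<ominus>\<^bsub>A 0\<^esub> W) k x"
proof -
  have lc: "lam x \<odot>\<^bsub>F 0\<^esub> f0 \<in> FC 0" if "x \<in> FC 0" for x
    using lam_simps(1)[OF that] f0 by simp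
  have H0: "(\<lambda>x. x \<oplus>\<^bsub>F 0\<^esub> (\<ominus>\<^bsub>R\<^esub> \<one>\<^bsub>R\<^esub>) \<odot>\<^bsub>F 0\<^esub> (lam x \<odot>\<^bsub>F 0\<^esub> f0)) \<in> module_hom R (F 0) (F 0)"
  proof (intro module_hom_plus module_hom_scale module_hom_ident F_module)
    show "(\<lambda>x. lam x \<odot>\<^bsub>F 0\<^esub> f0) \<in> module_hom R (F 0) (F 0)"
      by (intro module_homI) (use lam_simps f0 in \<open>auto simp: F.smult_l_distr F.smult_assoc1\<close>)
  qed simp
  have "(\<lambda>x. x \<ominus>\<^bsub>F 0\<^esub> lam x \<odot>\<^bsub>F 0\<^esub> f0) \<in> module_hom R (F 0) (F 0)"
    by (rule module_hom_cong[OF F_module H0]) (simp add: a_minus_def F.smult_l_minus lc)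
  then have H: "(\<lambda>x. x \<ominus>\<^bsub>F 0\<^esub> lam x \<odot>\<^bsub>F 0\<^esub> f0) \<in> module_hom R (F 0) (F (1 - 1))" by simp
  have G: "x \<ominus>\<^bsub>F 0\<^esub> lam x \<odot>\<^bsub>F 0\<^esub> f0 \<in> d 1 ` FC 1" if x: "x \<in> FC 0" for x
    using lam_proj[OF x] lam_ker[of "x \<ominus>\<^bsub>F 0\<^esub> lam x \<odot>\<^bsub>F 0\<^esub> f0"] x lc by simp
  obtain h0 where h0: "h0 \<in> module_hom R (F 0) (F 1)" "h0 \<in> extensional (FC 0)"
    "\<And>x. x \<in> FC 0 \<Longrightarrow> d 1 (h0 x) = x \<ominus>\<^bsub>F 0\<^esub> lam x \<odot>\<^bsub>F 0\<^esub> f0"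
    using projective_lift[OF F_proj F_module F_module d_hom H G] by blast
  have al: "idA \<ominus>\<^bsub>A 0\<^esub> W \<in> AC 0" using W_closed by simp
  obtain h where h: "h \<in> AC (-1)"
    "\<And>k x. k > 0 \<Longrightarrow> x \<in> FC k \<Longrightarrow> D (-1) h k x = (idA \<ominus>\<^bsub>A 0\<^esub> W) k x"
  proof (rule solve[of "idA \<ominus>\<^bsub>A 0\<^esub> W" "-1" 0 h0])
    show "D (- 1 + 1) (idA \<ominus>\<^bsub>A 0\<^esub> W) k x = \<zero>\<^bsub>F (k - - 1 - 2)\<^esub>" if "0 + 1 < k" "x \<in> FC k" for k x
    proof -
      have "D 0 (idA \<ominus>\<^bsub>A 0\<^esub> W) = D 0 idA \<ominus>\<^bsub>A (0 + 1)\<^esub> D 0 W"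
        by (rule module_hom_minus[OF A_module A_module D_hom]) (use W_closed in auto)
      then have "D 0 (idA \<ominus>\<^bsub>A 0\<^esub> W) k x = D 0 idA k x \<ominus>\<^bsub>F (k - 1)\<^esub> D 0 W k x"
        using A_minus[OF D_closed[OF idA_closed] D_closed[OF W_closed] that(2)] by simp
      then show ?thesis
        using D_W[of k x] ZE_D[OF idA_ZE that(2)] that by (simp add: F.M.minus_zero_right)
    qed
    show "rhs (idA \<ominus>\<^bsub>A 0\<^esub> W) (- 1) (0 + 1) h0 x \<in> d (0 + 1 - - 1) ` FC (0 + 1 - - 1)"
      if "x \<in> FC (0 + 1)" for x
    proof -
      have x: "x \<in> FC 1" using that by simp
      note dx = d_closed_1[OF x]
      have Wx: "W 1 x \<in> FC 1" using A_closed[OF W_closed x] by simp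
      have hx: "h0 (d 1 x) \<in> FC 1" using module_homD(1)[OF h0(1) dx] .
      \<comment> \<open>The right-hand side in degree 1. The parts along \<open>f0\<close> coming
        from \<open>d_W\<close> and from \<open>h0\<close> cancel, so \<open>y\<close> is a cycle,
        hence a boundary.\<close>
      define y where "y = x \<ominus>\<^bsub>F 1\<^esub> W 1 x \<ominus>\<^bsub>F 1\<^esub> h0 (d 1 x)"
      have y: "y \<in> FC 1" using x Wx hx by (simp add: y_def)
      have "d 1 y = d 1 x \<ominus>\<^bsub>F 0\<^esub> d 1 (W 1 x) \<ominus>\<^bsub>F 0\<^esub> d 1 (h0 (d 1 x))"
        using x Wx hx module_hom_minus[OF F_module F_module d_hom[of 1]] by (simp add: y_def)
      also have "\<dots> = d 1 x \<ominus>\<^bsub>F 0\<^esub> lam (d 1 x) \<odot>\<^bsub>F 0\<^esub> f0 \<ominus>\<^bsub>F 0\<^esub> (d 1 x \<ominus>\<^bsub>F 0\<^esub> lam (d 1 x) \<odot>\<^bsub>F 0\<^esub> f0)"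
        by (simp add: d_W[OF x] h0(3)[OF dx])
      also have "\<dots> = \<zero>\<^bsub>F 0\<^esub>" using dx lc[OF dx] by (simp add: F.M.minus_eq_zero_iff)
      finally have "y \<in> d 2 ` FC 2" using d_exact[of 1 y] y by simp
      moreover have "rhs (idA \<ominus>\<^bsub>A 0\<^esub> W) (-1) 1 h0 x = y"
        using A_minus[OF idA_closed W_closed x] x Wx hx by (simp add: rhs_def y_def sgn_act_def a_minus_def)
      ultimately show ?thesis by simp
    qed
  next
    fix h assume "h \<in> AC (-1)" "\<And>k x. k > 0 \<Longrightarrow> x \<in> FC k \<Longrightarrow> D (-1) h k x = (idA \<ominus>\<^bsub>A 0\<^esub> W) k x"
    then show thesis by (rule that)
  qed (use al h0(1) in simp_all)
  then show thesis by (rule that)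
qed

end

section \<open>Ext: generators v and coefficient maps\<close>

context resolution_data
begin

abbreviation "EE \<equiv> Ext_algebra R F d"

abbreviation "SS \<equiv> stable_Ext_algebra R F d"

abbreviation "io \<equiv> Ext_to_stable_Ext R F d"

lemma pres_E: "gr_pres R A (\<lambda>m n. mul n) idA (R Quot m) (\<lambda>r. m +>\<^bsub>R\<^esub> r) ZE EE clE BE"
  unfolding Ext_algebra_def
proof (rule pres_residue[OF pres_E0 m_ideal])
  show "r \<odot>\<^bsub>A n\<^esub> x \<in> BE n" if "r \<in> m" "x \<in> ZE n" for n r x using that by (rule kill_E)
qed

lemma pres_S: "gr_pres R A (\<lambda>m n. mul n) idA (R Quot m) (\<lambda>r. m +>\<^bsub>R\<^esub> r) ZS SS clS BS"
  unfolding stable_Ext_algebra_def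
proof (rule pres_residue[OF pres_S0 m_ideal])
  show "r \<odot>\<^bsub>A n\<^esub> x \<in> BS n" if "r \<in> m" "x \<in> ZS n" for n r x using that by (rule kill_S)
qed

sublocale Q: gr_pres_pair R A "\<lambda>m n. mul n" idA "R Quot m" "\<lambda>r. m +>\<^bsub>R\<^esub> r" ZE EE clE BE ZS SS clS BS io
proof (rule gr_pres_pair.intro[OF pres_E pres_S gr_pres_pair_axioms.intro])
  show "x \<in> ZS n" if "x \<in> ZE n" for x n using that by (rule ZE_ZS)
  show "io n (clE n x) = clS n x" if "x \<in> ZE n" for x n using that by (rule Ext_to_stable_Ext_cl)
qed

lemma EE_neg:
  assumes "n < 0"
  shows "carrier (acomp EE n) = {\<zero>\<^bsub>acomp EE n\<^esub>}"
proof -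
  have "a = \<zero>\<^bsub>acomp EE n\<^esub>" if "a \<in> carrier (acomp EE n)" for a
  proof -
    obtain z where "z \<in> ZE n" "a = clE n z" using \<open>a \<in> carrier (acomp EE n)\<close> by (elim Q.E.cl_cases)
    then show ?thesis using Q.E.cl_ker ZE_neg[OF assms] by blast
  qed
  then show ?thesis using Q.E.A.M.zero_closed[of n] by blast
qed

lemma EE_0:
  assumes "a \<in> carrier (acomp EE 0)"
  shows "\<exists>k\<in>carrier (R Quot m). a = k \<odot>\<^bsub>acomp EE 0\<^esub> aone EE"
proof -
  obtain z where z: "z \<in> ZE 0" "a = clE 0 z" using assms by (elim Q.E.cl_cases)
  obtain r where r: "r \<in> carrier R" "z \<ominus>\<^bsub>A 0\<^esub> r \<odot>\<^bsub>A 0\<^esub> idA \<in> BE 0" using ZE_0[OF z(1)] by blast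
  have "a = clE 0 (r \<odot>\<^bsub>A 0\<^esub> idA)"
    unfolding z(2) using Q.E.cl_eq_iff[OF z(1) Q.E.Z_smult[OF r(1) idA_ZE]] r(2) by simp
  also have "\<dots> = (m +>\<^bsub>R\<^esub> r) \<odot>\<^bsub>acomp EE 0\<^esub> aone EE"
    unfolding Q.E.cl_smult[OF r(1) idA_ZE] Q.E.cl_one ..
  finally show ?thesis using Q.E.pi(2) r(1) by blast
qed

lemma EE_one: "aone EE \<noteq> \<zero>\<^bsub>acomp EE 0\<^esub>"
  using Q.E.cl_ker[OF idA_ZE] idA_not_BE by (simp add: Q.E.cl_one)

definition vE :: "nat \<Rightarrow> (int \<Rightarrow> 'b \<Rightarrow> 'b) set" where
  "vE i = clE 1 (v i)"

lemma vE_closed: "i < e \<Longrightarrow> vE i \<in> carrier (acomp EE 1)"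
  unfolding vE_def by (intro Q.E.cl_closed v)

text \<open>Right multiplication by \<open>w i\<close>, an element outside E, as a map from E^(n+1)
  to E^n. A representative is selected because coboundaries are respected only by the special
  argument of \<open>BE_mul_w\<close>, valid for n \<ge> 0.\<close>

definition rcE :: "nat \<Rightarrow> int \<Rightarrow> (int \<Rightarrow> 'b \<Rightarrow> 'b) set \<Rightarrow> (int \<Rightarrow> 'b \<Rightarrow> 'b) set" where
  "rcE i n a = clE n (mul (-1) (SOME f. f \<in> ZE (n + 1) \<and> a = clE (n + 1) f) (w i))"

text \<open>In degree \<^term>\<open>0::int\<close> this uses that a homotopy composed with the boundary of \<^term>\<open>w i\<close> takes
  values in the maximal ideal.\<close>

lemma BE_mul_w:
  assumes f: "f \<in> BE (n + 1)" and n: "n \<ge> 0" and i: "i < e"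
  shows "mul (-1) f (w i) \<in> BE n"
proof -
  obtain \<gamma> where g: "\<gamma> \<in> AC n" "f = D n \<gamma>" using f by (auto simp: BE_def)
  have wA: "w i \<in> AC (-1)" by (rule w(1)[OF i])
  have DwA: "D (-1) (w i) \<in> AC 0" using D_closed[OF wA] by simp
  have gw: "mul (-1) \<gamma> (w i) \<in> AC (n - 1)" using mul_closed[OF g(1) wA] by simp
  define y where "y = mul 0 \<gamma> (D (-1) (w i))"
  have yA: "y \<in> AC n" using mul_closed[OF g(1) DwA] by (simp add: y_def)
  have z: "mul (-1) f (w i) \<in> ZE n" using ZE_mul_w[OF _ n i] BE_ZE f by blast
  have L: "D (n - 1) (mul (-1) \<gamma> (w i)) = mul (-1) f (w i) \<oplus>\<^bsub>A n\<^esub> sgn_act (A n) n y"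
    using Leibniz_mul[OF g(1) wA] by (simp add: g(2) y_def)
  have Dg: "D (n - 1) (mul (-1) \<gamma> (w i)) \<in> BE n" using gw by (simp add: BE_I)
  have "sgn_act (A n) n y = D (n - 1) (mul (-1) \<gamma> (w i)) \<ominus>\<^bsub>A n\<^esub> mul (-1) f (w i)"
    unfolding L using ZE_A[OF z] sgn_act_closed[OF A_module yA]
    by (simp add: a_minus_def A.M.a_ac A.M.r_neg1 A.M.r_neg)
  also have "\<dots> \<in> ZE n" using Q.E.Z_minus BE_ZE Dg z by blast
  finally have y': "sgn_act (A n) n y \<in> ZE n" .
  have "sgn_act (A n) n (sgn_act (A n) n y) \<in> ZE n"
    by (rule sgn_act_submodule[OF A_module ZE_sub y'])
  then have yZ: "y \<in> ZE n" using yA by (simp add: sgn_act_sgn_act[OF A_module]) (simp add: sgn_act_def)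
  have y0: "y k x = \<zero>\<^bsub>F (k - n)\<^esub>" if k: "k > 0" and x: "x \<in> FC k" for k x
    using w(3)[OF i k x] x module_hom_zero[OF F_module F_module A_hom[OF g(1)], of k]
    by (simp add: y_def compose_eq)
  have "y \<in> BE n"
  proof (cases "n = 0")
    case True
    have "lam (y 0 x) \<in> m" if x: "x \<in> FC 0" for x
    proof -
      have h: "\<gamma> 0 \<in> module_hom R (F 0) (F 0)" using A_hom[OF g(1), of 0] True by simp
      have gf: "\<gamma> 0 f0 \<in> FC 0" by (rule module_homD(1)[OF h f0])
      have cm: "c i \<otimes>\<^bsub>R\<^esub> lam x \<in> m" using c_m[OF i] lam_simps(1)[OF x] by (simp add: m.I_r_closed)
      have dn: "d 0 x = \<zero>\<^bsub>F (-1)\<^esub>" using F_neg[of "-1" "d 0 x"] d_closed[OF x] by simp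
      have "w i (-1) (d 0 x) = \<zero>\<^bsub>F 0\<^esub>"
        unfolding dn using module_hom_zero[OF F_module F_module A_hom[OF wA, of "-1"]] by simp
      then have "D (-1) (w i) 0 x = (c i \<otimes>\<^bsub>R\<^esub> lam x) \<odot>\<^bsub>F 0\<^esub> f0"
        using x w(2)[OF i x] f0 m.a_Hcarr[OF cm]
        by (simp add: D_apply sgn_act_zero[OF F_module] F.M.minus_zero_right)
      then have "y 0 x = (c i \<otimes>\<^bsub>R\<^esub> lam x) \<odot>\<^bsub>F 0\<^esub> \<gamma> 0 f0"
        using x f0 m.a_Hcarr[OF cm] by (simp add: y_def compose_eq module_homD(3)[OF h])
      then show ?thesis
        using cm gf lam_simps(1)[OF gf] m.a_Hcarr[OF cm] by (simp add: lam_simps m.I_r_closed)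
    qed
    then show ?thesis using BE_0 yZ True by blast
  next
    case False
    \<comment> \<open>For positive \<open>n\<close>, \<open>y\<close> is supported on
      \<open>F 0\<close> and takes values in the zero module \<open>F (- n)\<close>.\<close>
    have "y = \<zero>\<^bsub>A n\<^esub>"
      by (rule A_eqI'[OF yA A.M.zero_closed]) (use False n y0 in \<open>auto simp: A_simps(1)\<close>)
    then show ?thesis using BE_sub[of n] by (auto simp: submodule_def dest: subgroup.one_closed)
  qed
  then have "sgn_act (A n) n y \<in> BE n" by (rule sgn_act_submodule[OF A_module BE_sub])
  then have "D (n - 1) (mul (-1) \<gamma> (w i)) \<ominus>\<^bsub>A n\<^esub> sgn_act (A n) n y \<in> BE n"
    using A.submoduleE(3,5)[OF BE_sub] Dg by (simp add: a_minus_def)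
  moreover have "D (n - 1) (mul (-1) \<gamma> (w i)) \<ominus>\<^bsub>A n\<^esub> sgn_act (A n) n y = mul (-1) f (w i)"
    unfolding L using ZE_A[OF z] sgn_act_closed[OF A_module yA]
    by (simp add: a_minus_def A.M.a_assoc A.M.r_neg)
  ultimately show ?thesis by simp
qed

lemma rcE_cl:
  assumes f: "f \<in> ZE (n + 1)" and n: "n \<ge> 0" and i: "i < e"
  shows "rcE i n (clE (n + 1) f) = clE n (mul (-1) f (w i))"
proof -
  define g where "g = (SOME g. g \<in> ZE (n + 1) \<and> clE (n + 1) f = clE (n + 1) g)"
  have g: "g \<in> ZE (n + 1)" "clE (n + 1) f = clE (n + 1) g"
    using someI[of "\<lambda>g. g \<in> ZE (n + 1) \<and> clE (n + 1) f = clE (n + 1) g" f] f unfolding g_def by auto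
  have "g \<ominus>\<^bsub>A (n + 1)\<^esub> f \<in> BE (n + 1)" using Q.E.cl_eq_iff[OF g(1) f] g(2) by simp
  then have "mul (-1) (g \<ominus>\<^bsub>A (n + 1)\<^esub> f) (w i) \<in> BE n" by (rule BE_mul_w[OF _ n i])
  moreover have "mul (-1) (g \<ominus>\<^bsub>A (n + 1)\<^esub> f) (w i) = mul (-1) g (w i) \<ominus>\<^bsub>A n\<^esub> mul (-1) f (w i)"
    using module_hom_minus[OF A_module A_module B.mu_l[OF w(1)[OF i], of "n + 1"] ZE_A[OF g(1)] ZE_A[OF f]]
    by simp
  ultimately have "clE n (mul (-1) g (w i)) = clE n (mul (-1) f (w i))"
    using Q.E.cl_eq_iff[OF ZE_mul_w[OF g(1) n i] ZE_mul_w[OF f n i]] by simp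
  then show ?thesis by (simp add: rcE_def g_def)
qed

lemma rcE_hom:
  assumes n: "n \<ge> 0" and i: "i < e"
  shows "rcE i n \<in> module_hom (R Quot m) (acomp EE (n + 1)) (acomp EE n)"
proof (intro module_homI)
  fix a assume "a \<in> carrier (acomp EE (n + 1))"
  then obtain f where f: "f \<in> ZE (n + 1)" "a = clE (n + 1) f" by (elim Q.E.cl_cases)
  note fw = ZE_mul_w[OF f(1) n i]
  note h = B.mu_l[OF w(1)[OF i], of "n + 1"]
  show "rcE i n a \<in> carrier (acomp EE n)"
    unfolding f(2) rcE_cl[OF f(1) n i] by (rule Q.E.cl_closed[OF fw])
  {
    fix k assume "k \<in> carrier (R Quot m)"
    then obtain r where r: "r \<in> carrier R" "k = m +>\<^bsub>R\<^esub> r" by (elim Q.E.pi_cases)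
    have e: "mul (-1) (r \<odot>\<^bsub>A (n + 1)\<^esub> f) (w i) = r \<odot>\<^bsub>A n\<^esub> mul (-1) f (w i)"
      using module_homD(3)[OF h r(1) ZE_A[OF f(1)]] by simp
    show "rcE i n (k \<odot>\<^bsub>acomp EE (n + 1)\<^esub> a) = k \<odot>\<^bsub>acomp EE n\<^esub> rcE i n a"
      unfolding f(2) r(2) Q.E.cl_smult[OF r(1) f(1), symmetric] rcE_cl[OF f(1) n i]
        rcE_cl[OF Q.E.Z_smult[OF r(1) f(1)] n i] e Q.E.cl_smult[OF r(1) fw] ..
  }
  fix b assume "b \<in> carrier (acomp EE (n + 1))"
  then obtain g where g: "g \<in> ZE (n + 1)" "b = clE (n + 1) g" by (elim Q.E.cl_cases)
  note gw = ZE_mul_w[OF g(1) n i]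
  have e: "mul (-1) (f \<oplus>\<^bsub>A (n + 1)\<^esub> g) (w i) = mul (-1) f (w i) \<oplus>\<^bsub>A n\<^esub> mul (-1) g (w i)"
    using module_homD(2)[OF h ZE_A[OF f(1)] ZE_A[OF g(1)]] by simp
  show "rcE i n (a \<oplus>\<^bsub>acomp EE (n + 1)\<^esub> b) = rcE i n a \<oplus>\<^bsub>acomp EE n\<^esub> rcE i n b"
    unfolding f(2) g(2) Q.E.cl_add[OF f(1) g(1), symmetric] rcE_cl[OF f(1) n i] rcE_cl[OF g(1) n i]
      rcE_cl[OF Q.E.Z_add[OF f(1) g(1)] n i] e Q.E.cl_add[OF fw gw] ..
qed

text \<open>Associativity on cochains gives (b v_j) w_i = b (v_j w_i), and \<open>v_w\<close>
  evaluates the second factor up to a coboundary, which remains one after multiplication by a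
  cocycle.\<close>

lemma rcE_v:
  assumes n: "n \<ge> 0" and i: "i < e" and j: "j < e" and b: "b \<in> carrier (acomp EE n)"
  shows "rcE i n (amult EE n 1 b (vE j)) = (if i = j then b else \<zero>\<^bsub>acomp EE n\<^esub>)"
proof -
  obtain f where f: "f \<in> ZE n" "b = clE n f" using b by (elim Q.E.cl_cases)
  let ?I = "if i = j then idA else \<zero>\<^bsub>A 0\<^esub>"
  have fA: "f \<in> AC n" by (rule ZE_A[OF f(1)])
  have IA: "?I \<in> AC 0" by auto
  have vwA: "mul (-1) (v j) (w i) \<in> AC 0"
    using mul_closed[OF ZE_A[OF v(1)[OF j]] w(1)[OF i]] by simp
  have fv: "mul 1 f (v j) \<in> ZE (n + 1)" by (rule ZE_mul[OF f(1) v(1)[OF j]])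
  have "rcE i n (amult EE n 1 b (vE j)) = clE n (mul (-1) (mul 1 f (v j)) (w i))"
    unfolding f(2) vE_def Q.E.cl_mult[OF f(1) v(1)[OF j], symmetric] by (rule rcE_cl[OF fv n i])
  also have "mul (-1) (mul 1 f (v j)) (w i) = mul 0 f (mul (-1) (v j) (w i))"
    using B.mu_assoc[OF fA ZE_A[OF v(1)[OF j]] w(1)[OF i]] by simp
  finally have 1: "rcE i n (amult EE n 1 b (vE j)) = clE n (mul 0 f (mul (-1) (v j) (w i)))" .
  have "mul 0 f (mul (-1) (v j) (w i) \<ominus>\<^bsub>A 0\<^esub> ?I) \<in> BE n"
    using BE_mul_r[OF f(1) v_w[OF i j]] by simp
  also have "mul 0 f (mul (-1) (v j) (w i) \<ominus>\<^bsub>A 0\<^esub> ?I) = mul 0 f (mul (-1) (v j) (w i)) \<ominus>\<^bsub>A n\<^esub> mul 0 f ?I"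
    using module_hom_minus[OF A_module A_module B.mu_r[OF fA, of 0] vwA IA] by simp
  also have "mul 0 f ?I = (if i = j then f else \<zero>\<^bsub>A n\<^esub>)"
    using B.mu_u_r[OF fA] mul_zero_r[OF fA, of 0] by simp
  finally have 2: "mul 0 f (mul (-1) (v j) (w i)) \<ominus>\<^bsub>A n\<^esub> (if i = j then f else \<zero>\<^bsub>A n\<^esub>) \<in> BE n" .
  have "mul 0 f (mul (-1) (v j) (w i)) \<in> ZE n"
    using ZE_mul[OF f(1), of "mul (-1) (v j) (w i)" 0] ZE_mul_w[of "v j" 0 i] v(1)[OF j] i by simp
  then have "clE n (mul 0 f (mul (-1) (v j) (w i))) = clE n (if i = j then f else \<zero>\<^bsub>A n\<^esub>)"
    using Q.E.cl_eq_iff[of "mul 0 f (mul (-1) (v j) (w i))" n "if i = j then f else \<zero>\<^bsub>A n\<^esub>"] 2 f(1) Q.E.Z_zero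
    by simp
  then show ?thesis unfolding 1 using f(2) Q.E.cl_zero by simp
qed

text \<open>Re-bracketing serves both algebras: multiplication by \<open>W\<close> on the right
  expands elements of Ext in the v_i, and on the left it expands elements of stable Ext in the
  w_i.\<close>

lemma W_alpha:
  assumes f: "f \<in> AC n"
  shows "mul 0 f W \<in> AC n"
    and "mul 0 f W = finsum (A n) (\<lambda>i. mul 1 (mul (-1) f (w i)) (v i)) {..<e}"
    and "mul n W f \<in> AC n"
    and "mul n W f = finsum (A n) (\<lambda>i. mul (1 + n) (w i) (mul n (v i) f)) {..<e}"
proof -
  show "mul 0 f W \<in> AC n" using mul_closed[OF f W_closed] by simp
  show "mul n W f \<in> AC n" using mul_closed[OF W_closed f] by simp
  have "mul 0 f W = finsum (A (n + 0)) (\<lambda>i. mul 0 f (mul 1 (w i) (v i))) {..<e}"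
    unfolding W_def by (rule module_hom_finsum[OF A_module A_module B.mu_r[OF f]]) (auto intro: wv_closed)
  also have "\<dots> = finsum (A (n + 0)) (\<lambda>i. mul 1 (mul (-1) f (w i)) (v i)) {..<e}"
  proof (rule A.M.finsum_cong')
    fix i assume "i \<in> {..<e}"
    then have i: "i < e" by simp
    show "mul 0 f (mul 1 (w i) (v i)) = mul 1 (mul (-1) f (w i)) (v i)"
      using B.mu_assoc[OF f w(1)[OF i] ZE_A[OF v(1)[OF i]]] by simp
  next
    show "(\<lambda>i. mul 1 (mul (-1) f (w i)) (v i)) \<in> {..<e} \<rightarrow> AC (n + 0)"
    proof
      fix i assume "i \<in> {..<e}"
      then have i: "i < e" by simp
      show "mul 1 (mul (-1) f (w i)) (v i) \<in> AC (n + 0)"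
        using mul_closed[OF mul_closed[OF f w(1)[OF i]] ZE_A[OF v(1)[OF i]]] by simp
    qed
  qed simp
  finally show "mul 0 f W = finsum (A n) (\<lambda>i. mul 1 (mul (-1) f (w i)) (v i)) {..<e}" by simp
  have "mul n W f = finsum (A (0 + n)) (\<lambda>i. mul n (mul 1 (w i) (v i)) f) {..<e}"
    unfolding W_def by (rule module_hom_finsum[OF A_module A_module B.mu_l[OF f]]) (auto intro: wv_closed)
  also have "\<dots> = finsum (A (0 + n)) (\<lambda>i. mul (1 + n) (w i) (mul n (v i) f)) {..<e}"
  proof (rule A.M.finsum_cong')
    fix i assume "i \<in> {..<e}"
    then have i: "i < e" by simp
    show "mul n (mul 1 (w i) (v i)) f = mul (1 + n) (w i) (mul n (v i) f)"
      using B.mu_assoc[OF w(1)[OF i] ZE_A[OF v(1)[OF i]] f] by simp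
  next
    show "(\<lambda>i. mul (1 + n) (w i) (mul n (v i) f)) \<in> {..<e} \<rightarrow> AC (0 + n)"
    proof
      fix i assume "i \<in> {..<e}"
      then have i: "i < e" by simp
      show "mul (1 + n) (w i) (mul n (v i) f) \<in> AC (0 + n)"
        using mul_closed[OF w(1)[OF i] mul_closed[OF ZE_A[OF v(1)[OF i]] f]] by simp
    qed
  qed simp
  finally show "mul n W f = finsum (A n) (\<lambda>i. mul (1 + n) (w i) (mul n (v i) f)) {..<e}" by simp
qed

text \<open>A cocycle of degree \<open>n + 1\<close> is unaffected by homological degree 0, so f (1
  - W) equals f D h in every component that can be nonzero. This is a coboundary, and f W is the
  expansion in the v_i.\<close>

lemma rcE_sum:
  assumes n: "n \<ge> 0" and a: "a \<in> carrier (acomp EE (n + 1))"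
  shows "a = finsum (acomp EE (n + 1)) (\<lambda>i. amult EE n 1 (rcE i n a) (vE i)) {..<e}"
proof -
  obtain f where f: "f \<in> ZE (n + 1)" "a = clE (n + 1) f" using a by (elim Q.E.cl_cases)
  have fA: "f \<in> AC (n + 1)" by (rule ZE_A[OF f(1)])
  obtain h where h: "h \<in> AC (-1)"
    "\<And>k x. k > 0 \<Longrightarrow> x \<in> FC k \<Longrightarrow> D (-1) h k x = (idA \<ominus>\<^bsub>A 0\<^esub> W) k x"
    using h_ex by blast
  have DhA: "D (-1) h \<in> AC 0" using D_closed[OF h(1)] by simp
  have al: "idA \<ominus>\<^bsub>A 0\<^esub> W \<in> AC 0" using W_closed by simp
  have mW: "mul 0 f (idA \<ominus>\<^bsub>A 0\<^esub> W) = f \<ominus>\<^bsub>A (n + 1)\<^esub> mul 0 f W"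
    using module_hom_minus[OF A_module A_module B.mu_r[OF fA, of 0] idA_closed W_closed] B.mu_u_r[OF fA] by simp
  have "mul 0 f (idA \<ominus>\<^bsub>A 0\<^esub> W) = mul 0 f (D (-1) h)"
  proof (rule A_eqI'[of _ "n + 1"])
    fix k x assume "k \<ge> 0" "k \<ge> n + 1" and x: "x \<in> FC k"
    then have "k > 0" using n by simp
    then show "mul 0 f (idA \<ominus>\<^bsub>A 0\<^esub> W) k x = mul 0 f (D (-1) h) k x"
      using h(2)[OF _ x] x by (simp add: compose_eq)
  qed (use mul_closed[OF fA al] mul_closed[OF fA DhA] in simp_all)
  also have "\<dots> \<in> BE (n + 1)"
    using BE_mul_r[OF f(1), of "D (-1) h" 0] BE_I[OF h(1), of 0] by simp
  finally have 1: "f \<ominus>\<^bsub>A (n + 1)\<^esub> mul 0 f W \<in> BE (n + 1)" unfolding mW .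
  have tm: "mul 1 (mul (-1) f (w i)) (v i) \<in> ZE (n + 1)"
    "clE (n + 1) (mul 1 (mul (-1) f (w i)) (v i)) = amult EE n 1 (rcE i n a) (vE i)" if i: "i < e" for i
  proof -
    have fw: "mul (-1) f (w i) \<in> ZE n" by (rule ZE_mul_w[OF f(1) n i])
    show "mul 1 (mul (-1) f (w i)) (v i) \<in> ZE (n + 1)" by (rule ZE_mul[OF fw v(1)[OF i]])
    show "clE (n + 1) (mul 1 (mul (-1) f (w i)) (v i)) = amult EE n 1 (rcE i n a) (vE i)"
      unfolding f(2) rcE_cl[OF f(1) n i] vE_def by (rule Q.E.cl_mult[OF fw v(1)[OF i]])
  qed
  have tm': "(\<lambda>i. mul 1 (mul (-1) f (w i)) (v i)) \<in> {..<e} \<rightarrow> ZE (n + 1)"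
  proof
    fix i assume "i \<in> {..<e}"
    then have "i < e" by simp
    then show "mul 1 (mul (-1) f (w i)) (v i) \<in> ZE (n + 1)" by (rule tm(1))
  qed
  have WZ: "mul 0 f W \<in> ZE (n + 1)"
    unfolding W_alpha(2)[OF fA] using Q.E.cl_finsum(1)[OF _ tm'] by simp
  have "a = clE (n + 1) (mul 0 f W)"
    unfolding f(2) using Q.E.cl_eq_iff[OF f(1) WZ] 1 by simp
  also have "\<dots> = finsum (acomp EE (n + 1)) (\<lambda>i. clE (n + 1) (mul 1 (mul (-1) f (w i)) (v i))) {..<e}"
    unfolding W_alpha(2)[OF fA] using Q.E.cl_finsum(2)[OF _ tm'] by simp
  also have "\<dots> = finsum (acomp EE (n + 1)) (\<lambda>i. amult EE n 1 (rcE i n a) (vE i)) {..<e}"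
  proof (rule Q.E.A.M.finsum_cong')
    show "(\<lambda>i. amult EE n 1 (rcE i n a) (vE i)) \<in> {..<e} \<rightarrow> carrier (acomp EE (n + 1))"
    proof
      fix i assume "i \<in> {..<e}"
      then have "i < e" by simp
      from Q.E.cl_closed[OF tm(1)[OF this]] show "amult EE n 1 (rcE i n a) (vE i) \<in> carrier (acomp EE (n + 1))"
        unfolding tm(2)[OF \<open>i < e\<close>] .
    qed
    show "clE (n + 1) (mul 1 (mul (-1) f (w i)) (v i)) = amult EE n 1 (rcE i n a) (vE i)" if "i \<in> {..<e}" for i
      using that by (intro tm(2)) simp
  qed simp
  finally show ?thesis .
qed

section \<open>Stable Ext: inverting the v and eventual behaviour\<close>

definition wS :: "nat \<Rightarrow> int \<Rightarrow> (int \<Rightarrow> 'b \<Rightarrow> 'b) set set \<Rightarrow> (int \<Rightarrow> 'b \<Rightarrow> 'b) set set" where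
  "wS i n s = amult SS (-1) (1 + n) (clS (-1) (w i)) s"

lemma io_vE: "i < e \<Longrightarrow> io 1 (vE i) = clS 1 (v i)"
  unfolding vE_def by (rule Q.iota[OF v(1)])

lemma wS_hom:
  assumes "i < e"
  shows "wS i n \<in> module_hom (R Quot m) (acomp SS (1 + n)) (acomp SS n)"
  using Q.S.amult_r[OF Q.S.cl_closed[OF w_ZS[OF assms]], of "1 + n"] by (simp add: wS_def[abs_def])

text \<open>The same associativity as in Ext; the relation \<open>v_w\<close> holds modulo honest
  coboundaries, so it persists modulo the larger \<open>BS\<close>.\<close>

lemma wS_v:
  assumes i: "i < e" and j: "j < e" and s: "s \<in> carrier (acomp SS (1 + n))"
  shows "amult SS 1 n (io 1 (vE j)) (wS i n s) = (if i = j then s else \<zero>\<^bsub>acomp SS (1 + n)\<^esub>)"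
proof -
  obtain z where z: "z \<in> ZS (1 + n)" "s = clS (1 + n) z" using s by (elim Q.S.cl_cases)
  have zA: "z \<in> AC (1 + n)" by (rule ZS_A[OF z(1)])
  let ?I = "if i = j then idA else \<zero>\<^bsub>A 0\<^esub>"
  note vS = ZE_ZS[OF v(1)[OF j]] and wZ = w_ZS[OF i]
  have wz: "mul (1 + n) (w i) z \<in> ZS n" using ZS_mul[OF wZ z(1)] by simp
  have vw: "mul (-1) (v j) (w i) \<in> ZS 0" using ZS_mul[OF vS wZ] by simp
  have IA: "?I \<in> AC 0" by auto
  have vwz: "mul (1 + n) (mul (-1) (v j) (w i)) z \<in> ZS (1 + n)" using ZS_mul[OF vw z(1)] by simp
  have "wS i n s = clS n (mul (1 + n) (w i) z)"
    unfolding wS_def z(2) using Q.S.cl_mult[OF wZ z(1)] by simp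
  then have "amult SS 1 n (io 1 (vE j)) (wS i n s) = clS (1 + n) (mul n (v j) (mul (1 + n) (w i) z))"
    unfolding io_vE[OF j] using Q.S.cl_mult[OF vS wz] by simp
  also have "mul n (v j) (mul (1 + n) (w i) z) = mul (1 + n) (mul (-1) (v j) (w i)) z"
    using B.mu_assoc[OF ZE_A[OF v(1)[OF j]] w(1)[OF i] zA] by simp
  also have "clS (1 + n) \<dots> = clS (1 + n) (if i = j then z else \<zero>\<^bsub>A (1 + n)\<^esub>)"
  proof -
    have "mul (1 + n) (mul (-1) (v j) (w i) \<ominus>\<^bsub>A 0\<^esub> ?I) z \<in> BS (1 + n)"
      using BS_mul_l[OF BE_BS[OF v_w[OF i j]] z(1)] by simp
    also have "mul (1 + n) (mul (-1) (v j) (w i) \<ominus>\<^bsub>A 0\<^esub> ?I) z =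
        mul (1 + n) (mul (-1) (v j) (w i)) z \<ominus>\<^bsub>A (1 + n)\<^esub> mul (1 + n) ?I z"
      using module_hom_minus[OF A_module A_module B.mu_l[OF zA, of 0] ZS_A[OF vw] IA] by simp
    also have "mul (1 + n) ?I z = (if i = j then z else \<zero>\<^bsub>A (1 + n)\<^esub>)"
      using B.mu_u_l[OF zA] mul_zero_l[OF zA, of 0] by simp
    finally show ?thesis
      using Q.S.cl_eq_iff[OF vwz, of "if i = j then z else \<zero>\<^bsub>A (1 + n)\<^esub>"] z(1) Q.S.Z_zero by simp
  qed
  finally show ?thesis using z(2) Q.S.cl_zero by simp
qed

text \<open>1 - W and D h agree in positive homological degrees, hence differ by a bounded map, and
  W represents 1 in stable Ext. No condition on the degree remains.\<close>

lemma wS_sum: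
  assumes s: "s \<in> carrier (acomp SS n)"
  shows "s = finsum (acomp SS n) (\<lambda>i. wS i n (amult SS 1 n (io 1 (vE i)) s)) {..<e}"
proof -
  obtain z where z: "z \<in> ZS n" "s = clS n z" using s by (elim Q.S.cl_cases)
  have zA: "z \<in> AC n" by (rule ZS_A[OF z(1)])
  obtain h where h: "h \<in> AC (-1)"
    "\<And>k x. k > 0 \<Longrightarrow> x \<in> FC k \<Longrightarrow> D (-1) h k x = (idA \<ominus>\<^bsub>A 0\<^esub> W) k x"
    using h_ex by blast
  have DhA: "D (-1) h \<in> AC 0" using D_closed[OF h(1)] by simp
  have al: "idA \<ominus>\<^bsub>A 0\<^esub> W \<in> AC 0" using W_closed by simp
  have "(idA \<ominus>\<^bsub>A 0\<^esub> W) \<ominus>\<^bsub>A 0\<^esub> D (-1) h \<in> bd 0"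
    unfolding bd_iff
  proof (intro conjI exI[of _ 1] allI impI ballI)
    fix k :: int and x assume "1 \<le> k" and x: "x \<in> FC k"
    then show "((idA \<ominus>\<^bsub>A 0\<^esub> W) \<ominus>\<^bsub>A 0\<^esub> D (-1) h) k x = \<zero>\<^bsub>F (k - 0)\<^esub>"
      using A_minus[OF al DhA x] h(2)[of k x] A_closed[OF al x] by (simp add: F.M.minus_eq_zero_iff)
  qed (use al DhA in simp)
  then have "idA \<ominus>\<^bsub>A 0\<^esub> W \<in> BS 0" unfolding BS_def using al h(1) by auto
  then have "mul n (idA \<ominus>\<^bsub>A 0\<^esub> W) z \<in> BS n" using BS_mul_l[OF _ z(1), of "idA \<ominus>\<^bsub>A 0\<^esub> W" 0] by simp
  also have "mul n (idA \<ominus>\<^bsub>A 0\<^esub> W) z = z \<ominus>\<^bsub>A n\<^esub> mul n W z"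
    using module_hom_minus[OF A_module A_module B.mu_l[OF zA, of 0] idA_closed W_closed] B.mu_u_l[OF zA] by simp
  finally have 1: "z \<ominus>\<^bsub>A n\<^esub> mul n W z \<in> BS n" .
  have tm: "mul (1 + n) (w i) (mul n (v i) z) \<in> ZS n"
    "clS n (mul (1 + n) (w i) (mul n (v i) z)) = wS i n (amult SS 1 n (io 1 (vE i)) s)" if i: "i < e" for i
  proof -
    note vS = ZE_ZS[OF v(1)[OF i]]
    have vz: "mul n (v i) z \<in> ZS (1 + n)" by (rule ZS_mul[OF vS z(1)])
    show "mul (1 + n) (w i) (mul n (v i) z) \<in> ZS n" using ZS_mul[OF w_ZS[OF i] vz] by simp
    show "clS n (mul (1 + n) (w i) (mul n (v i) z)) = wS i n (amult SS 1 n (io 1 (vE i)) s)"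
      unfolding z(2) io_vE[OF i] wS_def Q.S.cl_mult[OF vS z(1), symmetric]
      using Q.S.cl_mult[OF w_ZS[OF i] vz] by simp
  qed
  have tm': "(\<lambda>i. mul (1 + n) (w i) (mul n (v i) z)) \<in> {..<e} \<rightarrow> ZS n"
  proof
    fix i assume "i \<in> {..<e}"
    then have "i < e" by simp
    then show "mul (1 + n) (w i) (mul n (v i) z) \<in> ZS n" by (rule tm(1))
  qed
  have WZ: "mul n W z \<in> ZS n"
    unfolding W_alpha(4)[OF zA] using Q.S.cl_finsum(1)[OF _ tm'] by simp
  have "s = clS n (mul n W z)"
    unfolding z(2) using Q.S.cl_eq_iff[OF z(1) WZ] 1 by simp
  also have "\<dots> = finsum (acomp SS n) (\<lambda>i. clS n (mul (1 + n) (w i) (mul n (v i) z))) {..<e}"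
    unfolding W_alpha(4)[OF zA] using Q.S.cl_finsum(2)[OF _ tm'] by simp
  also have "\<dots> = finsum (acomp SS n) (\<lambda>i. wS i n (amult SS 1 n (io 1 (vE i)) s)) {..<e}"
  proof (rule Q.S.A.M.finsum_cong')
    show "(\<lambda>i. wS i n (amult SS 1 n (io 1 (vE i)) s)) \<in> {..<e} \<rightarrow> carrier (acomp SS n)"
    proof
      fix i assume "i \<in> {..<e}"
      then have "i < e" by simp
      from Q.S.cl_closed[OF tm(1)[OF this]] show "wS i n (amult SS 1 n (io 1 (vE i)) s) \<in> carrier (acomp SS n)"
        unfolding tm(2)[OF \<open>i < e\<close>] .
    qed
    show "clS n (mul (1 + n) (w i) (mul n (v i) z)) = wS i n (amult SS 1 n (io 1 (vE i)) s)" if "i \<in> {..<e}" for i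
      using that by (intro tm(2)) simp
  qed simp
  finally show ?thesis .
qed

text \<open>The boundary of a stable cocycle \<open>z\<close> vanishes beyond some \<open>N\<close>.
  Left multiplication by a cocycle of large degree \<open>k\<close> annihilates all components
  below, since they end up in negative degrees; so \<open>mul n y z\<close> is an honest
  cocycle.\<close>

lemma SS_local:
  assumes s: "s \<in> carrier (acomp SS n)"
  shows "\<exists>N. \<forall>k\<ge>N. \<forall>b\<in>carrier (acomp EE k). amult SS k n (io k b) s \<in> io (k + n) ` carrier (acomp EE (k + n))"
proof -
  obtain z where z: "z \<in> ZS n" "s = clS n z" using s by (elim Q.S.cl_cases)
  have zA: "z \<in> AC n" by (rule ZS_A[OF z(1)])
  obtain N where N: "\<And>i x. i \<ge> N \<Longrightarrow> x \<in> FC i \<Longrightarrow> D n z i x = \<zero>\<^bsub>F (i - (n + 1))\<^esub>"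
    using z(1) unfolding ZS_def bd_iff by auto
  have "amult SS k n (io k b) s \<in> io (k + n) ` carrier (acomp EE (k + n))"
    if k: "k \<ge> N - n" and b: "b \<in> carrier (acomp EE k)" for k b
  proof -
    obtain y where y: "y \<in> ZE k" "b = clE k y" using b by (elim Q.E.cl_cases)
    have yA: "y \<in> AC k" by (rule ZE_A[OF y(1)])
    have "mul n y z \<in> ZE (k + n)"
    proof (rule ZE_I[OF mul_closed[OF yA zA]])
      fix i x assume i: "i \<ge> k + n + 1" and x: "x \<in> FC i"
      have eq: "i - n - 1 = i - (n + 1)" "i - n - k - 1 = i - (k + n) - 1" by simp_all
      have zx: "z i x \<in> FC (i - n)" by (rule A_closed[OF zA x])
      have "y (i - n - 1) (D n z i x) = \<zero>\<^bsub>F (i - (n + 1) - k)\<^esub>"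
        using N[of i x] i k x module_hom_zero[OF F_module F_module A_hom[OF yA, of "i - (n + 1)"]]
        by (simp only: eq)
      then have "sgn_act (F (i - n - k - 1)) k (y (i - n - 1) (D n z i x)) = \<zero>\<^bsub>F (i - n - k - 1)\<^esub>"
        by (simp add: sgn_act_zero[OF F_module] algebra_simps)
      then show "D (k + n) (mul n y z) i x = \<zero>\<^bsub>F (i - (k + n) - 1)\<^esub>"
        using Leibniz[OF yA zA x] ZE_D[OF y(1) zx] unfolding eq by simp
    qed
    from this have mz: "mul n y z \<in> ZE (k + n)" .
    have 1: "clE (k + n) (mul n y z) \<in> carrier (acomp EE (k + n))"
      and 2: "io (k + n) (clE (k + n) (mul n y z)) = clS (k + n) (mul n y z)"
      using Q.E.cl_closed[OF mz] Q.iota[OF mz] by simp_all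
    have "amult SS k n (io k b) s = clS (k + n) (mul n y z)"
      unfolding y(2) z(2) Q.iota[OF y(1)] using Q.S.cl_mult[OF ZE_ZS[OF y(1)] z(1)] by simp
    then have "amult SS k n (io k b) s = io (k + n) (clE (k + n) (mul n y z))" using 2 by simp
    then show ?thesis using 1 by (rule image_eqI)
  qed
  then show ?thesis by blast
qed

text \<open>A cocycle that is stably trivial differs from a coboundary by a bounded map, and left
  factors of large degree annihilate that map.\<close>

lemma io_kernel:
  assumes a: "a \<in> carrier (acomp EE n)" and "io n a = \<zero>\<^bsub>acomp SS n\<^esub>"
  shows "\<exists>N. \<forall>k\<ge>N. \<forall>b\<in>carrier (acomp EE k). amult EE k n b a = \<zero>\<^bsub>acomp EE (k + n)\<^esub>"
proof -
  obtain z where z: "z \<in> ZE n" "a = clE n z" using a by (elim Q.E.cl_cases)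
  have zA: "z \<in> AC n" by (rule ZE_A[OF z(1)])
  have "z \<in> BS n" using assms(2) Q.S.cl_ker[OF ZE_ZS[OF z(1)]] Q.iota[OF z(1)] z(2) by simp
  then obtain \<gamma> N where g: "\<gamma> \<in> AC (n - 1)"
    and N: "\<And>i x. i \<ge> N \<Longrightarrow> x \<in> FC i \<Longrightarrow> (z \<ominus>\<^bsub>A n\<^esub> D (n - 1) \<gamma>) i x = \<zero>\<^bsub>F (i - n)\<^esub>"
    unfolding BS_def bd_iff by blast
  have DA: "D (n - 1) \<gamma> \<in> AC n" using g by auto
  have "amult EE k n b a = \<zero>\<^bsub>acomp EE (k + n)\<^esub>" if k: "k \<ge> N - n" and b: "b \<in> carrier (acomp EE k)" for k b
  proof -
    obtain y where y: "y \<in> ZE k" "b = clE k y" using b by (elim Q.E.cl_cases)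
    have yA: "y \<in> AC k" by (rule ZE_A[OF y(1)])
    have "mul n y z = mul n y (D (n - 1) \<gamma>)"
    proof (rule A_eqI'[OF mul_closed[OF yA zA] mul_closed[OF yA DA]])
      fix i x assume i: "i \<ge> k + n" and x: "x \<in> FC i"
      then have "z i x = D (n - 1) \<gamma> i x"
        using N[of i x] k A_minus[OF zA DA x] A_closed[OF zA x] A_closed[OF DA x]
        by (simp add: F.M.minus_eq_zero_iff)
      then show "mul n y z i x = mul n y (D (n - 1) \<gamma>) i x" using x by (simp add: compose_eq)
    qed
    moreover have "mul n y (D (n - 1) \<gamma>) \<in> BE (k + n)"
      by (rule BE_mul_r[OF y(1) BE_I]) (use g in auto)
    ultimately have "mul n y z \<in> BE (k + n)" by simp
    moreover have "amult EE k n b a = clE (k + n) (mul n y z)"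
      unfolding y(2) z(2) using Q.E.cl_mult[OF y(1) z(1)] by simp
    ultimately show ?thesis using Q.E.cl_ker[OF ZE_mul[OF y(1) z(1)]] by simp
  qed
  then show ?thesis by blast
qed

end

section \<open>Extension of linear functionals\<close>

lemma (in module) smult_inv: "a \<in> Units R \<Longrightarrow> x \<in> carrier M \<Longrightarrow> inv\<^bsub>R\<^esub> a \<odot>\<^bsub>M\<^esub> (a \<odot>\<^bsub>M\<^esub> x) = x"
  using smult_assoc1[of "inv\<^bsub>R\<^esub> a" a x] R.Units_closed[of a] by simp

text \<open>Beyond the trivial case f = 0, a functional is determined by its kernel and one vector
  \<open>x1\<close> of value 1. A hyperplane containing the kernel but not \<open>x1\<close> is
  found by Zorn's lemma; the extension is the coordinate along \<open>x1\<close>.\<close>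

lemma functional_extension:
  fixes K :: "('k, 'r) ring_scheme" and M :: "('k, 'b) module"
  assumes K: "field K" and M: "module K M" and N: "submodule N K M"
    and f: "f \<in> module_hom K (M\<lparr>carrier := N\<rparr>) (ring_module K)"
  obtains g where "g \<in> module_hom K M (ring_module K)" "\<And>x. x \<in> N \<Longrightarrow> g x = f x"
proof -
  interpret K: field K by fact
  interpret M: module K M by fact
  have NM: "module K (M\<lparr>carrier := N\<rparr>)" by (rule submodule.submodule_is_module[OF N M])
  note f' = module_homD[OF f, simplified]
  note Nc = M.submoduleE(1)[OF N] and Nsm = M.submoduleE(4)[OF N] and Nadd = M.submoduleE(5)[OF N]
  show thesis
  proof (cases "\<forall>x\<in>N. f x = \<zero>\<^bsub>K\<^esub>")
    case True
    then show thesis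
      using that[of "\<lambda>x. \<zero>\<^bsub>K\<^esub>"] module_hom_const_zero[OF ring_module_module[OF K.is_cring], of M] by simp
  next
    case False
    then obtain x0 where x0: "x0 \<in> N" "f x0 \<noteq> \<zero>\<^bsub>K\<^esub>" by blast
    then have u: "f x0 \<in> Units K" using f'(1) K.field_Units by auto
    define x1 where "x1 = inv\<^bsub>K\<^esub> (f x0) \<odot>\<^bsub>M\<^esub> x0"
    have x1: "x1 \<in> N" "f x1 = \<one>\<^bsub>K\<^esub>"
      using x0 u f'(3)[of "inv\<^bsub>K\<^esub> (f x0)" x0] Nsm by (auto simp: x1_def)
    have x1M: "x1 \<in> carrier M" using x1 Nc by auto
    define L0 where "L0 = {x \<in> N. f x = \<zero>\<^bsub>K\<^esub>}"
    have L0: "submodule L0 K M"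
    proof (rule module_carrier_update(1)[OF M])
      have "f \<zero>\<^bsub>M\<^esub> = \<zero>\<^bsub>K\<^esub>"
        using module_hom_zero[OF NM ring_module_module[OF K.is_cring] f] by simp
      then show "\<zero>\<^bsub>M\<^esub> \<in> L0" using N by (auto simp: L0_def submodule_def dest: subgroup.one_closed)
    qed (use Nc Nsm Nadd f' in \<open>auto simp: L0_def\<close>)
    \<comment> \<open>A maximal subspace avoiding \<open>x1\<close> is a complement of the line
      through \<open>x1\<close>.\<close>
    define \<A> where "\<A> = {L. submodule L K M \<and> L0 \<subseteq> L \<and> x1 \<notin> L}"
    have "\<exists>L\<in>\<A>. \<forall>X\<in>\<A>. L \<subseteq> X \<longrightarrow> X = L"
    proof (rule subset_Zorn_nonempty)
      have "L0 \<in> \<A>" using L0 x1 by (auto simp: \<A>_def L0_def)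
      then show "\<A> \<noteq> {}" by blast
    next
      fix \<C> assume ne: "\<C> \<noteq> {}" and ch: "subset.chain \<A> \<C>"
      have sub: "submodule L K M" if "L \<in> \<C>" for L
        using ch that by (auto simp: subset_chain_def \<A>_def)
      have "submodule (\<Union>\<C>) K M"
      proof (rule module_carrier_update(1)[OF M])
        show "\<Union>\<C> \<subseteq> carrier M" using M.submoduleE(1)[OF sub] by auto
        obtain L where "L \<in> \<C>" using ne by blast
        then show "\<zero>\<^bsub>M\<^esub> \<in> \<Union>\<C>" using sub[of L] by (auto simp: submodule_def dest!: subgroup.one_closed)
        fix x y assume "x \<in> \<Union>\<C>" "y \<in> \<Union>\<C>"
        then obtain L L' where L: "L \<in> \<C>" "L' \<in> \<C>" "x \<in> L" "y \<in> L'" by auto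
        then have "L \<subseteq> L' \<or> L' \<subseteq> L" using ch by (auto simp: subset_chain_def)
        then show "x \<oplus>\<^bsub>M\<^esub> y \<in> \<Union>\<C>"
        proof
          assume "L \<subseteq> L'"
          then show ?thesis using L M.submoduleE(5)[OF sub[OF L(2)], of x y] by blast
        next
          assume "L' \<subseteq> L"
          then show ?thesis using L M.submoduleE(5)[OF sub[OF L(1)], of x y] by blast
        qed
      next
        fix r x assume "r \<in> carrier K" "x \<in> \<Union>\<C>"
        then show "r \<odot>\<^bsub>M\<^esub> x \<in> \<Union>\<C>" using M.submoduleE(4)[OF sub] by auto
      qed
      then show "\<Union>\<C> \<in> \<A>" using ch ne by (auto simp: \<A>_def subset_chain_def)
    qed
    then obtain L where LA: "L \<in> \<A>" and max: "\<And>X. X \<in> \<A> \<Longrightarrow> L \<subseteq> X \<Longrightarrow> X = L" by blast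
    have L: "submodule L K M" "L0 \<subseteq> L" "x1 \<notin> L" using LA by (auto simp: \<A>_def)
    note Lc = M.submoduleE(1)[OF L(1)] and Lneg = M.submoduleE(3)[OF L(1)]
      and Lsm = M.submoduleE(4)[OF L(1)] and Ladd = M.submoduleE(5)[OF L(1)]
    have Lz: "\<zero>\<^bsub>M\<^esub> \<in> L" using L(1) by (auto simp: submodule_def dest: subgroup.one_closed)
    have ex: "\<exists>c\<in>carrier K. \<exists>l\<in>L. y = l \<oplus>\<^bsub>M\<^esub> c \<odot>\<^bsub>M\<^esub> x1" if y: "y \<in> carrier M" for y
    proof (cases "y \<in> L")
      case True
      then show ?thesis using x1M y by (intro bexI[of _ "\<zero>\<^bsub>K\<^esub>"] bexI[of _ y]) auto
    next
      case False
      define X where "X = {l \<oplus>\<^bsub>M\<^esub> c \<odot>\<^bsub>M\<^esub> y | l c. l \<in> L \<and> c \<in> carrier K}"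
      have XI: "l \<oplus>\<^bsub>M\<^esub> c \<odot>\<^bsub>M\<^esub> y \<in> X" if "l \<in> L" "c \<in> carrier K" for l c
        using that by (auto simp: X_def)
      have "submodule X K M"
      proof (rule module_carrier_update(1)[OF M])
        show "X \<subseteq> carrier M" using Lc y by (auto simp: X_def)
        show "\<zero>\<^bsub>M\<^esub> \<in> X" using XI[OF Lz K.zero_closed] y by simp
        fix x z assume "x \<in> X" "z \<in> X"
        then obtain l c l' c' where *: "l \<in> L" "c \<in> carrier K" "x = l \<oplus>\<^bsub>M\<^esub> c \<odot>\<^bsub>M\<^esub> y"
          "l' \<in> L" "c' \<in> carrier K" "z = l' \<oplus>\<^bsub>M\<^esub> c' \<odot>\<^bsub>M\<^esub> y" by (auto simp: X_def)
        then have lM: "l \<in> carrier M" "l' \<in> carrier M" using Lc by auto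
        have "x \<oplus>\<^bsub>M\<^esub> z = (l \<oplus>\<^bsub>M\<^esub> l') \<oplus>\<^bsub>M\<^esub> (c \<oplus>\<^bsub>K\<^esub> c') \<odot>\<^bsub>M\<^esub> y"
          using * lM y by (simp add: M.smult_l_distr M.M.a_ac)
        then show "x \<oplus>\<^bsub>M\<^esub> z \<in> X" using XI[OF Ladd[OF *(1,4)], of "c \<oplus>\<^bsub>K\<^esub> c'"] * by simp
      next
        fix r x assume r: "r \<in> carrier K" and "x \<in> X"
        then obtain l c where *: "l \<in> L" "c \<in> carrier K" "x = l \<oplus>\<^bsub>M\<^esub> c \<odot>\<^bsub>M\<^esub> y" by (auto simp: X_def)
        then have lM: "l \<in> carrier M" using Lc by auto
        have "r \<odot>\<^bsub>M\<^esub> x = r \<odot>\<^bsub>M\<^esub> l \<oplus>\<^bsub>M\<^esub> (r \<otimes>\<^bsub>K\<^esub> c) \<odot>\<^bsub>M\<^esub> y"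
          using * lM y r by (simp add: M.smult_r_distr M.smult_assoc1)
        then show "r \<odot>\<^bsub>M\<^esub> x \<in> X" using XI[OF Lsm[OF r *(1)], of "r \<otimes>\<^bsub>K\<^esub> c"] * r by simp
      qed
      moreover have "L \<subseteq> X"
      proof
        fix l assume l: "l \<in> L"
        then have "l \<in> carrier M" using Lc by auto
        then show "l \<in> X" using XI[OF l K.zero_closed] y by simp
      qed
      moreover have "X \<noteq> L"
      proof -
        have "y \<in> X" using XI[OF Lz K.one_closed] y by simp
        then show ?thesis using False by blast
      qed
      \<comment> \<open>Adjoining \<open>y\<close> to the maximal \<open>L\<close> captures
        \<open>x1\<close>. Its coefficient of \<open>y\<close> is nonzero because \<open>x1\<close>
        is not in \<open>L\<close>, so \<open>y\<close> can be solved for.\<close>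
      ultimately have "x1 \<in> X" using max[of X] L(2) by (auto simp: \<A>_def)
      then obtain l c where *: "l \<in> L" "c \<in> carrier K" "x1 = l \<oplus>\<^bsub>M\<^esub> c \<odot>\<^bsub>M\<^esub> y" by (auto simp: X_def)
      have lM: "l \<in> carrier M" using * Lc by auto
      have "c \<noteq> \<zero>\<^bsub>K\<^esub>" using * L(3) y lM by auto
      then have c: "c \<in> Units K" using * K.field_Units by simp
      have "inv\<^bsub>K\<^esub> c \<odot>\<^bsub>M\<^esub> x1 = inv\<^bsub>K\<^esub> c \<odot>\<^bsub>M\<^esub> l \<oplus>\<^bsub>M\<^esub> y"
        unfolding *(3) using * lM y c by (simp add: M.smult_r_distr M.smult_inv)
      then have "\<ominus>\<^bsub>M\<^esub> (inv\<^bsub>K\<^esub> c \<odot>\<^bsub>M\<^esub> l) \<oplus>\<^bsub>M\<^esub> inv\<^bsub>K\<^esub> c \<odot>\<^bsub>M\<^esub> x1 = y"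
        using c y lM by (simp add: M.M.r_neg1)
      moreover have "\<ominus>\<^bsub>M\<^esub> (inv\<^bsub>K\<^esub> c \<odot>\<^bsub>M\<^esub> l) \<in> L" using c by (intro Lneg Lsm *(1)) simp
      ultimately show ?thesis using c
        by (intro bexI[of _ "inv\<^bsub>K\<^esub> c"] bexI[of _ "\<ominus>\<^bsub>M\<^esub> (inv\<^bsub>K\<^esub> c \<odot>\<^bsub>M\<^esub> l)"]) simp_all
    qed
    have uniq: "c = c'"
      if c: "c \<in> carrier K" "c' \<in> carrier K" and l: "l \<in> L" "l' \<in> L"
        and eq: "l \<oplus>\<^bsub>M\<^esub> c \<odot>\<^bsub>M\<^esub> x1 = l' \<oplus>\<^bsub>M\<^esub> c' \<odot>\<^bsub>M\<^esub> x1" for c c' l l'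
    proof (rule ccontr)
      assume ne: "c \<noteq> c'"
      have lM: "l \<in> carrier M" "l' \<in> carrier M" using l Lc by auto
      define a where "a = c \<ominus>\<^bsub>K\<^esub> c'"
      have "a \<noteq> \<zero>\<^bsub>K\<^esub>" using ne c K.minus_eq_zero_iff unfolding a_def by simp
      then have a: "a \<in> Units K" using c K.field_Units by (simp add: a_def)
      have "c \<odot>\<^bsub>M\<^esub> x1 = \<ominus>\<^bsub>M\<^esub> l \<oplus>\<^bsub>M\<^esub> (l' \<oplus>\<^bsub>M\<^esub> c' \<odot>\<^bsub>M\<^esub> x1)"
        using eq[symmetric] c lM x1M by (simp add: M.M.r_neg1)
      then have "a \<odot>\<^bsub>M\<^esub> x1 = (\<ominus>\<^bsub>M\<^esub> l \<oplus>\<^bsub>M\<^esub> (l' \<oplus>\<^bsub>M\<^esub> c' \<odot>\<^bsub>M\<^esub> x1)) \<oplus>\<^bsub>M\<^esub> \<ominus>\<^bsub>M\<^esub> (c' \<odot>\<^bsub>M\<^esub> x1)"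
        using c x1M by (simp add: a_def a_minus_def M.smult_l_distr M.smult_l_minus)
      also have "\<dots> = \<ominus>\<^bsub>M\<^esub> l \<oplus>\<^bsub>M\<^esub> l'"
        using c x1M lM by (simp add: M.M.a_assoc M.M.r_neg)
      finally have "a \<odot>\<^bsub>M\<^esub> x1 \<in> L" using Lneg Ladd l by simp
      then have "inv\<^bsub>K\<^esub> a \<odot>\<^bsub>M\<^esub> (a \<odot>\<^bsub>M\<^esub> x1) \<in> L" using Lsm a by blast
      then show False using M.smult_inv[OF a x1M] L(3) by simp
    qed
    define g where "g y = (THE c. c \<in> carrier K \<and> (\<exists>l\<in>L. y = l \<oplus>\<^bsub>M\<^esub> c \<odot>\<^bsub>M\<^esub> x1))" for y
    have g: "g y = c" if "c \<in> carrier K" "l \<in> L" "y = l \<oplus>\<^bsub>M\<^esub> c \<odot>\<^bsub>M\<^esub> x1" for y c l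
      unfolding g_def using that uniq by (intro the_equality) blast+
    have "g \<in> module_hom K M (ring_module K)"
    proof (intro module_homI)
      fix y assume "y \<in> carrier M"
      then obtain c l where cl: "c \<in> carrier K" "l \<in> L" "y = l \<oplus>\<^bsub>M\<^esub> c \<odot>\<^bsub>M\<^esub> x1" using ex by blast
      have lM: "l \<in> carrier M" using cl Lc by auto
      show "g y \<in> carrier (ring_module K)" using g[OF cl] cl by simp
      {
        fix r assume r: "r \<in> carrier K"
        have "r \<odot>\<^bsub>M\<^esub> y = r \<odot>\<^bsub>M\<^esub> l \<oplus>\<^bsub>M\<^esub> (r \<otimes>\<^bsub>K\<^esub> c) \<odot>\<^bsub>M\<^esub> x1"
          using cl lM r x1M by (simp add: M.smult_r_distr M.smult_assoc1)
        then have "g (r \<odot>\<^bsub>M\<^esub> y) = r \<otimes>\<^bsub>K\<^esub> c"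
          using g[of "r \<otimes>\<^bsub>K\<^esub> c" "r \<odot>\<^bsub>M\<^esub> l"] r cl Lsm by simp
        then show "g (r \<odot>\<^bsub>M\<^esub> y) = r \<odot>\<^bsub>ring_module K\<^esub> g y" using g[OF cl] by simp
      }
      fix z assume "z \<in> carrier M"
      then obtain c' l' where cl': "c' \<in> carrier K" "l' \<in> L" "z = l' \<oplus>\<^bsub>M\<^esub> c' \<odot>\<^bsub>M\<^esub> x1" using ex by blast
      have lM': "l' \<in> carrier M" using cl' Lc by auto
      have "y \<oplus>\<^bsub>M\<^esub> z = (l \<oplus>\<^bsub>M\<^esub> l') \<oplus>\<^bsub>M\<^esub> (c \<oplus>\<^bsub>K\<^esub> c') \<odot>\<^bsub>M\<^esub> x1"
        using cl cl' lM lM' x1M by (simp add: M.smult_l_distr M.M.a_ac)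
      then have "g (y \<oplus>\<^bsub>M\<^esub> z) = c \<oplus>\<^bsub>K\<^esub> c'"
        using g[of "c \<oplus>\<^bsub>K\<^esub> c'" "l \<oplus>\<^bsub>M\<^esub> l'"] cl cl' Ladd by simp
      then show "g (y \<oplus>\<^bsub>M\<^esub> z) = g y \<oplus>\<^bsub>ring_module K\<^esub> g z" using g[OF cl] g[OF cl'] by simp
    qed
    moreover have "g x = f x" if x: "x \<in> N" for x
    proof (rule g)
      have xM: "x \<in> carrier M" using x Nc by auto
      have fx: "f x \<in> carrier K" using f'(1) x by simp
      have n: "\<ominus>\<^bsub>K\<^esub> f x \<odot>\<^bsub>M\<^esub> x1 \<in> N" using Nsm fx x1 by simp
      show "x \<oplus>\<^bsub>M\<^esub> (\<ominus>\<^bsub>K\<^esub> f x) \<odot>\<^bsub>M\<^esub> x1 \<in> L"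
        using L(2) Nadd[OF x n] f'(2)[OF x n] f'(3)[OF _ x1(1), of "\<ominus>\<^bsub>K\<^esub> f x"] fx x1
        by (auto simp: L0_def K.r_neg)
      show "x = (x \<oplus>\<^bsub>M\<^esub> (\<ominus>\<^bsub>K\<^esub> f x) \<odot>\<^bsub>M\<^esub> x1) \<oplus>\<^bsub>M\<^esub> f x \<odot>\<^bsub>M\<^esub> x1"
        using xM x1M fx by (simp add: M.M.a_assoc M.smult_l_minus M.M.l_neg)
      show "f x \<in> carrier K" by fact
    qed
    ultimately show thesis by (rule that)
  qed
qed

section \<open>Stable cohomology as a module over a tensor algebra\<close>

text \<open>The algebraic content of the cochain computations. E is generated by the
  \<open>v i\<close>, with \<open>rc\<close> extracting right coefficients; \<open>wM\<close>
  inverts the map from M to M^e given by all \<open>v i\<close>. The last two assumptions compare M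
  with the image of E after multiplication by elements of large degree.\<close>

locale stable_pair =
  fixes K :: "('k, 'q) ring_scheme" and E :: "('k, 'e) gr_algebra" and M :: "('k, 'e, 's) gr_module"
    and io :: "int \<Rightarrow> 'e \<Rightarrow> 's" and e :: nat and v :: "nat \<Rightarrow> 'e" and rc :: "nat \<Rightarrow> int \<Rightarrow> 'e \<Rightarrow> 'e"
    and wM :: "nat \<Rightarrow> int \<Rightarrow> 's \<Rightarrow> 's"
  assumes K_field: "field K"
    and E_graded: "graded_left_module K E (regular_module E)"
    and M_graded: "graded_left_module K E M"
    and one_r: "a \<in> carrier (acomp E n) \<Longrightarrow> amult E n 0 a (aone E) = a"
    and one_closed: "aone E \<in> carrier (acomp E 0)" and one_not_zero: "aone E \<noteq> \<zero>\<^bsub>acomp E 0\<^esub>"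
    and E_neg: "n < 0 \<Longrightarrow> carrier (acomp E n) = {\<zero>\<^bsub>acomp E n\<^esub>}"
    and E_0: "a \<in> carrier (acomp E 0) \<Longrightarrow> \<exists>k\<in>carrier K. a = k \<odot>\<^bsub>acomp E 0\<^esub> aone E"
    and e_pos: "0 < e"
    and v_closed: "i < e \<Longrightarrow> v i \<in> carrier (acomp E 1)"
    and rc_hom: "n \<ge> 0 \<Longrightarrow> i < e \<Longrightarrow> rc i n \<in> module_hom K (acomp E (n + 1)) (acomp E n)"
    and rc_v: "n \<ge> 0 \<Longrightarrow> i < e \<Longrightarrow> j < e \<Longrightarrow> b \<in> carrier (acomp E n) \<Longrightarrow>
      rc i n (amult E n 1 b (v j)) = (if i = j then b else \<zero>\<^bsub>acomp E n\<^esub>)"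
    and rc_sum: "n \<ge> 0 \<Longrightarrow> a \<in> carrier (acomp E (n + 1)) \<Longrightarrow>
      a = finsum (acomp E (n + 1)) (\<lambda>i. amult E n 1 (rc i n a) (v i)) {..<e}"
    and wM_hom: "i < e \<Longrightarrow> wM i n \<in> module_hom K (mcomp M (1 + n)) (mcomp M n)"
    and wM_v: "i < e \<Longrightarrow> j < e \<Longrightarrow> s \<in> carrier (mcomp M (1 + n)) \<Longrightarrow>
      mact M 1 n (v j) (wM i n s) = (if i = j then s else \<zero>\<^bsub>mcomp M (1 + n)\<^esub>)"
    and wM_sum: "s \<in> carrier (mcomp M n) \<Longrightarrow>
      s = finsum (mcomp M n) (\<lambda>i. wM i n (mact M 1 n (v i) s)) {..<e}"
    and io_hom: "io \<in> gr_hom K E 0 (regular_module E) M"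
    and M_local: "s \<in> carrier (mcomp M n) \<Longrightarrow>
      \<exists>N. \<forall>k\<ge>N. \<forall>b\<in>carrier (acomp E k). mact M k n b s \<in> io (k + n) ` carrier (acomp E (k + n))"
    and io_kernel: "a \<in> carrier (acomp E n) \<Longrightarrow> io n a = \<zero>\<^bsub>mcomp M n\<^esub> \<Longrightarrow>
      \<exists>N. \<forall>k\<ge>N. \<forall>b\<in>carrier (acomp E k). amult E k n b a = \<zero>\<^bsub>acomp E (k + n)\<^esub>"
begin

abbreviation "EC n \<equiv> carrier (acomp E n)"

abbreviation "MC n \<equiv> carrier (mcomp M n)"

sublocale K: field K by (rule K_field)

lemma E_module: "module K (acomp E n)"
  using E_graded by (simp add: graded_left_module_def regular_module_def)

lemma M_module: "module K (mcomp M n)"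
  using M_graded by (simp add: graded_left_module_def)

sublocale E: module K "acomp E n" for n by (rule E_module)
sublocale M: module K "mcomp M n" for n by (rule M_module)

lemma Kmod: "module K (ring_module K)"
  by (rule ring_module_module[OF K.is_cring])

lemma amult_hom_r: "a \<in> EC k \<Longrightarrow> amult E k n a \<in> module_hom K (acomp E n) (acomp E (k + n))"
  and amult_hom_l: "b \<in> EC n \<Longrightarrow> (\<lambda>a. amult E k n a b) \<in> module_hom K (acomp E k) (acomp E (k + n))"
  and one_l: "a \<in> EC n \<Longrightarrow> amult E 0 n (aone E) a = a"
  and amult_assoc: "a \<in> EC l \<Longrightarrow> b \<in> EC k \<Longrightarrow> x \<in> EC n \<Longrightarrow>
    amult E (l + k) n (amult E l k a b) x = amult E l (k + n) a (amult E k n b x)"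
  using E_graded unfolding graded_left_module_def regular_module_def gr_module.simps by simp_all

lemma act_hom_r: "a \<in> EC k \<Longrightarrow> mact M k n a \<in> module_hom K (mcomp M n) (mcomp M (k + n))"
  and act_hom_l: "s \<in> MC n \<Longrightarrow> (\<lambda>a. mact M k n a s) \<in> module_hom K (acomp E k) (mcomp M (k + n))"
  and act_one: "s \<in> MC n \<Longrightarrow> mact M 0 n (aone E) s = s"
  and act_assoc: "a \<in> EC l \<Longrightarrow> b \<in> EC k \<Longrightarrow> s \<in> MC n \<Longrightarrow>
    mact M (l + k) n (amult E l k a b) s = mact M l (k + n) a (mact M k n b s)"
  using M_graded unfolding graded_left_module_def by simp_all

lemma amult_closed: "a \<in> EC k \<Longrightarrow> b \<in> EC n \<Longrightarrow> amult E k n a b \<in> EC (k + n)"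
  using module_homD(1)[OF amult_hom_r] .

lemma act_closed: "a \<in> EC k \<Longrightarrow> s \<in> MC n \<Longrightarrow> mact M k n a s \<in> MC (k + n)"
  using module_homD(1)[OF act_hom_r] .

lemma io_mhom: "io n \<in> module_hom K (acomp E n) (mcomp M n)"
  using io_hom by (simp add: gr_hom_def regular_module_def)

lemma io_closed: "a \<in> EC n \<Longrightarrow> io n a \<in> MC n"
  using module_homD(1)[OF io_mhom] .

lemma io_act: "a \<in> EC k \<Longrightarrow> b \<in> EC n \<Longrightarrow> io (k + n) (amult E k n a b) = mact M k n a (io n b)"
  using io_hom by (simp add: gr_hom_def regular_module_def)

section \<open>The isomorphisms M with M^e and E^(n+1) with (E^n)^e\<close>

lemma v_inj:
  assumes s: "s \<in> MC n" and z: "\<And>i. i < e \<Longrightarrow> mact M 1 n (v i) s = \<zero>\<^bsub>mcomp M (1 + n)\<^esub>"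
  shows "s = \<zero>\<^bsub>mcomp M n\<^esub>"
proof -
  have "s = finsum (mcomp M n) (\<lambda>i. wM i n (mact M 1 n (v i) s)) {..<e}" by (rule wM_sum[OF s])
  also have "\<dots> = finsum (mcomp M n) (\<lambda>i. \<zero>\<^bsub>mcomp M n\<^esub>) {..<e}"
  proof (rule M.M.finsum_cong')
    fix i assume "i \<in> {..<e}"
    then have i: "i < e" by simp
    show "wM i n (mact M 1 n (v i) s) = \<zero>\<^bsub>mcomp M n\<^esub>"
      unfolding z[OF i] by (rule module_hom_zero[OF M_module M_module wM_hom[OF i]])
  qed simp_all
  finally show ?thesis by simp
qed

lemma v_eq:
  assumes s: "s \<in> MC n" and t: "t \<in> MC n"
    and z: "\<And>i. i < e \<Longrightarrow> mact M 1 n (v i) s = mact M 1 n (v i) t"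
  shows "s = t"
proof -
  have "s \<ominus>\<^bsub>mcomp M n\<^esub> t = \<zero>\<^bsub>mcomp M n\<^esub>"
  proof (rule v_inj)
    fix i assume i: "i < e"
    show "mact M 1 n (v i) (s \<ominus>\<^bsub>mcomp M n\<^esub> t) = \<zero>\<^bsub>mcomp M (1 + n)\<^esub>"
      unfolding module_hom_minus[OF M_module M_module act_hom_r[OF v_closed[OF i]] s t] z[OF i]
      by (simp add: a_minus_def M.M.r_neg act_closed[OF v_closed[OF i] t])
  qed (use s t in simp)
  then show ?thesis using s t by (simp add: M.M.minus_eq_zero_iff)
qed

lemma v_surj:
  assumes t: "\<And>i. i < e \<Longrightarrow> t i \<in> MC (1 + n)"
  obtains s where "s \<in> MC n" "\<And>i. i < e \<Longrightarrow> mact M 1 n (v i) s = t i"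
proof -
  define s where "s = finsum (mcomp M n) (\<lambda>i. wM i n (t i)) {..<e}"
  have w: "(\<lambda>i. wM i n (t i)) \<in> {..<e} \<rightarrow> MC n"
  proof
    fix i assume "i \<in> {..<e}"
    then show "wM i n (t i) \<in> MC n" using module_homD(1)[OF wM_hom t] by simp
  qed
  have "mact M 1 n (v j) s = t j" if j: "j < e" for j
  proof -
    have "mact M 1 n (v j) s = finsum (mcomp M (1 + n)) (\<lambda>i. mact M 1 n (v j) (wM i n (t i))) {..<e}"
      unfolding s_def by (rule module_hom_finsum[OF M_module M_module act_hom_r[OF v_closed[OF j]] w])
    also have "\<dots> = finsum (mcomp M (1 + n)) (\<lambda>i. if j = i then t i else \<zero>\<^bsub>mcomp M (1 + n)\<^esub>) {..<e}"
    proof (rule M.M.finsum_cong')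
      show "(\<lambda>i. if j = i then t i else \<zero>\<^bsub>mcomp M (1 + n)\<^esub>) \<in> {..<e} \<rightarrow> MC (1 + n)"
        using t by (simp add: Pi_def)
      fix i assume "i \<in> {..<e}"
      then have i: "i < e" by simp
      show "mact M 1 n (v j) (wM i n (t i)) = (if j = i then t i else \<zero>\<^bsub>mcomp M (1 + n)\<^esub>)"
        unfolding wM_v[OF i j t[OF i]] by simp
    qed simp
    also have "\<dots> = t j" by (rule M.M.finsum_singleton) (use t j in \<open>simp_all add: Pi_def\<close>)
    finally show ?thesis .
  qed
  moreover have "s \<in> MC n" unfolding s_def using w by (rule M.M.finsum_closed)
  ultimately show thesis by (intro that)
qed

text \<open>By \<open>rc_sum\<close>, positive degrees of E are spanned by the products
  \<open>b v i\<close>; this replaces an explicit basis in most arguments.\<close>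

lemma span_eq:
  assumes n: "n \<ge> 0" and N: "module K N"
    and f: "f \<in> module_hom K (acomp E (n + 1)) N" and g: "g \<in> module_hom K (acomp E (n + 1)) N"
    and eq: "\<And>b i. b \<in> EC n \<Longrightarrow> i < e \<Longrightarrow> f (amult E n 1 b (v i)) = g (amult E n 1 b (v i))"
    and a: "a \<in> EC (n + 1)"
  shows "f a = g a"
proof -
  interpret N: module K N by fact
  have rcl: "rc i n a \<in> EC n" if "i < e" for i using module_homD(1)[OF rc_hom[OF n that] a] .
  have cl: "(\<lambda>i. amult E n 1 (rc i n a) (v i)) \<in> {..<e} \<rightarrow> EC (n + 1)"
    using rcl v_closed amult_closed by auto
  have "f a = finsum N (\<lambda>i. f (amult E n 1 (rc i n a) (v i))) {..<e}"
    using module_hom_finsum[OF E_module N f cl] rc_sum[OF n a] by simp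
  also have "\<dots> = finsum N (\<lambda>i. g (amult E n 1 (rc i n a) (v i))) {..<e}"
    by (rule N.M.finsum_cong') (use cl module_homD(1)[OF g] eq rcl in auto)
  also have "\<dots> = g a"
    using module_hom_finsum[OF E_module N g cl] rc_sum[OF n a] by simp
  finally show ?thesis .
qed

lemma span_mem:
  assumes n: "n \<ge> 0" and N: "module K N" and U: "submodule U K N"
    and f: "f \<in> module_hom K (acomp E (n + 1)) N"
    and eq: "\<And>b i. b \<in> EC n \<Longrightarrow> i < e \<Longrightarrow> f (amult E n 1 b (v i)) \<in> U"
    and a: "a \<in> EC (n + 1)"
  shows "f a \<in> U"
proof -
  interpret N: module K N by fact
  have rcl: "rc i n a \<in> EC n" if "i < e" for i using module_homD(1)[OF rc_hom[OF n that] a] .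
  have cl: "(\<lambda>i. amult E n 1 (rc i n a) (v i)) \<in> {..<e} \<rightarrow> EC (n + 1)"
    using rcl v_closed amult_closed by auto
  have fa: "f a = finsum N (\<lambda>i. f (amult E n 1 (rc i n a) (v i))) {..<e}"
    using module_hom_finsum[OF E_module N f cl] rc_sum[OF n a] by simp
  have "finsum N h J \<in> U" if "finite J" "h \<in> J \<rightarrow> U" for h and J :: "nat set"
    using that
  proof (induction J rule: finite_induct)
    case empty
    then show ?case using U by (auto simp: submodule_def dest: subgroup.one_closed)
  next
    case (insert x J)
    then have "h x \<in> U" "h \<in> J \<rightarrow> U" by auto
    moreover from this have "h x \<in> carrier N" "h \<in> J \<rightarrow> carrier N" using N.submoduleE(1)[OF U] by auto
    ultimately show ?case using insert N.submoduleE(5)[OF U] by simp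
  qed
  then show ?thesis unfolding fa using eq rcl by auto
qed

lemma rc_surj:
  assumes n: "n \<ge> 0" and b: "\<And>i. i < e \<Longrightarrow> b i \<in> EC n"
  obtains a where "a \<in> EC (n + 1)" "\<And>i. i < e \<Longrightarrow> rc i n a = b i"
proof -
  define a where "a = finsum (acomp E (n + 1)) (\<lambda>i. amult E n 1 (b i) (v i)) {..<e}"
  have cl: "(\<lambda>i. amult E n 1 (b i) (v i)) \<in> {..<e} \<rightarrow> EC (n + 1)"
    using b v_closed amult_closed by auto
  have "rc j n a = b j" if j: "j < e" for j
  proof -
    have "rc j n a = finsum (acomp E n) (\<lambda>i. rc j n (amult E n 1 (b i) (v i))) {..<e}"
      unfolding a_def by (rule module_hom_finsum[OF E_module E_module rc_hom[OF n j] cl])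
    also have "\<dots> = finsum (acomp E n) (\<lambda>i. if j = i then b i else \<zero>\<^bsub>acomp E n\<^esub>) {..<e}"
      by (rule E.M.finsum_cong') (use b j n rc_v in auto)
    also have "\<dots> = b j" by (rule E.M.finsum_singleton) (use b j in auto)
    finally show ?thesis .
  qed
  moreover have "a \<in> EC (n + 1)" unfolding a_def using cl by (rule E.M.finsum_closed)
  ultimately show thesis by (intro that)
qed

lemma rc_inj:
  assumes n: "n \<ge> 0" and a: "a \<in> EC (n + 1)"
    and z: "\<And>i. i < e \<Longrightarrow> rc i n a = \<zero>\<^bsub>acomp E n\<^esub>"
  shows "a = \<zero>\<^bsub>acomp E (n + 1)\<^esub>"
proof -
  have "a = finsum (acomp E (n + 1)) (\<lambda>i. amult E n 1 (rc i n a) (v i)) {..<e}" by (rule rc_sum[OF n a])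
  also have "\<dots> = finsum (acomp E (n + 1)) (\<lambda>i. \<zero>\<^bsub>acomp E (n + 1)\<^esub>) {..<e}"
    by (rule E.M.finsum_cong') (auto simp: z module_hom_zero[OF E_module E_module amult_hom_l[OF v_closed]])
  finally show ?thesis by simp
qed

text \<open>Taking right coefficients commutes with left multiplication. On the spanning products
  this is associativity together with \<open>rc_v\<close>.\<close>

lemma rc_mult:
  assumes k: "k \<ge> 0" and n: "n \<ge> 0" and i: "i < e"
    and x: "x \<in> EC k" and a: "a \<in> EC (n + 1)"
  shows "rc i (k + n) (amult E k (n + 1) x a) = amult E k n x (rc i n a)"
proof (rule span_eq[OF n E_module _ _ _ a])
  have "rc i (k + n) \<in> module_hom K (acomp E (k + (n + 1))) (acomp E (k + n))"
    using rc_hom[of "k + n" i] k n i by (simp add: add.assoc)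
  then show "(\<lambda>a. rc i (k + n) (amult E k (n + 1) x a)) \<in> module_hom K (acomp E (n + 1)) (acomp E (k + n))"
    by (rule module_hom_compose[OF amult_hom_r[OF x]])
  show "(\<lambda>a. amult E k n x (rc i n a)) \<in> module_hom K (acomp E (n + 1)) (acomp E (k + n))"
    by (rule module_hom_compose[OF rc_hom[OF n i] amult_hom_r[OF x]])
  fix b j assume b: "b \<in> EC n" and j: "j < e"
  show "rc i (k + n) (amult E k (n + 1) x (amult E n 1 b (v j))) = amult E k n x (rc i n (amult E n 1 b (v j)))"
    using rc_v[of "k + n" i j "amult E k n x b"] rc_v[OF n i j b] k n i j amult_closed[OF x b]
      amult_assoc[OF x b v_closed[OF j]] module_hom_zero[OF E_module E_module amult_hom_r[OF x]]
    by auto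
qed

section \<open>Coordinates on E indexed by words\<close>

text \<open>\<^term>\<open>cor b a\<close> is the coefficient in \<^term>\<open>a\<close> of the product \<open>v i\<^sub>n \<cdots> v i\<^sub>1\<close>, where
  \<open>b = [i\<^sub>1, \<dots>, i\<^sub>n]\<close>: words are stored in reverse.\<close>

fun cor :: "nat list \<Rightarrow> 'e \<Rightarrow> 'k" where
  "cor [] a = (THE k. k \<in> carrier K \<and> a = k \<odot>\<^bsub>acomp E 0\<^esub> aone E)"
| "cor (i # b) a = cor b (rc i (int (length b)) a)"

definition words :: "nat \<Rightarrow> nat list set" where
  "words n = {b. set b \<subseteq> {..<e} \<and> length b = n}"

lemma finite_words: "finite (words n)" and card_words: "card (words n) = e ^ n"
  unfolding words_def using finite_lists_length_eq[of "{..<e}" n] card_lists_length_eq[of "{..<e}" n] by auto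

lemma words_0: "words 0 = {[]}"
  by (auto simp: words_def)

lemma words_SucI: "i < e \<Longrightarrow> b \<in> words n \<Longrightarrow> i # b \<in> words (Suc n)"
  by (auto simp: words_def)

lemma words_SucE:
  assumes "b \<in> words (Suc n)"
  obtains i b' where "b = i # b'" "i < e" "b' \<in> words n"
  using assms by (cases b) (auto simp: words_def)

lemma scal_inj:
  assumes "k \<in> carrier K" "l \<in> carrier K" "k \<odot>\<^bsub>acomp E 0\<^esub> aone E = l \<odot>\<^bsub>acomp E 0\<^esub> aone E"
  shows "k = l"
proof (rule ccontr)
  assume ne: "k \<noteq> l"
  define a where "a = k \<ominus>\<^bsub>K\<^esub> l"
  have "a \<noteq> \<zero>\<^bsub>K\<^esub>" using ne assms by (simp add: a_def K.minus_eq_zero_iff)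
  then have a: "a \<in> Units K" using assms K.field_Units by (simp add: a_def)
  have "a \<odot>\<^bsub>acomp E 0\<^esub> aone E = \<zero>\<^bsub>acomp E 0\<^esub>"
    using assms one_closed by (simp add: a_def a_minus_def E.smult_l_distr E.smult_l_minus E.M.r_neg)
  then have "inv\<^bsub>K\<^esub> a \<odot>\<^bsub>acomp E 0\<^esub> (a \<odot>\<^bsub>acomp E 0\<^esub> aone E) = \<zero>\<^bsub>acomp E 0\<^esub>" using a by simp
  then show False using E.smult_inv[OF a one_closed] one_not_zero by simp
qed

lemma cor_Nil: "k \<in> carrier K \<Longrightarrow> cor [] (k \<odot>\<^bsub>acomp E 0\<^esub> aone E) = k"
  using scal_inj by (auto intro!: the_equality)

lemma cor_hom: "b \<in> words n \<Longrightarrow> cor b \<in> module_hom K (acomp E (int n)) (ring_module K)"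
proof (induction n arbitrary: b)
  case 0
  then have [simp]: "b = []" by (simp add: words_0)
  show ?case
  proof (intro module_homI)
    fix x assume "x \<in> EC (int 0)"
    then obtain k where k: "k \<in> carrier K" "x = k \<odot>\<^bsub>acomp E 0\<^esub> aone E" using E_0 by auto
    show "cor b x \<in> carrier (ring_module K)" using k cor_Nil by simp
    {
      fix r assume r: "r \<in> carrier K"
      show "cor b (r \<odot>\<^bsub>acomp E (int 0)\<^esub> x) = r \<odot>\<^bsub>ring_module K\<^esub> cor b x"
        using k r cor_Nil[OF k(1)] cor_Nil[of "r \<otimes>\<^bsub>K\<^esub> k"] one_closed by (simp add: E.smult_assoc1 del: cor.simps)
    }
    fix y assume "y \<in> EC (int 0)"
    then obtain l where l: "l \<in> carrier K" "y = l \<odot>\<^bsub>acomp E 0\<^esub> aone E" using E_0 by auto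
    show "cor b (x \<oplus>\<^bsub>acomp E (int 0)\<^esub> y) = cor b x \<oplus>\<^bsub>ring_module K\<^esub> cor b y"
      using k l cor_Nil[OF k(1)] cor_Nil[OF l(1)] cor_Nil[of "k \<oplus>\<^bsub>K\<^esub> l"] one_closed
      by (simp add: E.smult_l_distr del: cor.simps)
  qed
next
  case (Suc n)
  then obtain i b' where b: "b = i # b'" "i < e" "b' \<in> words n" by (elim words_SucE)
  then have "length b' = n" by (simp add: words_def)
  then show ?case
    using module_hom_compose[OF rc_hom[of "int n" i] Suc.IH[OF b(3)]] b by (simp add: add.commute)
qed

lemma cor_inj:
  "a \<in> EC (int n) \<Longrightarrow> (\<And>b. b \<in> words n \<Longrightarrow> cor b a = \<zero>\<^bsub>K\<^esub>) \<Longrightarrow> a = \<zero>\<^bsub>acomp E (int n)\<^esub>"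
proof (induction n arbitrary: a)
  case 0
  then obtain k where k: "k \<in> carrier K" "a = k \<odot>\<^bsub>acomp E 0\<^esub> aone E" using E_0 by auto
  then show ?case using 0(2)[of "[]"] cor_Nil[OF k(1)] one_closed by (simp add: words_0 del: cor.simps)
next
  case (Suc n)
  have a: "a \<in> EC (int n + 1)" using Suc.prems(1) by (simp add: add.commute)
  have "a = \<zero>\<^bsub>acomp E (int n + 1)\<^esub>"
  proof (rule rc_inj[OF _ a])
    fix i assume i: "i < e"
    show "rc i (int n) a = \<zero>\<^bsub>acomp E (int n)\<^esub>"
    proof (rule Suc.IH)
      show "rc i (int n) a \<in> EC (int n)" using module_homD(1)[OF rc_hom a] i by simp
      fix b assume b: "b \<in> words n"
      then show "cor b (rc i (int n) a) = \<zero>\<^bsub>K\<^esub>"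
        using Suc.prems(2)[OF words_SucI[OF i b]] by (simp add: words_def)
    qed
  qed simp
  then show ?case by (simp add: add.commute)
qed

lemma cor_surj:
  "(\<And>b. b \<in> words n \<Longrightarrow> \<tau> b \<in> carrier K) \<Longrightarrow>
    \<exists>a\<in>EC (int n). \<forall>b\<in>words n. cor b a = \<tau> b"
proof (induction n arbitrary: \<tau>)
  case 0
  then show ?case
    using cor_Nil[of "\<tau> []"] one_closed by (intro bexI[of _ "\<tau> [] \<odot>\<^bsub>acomp E 0\<^esub> aone E"]) (auto simp: words_0 simp del: cor.simps)
next
  case (Suc n)
  have "\<forall>i\<in>{..<e}. \<exists>a. a \<in> EC (int n) \<and> (\<forall>b\<in>words n. cor b a = \<tau> (i # b))"
  proof
    fix i assume "i \<in> {..<e}"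
    then show "\<exists>a. a \<in> EC (int n) \<and> (\<forall>b\<in>words n. cor b a = \<tau> (i # b))"
      using Suc.IH[of "\<lambda>b. \<tau> (i # b)"] Suc.prems words_SucI by blast
  qed
  then obtain f where f: "\<And>i. i < e \<Longrightarrow> f i \<in> EC (int n)"
    "\<And>i b. i < e \<Longrightarrow> b \<in> words n \<Longrightarrow> cor b (f i) = \<tau> (i # b)"
    using bchoice[of "{..<e}"] by (metis lessThan_iff)
  obtain a where a: "a \<in> EC (int n + 1)" "\<And>i. i < e \<Longrightarrow> rc i (int n) a = f i"
    using rc_surj[of "int n" f] f(1) by auto
  have "cor b a = \<tau> b" if "b \<in> words (Suc n)" for b
  proof -
    obtain i b' where b: "b = i # b'" "i < e" "b' \<in> words n" using \<open>b \<in> words (Suc n)\<close> by (elim words_SucE)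
    then have "length b' = n" by (simp add: words_def)
    then show ?thesis using b a(2) f(2) by simp
  qed
  then show ?case using a(1) by (auto simp: add.commute)
qed

lemma scal_v:
  assumes k: "k \<in> carrier K" and j: "j < e"
  shows "amult E 1 0 (v j) (k \<odot>\<^bsub>acomp E 0\<^esub> aone E) = amult E 0 1 (k \<odot>\<^bsub>acomp E 0\<^esub> aone E) (v j)"
  using module_homD(3)[OF amult_hom_r[OF v_closed[OF j], of 0] k one_closed]
    module_homD(3)[OF amult_hom_l[OF v_closed[OF j], of 0] k one_closed]
    one_r[OF v_closed[OF j]] one_l[OF v_closed[OF j]] by simp

text \<open>Left multiplication puts \<open>v j\<close> in front of a product, that is,
  \<open>j\<close> at the end of the reversed word. The induction strips factors on the right, where
  \<open>rc_mult\<close> applies, until \<open>v j\<close> alone is left and scalars are moved past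
  it.\<close>

lemma cor_v:
  assumes j: "j < e" "j' < e"
  shows "b \<in> words n \<Longrightarrow> a \<in> EC (int n) \<Longrightarrow>
    cor (b @ [j']) (amult E 1 (int n) (v j) a) = (if j' = j then cor b a else \<zero>\<^bsub>K\<^esub>)"
proof (induction n arbitrary: a b)
  case 0
  then obtain k where k: "k \<in> carrier K" "a = k \<odot>\<^bsub>acomp E 0\<^esub> aone E" using E_0 by auto
  have "rc j' 0 (amult E 0 1 a (v j)) = (if j' = j then a else \<zero>\<^bsub>acomp E 0\<^esub>)"
    using rc_v[OF _ j(2,1)] 0 by simp
  moreover have "cor [] \<zero>\<^bsub>acomp E 0\<^esub> = \<zero>\<^bsub>K\<^esub>"
    using module_hom_zero[OF E_module Kmod cor_hom[of "[]" 0]] by (simp add: words_0)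
  ultimately show ?case using 0 scal_v[OF k(1) j(1)] k(2) by (simp add: words_0 del: cor.simps(1))
next
  case (Suc n)
  then obtain i b' where b: "b = i # b'" "i < e" "b' \<in> words n" by (elim words_SucE)
  then have l: "length b' = n" by (simp add: words_def)
  have a: "a \<in> EC (int n + 1)" using Suc.prems(2) by (simp add: add.commute)
  have "rc i (1 + int n) (amult E 1 (int n + 1) (v j) a) = amult E 1 (int n) (v j) (rc i (int n) a)"
    by (rule rc_mult[OF _ _ b(2) v_closed[OF j(1)] a]) auto
  moreover have "rc i (int n) a \<in> EC (int n)" using module_homD(1)[OF rc_hom a] b by simp
  ultimately show ?case
    using Suc.IH[OF b(3)] b(1) l by (simp add: add.commute)
qed

section \<open>Injectivity of the canonical map and non-splitting\<close>

lemma v_left_inj: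
  assumes j: "j < e" and a: "a \<in> EC n" and z: "amult E 1 n (v j) a = \<zero>\<^bsub>acomp E (1 + n)\<^esub>"
  shows "a = \<zero>\<^bsub>acomp E n\<^esub>"
proof (cases "n < 0")
  case True
  then show ?thesis using E_neg a by blast
next
  case False
  then obtain k where k: "n = int k" using nonneg_int_cases by (metis linorder_not_less)
  show ?thesis unfolding k
  proof (rule cor_inj)
    show "a \<in> EC (int k)" using a k by simp
    fix b assume b: "b \<in> words k"
    then have bj: "b @ [j] \<in> words (Suc k)" using j by (auto simp: words_def)
    have "cor b a = cor (b @ [j]) (amult E 1 n (v j) a)"
      using cor_v[OF j j b] a k by simp
    also have "\<dots> = \<zero>\<^bsub>K\<^esub>"
      unfolding z using module_hom_zero[OF E_module Kmod cor_hom[OF bj]] k by simp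
    finally show "cor b a = \<zero>\<^bsub>K\<^esub>" .
  qed
qed

text \<open>An element of the kernel is annihilated by all of E^k for large \<open>k\<close>. The
  \<open>v i\<close> are left cancellable in E, so \<open>k\<close> can be lowered one step at a
  time until the unit itself annihilates the element.\<close>

lemma io_inj:
  assumes a: "a \<in> EC n" and z: "io n a = \<zero>\<^bsub>mcomp M n\<^esub>"
  shows "a = \<zero>\<^bsub>acomp E n\<^esub>"
proof -
  have *: "(\<forall>b\<in>EC (int k). amult E (int k) n b a = \<zero>\<^bsub>acomp E (int k + n)\<^esub>) \<Longrightarrow> a = \<zero>\<^bsub>acomp E n\<^esub>" for k
  proof (induction k)
    case 0
    then show ?case using one_closed one_l[OF a] by auto
  next
    case (Suc k)
    have "amult E (int k) n b a = \<zero>\<^bsub>acomp E (int k + n)\<^esub>" if b: "b \<in> EC (int k)" for b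
    proof (rule v_left_inj[OF e_pos amult_closed[OF b a]])
      have "amult E 1 (int k) (v 0) b \<in> EC (int (Suc k))"
        using amult_closed[OF v_closed[OF e_pos] b] by simp
      then show "amult E 1 (int k + n) (v 0) (amult E (int k) n b a) = \<zero>\<^bsub>acomp E (1 + (int k + n))\<^esub>"
        using Suc.prems amult_assoc[OF v_closed[OF e_pos] b a] by (simp add: add.assoc)
    qed
    then show ?case using Suc.IH by blast
  qed
  obtain N where N: "\<forall>k\<ge>N. \<forall>b\<in>EC k. amult E k n b a = \<zero>\<^bsub>acomp E (k + n)\<^esub>"
    using io_kernel[OF a z] by blast
  show ?thesis by (rule *[of "nat N"]) (use N in auto)
qed

lemma io_inj_on: "inj_on (io n) (EC n)"
proof (rule inj_onI)
  fix a b assume ab: "a \<in> EC n" "b \<in> EC n" "io n a = io n b"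
  have "io n (a \<ominus>\<^bsub>acomp E n\<^esub> b) = \<zero>\<^bsub>mcomp M n\<^esub>"
    using ab by (simp add: module_hom_minus[OF E_module M_module io_mhom] M.M.minus_eq_zero_iff io_closed)
  then have "a \<ominus>\<^bsub>acomp E n\<^esub> b = \<zero>\<^bsub>acomp E n\<^esub>" using io_inj ab by simp
  then show "a = b" using ab by (simp add: E.M.minus_eq_zero_iff)
qed

theorem io_no_complement:
  "\<not> has_direct_complement K E M (\<lambda>n. io n ` EC n)"
proof
  assume "has_direct_complement K E M (\<lambda>n. io n ` EC n)"
  then obtain T where T: "gr_submodule K E M T"
    and int: "\<And>n. io n ` EC n \<inter> T n = {\<zero>\<^bsub>mcomp M n\<^esub>}"
    and sum: "\<And>n. io n ` EC n <+>\<^bsub>mcomp M n\<^esub> T n = MC n"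
    unfolding has_direct_complement_def by blast
  obtain w where w: "w \<in> MC (-1)" "mact M 1 (-1) (v 0) w = io 0 (aone E)"
    using v_surj[of "\<lambda>i. io 0 (aone E)" "-1"] io_closed[OF one_closed] e_pos by auto
  have TM: "T n \<subseteq> MC n" for n
    using T M.submoduleE(1) unfolding gr_submodule_def by blast
  have "w \<in> io (-1) ` EC (-1) <+>\<^bsub>mcomp M (-1)\<^esub> T (-1)" using w(1) sum by simp
  then obtain a t where at: "a \<in> EC (-1)" "t \<in> T (-1)" "w = io (-1) a \<oplus>\<^bsub>mcomp M (-1)\<^esub> t"
    by (auto simp: set_add_def')
  \<comment> \<open>E is zero in degree -1, so \<open>w\<close> lies in the complement; then so does
    the product of \<open>v 0\<close> with \<open>w\<close>, the image of the unit.\<close>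
  then have "w = t"
    using E_neg[of "-1"] module_hom_zero[OF E_module M_module io_mhom] subsetD[OF TM at(2)] by simp
  then have "mact M 1 (-1) (v 0) w \<in> T (1 + -1)"
    using T at(2) v_closed[OF e_pos] unfolding gr_submodule_def by blast
  then have "io 0 (aone E) \<in> io 0 ` EC 0 \<inter> T 0" using w(2) one_closed by simp
  then have "io 0 (aone E) = \<zero>\<^bsub>mcomp M 0\<^esub>" using int by blast
  then show False using io_inj[OF one_closed] one_not_zero by simp
qed

end

section \<open>The spaces U modulo the image of E\<close>

context stable_pair
begin

definition U :: "int \<Rightarrow> 's set" where
  "U n = {s \<in> MC n. \<forall>i<e. mact M 1 n (v i) s \<in> io (1 + n) ` EC (1 + n)}"

lemma io_sub: "submodule (io n ` EC n) K (mcomp M n)"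
  by (rule submodule_image[OF E_module M_module io_mhom E.carrier_is_submodule])

lemma U_sub: "submodule (U n) K (mcomp M n)"
proof -
  have s: "submodule {s \<in> MC n. mact M 1 n (v i) s \<in> io (1 + n) ` EC (1 + n)} K (mcomp M n)"
    if "i < e" for i
    by (rule submodule_vimage[OF M_module M_module act_hom_r[OF v_closed[OF that]] io_sub])
  show ?thesis
  proof (rule module_carrier_update(1)[OF M_module])
    show "\<zero>\<^bsub>mcomp M n\<^esub> \<in> U n"
      using subgroup.one_closed[OF submodule.axioms(1)[OF s]] by (auto simp: U_def)
    fix x y assume "x \<in> U n" "y \<in> U n"
    then show "x \<oplus>\<^bsub>mcomp M n\<^esub> y \<in> U n"
      using M.submoduleE(5)[OF s, of _ x y] by (auto simp: U_def)
  next
    fix r x assume "r \<in> carrier K" "x \<in> U n"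
    then show "r \<odot>\<^bsub>mcomp M n\<^esub> x \<in> U n"
      using M.submoduleE(4)[OF s, of _ r x] by (auto simp: U_def)
  qed (auto simp: U_def)
qed

lemma U_M: "s \<in> U n \<Longrightarrow> s \<in> MC n"
  by (simp add: U_def)

lemma io_U:
  assumes "a \<in> EC n"
  shows "io n a \<in> U n"
proof -
  have "mact M 1 n (v i) (io n a) \<in> io (1 + n) ` EC (1 + n)" if "i < e" for i
    using io_act[OF v_closed[OF that] assms] amult_closed[OF v_closed[OF that] assms] by (metis imageI)
  then show ?thesis using assms by (simp add: U_def io_closed)
qed

text \<open>The components of the identification of U^n with (E^(1+n))^e. Under it the image of
  \<open>a\<close> in E^n becomes the tuple of the products of \<open>v j\<close> with
  \<open>a\<close>.\<close>

definition gg :: "int \<Rightarrow> nat \<Rightarrow> 's \<Rightarrow> 'e" where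
  "gg n j s = inv_into (EC (1 + n)) (io (1 + n)) (mact M 1 n (v j) s)"

lemma gg:
  assumes "s \<in> U n" "j < e"
  shows "gg n j s \<in> EC (1 + n)" "io (1 + n) (gg n j s) = mact M 1 n (v j) s"
  using assms unfolding gg_def U_def by (auto intro: inv_into_into f_inv_into_f)

lemma gg_eq:
  assumes "a \<in> EC (1 + n)" "io (1 + n) a = mact M 1 n (v j) s"
  shows "gg n j s = a"
  unfolding gg_def assms(2)[symmetric] by (rule inv_into_f_f[OF io_inj_on assms(1)])

lemma gg_hom:
  assumes j: "j < e"
  shows "gg n j \<in> module_hom K (mcomp M n\<lparr>carrier := U n\<rparr>) (acomp E (1 + n))"
proof (intro module_homI)
  fix s assume "s \<in> carrier (mcomp M n\<lparr>carrier := U n\<rparr>)"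
  then have s: "s \<in> U n" by simp
  show "gg n j s \<in> EC (1 + n)" by (rule gg(1)[OF s j])
  {
    fix r assume r: "r \<in> carrier K"
    have "gg n j (r \<odot>\<^bsub>mcomp M n\<^esub> s) = r \<odot>\<^bsub>acomp E (1 + n)\<^esub> gg n j s"
      using r gg[OF s j] U_M[OF s]
      by (intro gg_eq) (simp_all add: module_homD(3)[OF io_mhom] module_homD(3)[OF act_hom_r[OF v_closed[OF j]]])
    then show "gg n j (r \<odot>\<^bsub>mcomp M n\<lparr>carrier := U n\<rparr>\<^esub> s) = r \<odot>\<^bsub>acomp E (1 + n)\<^esub> gg n j s" by simp
  }
  fix t assume "t \<in> carrier (mcomp M n\<lparr>carrier := U n\<rparr>)"
  then have t: "t \<in> U n" by simp
  have "gg n j (s \<oplus>\<^bsub>mcomp M n\<^esub> t) = gg n j s \<oplus>\<^bsub>acomp E (1 + n)\<^esub> gg n j t"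
    using gg[OF s j] U_M[OF s] gg[OF t j] U_M[OF t]
    by (intro gg_eq) (simp_all add: module_homD(2)[OF io_mhom] module_homD(2)[OF act_hom_r[OF v_closed[OF j]]])
  then show "gg n j (s \<oplus>\<^bsub>mcomp M n\<lparr>carrier := U n\<rparr>\<^esub> t) = gg n j s \<oplus>\<^bsub>acomp E (1 + n)\<^esub> gg n j t" by simp
qed

lemma gg_io: "a \<in> EC n \<Longrightarrow> j < e \<Longrightarrow> gg n j (io n a) = amult E 1 n (v j) a"
  by (intro gg_eq amult_closed io_act v_closed)

lemma U_surj:
  assumes "\<And>j. j < e \<Longrightarrow> a j \<in> EC (1 + n)"
  obtains s where "s \<in> U n" "\<And>j. j < e \<Longrightarrow> gg n j s = a j"
proof -
  obtain s where s: "s \<in> MC n" "\<And>i. i < e \<Longrightarrow> mact M 1 n (v i) s = io (1 + n) (a i)"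
    using v_surj[of "\<lambda>i. io (1 + n) (a i)" n] io_closed[OF assms] by blast
  show thesis
  proof (rule that)
    show "s \<in> U n" using s assms by (simp add: U_def)
    show "gg n j s = a j" if "j < e" for j using gg_eq[OF assms[OF that]] s(2)[OF that] by simp
  qed
qed

lemma U_eq_io:
  assumes "s \<in> U n" "a \<in> EC n" "\<And>j. j < e \<Longrightarrow> gg n j s = amult E 1 n (v j) a"
  shows "s = io n a"
proof (rule v_eq[OF U_M[OF assms(1)] io_closed[OF assms(2)]])
  fix i assume i: "i < e"
  show "mact M 1 n (v i) s = mact M 1 n (v i) (io n a)"
    using gg(2)[OF assms(1) i] assms(3)[OF i] io_act[OF v_closed[OF i] assms(2)] by simp
qed

text \<open>The functionals \<^term>\<open>\<theta> c\<close> for \<open>c < u\<close> are coordinates on \<^term>\<open>U n\<close> modulo the image of \<^term>\<open>E\<close>.\<close>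

definition coords :: "int \<Rightarrow> nat \<Rightarrow> (nat \<Rightarrow> 's \<Rightarrow> 'k) \<Rightarrow> bool" where
  "coords n u \<theta> \<longleftrightarrow> (\<forall>c<u. \<theta> c \<in> module_hom K (mcomp M n) (ring_module K)) \<and>
     (\<forall>c<u. \<forall>a\<in>EC n. \<theta> c (io n a) = \<zero>\<^bsub>K\<^esub>) \<and>
     (\<forall>s\<in>U n. (\<forall>c<u. \<theta> c s = \<zero>\<^bsub>K\<^esub>) \<longrightarrow> s \<in> io n ` EC n) \<and>
     (\<forall>\<tau>. (\<forall>c<u. \<tau> c \<in> carrier K) \<longrightarrow> (\<exists>s\<in>U n. \<forall>c<u. \<theta> c s = \<tau> c))"

text \<open>Reduces the construction to functionals on U^n with any convenient index set: each is
  extended to the whole degree-n part of M, and the index set is renumbered by a bijection.\<close>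

lemma coords_ex:
  fixes \<theta> :: "'j \<Rightarrow> 's \<Rightarrow> 'k"
  assumes J: "finite J" "card J = u"
    and hom: "\<And>c. c \<in> J \<Longrightarrow> \<theta> c \<in> module_hom K (mcomp M n\<lparr>carrier := U n\<rparr>) (ring_module K)"
    and io: "\<And>c a. c \<in> J \<Longrightarrow> a \<in> EC n \<Longrightarrow> \<theta> c (io n a) = \<zero>\<^bsub>K\<^esub>"
    and ker: "\<And>s. s \<in> U n \<Longrightarrow> (\<And>c. c \<in> J \<Longrightarrow> \<theta> c s = \<zero>\<^bsub>K\<^esub>) \<Longrightarrow> s \<in> io n ` EC n"
    and surj: "\<And>\<tau>. (\<And>c. c \<in> J \<Longrightarrow> \<tau> c \<in> carrier K) \<Longrightarrow> \<exists>s\<in>U n. \<forall>c\<in>J. \<theta> c s = \<tau> c"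
  shows "\<exists>\<theta>. coords n u \<theta>"
proof -
  have "\<exists>g. g \<in> module_hom K (mcomp M n) (ring_module K) \<and> (\<forall>s\<in>U n. g s = \<theta> c s)" if "c \<in> J" for c
    using functional_extension[OF K_field M_module U_sub hom[OF that]] by metis
  then obtain g where g: "\<And>c. c \<in> J \<Longrightarrow> g c \<in> module_hom K (mcomp M n) (ring_module K)"
    "\<And>c s. c \<in> J \<Longrightarrow> s \<in> U n \<Longrightarrow> g c s = \<theta> c s" by metis
  obtain h where h: "bij_betw h {0..<u} J" using ex_bij_betw_nat_finite[OF J(1)] J(2) by auto
  have hJ: "c < u \<Longrightarrow> h c \<in> J" for c using h by (auto simp: bij_betw_def)
  have Jh: "\<exists>c<u. h c = j" if "j \<in> J" for j using h that by (force simp: bij_betw_def)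
  have "coords n u (\<lambda>c. g (h c))"
    unfolding coords_def
  proof (intro conjI allI impI ballI)
    fix s assume s: "s \<in> U n" "\<forall>c<u. g (h c) s = \<zero>\<^bsub>K\<^esub>"
    show "s \<in> io n ` EC n"
    proof (rule ker[OF s(1)])
      fix j assume j: "j \<in> J"
      then obtain c where "c < u" "h c = j" using Jh by blast
      then show "\<theta> j s = \<zero>\<^bsub>K\<^esub>" using s g(2)[OF j s(1)] by auto
    qed
  next
    fix \<tau> assume \<tau>: "\<forall>c<u. \<tau> c \<in> carrier K"
    have "\<exists>s\<in>U n. \<forall>j\<in>J. \<theta> j s = \<tau> (inv_into {0..<u} h j)"
    proof (rule surj)
      fix j assume "j \<in> J"
      then have "inv_into {0..<u} h j \<in> {0..<u}" using h by (intro inv_into_into) (auto simp: bij_betw_def)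
      then show "\<tau> (inv_into {0..<u} h j) \<in> carrier K" using \<tau> by simp
    qed
    then obtain s where s: "s \<in> U n" "\<And>j. j \<in> J \<Longrightarrow> \<theta> j s = \<tau> (inv_into {0..<u} h j)" by blast
    have "g (h c) s = \<tau> c" if "c < u" for c
      using g(2)[OF hJ[OF that] s(1)] s(2)[OF hJ[OF that]] h that
      by (simp add: bij_betw_def inv_into_f_f)
    then show "\<exists>s\<in>U n. \<forall>c<u. g (h c) s = \<tau> c" using s(1) by blast
  qed (use g hJ io io_U in auto)
  then show ?thesis by (rule exI[of _ "\<lambda>c. g (h c)"])
qed

text \<open>Here E^(-1) vanishes, so nothing is divided out and U^(-1) is (E^0)^e, a space of
  dimension \<open>e\<close> whose coordinates are the scalars of the components.\<close>

lemma coords_minus_one: "\<exists>\<theta>. coords (-1) e \<theta>"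
proof (rule coords_ex[of "{..<e}" e "\<lambda>j s. cor [] (gg (-1) j s)"])
  have nil: "[] \<in> words 0" by (simp add: words_0)
  have ch: "cor [] \<in> module_hom K (acomp E (1 + -1)) (ring_module K)" using cor_hom[OF nil] by simp
  show "(\<lambda>s. cor [] (gg (-1) j s)) \<in> module_hom K (mcomp M (-1)\<lparr>carrier := U (-1)\<rparr>) (ring_module K)"
    if "j \<in> {..<e}" for j
    using that by (intro module_hom_compose[OF gg_hom ch]) simp
  show "cor [] (gg (-1) j (io (-1) a)) = \<zero>\<^bsub>K\<^esub>" if "j \<in> {..<e}" "a \<in> EC (-1)" for j a
  proof -
    have j: "j < e" using that by simp
    have "a = \<zero>\<^bsub>acomp E (-1)\<^esub>" using that E_neg[of "-1"] by simp
    then have "gg (-1) j (io (-1) a) = \<zero>\<^bsub>acomp E (1 + -1)\<^esub>"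
      using gg_io[OF that(2) j] module_hom_zero[OF E_module E_module amult_hom_r[OF v_closed[OF j]]] by simp
    then show ?thesis using module_hom_zero[OF E_module Kmod ch] by (simp del: cor.simps)
  qed
  show "s \<in> io (-1) ` EC (-1)"
    if s: "s \<in> U (-1)" and z: "\<And>j. j \<in> {..<e} \<Longrightarrow> cor [] (gg (-1) j s) = \<zero>\<^bsub>K\<^esub>" for s
  proof -
    have "s = io (-1) \<zero>\<^bsub>acomp E (-1)\<^esub>"
    proof (rule U_eq_io[OF s E.M.zero_closed])
      fix j assume j: "j < e"
      have "gg (-1) j s = \<zero>\<^bsub>acomp E (int 0)\<^esub>"
        using gg(1)[OF s j] z[of j] j by (intro cor_inj) (simp_all add: words_0 del: cor.simps)
      then show "gg (-1) j s = amult E 1 (-1) (v j) \<zero>\<^bsub>acomp E (-1)\<^esub>"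
        using module_hom_zero[OF E_module E_module amult_hom_r[OF v_closed[OF j]], of "-1"] by simp
    qed
    then show ?thesis by simp
  qed
  show "\<exists>s\<in>U (-1). \<forall>j\<in>{..<e}. cor [] (gg (-1) j s) = \<tau> j" if \<tau>: "\<And>j. j \<in> {..<e} \<Longrightarrow> \<tau> j \<in> carrier K" for \<tau>
  proof -
    obtain s where "s \<in> U (-1)" "\<And>j. j < e \<Longrightarrow> gg (-1) j s = \<tau> j \<odot>\<^bsub>acomp E 0\<^esub> aone E"
      using U_surj[of "\<lambda>j. \<tau> j \<odot>\<^bsub>acomp E 0\<^esub> aone E" "-1"] \<tau> one_closed by auto
    then show ?thesis using \<tau> cor_Nil by (intro bexI[of _ s]) (auto simp del: cor.simps)
  qed
qed simp_all

text \<open>A tuple in (E^(N+1))^e has coordinates indexed by pairs of \<open>j\<close> and a word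
  of length N+1. The tuple coming from \<open>a\<close> in E^N repeats the coefficient of
  \<open>a\<close> at a word b in the \<open>e\<close> positions \<open>(j, b @ [j])\<close> and is
  zero elsewhere. Taking \<open>(0, b @ [0])\<close> as reference and subtracting its coordinate
  from the other positions of the group leaves e e^(N+1) - e^N functionals.\<close>

lemma coords_nat: "\<exists>\<theta>. coords (int N) (e ^ N * (e\<^sup>2 - 1)) \<theta>"
proof -
  define J where "J = {..<e} \<times> words (Suc N) - (\<lambda>b. (0, b @ [0])) ` words N"
  \<comment> \<open>The reference coordinate belonging to the pair, present only for pairs on the
    diagonal, where the word ends in \<open>j\<close>.\<close>
  define sub where "sub = (\<lambda>j b s. if last b = j then cor (butlast b @ [0]) (gg (int N) 0 s) else \<zero>\<^bsub>K\<^esub>)"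
  define \<theta> where "\<theta> = (\<lambda>(j, b) s. cor b (gg (int N) j s) \<ominus>\<^bsub>K\<^esub> sub j b s)"
  have w0: "b @ [j] \<in> words (Suc N)" if "b \<in> words N" "j < e" for b j
    using that by (auto simp: words_def)
  have wE: "\<exists>b' j'. b = b' @ [j'] \<and> b' \<in> words N \<and> j' < e" if "b \<in> words (Suc N)" for b
    using that by (cases b rule: rev_cases) (auto simp: words_def)
  have e0: "0 < e" by (rule e_pos)
  have subset: "(\<lambda>b. (0, b @ [0])) ` words N \<subseteq> {..<e} \<times> words (Suc N)" using w0 e0 by auto
  have inj: "inj_on (\<lambda>b. (0::nat, b @ [0::nat])) (words N)" by (auto simp: inj_on_def)
  have cJ: "card J = e ^ N * (e\<^sup>2 - 1)"
  proof -
    have "card J = e * e ^ Suc N - e ^ N"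
      unfolding J_def using subset finite_words inj
      by (subst card_Diff_subset) (auto simp: card_image card_words card_cartesian_product)
    also have "\<dots> = e ^ N * (e\<^sup>2 - 1)" by (simp add: power2_eq_square algebra_simps diff_mult_distrib2)
    finally show ?thesis .
  qed
  have ch: "cor b \<in> module_hom K (acomp E (1 + int N)) (ring_module K)" if "b \<in> words (Suc N)" for b
    using cor_hom[OF that] by simp
  have UM: "module K (mcomp M (int N)\<lparr>carrier := U (int N)\<rparr>)"
    by (rule submodule.submodule_is_module[OF U_sub M_module])
  have th: "\<theta> (j, b) s = cor b (gg (int N) j s) \<ominus>\<^bsub>K\<^esub> sub j b s" for j b s by (simp add: \<theta>_def)
  have cg: "cor b (gg (int N) j s) \<in> carrier K" if "b \<in> words (Suc N)" "j < e" "s \<in> U (int N)" for b j s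
    using module_homD(1)[OF ch[OF that(1)] gg(1)[OF that(3,2)]] by simp
  have subc: "sub j b s \<in> carrier K" if b: "b \<in> words (Suc N)" and s: "s \<in> U (int N)" for j b s
  proof -
    obtain b' j' where "b = b' @ [j']" "b' \<in> words N" using wE[OF b] by blast
    then show ?thesis using cg[OF w0[OF _ e0] e0 s, of b'] by (simp add: sub_def)
  qed
  show ?thesis
  proof (rule coords_ex[of J _ \<theta>])
    show "finite J" by (simp add: J_def finite_words)
    show "card J = e ^ N * (e\<^sup>2 - 1)" by (rule cJ)
  next
    fix c assume c: "c \<in> J"
    then obtain j b where jb: "c = (j, b)" "j < e" "b \<in> words (Suc N)" by (auto simp: J_def)
    obtain b' j' where b': "b = b' @ [j']" "b' \<in> words N" "j' < e" using wE[OF jb(3)] by blast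
    let ?UN = "mcomp M (int N)\<lparr>carrier := U (int N)\<rparr>"
    have h1: "(\<lambda>s. cor b (gg (int N) j s)) \<in> module_hom K ?UN (ring_module K)"
      by (rule module_hom_compose[OF gg_hom[OF jb(2)] ch[OF jb(3)]])
    have h2: "sub j b \<in> module_hom K ?UN (ring_module K)"
    proof (cases "last b = j")
      case True
      have "(\<lambda>s. cor (b' @ [0]) (gg (int N) 0 s)) \<in> module_hom K ?UN (ring_module K)"
        by (rule module_hom_compose[OF gg_hom[OF e0] ch[OF w0[OF b'(2) e0]]])
      then show ?thesis using True b' by (simp add: sub_def[abs_def])
    next
      case False
      then show ?thesis using module_hom_const_zero[OF Kmod, of ?UN] by (simp add: sub_def[abs_def])
    qed
    have "(\<lambda>s. cor b (gg (int N) j s) \<oplus>\<^bsub>ring_module K\<^esub> (\<ominus>\<^bsub>K\<^esub> \<one>\<^bsub>K\<^esub>) \<odot>\<^bsub>ring_module K\<^esub> sub j b s) \<in> module_hom K ?UN (ring_module K)"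
      by (intro module_hom_plus module_hom_scale UM Kmod h1 h2) simp
    then show "\<theta> c \<in> module_hom K ?UN (ring_module K)"
      by (rule module_hom_cong[OF UM]) (use jb subc in \<open>auto simp: th a_minus_def K.l_minus\<close>)
    fix a assume a: "a \<in> EC (int N)"
    have "cor b (gg (int N) j (io (int N) a)) = (if j' = j then cor b' a else \<zero>\<^bsub>K\<^esub>)"
      unfolding gg_io[OF a jb(2)] b'(1) by (rule cor_v[OF jb(2) b'(3,2) a])
    moreover have "cor (b' @ [0]) (gg (int N) 0 (io (int N) a)) = cor b' a"
      unfolding gg_io[OF a e0] using cor_v[OF e0 e0 b'(2) a] by simp
    moreover have "cor b' a \<in> carrier K" using module_homD(1)[OF cor_hom[OF b'(2)] a] by simp
    ultimately show "\<theta> c (io (int N) a) = \<zero>\<^bsub>K\<^esub>"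
      using jb(1) b'(1) by (simp add: th sub_def K.minus_eq_zero_iff)
  next
    fix s assume s: "s \<in> U (int N)" and z: "\<And>c. c \<in> J \<Longrightarrow> \<theta> c s = \<zero>\<^bsub>K\<^esub>"
    \<comment> \<open>The reference coordinates determine the only possible \<open>a\<close>;
      vanishing of the remaining functionals forces all other coordinates to agree with it.\<close>
    obtain a where a: "a \<in> EC (int N)" "\<And>b. b \<in> words N \<Longrightarrow> cor b a = cor (b @ [0]) (gg (int N) 0 s)"
      using cor_surj[of N "\<lambda>b. cor (b @ [0]) (gg (int N) 0 s)"] cg[OF w0[OF _ e0] e0 s] by blast
    have "gg (int N) j s = amult E 1 (int N) (v j) a" if j: "j < e" for j
    proof -
      let ?x = "gg (int N) j s" and ?y = "amult E 1 (int N) (v j) a"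
      have x: "?x \<in> EC (1 + int N)" by (rule gg(1)[OF s j])
      have y: "?y \<in> EC (1 + int N)" by (rule amult_closed[OF v_closed[OF j] a(1)])
      have "?x \<ominus>\<^bsub>acomp E (1 + int N)\<^esub> ?y = \<zero>\<^bsub>acomp E (int (Suc N))\<^esub>"
      proof (rule cor_inj)
        show "?x \<ominus>\<^bsub>acomp E (1 + int N)\<^esub> ?y \<in> EC (int (Suc N))" using x y by simp
        fix b assume b: "b \<in> words (Suc N)"
        obtain b' j' where b': "b = b' @ [j']" "b' \<in> words N" "j' < e" using wE[OF b] by blast
        have cy: "cor b ?y = (if j' = j then cor (b' @ [0]) (gg (int N) 0 s) else \<zero>\<^bsub>K\<^esub>)"
          unfolding b'(1) cor_v[OF j b'(3,2) a(1)] using a(2)[OF b'(2)] by simp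
        have cx: "cor b ?x = (if j' = j then cor (b' @ [0]) (gg (int N) 0 s) else \<zero>\<^bsub>K\<^esub>)"
        proof (cases "(j, b) \<in> J")
          case True
          have "cor b ?x \<ominus>\<^bsub>K\<^esub> sub j b s = \<zero>\<^bsub>K\<^esub>" using z[OF True] by (simp add: th)
          then have "cor b ?x = sub j b s" using cg[OF b j s] subc[OF b s] by (simp add: K.minus_eq_zero_iff)
          then show ?thesis using b' by (simp add: sub_def)
        next
          case False
          then show ?thesis using b j b' by (auto simp: J_def)
        qed
        have "cor b (?x \<ominus>\<^bsub>acomp E (1 + int N)\<^esub> ?y) = cor b ?x \<ominus>\<^bsub>ring_module K\<^esub> cor b ?y"
          using module_hom_minus[OF E_module Kmod ch[OF b] x y] .
        also have "\<dots> = \<zero>\<^bsub>ring_module K\<^esub>"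
          using cx cy module_homD(1)[OF ch[OF b] y] abelian_group.minus_eq_zero_iff[OF module_abelian[OF Kmod]] by metis
        finally show "cor b (?x \<ominus>\<^bsub>acomp E (1 + int N)\<^esub> ?y) = \<zero>\<^bsub>K\<^esub>" by simp
      qed
      then show ?thesis using x y by (simp add: E.M.minus_eq_zero_iff)
    qed
    then have "s = io (int N) a" by (rule U_eq_io[OF s a(1)])
    then show "s \<in> io (int N) ` EC (int N)" using a(1) by simp
  next
    fix \<tau> assume \<tau>: "\<And>c. c \<in> J \<Longrightarrow> \<tau> c \<in> carrier K"
    have "\<exists>a. a \<in> EC (1 + int N) \<and> (\<forall>b\<in>words (Suc N). cor b a = (if (j, b) \<in> J then \<tau> (j, b) else \<zero>\<^bsub>K\<^esub>))" for j
    proof -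
      have "(if (j, b) \<in> J then \<tau> (j, b) else \<zero>\<^bsub>K\<^esub>) \<in> carrier K" for b using \<tau> by simp
      then show ?thesis
        using cor_surj[of "Suc N" "\<lambda>b. if (j, b) \<in> J then \<tau> (j, b) else \<zero>\<^bsub>K\<^esub>"]
        unfolding of_nat_Suc by blast
    qed
    then obtain a where a: "\<And>j. a j \<in> EC (1 + int N)"
      "\<And>j b. b \<in> words (Suc N) \<Longrightarrow> cor b (a j) = (if (j, b) \<in> J then \<tau> (j, b) else \<zero>\<^bsub>K\<^esub>)" by metis
    obtain s where s: "s \<in> U (int N)" "\<And>j. j < e \<Longrightarrow> gg (int N) j s = a j"
      using U_surj[of a "int N"] a(1) by blast
    have "\<theta> c s = \<tau> c" if c: "c \<in> J" for c
    proof -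
      obtain j b where jb: "c = (j, b)" "j < e" "b \<in> words (Suc N)" using c by (auto simp: J_def)
      obtain b' j' where b': "b = b' @ [j']" "b' \<in> words N" "j' < e" using wE[OF jb(3)] by blast
      \<comment> \<open>The preimage was given zero reference coordinates, so the correction term
        drops out.\<close>
      have "(0, b' @ [0]) \<notin> J" using b' by (auto simp: J_def)
      then have "sub j b s = \<zero>\<^bsub>K\<^esub>" using b' s(2)[OF e0] a(2)[OF w0[OF b'(2) e0]] by (simp add: sub_def)
      moreover have "cor b (gg (int N) j s) = \<tau> c" using s(2)[OF jb(2)] a(2)[OF jb(3)] c jb(1) by simp
      ultimately show ?thesis using \<tau>[OF c] jb(1) by (simp add: th K.minus_zero_right)
    qed
    then show "\<exists>s\<in>U (int N). \<forall>c\<in>J. \<theta> c s = \<tau> c" using s(1) by blast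
  qed
qed

section \<open>The family of all functionals: finiteness, kernel and image\<close>

definition mlt :: "int \<Rightarrow> nat" where
  "mlt n = (if n = -1 then e else e ^ nat n * (e\<^sup>2 - 1))"

definition \<theta> :: "int \<Rightarrow> nat \<Rightarrow> 's \<Rightarrow> 'k" where
  "\<theta> n = (SOME \<theta>. coords n (mlt n) \<theta>)"

lemma coords_theta:
  assumes "n \<ge> -1"
  shows "coords n (mlt n) (\<theta> n)"
proof -
  have "\<exists>\<theta>. coords n (mlt n) \<theta>"
    using coords_minus_one coords_nat[of "nat n"] assms by (cases "n = -1") (auto simp: mlt_def)
  then show ?thesis unfolding \<theta>_def by (rule someI_ex)
qed

lemma theta_hom: "n \<ge> -1 \<Longrightarrow> c < mlt n \<Longrightarrow> \<theta> n c \<in> module_hom K (mcomp M n) (ring_module K)"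
  and theta_io: "n \<ge> -1 \<Longrightarrow> c < mlt n \<Longrightarrow> a \<in> EC n \<Longrightarrow> \<theta> n c (io n a) = \<zero>\<^bsub>K\<^esub>"
  and theta_ker: "n \<ge> -1 \<Longrightarrow> s \<in> U n \<Longrightarrow> (\<And>c. c < mlt n \<Longrightarrow> \<theta> n c s = \<zero>\<^bsub>K\<^esub>) \<Longrightarrow> s \<in> io n ` EC n"
  and theta_surj: "n \<ge> -1 \<Longrightarrow> (\<And>c. c < mlt n \<Longrightarrow> \<tau> c \<in> carrier K) \<Longrightarrow> \<exists>s\<in>U n. \<forall>c<mlt n. \<theta> n c s = \<tau> c"
  using coords_theta[of n] unfolding coords_def by blast+

text \<open>For \<open>b\<close> of large degree the product of \<open>b\<close> with
  \<open>s\<close> comes from E, where the functionals vanish. The bound depends on \<open>s\<close>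
  alone, not on \<open>b\<close> or \<open>c\<close>; it places the map to the dual copies in a
  direct sum instead of a product.\<close>

lemma theta_finite:
  assumes s: "s \<in> MC l"
  obtains B where "\<And>r c b. r + l \<ge> B \<Longrightarrow> r + l \<ge> -1 \<Longrightarrow> c < mlt (r + l) \<Longrightarrow> b \<in> EC r \<Longrightarrow>
    \<theta> (r + l) c (mact M r l b s) = \<zero>\<^bsub>K\<^esub>"
proof -
  obtain N where N: "\<forall>k\<ge>N. \<forall>b\<in>EC k. mact M k l b s \<in> io (k + l) ` EC (k + l)"
    using M_local[OF s] by blast
  show thesis
  proof (rule that[of "N + l"])
    fix r c b assume r: "r + l \<ge> N + l" "r + l \<ge> -1" "c < mlt (r + l)" "b \<in> EC r"
    then obtain a where "a \<in> EC (r + l)" "mact M r l b s = io (r + l) a" using N by auto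
    then show "\<theta> (r + l) c (mact M r l b s) = \<zero>\<^bsub>K\<^esub>" using theta_io r by simp
  qed
qed

text \<open>Descending induction on the degree k of the multipliers, starting from
  \<open>M_local\<close>. If E^(k+1) s lies in the image of E, then each b s with b in E^k lies in
  U, and vanishing of its coordinates puts it into the image. Below degree -1 the space U is zero
  because E is zero in the next degree. At k = 0 the multiplier is the unit.\<close>

lemma theta_kernel:
  assumes s: "s \<in> MC l"
    and z: "\<And>r c b. r + l \<ge> -1 \<Longrightarrow> c < mlt (r + l) \<Longrightarrow> b \<in> EC r \<Longrightarrow>
      \<theta> (r + l) c (mact M r l b s) = \<zero>\<^bsub>K\<^esub>"
  shows "s \<in> io l ` EC l"
proof -
  define P where "P k \<longleftrightarrow> (\<forall>b\<in>EC (int k). mact M (int k) l b s \<in> io (int k + l) ` EC (int k + l))" for k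
  obtain N where "\<forall>k\<ge>N. \<forall>b\<in>EC k. mact M k l b s \<in> io (k + l) ` EC (k + l)"
    using M_local[OF s] by blast
  then have "P (nat N)" by (simp add: P_def)
  moreover have "P k" if "P (Suc k)" for k
    unfolding P_def
  proof
    fix b assume b: "b \<in> EC (int k)"
    define t where "t = mact M (int k) l b s"
    have t: "t \<in> MC (int k + l)" using act_closed[OF b s] by (simp add: t_def)
    have vt: "mact M 1 (int k + l) (v i) t \<in> io (1 + (int k + l)) ` EC (1 + (int k + l))" if i: "i < e" for i
    proof -
      have "amult E 1 (int k) (v i) b \<in> EC (int (Suc k))"
        using amult_closed[OF v_closed[OF i] b] by simp
      then have "mact M (int (Suc k)) l (amult E 1 (int k) (v i) b) s \<in> io (int (Suc k) + l) ` EC (int (Suc k) + l)"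
        using \<open>P (Suc k)\<close> unfolding P_def by blast
      then show ?thesis
        using act_assoc[OF v_closed[OF i] b s] by (simp add: t_def add.assoc)
    qed
    then have tU: "t \<in> U (int k + l)" using t by (simp add: U_def)
    show "mact M (int k) l b s \<in> io (int k + l) ` EC (int k + l)"
    proof (cases "int k + l \<ge> -1")
      case True
      have "t \<in> io (int k + l) ` EC (int k + l)"
        by (rule theta_ker[OF True tU]) (use z[OF True _ b] in \<open>simp add: t_def\<close>)
      then show ?thesis by (simp add: t_def)
    next
      case False
      then have "mact M 1 (int k + l) (v i) t = \<zero>\<^bsub>mcomp M (1 + (int k + l))\<^esub>" if "i < e" for i
        using vt[OF that] E_neg[of "1 + (int k + l)"] module_hom_zero[OF E_module M_module io_mhom, of "1 + (int k + l)"] by auto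
      then have "t = \<zero>\<^bsub>mcomp M (int k + l)\<^esub>" using v_inj[OF t] by blast
      then have "t = io (int k + l) \<zero>\<^bsub>acomp E (int k + l)\<^esub>"
        using module_hom_zero[OF E_module M_module io_mhom] by simp
      then show ?thesis by (simp add: t_def)
    qed
  qed
  then have "P k \<Longrightarrow> P 0" for k by (induction k) auto
  ultimately have "P 0" by blast
  then have "mact M 0 l (aone E) s \<in> io (0 + l) ` EC (0 + l)"
    using one_closed unfolding P_def by auto
  then show ?thesis using act_one[OF s] by simp
qed

text \<open>Induction on the distance of \<open>l\<close> from the bound \<open>B\<close>, where
  everything prescribed vanishes and s = 0 works. Otherwise the shifted data b \<mapsto> \<phi>(b
  v_i) are realised by elements t_i one degree higher, and some \<open>s\<close> has v_i s = t_i. A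
  correction in U^l adjusts the values at the unit. It leaves positive multipliers alone, as v_i
  times the correction comes from E and is killed by every functional.\<close>

lemma theta_cosurj:
  assumes "\<And>r c. r + l \<ge> -1 \<Longrightarrow> c < mlt (r + l) \<Longrightarrow> \<phi> (r + l) c \<in> module_hom K (acomp E r) (ring_module K)"
    and "\<And>r c b. r + l \<ge> B \<Longrightarrow> b \<in> EC r \<Longrightarrow> \<phi> (r + l) c b = \<zero>\<^bsub>K\<^esub>"
  shows "\<exists>s\<in>MC l. \<forall>r c b. r + l \<ge> -1 \<longrightarrow> c < mlt (r + l) \<longrightarrow> b \<in> EC r \<longrightarrow>
    \<theta> (r + l) c (mact M r l b s) = \<phi> (r + l) c b"
  using assms
proof (induction "nat (B - l)" arbitrary: l \<phi>)
  case 0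
  have "\<theta> (r + l) c (mact M r l b \<zero>\<^bsub>mcomp M l\<^esub>) = \<phi> (r + l) c b"
    if r: "r + l \<ge> -1" and c: "c < mlt (r + l)" and b: "b \<in> EC r" for r c b
  proof -
    have "\<phi> (r + l) c b = \<zero>\<^bsub>K\<^esub>"
    proof (cases "r < 0")
      case True
      then have "b = \<zero>\<^bsub>acomp E r\<^esub>" using E_neg b by simp
      then show ?thesis using module_hom_zero[OF E_module Kmod 0(2)[OF r c]] by simp
    next
      case False
      then show ?thesis using 0(1) 0(3)[OF _ b] by simp
    qed
    then show ?thesis
      using module_hom_zero[OF M_module M_module act_hom_r[OF b]] module_hom_zero[OF M_module Kmod theta_hom[OF r c]]
      by simp
  qed
  then show ?case by (intro bexI[of _ "\<zero>\<^bsub>mcomp M l\<^esub>"]) auto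
next
  case (Suc k)
  note hom = Suc.prems(1) and fin = Suc.prems(2)
  have "\<exists>t. t \<in> MC (1 + l) \<and> (\<forall>r c b. r + (1 + l) \<ge> -1 \<longrightarrow> c < mlt (r + (1 + l)) \<longrightarrow>
      b \<in> EC r \<longrightarrow> \<theta> (r + (1 + l)) c (mact M r (1 + l) b t) = \<phi> (r + (1 + l)) c (amult E r 1 b (v i)))"
    if i: "i < e" for i
  proof -
    \<comment> \<open>The first index of the family is the total degree, so only the argument is
      shifted by \<open>v i\<close>.\<close>
    define \<psi> where "\<psi> = (\<lambda>n c b. \<phi> n c (amult E (n - (1 + l)) 1 b (v i)))"
    have 1: "k = nat (B - (1 + l))" using Suc.hyps(2) by simp
    have 2: "\<psi> (r + (1 + l)) c \<in> module_hom K (acomp E r) (ring_module K)"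
      if "r + (1 + l) \<ge> -1" "c < mlt (r + (1 + l))" for r c
    proof -
      have "\<phi> (r + 1 + l) c \<in> module_hom K (acomp E (r + 1)) (ring_module K)"
        using hom[of "r + 1" c] that by (simp add: add.assoc)
      then show ?thesis
        unfolding \<psi>_def using module_hom_compose[OF amult_hom_l[OF v_closed[OF i], of r]] by (simp add: add.assoc)
    qed
    have 3: "\<psi> (r + (1 + l)) c b = \<zero>\<^bsub>K\<^esub>" if "r + (1 + l) \<ge> B" "b \<in> EC r" for r c b
      using fin[of "r + 1" "amult E r 1 b (v i)" c] that amult_closed[OF that(2) v_closed[OF i]]
      by (simp add: \<psi>_def add.assoc)
    have "\<psi> (r + (1 + l)) c b = \<phi> (r + (1 + l)) c (amult E r 1 b (v i))" for r c b by (simp add: \<psi>_def)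
    then show ?thesis using Suc.hyps(1)[of "1 + l" \<psi>, OF 1 2 3] by auto
  qed
  then obtain t where t: "\<And>i. i < e \<Longrightarrow> t i \<in> MC (1 + l)"
    "\<And>i r c b. i < e \<Longrightarrow> r + (1 + l) \<ge> -1 \<Longrightarrow> c < mlt (r + (1 + l)) \<Longrightarrow> b \<in> EC r \<Longrightarrow>
      \<theta> (r + (1 + l)) c (mact M r (1 + l) b (t i)) = \<phi> (r + (1 + l)) c (amult E r 1 b (v i))"
    by metis
  obtain s where s: "s \<in> MC l" "\<And>i. i < e \<Longrightarrow> mact M 1 l (v i) s = t i"
    using v_surj[of t l] t(1) by blast
  have h0: "\<phi> l c \<in> module_hom K (acomp E 0) (ring_module K)" if "l \<ge> -1" "c < mlt l" for c
    using hom[of 0 c] that by simp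
  \<comment> \<open>Below degree -1 there are no coordinates to adjust, and any element of U
    serves.\<close>
  have "\<exists>x\<in>U l. l \<ge> -1 \<longrightarrow> (\<forall>c<mlt l. \<theta> l c x = \<phi> l c (aone E) \<ominus>\<^bsub>K\<^esub> \<theta> l c s)"
  proof (cases "l \<ge> -1")
    case True
    have "\<phi> l c (aone E) \<ominus>\<^bsub>K\<^esub> \<theta> l c s \<in> carrier K" if "c < mlt l" for c
      using module_homD(1)[OF h0[OF True that] one_closed] module_homD(1)[OF theta_hom[OF True that] s(1)] by simp
    then show ?thesis using theta_surj[OF True, of "\<lambda>c. \<phi> l c (aone E) \<ominus>\<^bsub>K\<^esub> \<theta> l c s"] by blast
  next
    case False
    then show ?thesis using io_U[of "\<zero>\<^bsub>acomp E l\<^esub>" l] by auto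
  qed
  then obtain x where x: "x \<in> U l" "\<And>c. l \<ge> -1 \<Longrightarrow> c < mlt l \<Longrightarrow> \<theta> l c x = \<phi> l c (aone E) \<ominus>\<^bsub>K\<^esub> \<theta> l c s" by blast
  have xM: "x \<in> MC l" by (rule U_M[OF x(1)])
  define y where "y = s \<oplus>\<^bsub>mcomp M l\<^esub> x"
  have y: "y \<in> MC l" using s(1) xM by (simp add: y_def)
  have "\<theta> (r + l) c (mact M r l b y) = \<phi> (r + l) c b"
    if r: "r + l \<ge> -1" and c: "c < mlt (r + l)" and b: "b \<in> EC r" for r c b
  proof -
    note fh = module_hom_compose[OF act_hom_l[OF y, of r] theta_hom[OF r c]]
    consider "r < 0" | "r = 0" | "r > 0" by linarith
    then show ?thesis
    proof cases
      case 1
      then have "b = \<zero>\<^bsub>acomp E r\<^esub>" using E_neg b by simp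
      then show ?thesis
        using module_hom_zero[OF E_module Kmod fh] module_hom_zero[OF E_module Kmod hom[OF r c]] by simp
    next
      \<comment> \<open>E^0 consists of multiples of the unit, so this case is the value fixed by
        the correction \<open>x\<close>.\<close>
      case 2
      then have l: "l \<ge> -1" and c': "c < mlt l" and b0: "b \<in> EC 0" using r c b by auto
      obtain k where k: "k \<in> carrier K" "b = k \<odot>\<^bsub>acomp E 0\<^esub> aone E" using E_0[OF b0] by blast
      note th = theta_hom[OF l c']
      have "\<theta> l c y = \<phi> l c (aone E)"
        using module_homD(2)[OF th s(1) xM] x(2)[OF l c'] module_homD(1)[OF th s(1)]
          module_homD(1)[OF h0[OF l c'] one_closed]
        by (simp add: y_def a_minus_def K.r_neg1 K.a_lcomm K.r_neg)
      moreover have "mact M 0 l b y = k \<odot>\<^bsub>mcomp M l\<^esub> y"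
        using module_homD(3)[OF act_hom_l[OF y, of 0] k(1) one_closed] k(2) act_one[OF y] by simp
      ultimately show ?thesis
        using 2 k module_homD(3)[OF th k(1) y] module_homD(3)[OF h0[OF l c'] k(1) one_closed] by simp
    next
      case 3
      define q where "q = r - 1"
      have q: "r = q + 1" "q \<ge> 0" using 3 by (auto simp: q_def)
      show ?thesis
        unfolding q(1)
      proof (rule span_eq[OF q(2) Kmod])
        show "(\<lambda>b. \<theta> (q + 1 + l) c (mact M (q + 1) l b y)) \<in> module_hom K (acomp E (q + 1)) (ring_module K)"
          using fh unfolding q(1) .
        show "\<phi> (q + 1 + l) c \<in> module_hom K (acomp E (q + 1)) (ring_module K)"
          using hom[OF r c] unfolding q(1) .
        show "b \<in> EC (q + 1)" using b q(1) by simp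
        fix b i assume b: "b \<in> EC q" and i: "i < e"
        have vx: "mact M 1 l (v i) x \<in> io (1 + l) ` EC (1 + l)" using x(1) i by (simp add: U_def)
        then obtain a where a: "a \<in> EC (1 + l)" "mact M 1 l (v i) x = io (1 + l) a" by blast
        have r': "q + (1 + l) \<ge> -1" "c < mlt (q + (1 + l))" using r c q(1) by (simp_all add: add.assoc)
        note th = theta_hom[OF r']
        have vy: "mact M 1 l (v i) y = t i \<oplus>\<^bsub>mcomp M (1 + l)\<^esub> io (1 + l) a"
          unfolding y_def module_homD(2)[OF act_hom_r[OF v_closed[OF i]] s(1) xM] s(2)[OF i] a(2) ..
        have "mact M (q + 1) l (amult E q 1 b (v i)) y =
            mact M q (1 + l) b (t i) \<oplus>\<^bsub>mcomp M (q + (1 + l))\<^esub> io (q + (1 + l)) (amult E q (1 + l) b a)"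
          unfolding act_assoc[OF b v_closed[OF i] y] vy io_act[OF b a(1)]
          by (rule module_homD(2)[OF act_hom_r[OF b] t(1)[OF i] io_closed[OF a(1)]])
        then have "\<theta> (q + (1 + l)) c (mact M (q + 1) l (amult E q 1 b (v i)) y) =
            \<theta> (q + (1 + l)) c (mact M q (1 + l) b (t i))"
          using module_homD(2)[OF th act_closed[OF b t(1)[OF i]] io_closed[OF amult_closed[OF b a(1)]]]
            theta_io[OF r' amult_closed[OF b a(1)]] module_homD(1)[OF th act_closed[OF b t(1)[OF i]]] by simp
        also have "\<dots> = \<phi> (q + (1 + l)) c (amult E q 1 b (v i))" by (rule t(2)[OF i r' b])
        finally show "\<theta> (q + 1 + l) c (mact M (q + 1) l (amult E q 1 b (v i)) y) = \<phi> (q + 1 + l) c (amult E q 1 b (v i))"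
          by (simp add: add.assoc)
      qed
    qed
  qed
  then show ?case using y by blast
qed

end

section \<open>Graded modules built from the dual\<close>

lemma gr_hom_D:
  assumes "f \<in> gr_hom K A j M N"
  shows "f n \<in> module_hom K (mcomp M n) (mcomp N (n + j))"
    and "a \<in> carrier (acomp A k) \<Longrightarrow> x \<in> carrier (mcomp M n) \<Longrightarrow> f (k + n) (mact M k n a x) =
      sgn_act (mcomp N (k + n + j)) (j * k) (mact N k (n + j) a (f n x))"
  using assms by (simp_all add: gr_hom_def)

lemma gr_hom_0I:
  assumes "\<And>n. f n \<in> module_hom K (mcomp M n) (mcomp N n)"
    and "\<And>k n a x. a \<in> carrier (acomp A k) \<Longrightarrow> x \<in> carrier (mcomp M n) \<Longrightarrow> f (k + n) (mact M k n a x) = mact N k n a (f n x)"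
  shows "f \<in> gr_hom K A 0 M N"
  using assms by (simp add: gr_hom_def)

lemma gr_hom_0D:
  assumes "f \<in> gr_hom K A 0 M N"
  shows "f n \<in> module_hom K (mcomp M n) (mcomp N n)"
    and "a \<in> carrier (acomp A k) \<Longrightarrow> x \<in> carrier (mcomp M n) \<Longrightarrow> f (k + n) (mact M k n a x) = mact N k n a (f n x)"
  using assms by (simp_all add: gr_hom_def)

lemma gr_mod:
  assumes "graded_left_module K A M"
  shows "module K (mcomp M n)"
    and "a \<in> carrier (acomp A k) \<Longrightarrow> mact M k n a \<in> module_hom K (mcomp M n) (mcomp M (k + n))"
    and "x \<in> carrier (mcomp M n) \<Longrightarrow> (\<lambda>a. mact M k n a x) \<in> module_hom K (acomp A k) (mcomp M (k + n))"
    and "x \<in> carrier (mcomp M n) \<Longrightarrow> mact M 0 n (aone A) x = x"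
    and "a \<in> carrier (acomp A l) \<Longrightarrow> b \<in> carrier (acomp A k) \<Longrightarrow> x \<in> carrier (mcomp M n) \<Longrightarrow>
        mact M (l + k) n (amult A l k a b) x = mact M l (k + n) a (mact M k n b x)"
  using assms unfolding graded_left_module_def by simp_all

lemma gr_act_closed:
  "graded_left_module K A M \<Longrightarrow> a \<in> carrier (acomp A k) \<Longrightarrow> x \<in> carrier (mcomp M n) \<Longrightarrow> mact M k n a x \<in> carrier (mcomp M (k + n))"
  using module_homD(1)[OF gr_mod(2)] .

lemma gr_shift_graded:
  assumes N: "graded_left_module K A N"
  shows "graded_left_module K A (gr_shift s N)"
  unfolding graded_left_module_def gr_shift_def gr_module.simps
proof (intro conjI allI ballI)
  note Nm = gr_mod(1)[OF N]
  fix n show "module K (mcomp N (n + s))" by (rule Nm)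
  fix k a assume a: "a \<in> carrier (acomp A k)"
  show "(\<lambda>x. sgn_act (mcomp N (k + n + s)) (k * s) (mact N k (n + s) a x)) \<in> module_hom K (mcomp N (n + s)) (mcomp N (k + n + s))"
    using module_hom_compose[OF gr_mod(2)[OF N a, of "n + s"] sgn_act_hom[OF Nm]] by (simp add: add.assoc)
next
  note Nm = gr_mod(1)[OF N]
  fix k n x assume x: "x \<in> carrier (mcomp N (n + s))"
  show "(\<lambda>a. sgn_act (mcomp N (k + n + s)) (k * s) (mact N k (n + s) a x)) \<in> module_hom K (acomp A k) (mcomp N (k + n + s))"
    using module_hom_compose[OF gr_mod(3)[OF N x, of k] sgn_act_hom[OF Nm]] by (simp add: add.assoc)
next
  fix n x assume x: "x \<in> carrier (mcomp N (n + s))"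
  show "sgn_act (mcomp N (0 + n + s)) (0 * s) (mact N 0 (n + s) (aone A) x) = x"
    using gr_mod(4)[OF N x] by simp
next
  note Nm = gr_mod(1)[OF N]
  fix l k n a b x
  assume a: "a \<in> carrier (acomp A l)" and b: "b \<in> carrier (acomp A k)" and x: "x \<in> carrier (mcomp N (n + s))"
  have bx: "mact N k (n + s) b x \<in> carrier (mcomp N (k + (n + s)))" by (rule gr_act_closed[OF N b x])
  have abx: "mact N l (k + (n + s)) a (mact N k (n + s) b x) \<in> carrier (mcomp N (l + (k + (n + s))))"
    by (rule gr_act_closed[OF N a bx])
  have "mact N l (k + (n + s)) a (sgn_act (mcomp N (k + (n + s))) (k * s) (mact N k (n + s) b x)) =
      sgn_act (mcomp N (l + (k + (n + s)))) (k * s) (mact N l (k + (n + s)) a (mact N k (n + s) b x))"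
    by (rule module_hom_sgn_act[OF Nm Nm gr_mod(2)[OF N a] bx])
  then show "sgn_act (mcomp N (l + k + n + s)) ((l + k) * s) (mact N (l + k) (n + s) (amult A l k a b) x) =
    sgn_act (mcomp N (l + (k + n) + s)) (l * s) (mact N l (k + n + s) a
      (sgn_act (mcomp N (k + n + s)) (k * s) (mact N k (n + s) b x)))"
    using gr_mod(5)[OF N a b x] sgn_act_sgn_act[OF Nm abx]
    by (simp add: add.assoc distrib_right)
qed

lemma gr_coprod_graded:
  assumes K: "cring K" and N: "\<And>j. j \<in> J \<Longrightarrow> graded_left_module K A (N j)"
  shows "graded_left_module K A (gr_coprod J N)"
  unfolding graded_left_module_def gr_coprod_def gr_module.simps
proof (intro conjI allI ballI)
  note Nm = gr_mod(1)[OF N]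
  fix n show "module K (coprod_module J (\<lambda>j. mcomp (N j) n))" by (intro coprod_module_module K Nm)
  fix k a assume a: "a \<in> carrier (acomp A k)"
  have cl: "(\<lambda>j\<in>J. mact (N j) k n a (x j)) \<in> carrier (coprod_module J (\<lambda>j. mcomp (N j) (k + n)))"
    if x: "x \<in> carrier (coprod_module J (\<lambda>j. mcomp (N j) n))" for x
  proof -
    have "{j \<in> J. mact (N j) k n a (x j) \<noteq> \<zero>\<^bsub>mcomp (N j) (k + n)\<^esub>} \<subseteq> {j \<in> J. x j \<noteq> \<zero>\<^bsub>mcomp (N j) n\<^esub>}"
      using module_hom_zero[OF Nm Nm gr_mod(2)[OF N a]] by auto
    then have "finite {j \<in> J. mact (N j) k n a (x j) \<noteq> \<zero>\<^bsub>mcomp (N j) (k + n)\<^esub>}"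
      by (rule finite_subset) (use x in auto)
    then show ?thesis
      using x by (auto intro!: gr_act_closed[OF N a] cong: conj_cong)
  qed
  show "(\<lambda>x. \<lambda>j\<in>J. mact (N j) k n a (x j)) \<in> module_hom K (coprod_module J (\<lambda>j. mcomp (N j) n)) (coprod_module J (\<lambda>j. mcomp (N j) (k + n)))"
    by (intro module_homI cl; simp only: coprod_module_simps; intro ext)
      (auto simp: restrict_def intro!: module_homD(2,3)[OF gr_mod(2)[OF N a]] dest: PiE_mem)
next
  note Nm = gr_mod(1)[OF N]
  fix k n x assume x: "x \<in> carrier (coprod_module J (\<lambda>j. mcomp (N j) n))"
  have cl: "(\<lambda>j\<in>J. mact (N j) k n a (x j)) \<in> carrier (coprod_module J (\<lambda>j. mcomp (N j) (k + n)))"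
    if a: "a \<in> carrier (acomp A k)" for a
  proof -
    have "{j \<in> J. mact (N j) k n a (x j) \<noteq> \<zero>\<^bsub>mcomp (N j) (k + n)\<^esub>} \<subseteq> {j \<in> J. x j \<noteq> \<zero>\<^bsub>mcomp (N j) n\<^esub>}"
      using module_hom_zero[OF Nm Nm gr_mod(2)[OF N a]] by auto
    then have "finite {j \<in> J. mact (N j) k n a (x j) \<noteq> \<zero>\<^bsub>mcomp (N j) (k + n)\<^esub>}"
      by (rule finite_subset) (use x in auto)
    then show ?thesis
      using x by (auto intro!: gr_act_closed[OF N a] cong: conj_cong)
  qed
  show "(\<lambda>a. \<lambda>j\<in>J. mact (N j) k n a (x j)) \<in> module_hom K (acomp A k) (coprod_module J (\<lambda>j. mcomp (N j) (k + n)))"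
    by (intro module_homI cl; (simp only: coprod_module_simps)?; (intro ext)?)
      (use x in \<open>auto simp: restrict_def intro!: module_homD(2,3)[OF gr_mod(3)[OF N]] dest: PiE_mem\<close>)
next
  fix n x assume x: "x \<in> carrier (coprod_module J (\<lambda>j. mcomp (N j) n))"
  then show "(\<lambda>j\<in>J. mact (N j) 0 n (aone A) (x j)) = x"
    by (intro ext) (auto simp: restrict_def PiE_def extensional_def intro!: gr_mod(4)[OF N] dest: Pi_mem)
next
  fix l k n a b x
  assume a: "a \<in> carrier (acomp A l)" and b: "b \<in> carrier (acomp A k)"
    and x: "x \<in> carrier (coprod_module J (\<lambda>j. mcomp (N j) n))"
  then show "(\<lambda>j\<in>J. mact (N j) (l + k) n (amult A l k a b) (x j)) =
     (\<lambda>j\<in>J. mact (N j) l (k + n) a ((\<lambda>j\<in>J. mact (N j) k n b (x j)) j))"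
    by (intro restrict_ext) (auto intro!: gr_mod(5)[OF N a b] dest: PiE_mem)
qed

lemma gr_dsum_graded:
  assumes M: "graded_left_module K A M" and N: "graded_left_module K A N"
  shows "graded_left_module K A (gr_dsum M N)"
  unfolding graded_left_module_def gr_dsum_def gr_module.simps
proof (intro conjI allI ballI)
  fix n show "module K (dsum_module (mcomp M n) (mcomp N n))" by (intro dsum_module_module gr_mod(1)[OF M] gr_mod(1)[OF N])
  fix k a assume a: "a \<in> carrier (acomp A k)"
  show "(\<lambda>x. (mact M k n a (fst x), mact N k n a (snd x))) \<in>
     module_hom K (dsum_module (mcomp M n) (mcomp N n)) (dsum_module (mcomp M (k + n)) (mcomp N (k + n)))"
    by (intro module_homI) (auto simp: module_homD[OF gr_mod(2)[OF M a]] module_homD[OF gr_mod(2)[OF N a]])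
next
  fix k n x assume x: "x \<in> carrier (dsum_module (mcomp M n) (mcomp N n))"
  then have x': "fst x \<in> carrier (mcomp M n)" "snd x \<in> carrier (mcomp N n)" by auto
  show "(\<lambda>a. (mact M k n a (fst x), mact N k n a (snd x))) \<in>
     module_hom K (acomp A k) (dsum_module (mcomp M (k + n)) (mcomp N (k + n)))"
    by (intro module_homI)
      (auto simp: module_homD[OF gr_mod(3)[OF M x'(1)]] module_homD[OF gr_mod(3)[OF N x'(2)]])
qed (auto simp: gr_mod(4,5)[OF M] gr_mod(4,5)[OF N])

lemma gr_hom_coprod:
  assumes K: "cring K" and f: "\<And>j. j \<in> J \<Longrightarrow> f j \<in> gr_hom K A 0 M (N j)"
    and fin: "\<And>n x. x \<in> carrier (mcomp M n) \<Longrightarrow> finite {j \<in> J. f j n x \<noteq> \<zero>\<^bsub>mcomp (N j) n\<^esub>}"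
  shows "(\<lambda>n x. \<lambda>j\<in>J. f j n x) \<in> gr_hom K A 0 M (gr_coprod J N)"
proof (rule gr_hom_0I)
  fix n
  have cl: "(\<lambda>j\<in>J. f j n x) \<in> carrier (coprod_module J (\<lambda>j. mcomp (N j) n))" if "x \<in> carrier (mcomp M n)" for x
    using fin[OF that] that by (auto intro!: module_homD(1)[OF gr_hom_0D(1)[OF f]] cong: conj_cong)
  show "(\<lambda>x. \<lambda>j\<in>J. f j n x) \<in> module_hom K (mcomp M n) (mcomp (gr_coprod J N) n)"
    unfolding gr_coprod_def gr_module.simps
    by (intro module_homI cl; (simp only: coprod_module_simps)?; (intro ext)?)
      (auto simp: restrict_def module_homD[OF gr_hom_0D(1)[OF f]])
next
  fix k n a x assume "a \<in> carrier (acomp A k)" "x \<in> carrier (mcomp M n)"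
  then show "(\<lambda>j\<in>J. f j (k + n) (mact M k n a x)) = mact (gr_coprod J N) k n a (\<lambda>j\<in>J. f j n x)"
    unfolding gr_coprod_def gr_module.simps by (intro restrict_ext) (auto simp: gr_hom_0D(2)[OF f])
qed

lemma gr_hom_dsum:
  assumes "f \<in> gr_hom K A 0 M N" "g \<in> gr_hom K A 0 M L"
  shows "(\<lambda>n x. (f n x, g n x)) \<in> gr_hom K A 0 M (gr_dsum N L)"
  by (intro gr_hom_0I module_homI)
    (auto simp: gr_dsum_def module_homD[OF gr_hom_0D(1)[OF assms(1)]] module_homD[OF gr_hom_0D(1)[OF assms(2)]]
      gr_hom_0D(2)[OF assms(1)] gr_hom_0D(2)[OF assms(2)])

lemma hom_module_neg:
  assumes M: "module R M" and N: "module R N" and f: "f \<in> carrier (hom_module R M N)" and x: "x \<in> carrier M"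
  shows "(\<ominus>\<^bsub>hom_module R M N\<^esub> f) x = \<ominus>\<^bsub>N\<^esub> f x"
proof -
  interpret H: module R "hom_module R M N" by (rule hom_module_module(2)[OF M N])
  interpret N: module R N by fact
  have "\<ominus>\<^bsub>hom_module R M N\<^esub> f = (\<ominus>\<^bsub>R\<^esub> \<one>\<^bsub>R\<^esub>) \<odot>\<^bsub>hom_module R M N\<^esub> f"
    using H.smult_l_minus[OF H.R.one_closed f] H.smult_one[OF f] by (simp only:)
  then show ?thesis using f x module_homD(1)[of f R M N x] by (simp add: N.smult_l_minus)
qed

lemma hom_module_sgn_act:
  assumes M: "module R M" and N: "module R N" and f: "f \<in> carrier (hom_module R M N)" and x: "x \<in> carrier M"
  shows "(sgn_act (hom_module R M N) k f) x = sgn_act N k (f x)"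
  using hom_module_neg[OF assms] by (simp add: sgn_act_def)

lemma sgn_act_eq_zero_iff:
  assumes "module R M" "x \<in> carrier M"
  shows "sgn_act M k x = \<zero>\<^bsub>M\<^esub> \<longleftrightarrow> x = \<zero>\<^bsub>M\<^esub>"
  using sgn_act_sgn_act[OF assms, of k k] sgn_act_zero[OF assms(1), of k] by (auto simp: sgn_act_def)

lemma sgn_act_cancel:
  assumes "module R M" "x \<in> carrier M"
  shows "sgn_act M k (sgn_act M k x) = x"
  using sgn_act_sgn_act[OF assms, of k k] by (simp add: sgn_act_def)

lemma even_mult_succ: "even (- (k * k) - k :: int)"
  by simp

section \<open>The graded dual of E and the map onto its shifted copies\<close>

context stable_pair
begin

abbreviation I :: "('k, 'e, 'e \<Rightarrow> 'k) gr_module" where "I \<equiv> gr_dual K E"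

lemma I_comp: "mcomp I n = hom_module K (acomp E (- n)) (ring_module K)"
  by (simp add: gr_dual_def)

lemma I_act: "mact I k n a f = (\<lambda>b \<in> EC (- (k + n)).
    sgn_act (ring_module K) (k * (n + - (k + n))) (f (amult E (- (k + n)) k b a)))"
  by (simp add: gr_dual_def)

lemma I_carrier: "f \<in> carrier (mcomp I n) \<longleftrightarrow>
    f \<in> module_hom K (acomp E (- n)) (ring_module K) \<and> f \<in> extensional (EC (- n))"
  by (simp add: I_comp)

lemma amult_dual:
  assumes "a \<in> EC k" "b \<in> EC (- (k + n))"
  shows "amult E (- (k + n)) k b a \<in> EC (- n)"
  using amult_closed[OF assms(2,1)] by simp

lemma I_act_closed:
  assumes a: "a \<in> EC k" and f: "f \<in> carrier (mcomp I n)"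
  shows "mact I k n a f \<in> carrier (mcomp I (k + n))"
proof -
  have "(\<lambda>b. amult E (- (k + n)) k b a) \<in> module_hom K (acomp E (- (k + n))) (acomp E (- n))"
    using amult_hom_l[OF a, of "- (k + n)"] by simp
  then have "(\<lambda>b. sgn_act (ring_module K) (k * (n + - (k + n))) (f (amult E (- (k + n)) k b a)))
      \<in> module_hom K (acomp E (- (k + n))) (ring_module K)"
    using f by (intro module_hom_compose[OF module_hom_compose sgn_act_hom[OF Kmod]]) (auto simp: I_carrier)
  then have "mact I k n a f \<in> module_hom K (acomp E (- (k + n))) (ring_module K)"
    unfolding I_act by (rule module_hom_cong[OF E_module]) simp
  then show ?thesis by (auto simp: I_carrier I_act)
qed

lemma I_graded: "graded_left_module K E I"
  unfolding graded_left_module_def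
proof (intro conjI allI ballI)
  fix n show "module K (mcomp I n)" unfolding I_comp by (rule hom_module_module(2)[OF E_module Kmod])
  fix k a assume a: "a \<in> EC k"
  note s = module_homD[OF sgn_act_hom[OF Kmod, of "k * (n + - (k + n))"], simplified]
  show "mact I k n a \<in> module_hom K (mcomp I n) (mcomp I (k + n))"
  proof (intro module_homI I_act_closed[OF a])
    fix f assume f: "f \<in> carrier (mcomp I n)"
    have fc: "f (amult E (- (k + n)) k b a) \<in> carrier K" if "b \<in> EC (- (k + n))" for b
      using module_homD(1)[of f K "acomp E (- n)" "ring_module K" "amult E (- (k + n)) k b a"] f amult_dual[OF a that]
      by (simp add: I_carrier del: minus_add_distrib)
    {
      fix r assume r: "r \<in> carrier K"
      show "mact I k n a (r \<odot>\<^bsub>mcomp I n\<^esub> f) = r \<odot>\<^bsub>mcomp I (k + n)\<^esub> mact I k n a f"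
        unfolding I_act I_comp hom_module_simps
        using r fc amult_dual[OF a] s(3)[OF r fc] by (intro restrict_ext) simp
    }
    fix g assume g: "g \<in> carrier (mcomp I n)"
    have gc: "g (amult E (- (k + n)) k b a) \<in> carrier K" if "b \<in> EC (- (k + n))" for b
      using module_homD(1)[of g K "acomp E (- n)" "ring_module K" "amult E (- (k + n)) k b a"] g amult_dual[OF a that]
      by (simp add: I_carrier del: minus_add_distrib)
    show "mact I k n a (f \<oplus>\<^bsub>mcomp I n\<^esub> g) = mact I k n a f \<oplus>\<^bsub>mcomp I (k + n)\<^esub> mact I k n a g"
      unfolding I_act I_comp hom_module_simps
      using fc gc amult_dual[OF a] s(2)[OF fc gc] by (intro restrict_ext) simp
  qed
next
  fix k n f assume f: "f \<in> carrier (mcomp I n)"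
  then have fh: "f \<in> module_hom K (acomp E (- n)) (ring_module K)" by (simp add: I_carrier)
  have h: "(\<lambda>a. sgn_act (ring_module K) (k * (n + - (k + n))) (f (amult E (- (k + n)) k b a))) \<in> module_hom K (acomp E k) (ring_module K)"
    if b: "b \<in> EC (- (k + n))" for b
  proof -
    have "amult E (- (k + n)) k b \<in> module_hom K (acomp E k) (acomp E (- n))"
      using amult_hom_r[OF b, of k] by simp
    then show ?thesis by (intro module_hom_compose[OF module_hom_compose[OF _ fh] sgn_act_hom[OF Kmod]])
  qed
  show "(\<lambda>a. mact I k n a f) \<in> module_hom K (acomp E k) (mcomp I (k + n))"
  proof (intro module_homI I_act_closed f)
    fix a assume a: "a \<in> EC k"
    {
      fix r assume r: "r \<in> carrier K"
      show "mact I k n (r \<odot>\<^bsub>acomp E k\<^esub> a) f = r \<odot>\<^bsub>mcomp I (k + n)\<^esub> mact I k n a f"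
        unfolding I_act I_comp hom_module_simps
        using module_homD(3)[OF h r a] by (intro restrict_ext) simp
    }
    fix b assume b: "b \<in> EC k"
    show "mact I k n (a \<oplus>\<^bsub>acomp E k\<^esub> b) f = mact I k n a f \<oplus>\<^bsub>mcomp I (k + n)\<^esub> mact I k n b f"
      unfolding I_act I_comp hom_module_simps
      using module_homD(2)[OF h a b] by (intro restrict_ext) simp
  qed
next
  fix n f assume f: "f \<in> carrier (mcomp I n)"
  then show "mact I 0 n (aone E) f = f"
    by (intro ext) (auto simp: I_act one_r I_carrier extensional_def)
next
  fix l k n a b f
  assume a: "a \<in> EC l" and b: "b \<in> EC k" and f: "f \<in> carrier (mcomp I n)"
  show "mact I (l + k) n (amult E l k a b) f = mact I l (k + n) a (mact I k n b f)"
  proof (rule ext)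
    fix c
    show "mact I (l + k) n (amult E l k a b) f c = mact I l (k + n) a (mact I k n b f) c"
    proof (cases "c \<in> EC (- (l + (k + n)))")
      case True
      have ca: "amult E (- (l + (k + n))) l c a \<in> EC (- (k + n))" by (rule amult_dual[OF a True])
      have cab: "amult E (- (k + n)) k (amult E (- (l + (k + n))) l c a) b \<in> EC (- n)"
        by (rule amult_dual[OF b ca])
      let ?y = "f (amult E (- (k + n)) k (amult E (- (l + (k + n))) l c a) b)"
      have fh: "f \<in> module_hom K (acomp E (- n)) (ring_module K)" using f by (simp add: I_carrier)
      have y: "?y \<in> carrier (ring_module K)" by (rule module_homD(1)[OF fh cab])
      have ass: "amult E (- (l + (k + n))) (l + k) c (amult E l k a b) =
          amult E (- (k + n)) k (amult E (- (l + (k + n))) l c a) b"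
        using amult_assoc[OF True a b] by simp
      \<comment> \<open>The exponents reduce to -(l + k)^2 and -l^2 - k^2, which differ by the even
        number 2 l k.\<close>
      have "even ((l + k) * (n + - (l + k + n)) - (l * (k + n + - (l + (k + n))) + k * (n + - (k + n))))"
        by (simp add: algebra_simps)
      note sc = sgn_act_cong[OF this]
      have "mact I (l + k) n (amult E l k a b) f c = sgn_act (ring_module K) ((l + k) * (n + - (l + k + n))) ?y"
        using True ass by (simp add: I_act add.assoc)
      also have "\<dots> = sgn_act (ring_module K) (l * (k + n + - (l + (k + n)))) (sgn_act (ring_module K) (k * (n + - (k + n))) ?y)"
        unfolding sc sgn_act_sgn_act[OF Kmod y] ..
      also have "\<dots> = mact I l (k + n) a (mact I k n b f) c"
        using True ca by (simp add: I_act)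
      finally show ?thesis .
    next
      case False
      then show ?thesis by (simp add: I_act add.assoc)
    qed
  qed
qed

text \<open>The coinduced map: a linear functional on degree \<open>- s\<close> of M yields a
  homomorphism from M to the shift of I by \<open>s\<close>. The sign (-1)^(l(s+1)) balances those
  in the action on the dual and in the shift.\<close>

definition co :: "int \<Rightarrow> ('s \<Rightarrow> 'k) \<Rightarrow> int \<Rightarrow> 's \<Rightarrow> ('e \<Rightarrow> 'k)" where
  "co s f l x = (\<lambda>b\<in>EC (- (l + s)). sgn_act (ring_module K) (l * (s + 1)) (f (mact M (- (l + s)) l b x)))"

lemma shift_comp: "mcomp (gr_shift s N) n = mcomp N (n + s)"
  by (simp add: gr_shift_def)

lemma act_dual:
  assumes "b \<in> EC (- (l + s))" "x \<in> MC l"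
  shows "mact M (- (l + s)) l b x \<in> MC (- s)"
  using act_closed[OF assms] by simp

lemma co_gr_hom:
  assumes f: "f \<in> module_hom K (mcomp M (- s)) (ring_module K)"
  shows "co s f \<in> gr_hom K E 0 M (gr_shift s I)"
proof (rule gr_hom_0I)
  fix l
  have cl: "co s f l x \<in> carrier (mcomp I (l + s))" if x: "x \<in> MC l" for x
  proof -
    have "(\<lambda>b. mact M (- (l + s)) l b x) \<in> module_hom K (acomp E (- (l + s))) (mcomp M (- s))"
      using act_hom_l[OF x, of "- (l + s)"] by simp
    from module_hom_compose[OF module_hom_compose[OF this f] sgn_act_hom[OF Kmod, of "l * (s + 1)"]]
    have "co s f l x \<in> module_hom K (acomp E (- (l + s))) (ring_module K)"
      by (rule module_hom_cong[OF E_module]) (simp add: co_def)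
    then show ?thesis by (simp add: I_carrier) (simp add: co_def)
  qed
  have h: "(\<lambda>x. sgn_act (ring_module K) (l * (s + 1)) (f (mact M (- (l + s)) l b x))) \<in> module_hom K (mcomp M l) (ring_module K)"
    if b: "b \<in> EC (- (l + s))" for b
  proof -
    have "mact M (- (l + s)) l b \<in> module_hom K (mcomp M l) (mcomp M (- s))"
      using act_hom_r[OF b, of l] by simp
    then show ?thesis by (intro module_hom_compose[OF module_hom_compose[OF _ f] sgn_act_hom[OF Kmod]])
  qed
  show "co s f l \<in> module_hom K (mcomp M l) (mcomp (gr_shift s I) l)"
    unfolding shift_comp
  proof (intro module_homI cl)
    fix x assume x: "x \<in> MC l"
    {
      fix r assume r: "r \<in> carrier K"
      show "co s f l (r \<odot>\<^bsub>mcomp M l\<^esub> x) = r \<odot>\<^bsub>mcomp I (l + s)\<^esub> co s f l x"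
        unfolding I_comp hom_module_simps co_def using module_homD(3)[OF h r x] by (intro restrict_ext) simp
    }
    fix y assume y: "y \<in> MC l"
    show "co s f l (x \<oplus>\<^bsub>mcomp M l\<^esub> y) = co s f l x \<oplus>\<^bsub>mcomp I (l + s)\<^esub> co s f l y"
      unfolding I_comp hom_module_simps co_def using module_homD(2)[OF h x y] by (intro restrict_ext) simp
  qed
  fix k a x assume a: "a \<in> EC k" and x: "x \<in> MC l"
  have coI: "co s f l x \<in> carrier (mcomp I (l + s))" by (rule cl[OF x])
  have cI: "mact I k (l + s) a (co s f l x) \<in> carrier (mcomp I (k + (l + s)))" by (rule I_act_closed[OF a coI])
  show "co s f (k + l) (mact M k l a x) = mact (gr_shift s I) k l a (co s f l x)"
  proof (rule ext)
    fix b
    have r: "mact (gr_shift s I) k l a (co s f l x) = sgn_act (mcomp I (k + (l + s))) (k * s) (mact I k (l + s) a (co s f l x))"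
      by (simp add: gr_shift_def add.assoc)
    show "co s f (k + l) (mact M k l a x) b = mact (gr_shift s I) k l a (co s f l x) b"
    proof (cases "b \<in> EC (- (k + (l + s)))")
      case True
      have ba: "amult E (- (k + (l + s))) k b a \<in> EC (- (l + s))" by (rule amult_dual[OF a True])
      let ?y = "f (mact M (- (l + s)) l (amult E (- (k + (l + s))) k b a) x)"
      have y: "?y \<in> carrier (ring_module K)" by (rule module_homD(1)[OF f act_dual[OF ba x]])
      have ass: "mact M (- (k + (l + s))) (k + l) b (mact M k l a x) = mact M (- (l + s)) l (amult E (- (k + (l + s))) k b a) x"
        using act_assoc[OF True a x] by simp
      \<comment> \<open>All terms cancel except -k^2 - k, minus a product of two consecutive
        integers.\<close>
      have "even (k * s + (k * (l + s + - (k + (l + s))) + l * (s + 1)) - (k + l) * (s + 1))"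
        using even_mult_succ[of k] by (simp add: algebra_simps)
      note sc = sgn_act_cong[OF this]
      have "mact (gr_shift s I) k l a (co s f l x) b =
          sgn_act (ring_module K) (k * s) (mact I k (l + s) a (co s f l x) b)"
        unfolding r I_comp using hom_module_sgn_act[OF E_module Kmod _ True] cI by (simp only: I_comp)
      also have "\<dots> = sgn_act (ring_module K) (k * s) (sgn_act (ring_module K) (k * (l + s + - (k + (l + s)))) (sgn_act (ring_module K) (l * (s + 1)) ?y))"
        using True ba by (simp add: I_act co_def)
      also have "\<dots> = sgn_act (ring_module K) ((k + l) * (s + 1)) ?y"
        unfolding sgn_act_sgn_act[OF Kmod y] sgn_act_sgn_act[OF Kmod sgn_act_closed[OF Kmod y]] sc by (rule refl)
      also have "\<dots> = co s f (k + l) (mact M k l a x) b"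
        using True ass by (simp add: co_def add.assoc)
      finally show ?thesis by simp
    next
      case False
      have "sgn_act (mcomp I (k + (l + s))) (k * s) (mact I k (l + s) a (co s f l x)) \<in> carrier (mcomp I (k + (l + s)))"
        by (rule sgn_act_closed[OF gr_mod(1)[OF I_graded] cI])
      then show ?thesis using False unfolding r I_carrier by (auto simp: co_def extensional_def add.assoc)
    qed
  qed
qed

lemma co_zero_iff:
  assumes f: "f \<in> module_hom K (mcomp M (- s)) (ring_module K)" and x: "x \<in> MC l"
  shows "co s f l x = \<zero>\<^bsub>mcomp (gr_shift s I) l\<^esub> \<longleftrightarrow> (\<forall>b\<in>EC (- (l + s)). f (mact M (- (l + s)) l b x) = \<zero>\<^bsub>K\<^esub>)"
proof -
  have "co s f l x = \<zero>\<^bsub>mcomp (gr_shift s I) l\<^esub> \<longleftrightarrow>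
      (\<forall>b\<in>EC (- (l + s)). sgn_act (ring_module K) (l * (s + 1)) (f (mact M (- (l + s)) l b x)) = \<zero>\<^bsub>ring_module K\<^esub>)"
    unfolding shift_comp I_comp hom_module_simps co_def by (simp add: fun_eq_iff restrict_def) blast
  also have "\<dots> \<longleftrightarrow> (\<forall>b\<in>EC (- (l + s)). f (mact M (- (l + s)) l b x) = \<zero>\<^bsub>K\<^esub>)"
    using sgn_act_eq_zero_iff[OF Kmod module_homD(1)[OF f act_dual[OF _ x]]] by simp
  finally show ?thesis .
qed

definition target where
  "target = gr_dsum (gr_power (gr_shift 1 I) e)
     (gr_coprod UNIV (\<lambda>i::nat. gr_power (gr_shift (- int i) I) (e ^ i * (e\<^sup>2 - 1))))"

text \<open>A functional on degree n gives a map to the shift of I by -n. The functionals in degree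
  -1 therefore land in the copies shifted by 1, and those in degree i \<ge> 0 in the copies shifted
  by -i.\<close>

definition p where
  "p l x = ((\<lambda>c\<in>{..<e}. co 1 (\<theta> (-1) c) l x),
     (\<lambda>i\<in>UNIV. \<lambda>c\<in>{..<e ^ i * (e\<^sup>2 - 1)}. co (- int i) (\<theta> (int i) c) l x))"

lemma theta_hom':
  "c < e \<Longrightarrow> \<theta> (-1) c \<in> module_hom K (mcomp M (- 1)) (ring_module K)"
  "c < e ^ i * (e\<^sup>2 - 1) \<Longrightarrow> \<theta> (int i) c \<in> module_hom K (mcomp M (- (- int i))) (ring_module K)"
  using theta_hom[of "-1" c] theta_hom[of "int i" c] by (simp_all add: mlt_def)

lemma target_graded: "graded_left_module K E target"
  unfolding target_def gr_power_def
  by (intro gr_dsum_graded gr_coprod_graded gr_shift_graded I_graded K.is_cring)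

lemma power_zero: "\<zero>\<^bsub>mcomp (gr_power N r) n\<^esub> = (\<lambda>c\<in>{..<r}. \<zero>\<^bsub>mcomp N n\<^esub>)"
  by (simp add: gr_power_def gr_coprod_def)

lemma comp_zero:
  assumes i: "int i \<ge> B" and B: "\<And>r c b. r + l \<ge> B \<Longrightarrow> r + l \<ge> -1 \<Longrightarrow> c < mlt (r + l) \<Longrightarrow> b \<in> EC r \<Longrightarrow>
    \<theta> (r + l) c (mact M r l b x) = \<zero>\<^bsub>K\<^esub>" and x: "x \<in> MC l"
  shows "(\<lambda>c\<in>{..<e ^ i * (e\<^sup>2 - 1)}. co (- int i) (\<theta> (int i) c) l x) =
    \<zero>\<^bsub>mcomp (gr_power (gr_shift (- int i) I) (e ^ i * (e\<^sup>2 - 1))) l\<^esub>"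
  unfolding power_zero
proof (intro restrict_ext)
  fix c assume "c \<in> {..<e ^ i * (e\<^sup>2 - 1)}"
  then have c: "c < e ^ i * (e\<^sup>2 - 1)" by simp
  show "co (- int i) (\<theta> (int i) c) l x = \<zero>\<^bsub>mcomp (gr_shift (- int i) I) l\<^esub>"
    unfolding co_zero_iff[OF theta_hom'(2)[OF c] x]
    using B[of "- (l + - int i)" c] i c by (simp add: mlt_def)
qed

lemma p_gr_hom: "p \<in> gr_hom K E 0 M target"
proof -
  have 1: "(\<lambda>l x. \<lambda>c\<in>{..<e}. co 1 (\<theta> (-1) c) l x) \<in> gr_hom K E 0 M (gr_power (gr_shift 1 I) e)"
    unfolding gr_power_def
    by (rule gr_hom_coprod[OF K.is_cring co_gr_hom]) (auto intro: theta_hom')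
  have 2: "(\<lambda>l x. \<lambda>c\<in>{..<e ^ i * (e\<^sup>2 - 1)}. co (- int i) (\<theta> (int i) c) l x) \<in>
      gr_hom K E 0 M (gr_power (gr_shift (- int i) I) (e ^ i * (e\<^sup>2 - 1)))" for i
    unfolding gr_power_def
    by (rule gr_hom_coprod[OF K.is_cring co_gr_hom[OF theta_hom'(2)]]) auto
  have 3: "(\<lambda>l x. \<lambda>i\<in>UNIV. \<lambda>c\<in>{..<e ^ i * (e\<^sup>2 - 1)}. co (- int i) (\<theta> (int i) c) l x) \<in>
      gr_hom K E 0 M (gr_coprod UNIV (\<lambda>i::nat. gr_power (gr_shift (- int i) I) (e ^ i * (e\<^sup>2 - 1))))"
  proof (rule gr_hom_coprod[OF K.is_cring 2])
    fix l x assume x: "x \<in> MC l"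
    obtain B where B: "\<And>r c b. r + l \<ge> B \<Longrightarrow> r + l \<ge> -1 \<Longrightarrow> c < mlt (r + l) \<Longrightarrow> b \<in> EC r \<Longrightarrow>
      \<theta> (r + l) c (mact M r l b x) = \<zero>\<^bsub>K\<^esub>" using theta_finite[OF x] by blast
    have "{i \<in> UNIV. (\<lambda>c\<in>{..<e ^ i * (e\<^sup>2 - 1)}. co (- int i) (\<theta> (int i) c) l x) \<noteq>
        \<zero>\<^bsub>mcomp (gr_power (gr_shift (- int i) I) (e ^ i * (e\<^sup>2 - 1))) l\<^esub>} \<subseteq> {..<nat B}"
    proof
      fix i assume "i \<in> {i \<in> UNIV. (\<lambda>c\<in>{..<e ^ i * (e\<^sup>2 - 1)}. co (- int i) (\<theta> (int i) c) l x) \<noteq>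
        \<zero>\<^bsub>mcomp (gr_power (gr_shift (- int i) I) (e ^ i * (e\<^sup>2 - 1))) l\<^esub>}"
      then have "\<not> int i \<ge> B" using comp_zero[OF _ B x, of i] by auto
      then show "i \<in> {..<nat B}" by simp
    qed
    then show "finite {i \<in> UNIV. (\<lambda>c\<in>{..<e ^ i * (e\<^sup>2 - 1)}. co (- int i) (\<theta> (int i) c) l x) \<noteq>
        \<zero>\<^bsub>mcomp (gr_power (gr_shift (- int i) I) (e ^ i * (e\<^sup>2 - 1))) l\<^esub>}"
      by (rule finite_subset) simp
  qed
  show ?thesis unfolding target_def p_def[abs_def] by (rule gr_hom_dsum[OF 1 3])
qed

lemma target_zero: "\<zero>\<^bsub>mcomp target l\<^esub> = ((\<lambda>c\<in>{..<e}. \<zero>\<^bsub>mcomp (gr_shift 1 I) l\<^esub>),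
    (\<lambda>i\<in>UNIV. \<lambda>c\<in>{..<e ^ i * (e\<^sup>2 - 1)}. \<zero>\<^bsub>mcomp (gr_shift (- int i) I) l\<^esub>))"
  by (simp add: target_def gr_dsum_def power_zero) (simp add: gr_coprod_def power_zero)

lemma restrict_eq_iff: "restrict f A = restrict g A \<longleftrightarrow> (\<forall>x\<in>A. f x = g x)"
  by (auto simp: fun_eq_iff restrict_def)

text \<open>The separate component for degree -1 and the family over the natural numbers are merged
  into one condition over all degrees from -1 on, the form in which the kernel was computed.\<close>

lemma p_zero_iff:
  assumes x: "x \<in> MC l"
  shows "p l x = \<zero>\<^bsub>mcomp target l\<^esub> \<longleftrightarrow> (\<forall>r c b. r + l \<ge> -1 \<longrightarrow> c < mlt (r + l) \<longrightarrow> b \<in> EC r \<longrightarrow>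
    \<theta> (r + l) c (mact M r l b x) = \<zero>\<^bsub>K\<^esub>)" (is "?L \<longleftrightarrow> ?R")
proof -
  have "?L \<longleftrightarrow> (\<forall>c<e. \<forall>b\<in>EC (- (l + 1)). \<theta> (-1) c (mact M (- (l + 1)) l b x) = \<zero>\<^bsub>K\<^esub>) \<and>
      (\<forall>i. \<forall>c<e ^ i * (e\<^sup>2 - 1). \<forall>b\<in>EC (- (l + - int i)).
         \<theta> (int i) c (mact M (- (l + - int i)) l b x) = \<zero>\<^bsub>K\<^esub>)" (is "_ \<longleftrightarrow> ?R1 \<and> ?R2")
    unfolding p_def target_zero prod.inject restrict_eq_iff
    using co_zero_iff[OF theta_hom'(1) x] co_zero_iff[OF theta_hom'(2) x] by auto
  also have "\<dots> \<longleftrightarrow> ?R"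
  proof
    assume R: "?R1 \<and> ?R2"
    show ?R
    proof (intro allI impI)
      fix r c b assume r: "r + l \<ge> -1" and c: "c < mlt (r + l)" and b: "b \<in> EC r"
      show "\<theta> (r + l) c (mact M r l b x) = \<zero>\<^bsub>K\<^esub>"
      proof (cases "r + l = -1")
        case True
        then have rr: "r = - (l + 1)" by simp
        show ?thesis using R c b True unfolding rr by (simp add: mlt_def)
      next
        case False
        then obtain i where i: "r + l = int i" using r zero_le_imp_eq_int[of "r + l"] by force
        then have rr: "r = - (l + - int i)" by simp
        show ?thesis using R c b i unfolding rr by (simp add: mlt_def)
      qed
    qed
  next
    assume R: ?R
    have ?R1 using R[rule_format, of "- (l + 1)"] by (simp add: mlt_def)
    moreover have ?R2 using R[rule_format, of "- (l + - int _)"] by (simp add: mlt_def)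
    ultimately show "?R1 \<and> ?R2" ..
  qed
  finally show ?thesis .
qed

lemma co_eqI:
  assumes g: "g \<in> carrier (mcomp (gr_shift s I) l)" and x: "x \<in> MC l"
    and f: "\<And>b. b \<in> EC (- (l + s)) \<Longrightarrow> f (mact M (- (l + s)) l b x) = sgn_act (ring_module K) (l * (s + 1)) (g b)"
  shows "co s f l x = g"
proof
  fix b
  have g': "g \<in> module_hom K (acomp E (- (l + s))) (ring_module K)" "g \<in> extensional (EC (- (l + s)))"
    using g by (simp_all add: shift_comp I_carrier)
  show "co s f l x b = g b"
    using f g'(2) sgn_act_cancel[OF Kmod module_homD(1)[OF g'(1)]] by (auto simp: co_def extensional_def)
qed

text \<open>Through \<open>p_zero_iff\<close> and \<open>co_eqI\<close> exactness becomes a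
  statement about functionals: injectivity is \<open>io_inj_on\<close>, the kernel is
  \<open>theta_kernel\<close>, and surjectivity is \<open>theta_cosurj\<close>.\<close>

theorem exact_sequence: "gr_short_exact K E (regular_module E) io M p target"
  unfolding gr_short_exact_def
proof (intro conjI allI)
  fix l
  show "inj_on (io l) (carrier (mcomp (regular_module E) l))"
    by (simp add: regular_module_def io_inj_on)
  show "io l ` carrier (mcomp (regular_module E) l) = a_kernel (mcomp M l) (mcomp target l) (p l)"
  proof
    show "io l ` carrier (mcomp (regular_module E) l) \<subseteq> a_kernel (mcomp M l) (mcomp target l) (p l)"
    proof
      fix x assume "x \<in> io l ` carrier (mcomp (regular_module E) l)"
      then obtain a where a: "a \<in> EC l" "x = io l a" by (auto simp: regular_module_def)
      have "\<theta> (r + l) c (mact M r l b x) = \<zero>\<^bsub>K\<^esub>"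
        if "r + l \<ge> -1" "c < mlt (r + l)" "b \<in> EC r" for r c b
        unfolding a(2) io_act[OF that(3) a(1), symmetric] by (rule theta_io[OF that(1,2) amult_closed[OF that(3) a(1)]])
      then show "x \<in> a_kernel (mcomp M l) (mcomp target l) (p l)"
        using p_zero_iff[of x l] a io_closed by (simp add: a_kernel_def')
    qed
    show "a_kernel (mcomp M l) (mcomp target l) (p l) \<subseteq> io l ` carrier (mcomp (regular_module E) l)"
    proof
      fix x assume "x \<in> a_kernel (mcomp M l) (mcomp target l) (p l)"
      then have x: "x \<in> MC l" "p l x = \<zero>\<^bsub>mcomp target l\<^esub>" by (auto simp: a_kernel_def')
      then have "x \<in> io l ` EC l" using p_zero_iff[OF x(1)] by (intro theta_kernel) auto
      then show "x \<in> io l ` carrier (mcomp (regular_module E) l)" by (simp add: regular_module_def)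
    qed
  qed
  show "p l ` MC l = carrier (mcomp target l)"
  proof
    show "p l ` MC l \<subseteq> carrier (mcomp target l)"
      using module_homD(1)[OF gr_hom_0D(1)[OF p_gr_hom]] by auto
    show "carrier (mcomp target l) \<subseteq> p l ` MC l"
    proof
      fix t assume t: "t \<in> carrier (mcomp target l)"
      have t1: "fst t \<in> (\<Pi>\<^sub>E c\<in>{..<e}. carrier (mcomp (gr_shift 1 I) l))"
        using t by (auto simp: target_def gr_dsum_def gr_power_def gr_coprod_def)
      have "snd t \<in> (\<Pi>\<^sub>E i\<in>UNIV. \<Pi>\<^sub>E c\<in>{..<e ^ i * (e\<^sup>2 - 1)}. carrier (mcomp (gr_shift (- int i) I) l))"
        using t by (simp add: target_def gr_dsum_def gr_power_def gr_coprod_def mem_Times_iff)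
      then have t2: "snd t i \<in> (\<Pi>\<^sub>E c\<in>{..<e ^ i * (e\<^sup>2 - 1)}. carrier (mcomp (gr_shift (- int i) I) l))" for i
        by (rule PiE_mem) simp
      have "finite {i. snd t i \<noteq> \<zero>\<^bsub>mcomp (gr_power (gr_shift (- int i) I) (e ^ i * (e\<^sup>2 - 1))) l\<^esub>}"
        using t by (auto simp: target_def gr_dsum_def gr_coprod_def)
      then obtain B where B: "\<And>i. snd t i \<noteq> \<zero>\<^bsub>mcomp (gr_power (gr_shift (- int i) I) (e ^ i * (e\<^sup>2 - 1))) l\<^esub> \<Longrightarrow> i < B"
        unfolding finite_nat_set_iff_bounded by blast
      have t1': "fst t c \<in> carrier (mcomp (gr_shift 1 I) l)" if "c < e" for c using t1 that by auto
      have t2': "snd t i c \<in> carrier (mcomp (gr_shift (- int i) I) l)" if "c < e ^ i * (e\<^sup>2 - 1)" for i c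
        using t2[of i] that by auto
      \<comment> \<open>The two components of \<open>t\<close> are read as one family of functionals
        indexed by the degree n \<ge> -1.\<close>
      define g where "g = (\<lambda>n c. if n = -1 then fst t c else snd t (nat n) c)"
      have g: "g n c \<in> carrier (mcomp (gr_shift (- n) I) l)" if "n \<ge> -1" "c < mlt n" for n c
        using that t1'[of c] t2'[of c "nat n"] by (auto simp: g_def mlt_def split: if_splits)
      \<comment> \<open>Removes the sign built into \<open>co\<close>; beyond the multiplicity the
        value is irrelevant to \<open>p\<close> and set to zero.\<close>
      define \<phi> where "\<phi> = (\<lambda>n c b. if c < mlt n then sgn_act (ring_module K) (l * (- n + 1)) (g n c b) else \<zero>\<^bsub>K\<^esub>)"
      have "\<exists>s\<in>MC l. \<forall>r c b. r + l \<ge> -1 \<longrightarrow> c < mlt (r + l) \<longrightarrow> b \<in> EC r \<longrightarrow>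
        \<theta> (r + l) c (mact M r l b s) = \<phi> (r + l) c b"
      proof (rule theta_cosurj[where B = "int B" and \<phi> = \<phi> and l = l])
        fix r c assume "r + l \<ge> -1" and c: "c < mlt (r + l)"
        then have "g (r + l) c \<in> module_hom K (acomp E r) (ring_module K)"
          using g[of "r + l" c] by (simp add: shift_comp I_carrier)
        from module_hom_compose[OF this sgn_act_hom[OF Kmod]] c
        show "\<phi> (r + l) c \<in> module_hom K (acomp E r) (ring_module K)" by (simp add: \<phi>_def)
      next
        fix r c b assume r: "r + l \<ge> int B" and b: "b \<in> EC r"
        show "\<phi> (r + l) c b = \<zero>\<^bsub>K\<^esub>"
        proof (cases "c < mlt (r + l)")
          case True
          define i where "i = nat (r + l)"
          have i: "r + l = int i" "\<not> i < B" using r by (auto simp: i_def)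
          have c: "c < e ^ i * (e\<^sup>2 - 1)" using True i by (simp add: mlt_def)
          have "g (r + l) c = \<zero>\<^bsub>mcomp (gr_shift (- int i) I) l\<^esub>"
          proof -
            have "snd t i = \<zero>\<^bsub>mcomp (gr_power (gr_shift (- int i) I) (e ^ i * (e\<^sup>2 - 1))) l\<^esub>" using B[of i] i by blast
            then show ?thesis using i c by (simp add: g_def power_zero)
          qed
          moreover have "- (l + - int i) = r" using i by simp
          ultimately have "g (r + l) c b = \<zero>\<^bsub>K\<^esub>" using b by (simp add: shift_comp I_comp)
          then show ?thesis using True sgn_act_zero[OF Kmod] by (simp add: \<phi>_def)
        qed (simp add: \<phi>_def)
      qed
      then obtain s where s: "s \<in> MC l"
        "\<And>r c b. r + l \<ge> -1 \<Longrightarrow> c < mlt (r + l) \<Longrightarrow> b \<in> EC r \<Longrightarrow> \<theta> (r + l) c (mact M r l b s) = \<phi> (r + l) c b"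
        by blast
      have co: "co (- n) (\<theta> n c) l s = g n c" if n: "n \<ge> -1" and c: "c < mlt n" for n c
      proof (rule co_eqI[OF g[OF n c] s(1)])
        fix b assume "b \<in> EC (- (l + - n))"
        then show "\<theta> n c (mact M (- (l + - n)) l b s) = sgn_act (ring_module K) (l * (- n + 1)) (g n c b)"
          using s(2)[of "- (l + - n)" c b] n c by (simp add: \<phi>_def)
      qed
      have "p l s = t"
      proof (intro prod_eqI)
        show "fst (p l s) = fst t"
        proof (rule ext)
          fix c show "fst (p l s) c = fst t c"
            using co[of "-1" c] t1 by (auto simp: p_def g_def mlt_def PiE_def extensional_def)
        qed
        show "snd (p l s) = snd t"
        proof (rule ext, rule ext)
          fix i c show "snd (p l s) i c = snd t i c"
            using co[of "int i" c] t2[of i] by (auto simp: p_def g_def mlt_def PiE_def extensional_def)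
        qed
      qed
      then show "t \<in> p l ` MC l" using s(1) by blast
    qed
  qed
qed (fact E_graded M_graded target_graded io_hom p_gr_hom)+

end

section \<open>Graded projective resolutions over the tensor algebra\<close>

text \<open>A copy of the module with elements renamed along an injection, so that it lives on the
  type demanded of test modules.\<close>

definition transport :: "('v \<Rightarrow> 'w) \<Rightarrow> ('k, 'e, 'v) gr_module \<Rightarrow> ('k, 'e, 'w) gr_module" where
  "transport h N = \<lparr>mcomp = (\<lambda>n. make_module (h ` carrier (mcomp N n)) (h \<zero>\<^bsub>mcomp N n\<^esub>)
      (\<lambda>x y. h (inv_into UNIV h x \<oplus>\<^bsub>mcomp N n\<^esub> inv_into UNIV h y)) (\<lambda>r x. h (r \<odot>\<^bsub>mcomp N n\<^esub> inv_into UNIV h x))),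
    mact = (\<lambda>k n a x. h (mact N k n a (inv_into UNIV h x)))\<rparr>"

lemma transport_gr:
  assumes h: "inj h" and N: "graded_left_module K A N"
  shows "graded_left_module K A (transport h N)"
    and "(\<lambda>n. inv_into UNIV h) \<in> gr_hom K A 0 (transport h N) N"
proof -
  note Nm = gr_mod(1)[OF N]
  have [simp]: "inv_into UNIV h (h x) = x" for x using h by (rule inv_f_f)
  have c: "carrier (mcomp (transport h N) n) = h ` carrier (mcomp N n)" "\<zero>\<^bsub>mcomp (transport h N) n\<^esub> = h \<zero>\<^bsub>mcomp N n\<^esub>"
    "h x \<oplus>\<^bsub>mcomp (transport h N) n\<^esub> h y = h (x \<oplus>\<^bsub>mcomp N n\<^esub> y)" "r \<odot>\<^bsub>mcomp (transport h N) n\<^esub> h x = h (r \<odot>\<^bsub>mcomp N n\<^esub> x)"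
    "mact (transport h N) k n a (h x) = h (mact N k n a x)" for n x y r k a
    by (simp_all add: transport_def)
  show "graded_left_module K A (transport h N)"
    unfolding graded_left_module_def
  proof (intro conjI allI ballI)
    fix n show "module K (mcomp (transport h N) n)"
      by (rule module_image_id[OF Nm, of h n]) (simp_all add: c)
    fix k a assume a: "a \<in> carrier (acomp A k)"
    show "mact (transport h N) k n a \<in> module_hom K (mcomp (transport h N) n) (mcomp (transport h N) (k + n))"
      by (intro module_homI) (auto simp: c module_homD[OF gr_mod(2)[OF N a]])
  next
    fix k n x assume "x \<in> carrier (mcomp (transport h N) n)"
    then obtain x' where x: "x = h x'" "x' \<in> carrier (mcomp N n)" by (auto simp: c)
    show "(\<lambda>a. mact (transport h N) k n a x) \<in> module_hom K (acomp A k) (mcomp (transport h N) (k + n))"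
      unfolding x(1) by (intro module_homI) (auto simp: c module_homD[OF gr_mod(3)[OF N x(2)]])
  qed (auto simp: c gr_mod(4,5)[OF N])
  show "(\<lambda>n. inv_into UNIV h) \<in> gr_hom K A 0 (transport h N) N"
    by (intro gr_hom_0I module_homI) (auto simp: c)
qed

lemma gr_hom_compose:
  assumes f: "f \<in> gr_hom K A 0 L M" and g: "g \<in> gr_hom K A j M N"
  shows "(\<lambda>n x. g n (f n x)) \<in> gr_hom K A j L N"
  unfolding gr_hom_def
proof (intro CollectI conjI allI ballI)
  show "(\<lambda>x. g n (f n x)) \<in> module_hom K (mcomp L n) (mcomp N (n + j))" for n
    by (rule module_hom_compose[OF gr_hom_0D(1)[OF f] gr_hom_D(1)[OF g]])
  fix k n a x assume a: "a \<in> carrier (acomp A k)" and x: "x \<in> carrier (mcomp L n)"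
  show "g (k + n) (f (k + n) (mact L k n a x)) = sgn_act (mcomp N (k + n + j)) (j * k) (mact N k (n + j) a (g n (f n x)))"
    unfolding gr_hom_0D(2)[OF f a x] by (rule gr_hom_D(2)[OF g a module_homD(1)[OF gr_hom_0D(1)[OF f] x]])
qed

lemma gr_hom_0_ident: "(\<lambda>n x. x) \<in> gr_hom K A 0 M M"
  by (intro gr_hom_0I module_hom_ident) simp

lemma gr_hom_0_plus:
  assumes M: "graded_left_module K A M" and N: "graded_left_module K A N"
    and f: "f \<in> gr_hom K A 0 M N" and g: "g \<in> gr_hom K A 0 M N"
  shows "(\<lambda>n x. f n x \<oplus>\<^bsub>mcomp N n\<^esub> g n x) \<in> gr_hom K A 0 M N"
proof (intro gr_hom_0I module_hom_plus[OF gr_mod(1)[OF M] gr_mod(1)[OF N] gr_hom_0D(1)[OF f] gr_hom_0D(1)[OF g]])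
  fix k n a x assume a: "a \<in> carrier (acomp A k)" and x: "x \<in> carrier (mcomp M n)"
  show "f (k + n) (mact M k n a x) \<oplus>\<^bsub>mcomp N (k + n)\<^esub> g (k + n) (mact M k n a x) = mact N k n a (f n x \<oplus>\<^bsub>mcomp N n\<^esub> g n x)"
    unfolding gr_hom_0D(2)[OF f a x] gr_hom_0D(2)[OF g a x]
    using module_homD(2)[OF gr_mod(2)[OF N a] module_homD(1)[OF gr_hom_0D(1)[OF f] x] module_homD(1)[OF gr_hom_0D(1)[OF g] x]] by simp
qed

lemma gr_hom_fst: "(\<lambda>n. fst) \<in> gr_hom K A 0 (gr_dsum M N) M"
  and gr_hom_snd: "(\<lambda>n. snd) \<in> gr_hom K A 0 (gr_dsum M N) N"
  by (intro gr_hom_0I module_homI; auto simp: gr_dsum_def)+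

text \<open>The test modules in \<^const>\<open>gr_projective\<close> live on fixed types, hence the injection \<^term>\<open>h\<close>.\<close>

lemma gr_projective_split:
  fixes P :: "('k, 'e, 'p) gr_module" and L :: "('k, 'e, 'w) gr_module" and Q :: "('k, 'e, 'p) gr_module"
    and h :: "'w \<times> 'p \<Rightarrow> int \<times> 'p \<Rightarrow> 'e"
  assumes P: "gr_projective K A P" and L: "graded_left_module K A L" and Q: "graded_left_module K A Q"
    and h: "inj h"
    and \<psi>: "\<psi> \<in> gr_hom K A 0 L P" and \<delta>: "\<delta> \<in> gr_hom K A 0 Q P"
    and surj: "\<And>l x. x \<in> carrier (mcomp P l) \<Longrightarrow>
      \<exists>a\<in>carrier (mcomp L l). \<exists>y\<in>carrier (mcomp Q l). x = \<psi> l a \<oplus>\<^bsub>mcomp P l\<^esub> \<delta> l y"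
  obtains \<alpha> s where "\<alpha> \<in> gr_hom K A 0 P L" "s \<in> gr_hom K A 0 P Q"
    "\<And>l x. x \<in> carrier (mcomp P l) \<Longrightarrow> \<psi> l (\<alpha> l x) \<oplus>\<^bsub>mcomp P l\<^esub> \<delta> l (s l x) = x"
proof -
  let ?N = "gr_dsum L Q"
  let ?T = "transport h ?N"
  have PG: "graded_left_module K A P" using P by (simp add: gr_projective_def)
  have N: "graded_left_module K A ?N" by (rule gr_dsum_graded[OF L Q])
  note T = transport_gr[OF h N]
  have g0: "(\<lambda>n x. \<psi> n (fst x) \<oplus>\<^bsub>mcomp P n\<^esub> \<delta> n (snd x)) \<in> gr_hom K A 0 ?N P"
    by (rule gr_hom_0_plus[OF N PG gr_hom_compose[OF gr_hom_fst \<psi>] gr_hom_compose[OF gr_hom_snd \<delta>]])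
  define g where "g = (\<lambda>n x. \<psi> n (fst (inv_into UNIV h x)) \<oplus>\<^bsub>mcomp P n\<^esub> \<delta> n (snd (inv_into UNIV h x)))"
  have g: "g \<in> gr_hom K A 0 ?T P"
    unfolding g_def using gr_hom_compose[OF T(2) g0] .
  have "g n ` carrier (mcomp ?T n) = carrier (mcomp P n)" for n
  proof
    show "g n ` carrier (mcomp ?T n) \<subseteq> carrier (mcomp P n)" using module_homD(1)[OF gr_hom_0D(1)[OF g]] by auto
    show "carrier (mcomp P n) \<subseteq> g n ` carrier (mcomp ?T n)"
    proof
      fix x assume "x \<in> carrier (mcomp P n)"
      then obtain a y where ay: "a \<in> carrier (mcomp L n)" "y \<in> carrier (mcomp Q n)" "x = \<psi> n a \<oplus>\<^bsub>mcomp P n\<^esub> \<delta> n y"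
        using surj by blast
      have "h (a, y) \<in> carrier (mcomp ?T n)" using ay by (simp add: transport_def gr_dsum_def)
      moreover have "g n (h (a, y)) = x" using ay by (simp add: g_def inv_f_f[OF h])
      ultimately show "x \<in> g n ` carrier (mcomp ?T n)" by blast
    qed
  qed
  \<comment> \<open>The identity of \<open>P\<close> is lifted through the relabelled direct sum;
    the two projections of the lift are the maps wanted.\<close>
  then have "\<exists>u\<in>gr_hom K A 0 P ?T. \<forall>n. \<forall>x\<in>carrier (mcomp P n). g n (u n x) = x"
    using P T(1) PG g gr_hom_0_ident[of K A P] unfolding gr_projective_def by blast
  then obtain u where u: "u \<in> gr_hom K A 0 P ?T" "\<And>n x. x \<in> carrier (mcomp P n) \<Longrightarrow> g n (u n x) = x" by blast
  show thesis
  proof (rule that)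
    show "(\<lambda>n x. fst (inv_into UNIV h (u n x))) \<in> gr_hom K A 0 P L"
      by (rule gr_hom_compose[OF gr_hom_compose[OF u(1) T(2)] gr_hom_fst])
    show "(\<lambda>n x. snd (inv_into UNIV h (u n x))) \<in> gr_hom K A 0 P Q"
      by (rule gr_hom_compose[OF gr_hom_compose[OF u(1) T(2)] gr_hom_snd])
    show "\<psi> l (fst (inv_into UNIV h (u l x))) \<oplus>\<^bsub>mcomp P l\<^esub> \<delta> l (snd (inv_into UNIV h (u l x))) = x" if "x \<in> carrier (mcomp P l)" for l x
      using u(2)[OF that] by (simp add: g_def)
  qed
qed

section \<open>Splitting an arbitrary resolution of the trivial module\<close>

locale stable_pair_resolution = stable_pair K E M io e v rc wM
  for K :: "('k, 'q) ring_scheme" and E :: "('k, 'e) gr_algebra" and M :: "('k, 'e, 's) gr_module"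
    and io e v rc wM +
  fixes P :: "int \<Rightarrow> ('k, 'e, 'p) gr_module" and \<delta> :: "int \<Rightarrow> int \<Rightarrow> 'p \<Rightarrow> 'p" and \<eta> :: "int \<Rightarrow> 'p \<Rightarrow> 'e set"
  assumes res: "gr_projective_resolution K E P \<delta> \<eta> (gr_quot_module (regular_module E) (degree_ge_one E))"
begin

abbreviation "PC i l \<equiv> carrier (mcomp (P i) l)"

abbreviation kk :: "('k, 'e, 'e set) gr_module" where
  "kk \<equiv> gr_quot_module (regular_module E) (degree_ge_one E)"

lemmas res' = res[unfolded gr_projective_resolution_def]

lemma kk_graded: "graded_left_module K E kk"
  using res' by (rule conjunct1)

lemma P_proj: "gr_projective K E (P i)"
  using res'[THEN conjunct2, THEN conjunct1] by (rule spec)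

lemma P_neg: "i < 0 \<Longrightarrow> PC i l = {\<zero>\<^bsub>mcomp (P i) l\<^esub>}"
  using res'[THEN conjunct2, THEN conjunct2, THEN conjunct1] by simp

lemma \<delta>_hom': "\<delta> i \<in> gr_hom K E 0 (P i) (P (i - 1))"
  using res'[THEN conjunct2, THEN conjunct2, THEN conjunct2, THEN conjunct1] by (rule spec)

lemma \<eta>_hom: "\<eta> \<in> gr_hom K E 0 (P 0) kk"
  using res' by (elim conjE)

lemma \<eta>_surj: "\<eta> l ` PC 0 l = carrier (mcomp kk l)"
  using res' by (elim conjE) (erule spec)

lemma \<eta>_ker: "a_kernel (mcomp (P 0) l) (mcomp kk l) (\<eta> l) = \<delta> 1 l ` PC 1 l"
  using res' by (elim conjE) (rule spec)

lemma \<delta>_ker: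
  assumes "i \<ge> 1"
  shows "a_kernel (mcomp (P i) l) (mcomp (P (i - 1)) l) (\<delta> i l) = \<delta> (i + 1) l ` PC (i + 1) l"
  using res' assms by (elim conjE) simp

lemma P_graded: "graded_left_module K E (P i)"
  using P_proj by (simp add: gr_projective_def)

lemma P_mod: "module K (mcomp (P i) l)"
  by (rule gr_mod(1)[OF P_graded])

sublocale P: module K "mcomp (P i) l" for i l by (rule P_mod)

lemma \<delta>_hom: "\<delta> (i + 1) \<in> gr_hom K E 0 (P (i + 1)) (P i)"
  using \<delta>_hom'[of "i + 1"] by simp

lemma \<delta>_mhom: "\<delta> (i + 1) l \<in> module_hom K (mcomp (P (i + 1)) l) (mcomp (P i) l)"
  by (rule gr_hom_0D(1)[OF \<delta>_hom])

lemma \<delta>_act: "a \<in> EC k \<Longrightarrow> x \<in> PC (i + 1) l \<Longrightarrow>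
    \<delta> (i + 1) (k + l) (mact (P (i + 1)) k l a x) = mact (P i) k l a (\<delta> (i + 1) l x)"
  by (rule gr_hom_0D(2)[OF \<delta>_hom])

lemma \<delta>_closed: "x \<in> PC (i + 1) l \<Longrightarrow> \<delta> (i + 1) l x \<in> PC i l"
  using module_homD(1)[OF \<delta>_mhom] .

lemma P_act_closed: "a \<in> EC k \<Longrightarrow> x \<in> PC i l \<Longrightarrow> mact (P i) k l a x \<in> PC i (k + l)"
  by (rule gr_act_closed[OF P_graded])

lemma \<delta>_exact:
  "i \<ge> 0 \<Longrightarrow> x \<in> PC (i + 1) l \<Longrightarrow> \<delta> (i + 1) l x = \<zero>\<^bsub>mcomp (P i) l\<^esub> \<Longrightarrow>
    \<exists>y\<in>PC (i + 1 + 1) l. x = \<delta> (i + 1 + 1) l y"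
  using \<delta>_ker[of "i + 1" l] by (simp add: a_kernel_def' set_eq_iff image_iff) blast

lemma \<delta>_\<delta>:
  assumes x: "x \<in> PC (i + 1 + 1) l"
  shows "\<delta> (i + 1) l (\<delta> (i + 1 + 1) l x) = \<zero>\<^bsub>mcomp (P i) l\<^esub>"
proof (cases "i < 0")
  case True
  have "\<delta> (i + 1) l (\<delta> (i + 1 + 1) l x) \<in> PC i l" by (rule \<delta>_closed[OF \<delta>_closed[OF x]])
  then show ?thesis unfolding P_neg[OF True] by (rule singletonD)
next
  case False
  then have "1 \<le> i + 1" by simp
  from \<delta>_ker[OF this, of l] have "\<delta> (i + 1 + 1) l x \<in> a_kernel (mcomp (P (i + 1)) l) (mcomp (P (i + 1 - 1)) l) (\<delta> (i + 1) l)"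
    using x by (metis imageI)
  then show ?thesis by (simp add: a_kernel_def')
qed

lemma deg_sub: "submodule (degree_ge_one E l) K (acomp E l)"
  using E.carrier_is_submodule submodule_zero[OF E_module] by (simp add: degree_ge_one_def)

lemma kk_comp: "mcomp kk l = quot_module (acomp E l) (degree_ge_one E l)"
  by (simp add: gr_quot_module_def regular_module_def)

lemma kk_zero: "\<zero>\<^bsub>mcomp kk l\<^esub> = degree_ge_one E l"
  by (simp add: kk_comp)

lemma kk_carrier: "y \<in> carrier (mcomp kk l) \<longleftrightarrow> (\<exists>a\<in>EC l. y = degree_ge_one E l +>\<^bsub>acomp E l\<^esub> a)"
  using quot_module_carrier[OF E_module deg_sub, of l] unfolding kk_comp by auto

lemma kk_eq_zero_iff:
  assumes "a \<in> EC l"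
  shows "degree_ge_one E l +>\<^bsub>acomp E l\<^esub> a = \<zero>\<^bsub>mcomp kk l\<^esub> \<longleftrightarrow> a \<in> degree_ge_one E l"
  using quot_module_eq_iff[OF E_module deg_sub assms E.M.zero_closed] quot_module_zero[OF E_module deg_sub, of l] assms
  by (simp add: kk_zero E.M.minus_zero_right)

lemma kk_trivial:
  assumes "l \<noteq> 0" "y \<in> carrier (mcomp kk l)"
  shows "y = \<zero>\<^bsub>mcomp kk l\<^esub>"
proof -
  obtain a where a: "a \<in> EC l" "y = degree_ge_one E l +>\<^bsub>acomp E l\<^esub> a"
    using assms(2) kk_carrier by blast
  have "a \<in> degree_ge_one E l" using a(1) E_neg[of l] assms(1) by (auto simp: degree_ge_one_def)
  then show ?thesis using a kk_eq_zero_iff by simp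
qed

definition kone where "kone = degree_ge_one E 0 +>\<^bsub>acomp E 0\<^esub> aone E"

lemma kone_closed: "kone \<in> carrier (mcomp kk 0)"
  unfolding kk_carrier kone_def using one_closed by blast

lemma kone_act:
  assumes a: "a \<in> EC 0"
  shows "mact kk 0 0 a kone = degree_ge_one E 0 +>\<^bsub>acomp E 0\<^esub> a"
proof -
  have "quot_map (acomp E (0 + 0)) (degree_ge_one E (0 + 0)) (amult E 0 0 a) (degree_ge_one E 0 +>\<^bsub>acomp E 0\<^esub> aone E) =
      degree_ge_one E (0 + 0) +>\<^bsub>acomp E (0 + 0)\<^esub> amult E 0 0 a (aone E)"
  proof (rule quot_map_coset)
    show "amult E 0 0 a x \<in> degree_ge_one E (0 + 0)" if "x \<in> degree_ge_one E 0" for x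
      using that module_hom_zero[OF E_module E_module amult_hom_r[OF a], of 0] by (simp add: degree_ge_one_def)
  qed (use submodule.axioms(1)[OF deg_sub[of 0]] one_closed module_homD(1,2)[OF amult_hom_r[OF a, of 0]] in
      \<open>simp_all add: module_abelian[OF E_module]\<close>)
  then show ?thesis using one_r[OF a] by (simp add: gr_quot_module_def regular_module_def kone_def)
qed

lemma \<eta>_mhom: "\<eta> l \<in> module_hom K (mcomp (P 0) l) (mcomp kk l)"
  by (rule gr_hom_0D(1)[OF \<eta>_hom])

lemma kk_mod: "module K (mcomp kk l)"
  by (rule gr_mod(1)[OF kk_graded])

lemma \<eta>_exact: "x \<in> PC 0 l \<Longrightarrow> \<eta> l x = \<zero>\<^bsub>mcomp kk l\<^esub> \<Longrightarrow> \<exists>y\<in>PC 1 l. x = \<delta> 1 l y"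
  using \<eta>_ker[of l] by (auto simp: a_kernel_def')

lemma \<eta>_\<delta>: "y \<in> PC 1 l \<Longrightarrow> \<eta> l (\<delta> 1 l y) = \<zero>\<^bsub>mcomp kk l\<^esub>"
  using \<eta>_ker[of l] by (auto simp: a_kernel_def')

lemma \<delta>1: "x \<in> PC 1 l \<Longrightarrow> \<delta> 1 l x \<in> PC 0 l"
  "\<delta> 1 \<in> gr_hom K E 0 (P 1) (P 0)" "\<delta> 1 l \<in> module_hom K (mcomp (P 1) l) (mcomp (P 0) l)"
  using \<delta>_closed[of x 0 l] \<delta>_hom[of 0] \<delta>_mhom[of 0 l] by simp_all

text \<open>The trivial module sits in degree 0, so \<open>v i\<close>, which raises degrees,
  annihilates it; hence \<open>v i\<close> carries \<open>P 0\<close> into the kernel of the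
  augmentation.\<close>

lemma v_P0:
  assumes x: "x \<in> PC 0 l" and i: "i < e"
  shows "\<exists>y\<in>PC 1 (1 + l). mact (P 0) 1 l (v i) x = \<delta> 1 (1 + l) y"
proof (rule \<eta>_exact)
  show "mact (P 0) 1 l (v i) x \<in> PC 0 (1 + l)" by (rule P_act_closed[OF v_closed[OF i] x])
  have \<eta>x: "\<eta> l x \<in> carrier (mcomp kk l)" by (rule module_homD(1)[OF \<eta>_mhom x])
  have e: "\<eta> (1 + l) (mact (P 0) 1 l (v i) x) = mact kk 1 l (v i) (\<eta> l x)"
    by (rule gr_hom_0D(2)[OF \<eta>_hom v_closed[OF i] x])
  show "\<eta> (1 + l) (mact (P 0) 1 l (v i) x) = \<zero>\<^bsub>mcomp kk (1 + l)\<^esub>"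
  proof (cases "l = 0")
    case True
    then show ?thesis unfolding e using kk_trivial[of "1 + l"] gr_act_closed[OF kk_graded v_closed[OF i] \<eta>x] by simp
  next
    case False
    show ?thesis unfolding e kk_trivial[OF False \<eta>x]
      by (rule module_hom_zero[OF kk_mod kk_mod gr_mod(2)[OF kk_graded v_closed[OF i]]])
  qed
qed

text \<open>A Schanuel argument. Let \<open>p0\<close> lift the generator. The module E, mapped by a
  \<mapsto> a p0, and \<open>P 1\<close> together cover \<open>P 0\<close>, which splits this cover
  into \<phi> and \<open>s2\<close>. On boundaries \<phi> has values in the augmentation ideal,
  which is free on the \<open>v i\<close>, so the E-part lifts to \<open>P 1\<close> through
  preimages \<open>q i\<close> of v_i p0. The result \<sigma> is a section of
  \<open>\<delta> 1\<close> over its image, composed with \<open>\<delta> 1\<close>.\<close>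

lemma section_one:
  obtains \<sigma> where "\<sigma> \<in> gr_hom K E 0 (P 1) (P 1)"
    "\<And>l x. x \<in> PC 1 l \<Longrightarrow> \<delta> 1 l (\<sigma> l x) = \<delta> 1 l x"
    "\<And>l x. x \<in> PC 1 l \<Longrightarrow> \<delta> 1 l x = \<zero>\<^bsub>mcomp (P 0) l\<^esub> \<Longrightarrow> \<sigma> l x = \<zero>\<^bsub>mcomp (P 1) l\<^esub>"
proof -
  obtain p0 where p0: "p0 \<in> PC 0 0" "\<eta> 0 p0 = kone"
    using kone_closed \<eta>_surj[of 0] by (metis imageE)
  define \<psi> where "\<psi> = (\<lambda>l a. mact (P 0) l 0 a p0)"
  have \<psi>: "\<psi> \<in> gr_hom K E 0 (regular_module E) (P 0)"
  proof (rule gr_hom_0I)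
    show "\<psi> l \<in> module_hom K (mcomp (regular_module E) l) (mcomp (P 0) l)" for l
      using gr_mod(3)[OF P_graded p0(1), of l] by (simp add: regular_module_def \<psi>_def)
    show "\<psi> (k + l) (mact (regular_module E) k l a b) = mact (P 0) k l a (\<psi> l b)"
      if "a \<in> EC k" "b \<in> carrier (mcomp (regular_module E) l)" for k l a b
      using gr_mod(5)[OF P_graded that(1) _ p0(1), of b l] that(2) by (simp add: regular_module_def \<psi>_def)
  qed
  have \<psi>m: "\<psi> l \<in> module_hom K (acomp E l) (mcomp (P 0) l)" for l
    using gr_hom_0D(1)[OF \<psi>, of l] by (simp add: regular_module_def)
  have \<eta>\<psi>: "\<eta> 0 (\<psi> 0 a) = degree_ge_one E 0 +>\<^bsub>acomp E 0\<^esub> a" if "a \<in> EC 0" for a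
    using gr_hom_0D(2)[OF \<eta>_hom that p0(1)] p0(2) kone_act[OF that] by (simp add: \<psi>_def)
  have cover: "\<exists>a\<in>carrier (mcomp (regular_module E) l). \<exists>y\<in>PC 1 l. x = \<psi> l a \<oplus>\<^bsub>mcomp (P 0) l\<^esub> \<delta> 1 l y"
    if x: "x \<in> PC 0 l" for l x
  proof -
    have \<eta>x: "\<eta> l x \<in> carrier (mcomp kk l)" by (rule module_homD(1)[OF \<eta>_mhom x])
    have "\<exists>a\<in>EC l. \<eta> l (\<psi> l a) = \<eta> l x"
    proof (cases "l = 0")
      case True
      then show ?thesis using \<eta>x \<eta>\<psi> kk_carrier[of "\<eta> 0 x" 0] by auto
    next
      case False
      show ?thesis
        unfolding kk_trivial[OF False \<eta>x]
        by (intro bexI[of _ "\<zero>\<^bsub>acomp E l\<^esub>"] kk_trivial[OF False] module_homD(1)[OF \<eta>_mhom] module_homD(1)[OF \<psi>m]) simp_all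
    qed
    then obtain a where a: "a \<in> EC l" "\<eta> l (\<psi> l a) = \<eta> l x" by blast
    have \<psi>a: "\<psi> l a \<in> PC 0 l" by (rule module_homD(1)[OF \<psi>m a(1)])
    have "\<eta> l (x \<ominus>\<^bsub>mcomp (P 0) l\<^esub> \<psi> l a) = \<zero>\<^bsub>mcomp kk l\<^esub>"
      unfolding module_hom_minus[OF P_mod kk_mod \<eta>_mhom x \<psi>a] a(2)
      using \<eta>x abelian_group.minus_eq_zero_iff[OF module_abelian[OF kk_mod]] by blast
    then obtain y where y: "y \<in> PC 1 l" "x \<ominus>\<^bsub>mcomp (P 0) l\<^esub> \<psi> l a = \<delta> 1 l y"
      using \<eta>_exact[of "x \<ominus>\<^bsub>mcomp (P 0) l\<^esub> \<psi> l a" l] x \<psi>a by auto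
    have "x = \<psi> l a \<oplus>\<^bsub>mcomp (P 0) l\<^esub> (x \<ominus>\<^bsub>mcomp (P 0) l\<^esub> \<psi> l a)"
      using x \<psi>a by (simp add: a_minus_def P.M.a_ac P.M.r_neg1 P.M.r_neg)
    then show ?thesis using a(1) y by (auto simp: regular_module_def)
  qed
  \<comment> \<open>Encodes a pair as a function: index 0 stores the element of E, every other index
    stores the indicator function of \<open>y\<close>, which separates points because the unit is
    nonzero.\<close>
  define h where "h = (\<lambda>(a :: 'e, y :: 'p). \<lambda>(i :: int, y' :: 'p). if i = 0 then a else if y' = y then aone E else \<zero>\<^bsub>acomp E 0\<^esub>)"
  have h: "inj h"
  proof (rule injI, clarify)
    fix a b :: 'e and x y :: 'p
    assume eq: "h (a, x) = h (b, y)"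
    have "a = b" using fun_cong[OF eq, of "(0, x)"] by (simp add: h_def)
    moreover have "x = y" using fun_cong[OF eq, of "(1, x)"] one_not_zero by (simp add: h_def split: if_splits)
    ultimately show "a = b \<and> x = y" by simp
  qed
  have reg: "graded_left_module K E (regular_module E)" by (rule E_graded)
  obtain \<phi> s2 where \<phi>: "\<phi> \<in> gr_hom K E 0 (P 0) (regular_module E)" and s2: "s2 \<in> gr_hom K E 0 (P 0) (P 1)"
    and dec: "\<And>l x. x \<in> PC 0 l \<Longrightarrow> \<psi> l (\<phi> l x) \<oplus>\<^bsub>mcomp (P 0) l\<^esub> \<delta> 1 l (s2 l x) = x"
    using gr_projective_split[OF P_proj reg P_graded h \<psi> \<delta>1(2) cover] by blast
  have \<phi>m: "\<phi> l \<in> module_hom K (mcomp (P 0) l) (acomp E l)" for l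
    using gr_hom_0D(1)[OF \<phi>, of l] by (simp add: regular_module_def)
  \<comment> \<open>This says that \<phi> maps the kernel of the augmentation into degrees at least
    1: in degree 0 the augmentation detects E^0, and below it E is zero.\<close>
  have \<phi>z: "\<phi> l z = \<zero>\<^bsub>acomp E l\<^esub>"
    if l: "l \<le> 0" and z: "z \<in> PC 0 l" and \<eta>z: "\<eta> l z = \<zero>\<^bsub>mcomp kk l\<^esub>" for l z
  proof (cases "l = 0")
    case True
    have zc: "\<phi> 0 z \<in> EC 0" "z \<in> PC 0 0" using module_homD(1)[OF \<phi>m z] z True by simp_all
    have s: "s2 0 z \<in> PC 1 0" by (rule module_homD(1)[OF gr_hom_0D(1)[OF s2] zc(2)])
    have "\<eta> 0 (\<psi> 0 (\<phi> 0 z) \<oplus>\<^bsub>mcomp (P 0) 0\<^esub> \<delta> 1 0 (s2 0 z)) = \<eta> 0 (\<psi> 0 (\<phi> 0 z)) \<oplus>\<^bsub>mcomp kk 0\<^esub> \<zero>\<^bsub>mcomp kk 0\<^esub>"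
      using module_homD(2)[OF \<eta>_mhom module_homD(1)[OF \<psi>m zc(1)] \<delta>1(1)[OF s]] \<eta>_\<delta>[OF s] by simp
    then have "\<eta> 0 (\<psi> 0 (\<phi> 0 z)) = \<zero>\<^bsub>mcomp kk 0\<^esub>"
      using dec[OF zc(2)] \<eta>z True module_homD(1)[OF \<eta>_mhom module_homD(1)[OF \<psi>m zc(1)]]
        abelian_groupE(1)[OF module_abelian[OF kk_mod]]
        abelian_monoid.r_zero[OF abelian_group.axioms(1)[OF module_abelian[OF kk_mod]]] by metis
    then show ?thesis using \<eta>\<psi>[OF zc(1)] kk_eq_zero_iff[OF zc(1)] True by (simp add: degree_ge_one_def)
  next
    case False
    then show ?thesis using module_homD(1)[OF \<phi>m z] E_neg[of l] l by simp
  qed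
  have "\<exists>q. q \<in> PC 1 1 \<and> mact (P 0) 1 0 (v i) p0 = \<delta> 1 1 q" if "i < e" for i
    using v_P0[OF p0(1) that] by auto
  then obtain q where q: "\<And>i. i < e \<Longrightarrow> q i \<in> PC 1 1" "\<And>i. i < e \<Longrightarrow> mact (P 0) 1 0 (v i) p0 = \<delta> 1 1 (q i)"
    by metis
  \<comment> \<open>The linear map from the augmentation ideal to \<open>P 1\<close> sending
    \<open>v i\<close> to \<open>q i\<close>, written with right coefficients and zero outside the
    ideal.\<close>
  define s1 where "s1 = (\<lambda>l a. if l \<ge> 1 then finsum (mcomp (P 1) l) (\<lambda>i. mact (P 1) (l - 1) 1 (rc i (l - 1) a) (q i)) {..<e}
      else \<zero>\<^bsub>mcomp (P 1) l\<^esub>)"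
  have rch: "rc i (l - 1) \<in> module_hom K (acomp E l) (acomp E (l - 1))" if "l \<ge> 1" "i < e" for l i
    using rc_hom[of "l - 1" i] that by simp
  have qh: "(\<lambda>a. mact (P 1) (l - 1) 1 (rc i (l - 1) a) (q i)) \<in> module_hom K (acomp E l) (mcomp (P 1) l)"
    if "l \<ge> 1" "i < e" for l i
    using module_hom_compose[OF rch[OF that] gr_mod(3)[OF P_graded q(1)[OF that(2)], of "l - 1"]] by simp
  have s1m: "s1 l \<in> module_hom K (acomp E l) (mcomp (P 1) l)" for l
  proof (cases "l \<ge> 1")
    case True
    have "(\<lambda>a. finsum (mcomp (P 1) l) (\<lambda>i. mact (P 1) (l - 1) 1 (rc i (l - 1) a) (q i)) {..<e}) \<in> module_hom K (acomp E l) (mcomp (P 1) l)"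
      by (rule module_hom_finsum_fun[OF E_module P_mod]) (use qh[OF True] in simp)
    then show ?thesis using True by (simp add: s1_def[abs_def])
  qed (use module_hom_const_zero[OF P_mod] in \<open>simp add: s1_def[abs_def]\<close>)
  have s1_act: "s1 (k + l) (amult E k l a b) = mact (P 1) k l a (s1 l b)"
    if a: "a \<in> EC k" and b: "b \<in> EC l" and l: "l \<ge> 1" for k l a b
  proof (cases "k \<ge> 0")
    case False
    then have "a = \<zero>\<^bsub>acomp E k\<^esub>" using a E_neg[of k] by simp
    then show ?thesis
      using module_hom_zero[OF E_module E_module amult_hom_l[OF b]] module_hom_zero[OF E_module P_mod s1m]
        module_hom_zero[OF E_module P_mod gr_mod(3)[OF P_graded module_homD(1)[OF s1m b]]] by simp
  next
    case True
    have rcl: "rc i (l - 1) b \<in> EC (l - 1)" if "i < e" for i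
      by (rule module_homD(1)[OF rch[OF l that] b])
    have qc: "mact (P 1) (l - 1) 1 (rc i (l - 1) b) (q i) \<in> PC 1 l" if "i < e" for i
      by (rule module_homD(1)[OF qh[OF l that] b])
    have eq: "mact (P 1) (k + l - 1) 1 (rc i (k + l - 1) (amult E k l a b)) (q i) =
        mact (P 1) k l a (mact (P 1) (l - 1) 1 (rc i (l - 1) b) (q i))" if i: "i < e" for i
    proof -
      have "rc i (k + (l - 1)) (amult E k (l - 1 + 1) a b) = amult E k (l - 1) a (rc i (l - 1) b)"
        by (rule rc_mult[OF True _ i a]) (use l b in simp_all)
      then have "rc i (k + l - 1) (amult E k l a b) = amult E k (l - 1) a (rc i (l - 1) b)" by (simp add: add_diff_eq)
      then show ?thesis
        using gr_mod(5)[OF P_graded a rcl[OF i] q(1)[OF i]] by (simp add: add_diff_eq)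
    qed
    have "mact (P 1) k l a (s1 l b) = finsum (mcomp (P 1) (k + l)) (\<lambda>i. mact (P 1) k l a (mact (P 1) (l - 1) 1 (rc i (l - 1) b) (q i))) {..<e}"
      using l module_hom_finsum[OF P_mod P_mod gr_mod(2)[OF P_graded a], of "\<lambda>i. mact (P 1) (l - 1) 1 (rc i (l - 1) b) (q i)" "{..<e}" 1 l] qc
      by (simp add: s1_def Pi_def)
    also have "\<dots> = finsum (mcomp (P 1) (k + l)) (\<lambda>i. mact (P 1) (k + l - 1) 1 (rc i (k + l - 1) (amult E k l a b)) (q i)) {..<e}"
    proof (rule P.M.finsum_cong'[OF refl])
      show "(\<lambda>i. mact (P 1) (k + l - 1) 1 (rc i (k + l - 1) (amult E k l a b)) (q i)) \<in> {..<e} \<rightarrow> PC 1 (k + l)"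
        using eq P_act_closed[OF a qc] by (simp add: Pi_def)
    qed (use eq in simp)
    also have "\<dots> = s1 (k + l) (amult E k l a b)" using l True by (simp add: s1_def)
    finally show ?thesis by simp
  qed
  have \<delta>s1: "\<delta> 1 l (s1 l a) = \<psi> l a" if l: "l \<ge> 1" and a: "a \<in> EC l" for l a
  proof -
    have rcl: "rc i (l - 1) a \<in> EC (l - 1)" if "i < e" for i
      by (rule module_homD(1)[OF rch[OF l that] a])
    have rv: "amult E (l - 1) 1 (rc i (l - 1) a) (v i) \<in> EC l" if "i < e" for i
      using amult_closed[OF rcl[OF that] v_closed[OF that]] by simp
    have qc: "mact (P 1) (l - 1) 1 (rc i (l - 1) a) (q i) \<in> PC 1 l" if "i < e" for i
      by (rule module_homD(1)[OF qh[OF l that] a])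
    have eq: "\<delta> 1 l (mact (P 1) (l - 1) 1 (rc i (l - 1) a) (q i)) = \<psi> l (amult E (l - 1) 1 (rc i (l - 1) a) (v i))"
      if i: "i < e" for i
      using gr_hom_0D(2)[OF \<delta>1(2) rcl[OF i] q(1)[OF i]] q(2)[OF i]
        gr_mod(5)[OF P_graded rcl[OF i] v_closed[OF i] p0(1)] by (simp add: \<psi>_def)
    have "\<delta> 1 l (s1 l a) = finsum (mcomp (P 0) l) (\<lambda>i. \<delta> 1 l (mact (P 1) (l - 1) 1 (rc i (l - 1) a) (q i))) {..<e}"
      using l module_hom_finsum[OF P_mod P_mod \<delta>1(3), of "\<lambda>i. mact (P 1) (l - 1) 1 (rc i (l - 1) a) (q i)" "{..<e}" l] qc
      by (simp add: s1_def Pi_def)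
    also have "\<dots> = finsum (mcomp (P 0) l) (\<lambda>i. \<psi> l (amult E (l - 1) 1 (rc i (l - 1) a) (v i))) {..<e}"
      by (rule P.M.finsum_cong'[OF refl]) (use eq module_homD(1)[OF \<psi>m rv] in \<open>simp_all add: Pi_def\<close>)
    also have "\<dots> = \<psi> l (finsum (acomp E l) (\<lambda>i. amult E (l - 1) 1 (rc i (l - 1) a) (v i)) {..<e})"
      by (rule module_hom_finsum[OF E_module P_mod \<psi>m, symmetric]) (use rv in \<open>simp add: Pi_def\<close>)
    also have "finsum (acomp E l) (\<lambda>i. amult E (l - 1) 1 (rc i (l - 1) a) (v i)) {..<e} = a"
      using rc_sum[of "l - 1" a] l a by simp
    finally show ?thesis .
  qed
  define z where "z = (\<lambda>l x. \<phi> l (\<delta> 1 l x))"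
  have zm: "z l \<in> module_hom K (mcomp (P 1) l) (acomp E l)" for l
    unfolding z_def by (rule module_hom_compose[OF \<delta>1(3) \<phi>m])
  have z_act: "z (k + l) (mact (P 1) k l a x) = amult E k l a (z l x)"
    if "a \<in> EC k" "x \<in> PC 1 l" for k l a x
    using gr_hom_0D(2)[OF gr_hom_compose[OF \<delta>1(2) \<phi>] that] by (simp add: z_def regular_module_def)
  have z0: "z l x = \<zero>\<^bsub>acomp E l\<^esub>" if "l \<le> 0" "x \<in> PC 1 l" for l x
    unfolding z_def by (rule \<phi>z[OF that(1) \<delta>1(1)[OF that(2)] \<eta>_\<delta>[OF that(2)]])
  have s1z: "(\<lambda>l x. s1 l (z l x)) \<in> gr_hom K E 0 (P 1) (P 1)"
  proof (intro gr_hom_0I module_hom_compose[OF zm s1m])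
    fix k l a x assume a: "a \<in> EC k" and x: "x \<in> PC 1 l"
    have zx: "z l x \<in> EC l" by (rule module_homD(1)[OF zm x])
    show "s1 (k + l) (z (k + l) (mact (P 1) k l a x)) = mact (P 1) k l a (s1 l (z l x))"
    proof (cases "l \<ge> 1")
      case True
      then show ?thesis unfolding z_act[OF a x] by (rule s1_act[OF a zx])
    next
      case False
      then have "z l x = \<zero>\<^bsub>acomp E l\<^esub>" using z0 x by simp
      then show ?thesis unfolding z_act[OF a x]
        using module_hom_zero[OF E_module E_module amult_hom_r[OF a]] module_hom_zero[OF E_module P_mod s1m]
          module_hom_zero[OF P_mod P_mod gr_mod(2)[OF P_graded a]] by simp
    qed
  qed
  define \<sigma> where "\<sigma> = (\<lambda>l x. s1 l (z l x) \<oplus>\<^bsub>mcomp (P 1) l\<^esub> s2 l (\<delta> 1 l x))"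
  show thesis
  proof (rule that)
    show "\<sigma> \<in> gr_hom K E 0 (P 1) (P 1)"
      unfolding \<sigma>_def by (rule gr_hom_0_plus[OF P_graded P_graded s1z gr_hom_compose[OF \<delta>1(2) s2]])
    fix l x assume x: "x \<in> PC 1 l"
    note dx = \<delta>1(1)[OF x]
    have zx: "z l x \<in> EC l" by (rule module_homD(1)[OF zm x])
    have s2x: "s2 l (\<delta> 1 l x) \<in> PC 1 l" by (rule module_homD(1)[OF gr_hom_0D(1)[OF s2] dx])
    have s1x: "s1 l (z l x) \<in> PC 1 l" by (rule module_homD(1)[OF s1m zx])
    have "\<delta> 1 l (s1 l (z l x)) = \<psi> l (z l x)"
    proof (cases "l \<ge> 1")
      case False
      then have "z l x = \<zero>\<^bsub>acomp E l\<^esub>" using z0 x by simp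
      then show ?thesis
        using module_hom_zero[OF E_module P_mod s1m] module_hom_zero[OF E_module P_mod \<psi>m]
          module_hom_zero[OF P_mod P_mod \<delta>1(3)] by simp
    qed (use \<delta>s1 zx in simp)
    then show "\<delta> 1 l (\<sigma> l x) = \<delta> 1 l x"
      unfolding \<sigma>_def module_homD(2)[OF \<delta>1(3) s1x s2x] using dec[OF dx] by (simp add: z_def)
    assume "\<delta> 1 l x = \<zero>\<^bsub>mcomp (P 0) l\<^esub>"
    then show "\<sigma> l x = \<zero>\<^bsub>mcomp (P 1) l\<^esub>"
      unfolding \<sigma>_def z_def
      using module_hom_zero[OF P_mod E_module \<phi>m] module_hom_zero[OF E_module P_mod s1m]
        module_hom_zero[OF P_mod P_mod gr_hom_0D(1)[OF s2]] by simp
  qed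
qed

text \<open>Since x - \<sigma> x is a cycle, \<sigma> and the next differential together cover
  \<open>P (i + 1)\<close>; splitting this cover gives x = \<sigma>(\<alpha> x) + \<delta>(y x). If
  x is a cycle, applying \<delta> shows that \<alpha> x is one too, so the first term vanishes and y
  is a section over the cycles. Covering the whole module avoids turning the image of \<delta> into
  a module of its own.\<close>

lemma section_step:
  assumes i: "i \<ge> 0" and \<sigma>: "\<sigma> \<in> gr_hom K E 0 (P (i + 1)) (P (i + 1))"
    and 1: "\<And>l x. x \<in> PC (i + 1) l \<Longrightarrow> \<delta> (i + 1) l (\<sigma> l x) = \<delta> (i + 1) l x"
    and 2: "\<And>l x. x \<in> PC (i + 1) l \<Longrightarrow> \<delta> (i + 1) l x = \<zero>\<^bsub>mcomp (P i) l\<^esub> \<Longrightarrow> \<sigma> l x = \<zero>\<^bsub>mcomp (P (i + 1)) l\<^esub>"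
  shows "\<exists>y\<in>gr_hom K E 0 (P (i + 1)) (P (i + 1 + 1)). \<forall>l. \<forall>x\<in>PC (i + 1) l.
    \<delta> (i + 1) l x = \<zero>\<^bsub>mcomp (P i) l\<^esub> \<longrightarrow> \<delta> (i + 1 + 1) l (y l x) = x"
proof -
  \<comment> \<open>Two indicator functions side by side: index 0 records the first component, every
    other index the second.\<close>
  define h where "h = (\<lambda>(x :: 'p, y :: 'p). \<lambda>(i :: int, y' :: 'p). if y' = (if i = 0 then x else y) then aone E else \<zero>\<^bsub>acomp E 0\<^esub>)"
  have h: "inj h"
  proof (rule injI, clarify)
    fix a b x y :: 'p
    assume eq: "h (a, x) = h (b, y)"
    have "a = b" using fun_cong[OF eq, of "(0, a)"] one_not_zero by (simp add: h_def split: if_splits)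
    moreover have "x = y" using fun_cong[OF eq, of "(1, x)"] one_not_zero by (simp add: h_def split: if_splits)
    ultimately show "a = b \<and> x = y" by simp
  qed
  note \<sigma>m = gr_hom_0D(1)[OF \<sigma>]
  have cover: "\<exists>a\<in>PC (i + 1) l. \<exists>y\<in>PC (i + 1 + 1) l. x = \<sigma> l a \<oplus>\<^bsub>mcomp (P (i + 1)) l\<^esub> \<delta> (i + 1 + 1) l y"
    if x: "x \<in> PC (i + 1) l" for l x
  proof -
    have \<sigma>x: "\<sigma> l x \<in> PC (i + 1) l" by (rule module_homD(1)[OF \<sigma>m x])
    have "\<delta> (i + 1) l (x \<ominus>\<^bsub>mcomp (P (i + 1)) l\<^esub> \<sigma> l x) = \<zero>\<^bsub>mcomp (P i) l\<^esub>"
      unfolding module_hom_minus[OF P_mod P_mod \<delta>_mhom x \<sigma>x] 1[OF x]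
      using \<delta>_closed[OF x] by (simp add: P.M.minus_eq_zero_iff)
    then obtain y where y: "y \<in> PC (i + 1 + 1) l" "x \<ominus>\<^bsub>mcomp (P (i + 1)) l\<^esub> \<sigma> l x = \<delta> (i + 1 + 1) l y"
      using \<delta>_exact[OF i, of "x \<ominus>\<^bsub>mcomp (P (i + 1)) l\<^esub> \<sigma> l x" l] x \<sigma>x by auto
    have "x = \<sigma> l x \<oplus>\<^bsub>mcomp (P (i + 1)) l\<^esub> (x \<ominus>\<^bsub>mcomp (P (i + 1)) l\<^esub> \<sigma> l x)"
      using x \<sigma>x by (simp add: a_minus_def P.M.a_ac P.M.r_neg1 P.M.r_neg)
    then show ?thesis using x y by auto
  qed
  obtain \<alpha> y where \<alpha>: "\<alpha> \<in> gr_hom K E 0 (P (i + 1)) (P (i + 1))" and y: "y \<in> gr_hom K E 0 (P (i + 1)) (P (i + 1 + 1))"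
    and dec: "\<And>l x. x \<in> PC (i + 1) l \<Longrightarrow> \<sigma> l (\<alpha> l x) \<oplus>\<^bsub>mcomp (P (i + 1)) l\<^esub> \<delta> (i + 1 + 1) l (y l x) = x"
    using gr_projective_split[OF P_proj P_graded P_graded h \<sigma> \<delta>_hom cover] by blast
  have "\<delta> (i + 1 + 1) l (y l x) = x"
    if x: "x \<in> PC (i + 1) l" and dx: "\<delta> (i + 1) l x = \<zero>\<^bsub>mcomp (P i) l\<^esub>" for l x
  proof -
    have \<alpha>x: "\<alpha> l x \<in> PC (i + 1) l" by (rule module_homD(1)[OF gr_hom_0D(1)[OF \<alpha>] x])
    have yx: "y l x \<in> PC (i + 1 + 1) l" by (rule module_homD(1)[OF gr_hom_0D(1)[OF y] x])
    have "\<delta> (i + 1) l (\<sigma> l (\<alpha> l x) \<oplus>\<^bsub>mcomp (P (i + 1)) l\<^esub> \<delta> (i + 1 + 1) l (y l x)) = \<delta> (i + 1) l (\<alpha> l x)"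
      unfolding module_homD(2)[OF \<delta>_mhom module_homD(1)[OF \<sigma>m \<alpha>x] \<delta>_closed[OF yx]] 1[OF \<alpha>x] \<delta>_\<delta>[OF yx]
      using \<delta>_closed[OF \<alpha>x] by simp
    then have "\<delta> (i + 1) l (\<alpha> l x) = \<zero>\<^bsub>mcomp (P i) l\<^esub>" using dec[OF x] dx by simp
    then have "\<sigma> l (\<alpha> l x) = \<zero>\<^bsub>mcomp (P (i + 1)) l\<^esub>" by (rule 2[OF \<alpha>x])
    then show ?thesis using dec[OF x] \<delta>_closed[OF yx] by simp
  qed
  then show ?thesis using y by blast
qed

text \<open>Once y is a section over cycles, y after the next differential has the two properties of
  \<sigma> one step further, so the splitting propagates along the resolution.\<close>

lemma section_ex:
  "\<exists>y\<in>gr_hom K E 0 (P (int n + 1)) (P (int n + 1 + 1)). \<forall>l. \<forall>x\<in>PC (int n + 1) l.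
    \<delta> (int n + 1) l x = \<zero>\<^bsub>mcomp (P (int n)) l\<^esub> \<longrightarrow> \<delta> (int n + 1 + 1) l (y l x) = x"
proof (induction n)
  case 0
  obtain \<sigma> where "\<sigma> \<in> gr_hom K E 0 (P 1) (P 1)"
    "\<And>l x. x \<in> PC 1 l \<Longrightarrow> \<delta> 1 l (\<sigma> l x) = \<delta> 1 l x"
    "\<And>l x. x \<in> PC 1 l \<Longrightarrow> \<delta> 1 l x = \<zero>\<^bsub>mcomp (P 0) l\<^esub> \<Longrightarrow> \<sigma> l x = \<zero>\<^bsub>mcomp (P 1) l\<^esub>"
    using section_one by blast
  then show ?case using section_step[of 0 \<sigma>] by simp
next
  case (Suc n)
  then obtain y where y: "y \<in> gr_hom K E 0 (P (int n + 1)) (P (int n + 1 + 1))"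
    "\<And>l x. x \<in> PC (int n + 1) l \<Longrightarrow> \<delta> (int n + 1) l x = \<zero>\<^bsub>mcomp (P (int n)) l\<^esub> \<Longrightarrow> \<delta> (int n + 1 + 1) l (y l x) = x"
    by blast
  have eq: "int (Suc n) = int n + 1" by simp
  have "\<exists>u\<in>gr_hom K E 0 (P (int n + 1 + 1)) (P (int n + 1 + 1 + 1)). \<forall>l. \<forall>x\<in>PC (int n + 1 + 1) l.
    \<delta> (int n + 1 + 1) l x = \<zero>\<^bsub>mcomp (P (int n + 1)) l\<^esub> \<longrightarrow> \<delta> (int n + 1 + 1 + 1) l (u l x) = x"
  proof (rule section_step)
    show "(\<lambda>l x. y l (\<delta> (int n + 1 + 1) l x)) \<in> gr_hom K E 0 (P (int n + 1 + 1)) (P (int n + 1 + 1))"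
      by (rule gr_hom_compose[OF \<delta>_hom y(1)])
    fix l x assume x: "x \<in> PC (int n + 1 + 1) l"
    show "\<delta> (int n + 1 + 1) l (y l (\<delta> (int n + 1 + 1) l x)) = \<delta> (int n + 1 + 1) l x"
      by (rule y(2)[OF \<delta>_closed[OF x] \<delta>_\<delta>[OF x]])
    assume "\<delta> (int n + 1 + 1) l x = \<zero>\<^bsub>mcomp (P (int n + 1)) l\<^esub>"
    then show "y l (\<delta> (int n + 1 + 1) l x) = \<zero>\<^bsub>mcomp (P (int n + 1 + 1)) l\<^esub>"
      using module_hom_zero[OF P_mod P_mod gr_hom_0D(1)[OF y(1)]] by simp
  qed simp
  then show ?case unfolding eq .
qed

end

lemma quot_module_self:
  assumes "abelian_group Z"
  shows "carrier (quot_module Z (carrier Z)) = {\<zero>\<^bsub>quot_module Z (carrier Z)\<^esub>}"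
proof -
  interpret abelian_group Z by fact
  have *: "carrier Z +>\<^bsub>Z\<^esub> a = carrier Z" if a: "a \<in> carrier Z" for a
  proof
    show "carrier Z +>\<^bsub>Z\<^esub> a \<subseteq> carrier Z" using a by (auto simp: a_r_coset_def')
    show "carrier Z \<subseteq> carrier Z +>\<^bsub>Z\<^esub> a"
    proof
      fix x assume x: "x \<in> carrier Z"
      then have "x = (x \<ominus>\<^bsub>Z\<^esub> a) \<oplus>\<^bsub>Z\<^esub> a" using a by (simp add: a_minus_def a_assoc l_neg)
      then show "x \<in> carrier Z +>\<^bsub>Z\<^esub> a" using x a by (auto simp: a_r_coset_def')
    qed
  qed
  show ?thesis
  proof
    show "carrier (quot_module Z (carrier Z)) \<subseteq> {\<zero>\<^bsub>quot_module Z (carrier Z)\<^esub>}" by (simp add: A_RCOSETS_def' *)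
    show "{\<zero>\<^bsub>quot_module Z (carrier Z)\<^esub>} \<subseteq> carrier (quot_module Z (carrier Z))"
      using *[OF zero_closed] by (auto simp: A_RCOSETS_def' intro!: bexI[OF _ zero_closed])
  qed
qed

text \<open>Sums and multiples in one computation: with r = 1 it gives addition, with f = 0
  scaling.\<close>

lemma gr_hom_lin:
  assumes L: "graded_left_module K A L" and N: "graded_left_module K A N"
    and f: "f \<in> gr_hom K A j L N" and g: "g \<in> gr_hom K A j L N" and r: "r \<in> carrier K"
  shows "(\<lambda>n x. f n x \<oplus>\<^bsub>mcomp N (n + j)\<^esub> r \<odot>\<^bsub>mcomp N (n + j)\<^esub> g n x) \<in> gr_hom K A j L N"
  unfolding gr_hom_def
proof (intro CollectI conjI allI ballI)
  note Nm = gr_mod(1)[OF N] and Lm = gr_mod(1)[OF L]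
  show "(\<lambda>x. f n x \<oplus>\<^bsub>mcomp N (n + j)\<^esub> r \<odot>\<^bsub>mcomp N (n + j)\<^esub> g n x) \<in> module_hom K (mcomp L n) (mcomp N (n + j))" for n
    by (rule module_hom_plus[OF Lm Nm gr_hom_D(1)[OF f] module_hom_scale[OF Lm Nm gr_hom_D(1)[OF g] r]])
  fix k n a x assume a: "a \<in> carrier (acomp A k)" and x: "x \<in> carrier (mcomp L n)"
  have fx: "f n x \<in> carrier (mcomp N (n + j))" and gx: "g n x \<in> carrier (mcomp N (n + j))"
    using module_homD(1)[OF gr_hom_D(1)[OF f] x] module_homD(1)[OF gr_hom_D(1)[OF g] x] by auto
  have T: "(\<lambda>y. sgn_act (mcomp N (k + n + j)) (j * k) (mact N k (n + j) a y)) \<in> module_hom K (mcomp N (n + j)) (mcomp N (k + n + j))"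
    by (rule module_hom_compose[OF _ sgn_act_hom[OF Nm]]) (use gr_mod(2)[OF N a, of "n + j"] in \<open>simp add: add.assoc\<close>)
  show "f (k + n) (mact L k n a x) \<oplus>\<^bsub>mcomp N (k + n + j)\<^esub> r \<odot>\<^bsub>mcomp N (k + n + j)\<^esub> g (k + n) (mact L k n a x) =
      sgn_act (mcomp N (k + n + j)) (j * k) (mact N k (n + j) a (f n x \<oplus>\<^bsub>mcomp N (n + j)\<^esub> r \<odot>\<^bsub>mcomp N (n + j)\<^esub> g n x))"
    unfolding gr_hom_D(2)[OF f a x] gr_hom_D(2)[OF g a x]
      module_homD(2)[OF T fx module.smult_closed[OF Nm r gx]] module_homD(3)[OF T r gx] ..
qed

lemma gr_hom_cong:
  assumes L: "graded_left_module K A L" and f: "f \<in> gr_hom K A j L N"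
    and fg: "\<And>n x. x \<in> carrier (mcomp L n) \<Longrightarrow> f n x = g n x"
  shows "g \<in> gr_hom K A j L N"
  unfolding gr_hom_def
proof (intro CollectI conjI allI ballI)
  show "g n \<in> module_hom K (mcomp L n) (mcomp N (n + j))" for n
    by (rule module_hom_cong[OF gr_mod(1)[OF L] gr_hom_D(1)[OF f] fg])
  fix k n a x assume a: "a \<in> carrier (acomp A k)" and x: "x \<in> carrier (mcomp L n)"
  show "g (k + n) (mact L k n a x) = sgn_act (mcomp N (k + n + j)) (j * k) (mact N k (n + j) a (g n x))"
    using gr_hom_D(2)[OF f a x] unfolding fg[OF x] fg[OF gr_act_closed[OF L a x]] .
qed

lemma gr_hom_zero:
  assumes N: "graded_left_module K A N"
  shows "(\<lambda>n x. \<zero>\<^bsub>mcomp N (n + j)\<^esub>) \<in> gr_hom K A j L N"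
  unfolding gr_hom_def
proof (intro CollectI conjI allI ballI)
  note Nm = gr_mod(1)[OF N]
  show "(\<lambda>x. \<zero>\<^bsub>mcomp N (n + j)\<^esub>) \<in> module_hom K (mcomp L n) (mcomp N (n + j))" for n
    by (rule module_hom_const_zero[OF Nm])
  fix k n a x assume a: "a \<in> carrier (acomp A k)"
  show "\<zero>\<^bsub>mcomp N (k + n + j)\<^esub> = sgn_act (mcomp N (k + n + j)) (j * k) (mact N k (n + j) a \<zero>\<^bsub>mcomp N (n + j)\<^esub>)"
    using module_hom_zero[OF Nm Nm gr_mod(2)[OF N a, of "n + j"]] sgn_act_zero[OF Nm] by (simp add: add.assoc)
qed

section \<open>Extending cocycles with values in M\<close>

context stable_pair_resolution
begin

text \<open>On \<open>P 0\<close> a cocycle vanishes on boundaries, and every v_i x is a boundary.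
  So v_i f(x) = 0 for all i, up to sign, and the \<open>v i\<close> are jointly injective on
  M.\<close>

lemma cocycle_low:
  assumes f: "f \<in> gr_hom K E j (P n) M" and n: "n \<le> 0"
    and z: "\<And>l y. y \<in> PC (n + 1) l \<Longrightarrow> f l (\<delta> (n + 1) l y) = \<zero>\<^bsub>mcomp M (l + j)\<^esub>"
    and x: "x \<in> PC n l"
  shows "f l x = \<zero>\<^bsub>mcomp M (l + j)\<^esub>"
proof (cases "n < 0")
  case True
  then have "x = \<zero>\<^bsub>mcomp (P n) l\<^esub>" using P_neg[of n l] x by simp
  then show ?thesis using module_hom_zero[OF P_mod M_module gr_hom_D(1)[OF f]] by simp
next
  case False
  then have n0: "n = 0" using n by simp
  have x0: "x \<in> PC 0 l" using x n0 by simp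
  have fx: "f l x \<in> MC (l + j)" by (rule module_homD(1)[OF gr_hom_D(1)[OF f] x])
  show ?thesis
  proof (rule v_inj[OF fx])
    fix i assume i: "i < e"
    obtain y where y: "y \<in> PC 1 (1 + l)" "mact (P 0) 1 l (v i) x = \<delta> 1 (1 + l) y"
      using v_P0[OF x0 i] by blast
    have "sgn_act (mcomp M (1 + l + j)) (j * 1) (mact M 1 (l + j) (v i) (f l x)) = \<zero>\<^bsub>mcomp M (1 + l + j)\<^esub>"
      using gr_hom_D(2)[OF f v_closed[OF i] x] z[of y "1 + l"] y by (simp add: n0)
    then show "mact M 1 (l + j) (v i) (f l x) = \<zero>\<^bsub>mcomp M (1 + (l + j))\<^esub>"
      using sgn_act_eq_zero_iff[OF M_module act_closed[OF v_closed[OF i] fx]] by (simp add: add.assoc)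
  qed
qed

context
  fixes f i j
  assumes i: "i \<ge> 0" and f: "f \<in> gr_hom K E j (P (i + 1)) M"
    and z: "\<And>l y. y \<in> PC (i + 1 + 1) l \<Longrightarrow> f l (\<delta> (i + 1 + 1) l y) = \<zero>\<^bsub>mcomp M (l + j)\<^esub>"
begin

lemma cocycle_factor:
  assumes y: "y \<in> PC (i + 1) l" and y': "y' \<in> PC (i + 1) l"
    and eq: "\<delta> (i + 1) l y = \<delta> (i + 1) l y'"
  shows "f l y = f l y'"
proof -
  have "\<delta> (i + 1) l (y \<ominus>\<^bsub>mcomp (P (i + 1)) l\<^esub> y') = \<zero>\<^bsub>mcomp (P i) l\<^esub>"
    unfolding module_hom_minus[OF P_mod P_mod \<delta>_mhom y y'] eq
    using \<delta>_closed[OF y'] by (simp add: P.M.minus_eq_zero_iff)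
  then obtain u where u: "u \<in> PC (i + 1 + 1) l" "y \<ominus>\<^bsub>mcomp (P (i + 1)) l\<^esub> y' = \<delta> (i + 1 + 1) l u"
    using \<delta>_exact[OF i, of "y \<ominus>\<^bsub>mcomp (P (i + 1)) l\<^esub> y'" l] y y' by auto
  have "f l y \<ominus>\<^bsub>mcomp M (l + j)\<^esub> f l y' = \<zero>\<^bsub>mcomp M (l + j)\<^esub>"
    using module_hom_minus[OF P_mod M_module gr_hom_D(1)[OF f] y y'] z[OF u(1)] u(2) by simp
  then show ?thesis
    using module_homD(1)[OF gr_hom_D(1)[OF f]] y y' by (simp add: M.M.minus_eq_zero_iff)
qed

text \<open>Compose \<open>f\<close> with the section y. The value at a boundary \<delta> x is f at
  some preimage of \<delta> x, and a cocycle does not distinguish preimages.\<close>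

lemma cobound_high:
  assumes "i = int N + 1"
  shows "\<exists>u\<in>gr_hom K E j (P i) M. \<forall>l. \<forall>x\<in>PC (i + 1) l. u l (\<delta> (i + 1) l x) = f l x"
proof -
  obtain y where y: "y \<in> gr_hom K E 0 (P i) (P (i + 1))"
    and y': "\<forall>l. \<forall>x\<in>PC i l. \<delta> i l x = \<zero>\<^bsub>mcomp (P (int N)) l\<^esub> \<longrightarrow> \<delta> (i + 1) l (y l x) = x"
    using section_ex[of N, folded assms] by (rule bexE)
  have yc: "y l x \<in> PC (i + 1) l" if "x \<in> PC i l" for l x
    by (rule module_homD(1)[OF gr_hom_0D(1)[OF y] that])
  have "(\<lambda>l x. f l (y l x)) \<in> gr_hom K E j (P i) M"
    by (rule gr_hom_compose[OF y f])
  moreover have "f l (y l (\<delta> (i + 1) l x)) = f l x" if x: "x \<in> PC (i + 1) l" for l x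
  proof (rule cocycle_factor[OF yc[OF \<delta>_closed[OF x]] x])
    have "\<delta> (int N + 1) l (\<delta> (int N + 1 + 1) l x) = \<zero>\<^bsub>mcomp (P (int N)) l\<^esub>"
      by (rule \<delta>_\<delta>) (use x in \<open>simp only: assms\<close>)
    then have "\<delta> i l (\<delta> (i + 1) l x) = \<zero>\<^bsub>mcomp (P (int N)) l\<^esub>" by (simp only: assms)
    then show "\<delta> (i + 1) l (y l (\<delta> (i + 1) l x)) = \<delta> (i + 1) l x"
      by (rule y'[rule_format, OF \<delta>_closed[OF x]])
  qed
  ultimately show ?thesis by (intro bexI[of _ "\<lambda>l x. f l (y l x)"]) simp_all
qed

end

text \<open>The only place where M^e enters as a target. For x in \<open>P 0\<close> each v_i x is a
  boundary \<delta> y_i, so an extension u must satisfy v_i u(x) = (-1)^j f(y_i). By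
  \<open>v_surj\<close> and \<open>v_eq\<close> exactly one element does, and uniqueness yields
  linearity over E.\<close>

lemma cobound_one:
  assumes f: "f \<in> gr_hom K E j (P 1) M"
    and z: "\<And>l y. y \<in> PC 2 l \<Longrightarrow> f l (\<delta> 2 l y) = \<zero>\<^bsub>mcomp M (l + j)\<^esub>"
  shows "\<exists>u\<in>gr_hom K E j (P 0) M. \<forall>l. \<forall>x\<in>PC 1 l. u l (\<delta> 1 l x) = f l x"
proof -
  have factor: "f l y = f l y'" if "y \<in> PC 1 l" "y' \<in> PC 1 l" "\<delta> 1 l y = \<delta> 1 l y'" for l y y'
    using cocycle_factor[of 0 f j y l y'] f z that by simp
  note fm = gr_hom_D(1)[OF f]
  \<comment> \<open>A homomorphism of degree j passes \<open>v i\<close>, which has degree 1, at the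
    cost of (-1)^j.\<close>
  define sf where "sf = (\<lambda>l y. sgn_act (mcomp M (l + j)) j (f l y))"
  have sfm: "sf l \<in> module_hom K (mcomp (P 1) l) (mcomp M (l + j))" for l
    unfolding sf_def by (rule module_hom_compose[OF fm sgn_act_hom[OF M_module]])
  note fc = module_homD(1)[OF fm]
  have "\<exists>y. \<forall>l x i. x \<in> PC 0 l \<longrightarrow> i < e \<longrightarrow> y l x i \<in> PC 1 (1 + l) \<and> mact (P 0) 1 l (v i) x = \<delta> 1 (1 + l) (y l x i)"
    using v_P0 by (intro choice allI) meson
  then obtain y where y: "\<And>l x i. x \<in> PC 0 l \<Longrightarrow> i < e \<Longrightarrow> y l x i \<in> PC 1 (1 + l)"
    "\<And>l x i. x \<in> PC 0 l \<Longrightarrow> i < e \<Longrightarrow> mact (P 0) 1 l (v i) x = \<delta> 1 (1 + l) (y l x i)" by blast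
  have vM: "mact M 1 (l + j) (v i) \<in> module_hom K (mcomp M (l + j)) (mcomp M (1 + l + j))" if "i < e" for i l
    using act_hom_r[OF v_closed[OF that], of "l + j"] by (simp add: add.assoc)
  have "\<exists>s. x \<in> PC 0 l \<longrightarrow> s \<in> MC (l + j) \<and> (\<forall>i<e. mact M 1 (l + j) (v i) s = sf (1 + l) (y l x i))" for l x
  proof (cases "x \<in> PC 0 l")
    case True
    have t: "sf (1 + l) (y l x i) \<in> MC (1 + (l + j))" if "i < e" for i
      using module_homD(1)[OF sfm y(1)[OF True that]] by (simp add: add.assoc)
    obtain s where "s \<in> MC (l + j)" "\<And>i. i < e \<Longrightarrow> mact M 1 (l + j) (v i) s = sf (1 + l) (y l x i)"
      using v_surj[of "\<lambda>i. sf (1 + l) (y l x i)" "l + j"] t by blast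
    then show ?thesis by blast
  qed simp
  then have "\<exists>u. \<forall>l x. x \<in> PC 0 l \<longrightarrow> u l x \<in> MC (l + j) \<and> (\<forall>i<e. mact M 1 (l + j) (v i) (u l x) = sf (1 + l) (y l x i))"
    by (intro choice allI)
  then obtain u where uc: "\<And>l x. x \<in> PC 0 l \<Longrightarrow> u l x \<in> MC (l + j)"
    and u: "\<And>l x i. x \<in> PC 0 l \<Longrightarrow> i < e \<Longrightarrow> mact M 1 (l + j) (v i) (u l x) = sf (1 + l) (y l x i)" by blast
  \<comment> \<open>Characterises u(x) by any preimages \<open>w\<close>, not just the selected
    \<open>y l x i\<close>; every later property of u is proved by naming suitable ones.\<close>
  have u_eq: "u l x = s"
    if x: "x \<in> PC 0 l" and s: "s \<in> MC (l + j)"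
      and w: "\<And>i. i < e \<Longrightarrow> \<exists>w\<in>PC 1 (1 + l). mact (P 0) 1 l (v i) x = \<delta> 1 (1 + l) w \<and> mact M 1 (l + j) (v i) s = sf (1 + l) w"
    for l x s
  proof (rule v_eq[OF uc[OF x] s])
    fix i assume i: "i < e"
    obtain w where w: "w \<in> PC 1 (1 + l)" "mact (P 0) 1 l (v i) x = \<delta> 1 (1 + l) w" "mact M 1 (l + j) (v i) s = sf (1 + l) w"
      using w[OF i] by blast
    show "mact M 1 (l + j) (v i) (u l x) = mact M 1 (l + j) (v i) s"
      using factor[OF y(1)[OF x i] w(1)] y(2)[OF x i] w(2) unfolding u[OF x i] w(3) by (simp add: sf_def)
  qed
  note vP = gr_mod(2)[OF P_graded v_closed]
  have um: "u l \<in> module_hom K (mcomp (P 0) l) (mcomp M (l + j))" for l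
  proof (rule module_homI)
    fix x assume x: "x \<in> PC 0 l"
    show "u l x \<in> MC (l + j)" by (rule uc[OF x])
    {
      fix x' assume x': "x' \<in> PC 0 l"
      show "u l (x \<oplus>\<^bsub>mcomp (P 0) l\<^esub> x') = u l x \<oplus>\<^bsub>mcomp M (l + j)\<^esub> u l x'"
      proof (rule u_eq)
        fix i assume i: "i < e"
        note yx = y(1)[OF x i] y(1)[OF x' i]
        show "\<exists>w\<in>PC 1 (1 + l). mact (P 0) 1 l (v i) (x \<oplus>\<^bsub>mcomp (P 0) l\<^esub> x') = \<delta> 1 (1 + l) w \<and>
            mact M 1 (l + j) (v i) (u l x \<oplus>\<^bsub>mcomp M (l + j)\<^esub> u l x') = sf (1 + l) w"
          unfolding module_homD(2)[OF vP[OF i] x x'] module_homD(2)[OF vM[OF i] uc[OF x] uc[OF x']]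
            y(2)[OF x i] y(2)[OF x' i] u[OF x i] u[OF x' i] module_homD(2)[OF \<delta>1(3) yx, symmetric] module_homD(2)[OF sfm yx, symmetric]
          using yx by (intro bexI conjI) (rule refl, rule refl, simp)
      qed (use x x' uc in simp_all)
    }
    fix r assume r: "r \<in> carrier K"
    show "u l (r \<odot>\<^bsub>mcomp (P 0) l\<^esub> x) = r \<odot>\<^bsub>mcomp M (l + j)\<^esub> u l x"
    proof (rule u_eq)
      fix i assume i: "i < e"
      note yx = y(1)[OF x i]
      show "\<exists>w\<in>PC 1 (1 + l). mact (P 0) 1 l (v i) (r \<odot>\<^bsub>mcomp (P 0) l\<^esub> x) = \<delta> 1 (1 + l) w \<and>
          mact M 1 (l + j) (v i) (r \<odot>\<^bsub>mcomp M (l + j)\<^esub> u l x) = sf (1 + l) w"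
        unfolding module_homD(3)[OF vP[OF i] r x] module_homD(3)[OF vM[OF i] r uc[OF x]]
          y(2)[OF x i] u[OF x i] module_homD(3)[OF \<delta>1(3) r yx, symmetric] module_homD(3)[OF sfm r yx, symmetric]
        using yx r by (intro bexI conjI) (rule refl, rule refl, simp)
    qed (use x r uc in simp_all)
  qed
  \<comment> \<open>Extends the defining relation from the \<open>v i\<close> to all elements of
    positive degree. The pairs (\<delta> y, \<plusminus> f y) form a submodule, and the pair (c x, c
    u(x)) lies in it for c = b v_i, hence for all c by spanning.\<close>
  have lift: "\<exists>w\<in>PC 1 (q + 1 + l). mact (P 0) (q + 1) l c x = \<delta> 1 (q + 1 + l) w \<and>
      mact M (q + 1) (l + j) c (u l x) = sgn_act (mcomp M (q + 1 + l + j)) (j * (q + 1)) (f (q + 1 + l) w)"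
    if q: "q \<ge> 0" and c: "c \<in> EC (q + 1)" and x: "x \<in> PC 0 l" for q c l x
  proof -
    define N where "N = dsum_module (mcomp (P 0) (q + 1 + l)) (mcomp M (q + 1 + l + j))"
    define g where "g = (\<lambda>y. (\<delta> 1 (q + 1 + l) y, sgn_act (mcomp M (q + 1 + l + j)) (j * (q + 1)) (f (q + 1 + l) y)))"
    have N: "module K N" unfolding N_def by (intro dsum_module_module P_mod M_module)
    have g: "g \<in> module_hom K (mcomp (P 1) (q + 1 + l)) N"
      unfolding N_def g_def
      by (intro module_homI) (auto simp: module_homD[OF \<delta>1(3)] module_homD[OF module_hom_compose[OF fm sgn_act_hom[OF M_module]]])
    have U: "submodule (g ` PC 1 (q + 1 + l)) K N" by (rule submodule_image[OF P_mod N g P.carrier_is_submodule])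
    have h: "(\<lambda>c. mact M (q + 1) (l + j) c (u l x)) \<in> module_hom K (acomp E (q + 1)) (mcomp M (q + 1 + l + j))"
      using act_hom_l[OF uc[OF x], of "q + 1"] by (simp add: add.assoc)
    have hh: "(\<lambda>c. (mact (P 0) (q + 1) l c x, mact M (q + 1) (l + j) c (u l x))) \<in> module_hom K (acomp E (q + 1)) N"
      unfolding N_def
      by (intro module_homI) (simp_all add: module_homD[OF gr_mod(3)[OF P_graded x]] module_homD[OF h])
    have "(mact (P 0) (q + 1) l c x, mact M (q + 1) (l + j) c (u l x)) \<in> g ` PC 1 (q + 1 + l)"
    proof (rule span_mem[OF q N U hh _ c])
      fix b i assume b: "b \<in> EC q" and i: "i < e"
      note yx = y(1)[OF x i]
      have 1: "mact (P 0) (q + 1) l (amult E q 1 b (v i)) x = \<delta> 1 (q + (1 + l)) (mact (P 1) q (1 + l) b (y l x i))"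
        unfolding gr_mod(5)[OF P_graded b v_closed[OF i] x] y(2)[OF x i] gr_hom_0D(2)[OF \<delta>1(2) b yx] ..
      have bf: "mact M q (1 + l + j) b \<in> module_hom K (mcomp M (1 + l + j)) (mcomp M (q + (1 + l) + j))"
        using act_hom_r[OF b, of "1 + l + j"] by (simp add: add.assoc)
      have "mact M (q + 1) (l + j) (amult E q 1 b (v i)) (u l x) = mact M q (1 + l + j) b (sf (1 + l) (y l x i))"
        using act_assoc[OF b v_closed[OF i] uc[OF x]] u[OF x i] by (simp add: add.assoc)
      also have "\<dots> = sgn_act (mcomp M (q + (1 + l) + j)) j (mact M q (1 + l + j) b (f (1 + l) (y l x i)))"
        unfolding sf_def by (rule module_hom_sgn_act[OF M_module M_module bf fc[OF yx]])
      also have "\<dots> = sgn_act (mcomp M (q + (1 + l) + j)) (j * (q + 1)) (f (q + (1 + l)) (mact (P 1) q (1 + l) b (y l x i)))"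
        unfolding gr_hom_D(2)[OF f b yx] sgn_act_sgn_act[OF M_module module_homD(1)[OF bf fc[OF yx]]]
        by (rule sgn_act_cong) (simp add: algebra_simps)
      finally show "(mact (P 0) (q + 1) l (amult E q 1 b (v i)) x, mact M (q + 1) (l + j) (amult E q 1 b (v i)) (u l x)) \<in>
          g ` PC 1 (q + 1 + l)"
        using 1 P_act_closed[OF b yx] by (auto simp: g_def add.assoc intro!: image_eqI)
    qed
    then show ?thesis by (auto simp: g_def)
  qed
  have "u \<in> gr_hom K E j (P 0) M"
    unfolding gr_hom_def
  proof (intro CollectI conjI allI ballI um)
    fix k l a x assume a: "a \<in> EC k" and x: "x \<in> PC 0 l"
    note ax = P_act_closed[OF a x]
    have aM: "mact M k (l + j) a (u l x) \<in> MC (k + l + j)" using act_closed[OF a uc[OF x]] by (simp add: add.assoc)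
    show "u (k + l) (mact (P 0) k l a x) = sgn_act (mcomp M (k + l + j)) (j * k) (mact M k (l + j) a (u l x))"
    proof (cases "k < 0")
      case True
      then have "a = \<zero>\<^bsub>acomp E k\<^esub>" using a E_neg[of k] by simp
      then show ?thesis
        using module_hom_zero[OF E_module P_mod gr_mod(3)[OF P_graded x]] module_hom_zero[OF P_mod M_module um]
          module_hom_zero[OF E_module M_module act_hom_l[OF uc[OF x]], of k] sgn_act_zero[OF M_module]
        by (simp add: add.assoc)
    next
      case False
      show ?thesis
      proof (rule u_eq[OF ax sgn_act_closed[OF M_module aM]])
        fix i assume i: "i < e"
        have c: "amult E 1 k (v i) a \<in> EC (k + 1)" using amult_closed[OF v_closed[OF i] a] by (simp add: add.commute)
        \<comment> \<open>To test u(a x) against \<open>v i\<close>, the relation is used for the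
          element \<open>v i\<close> times \<open>a\<close>, of degree k + 1.\<close>
        obtain w where w: "w \<in> PC 1 (k + 1 + l)" "mact (P 0) (k + 1) l (amult E 1 k (v i) a) x = \<delta> 1 (k + 1 + l) w"
          "mact M (k + 1) (l + j) (amult E 1 k (v i) a) (u l x) = sgn_act (mcomp M (k + 1 + l + j)) (j * (k + 1)) (f (k + 1 + l) w)"
          using lift[OF _ c x] False by auto
        have eq: "k + 1 = 1 + k" "1 + k + l = 1 + (k + l)" by simp_all
        have fw: "f (1 + (k + l)) w \<in> MC (1 + (k + l) + j)" using fc[OF w(1)] unfolding eq .
        have "mact M 1 (k + l + j) (v i) (mact M k (l + j) a (u l x)) = sgn_act (mcomp M (1 + (k + l) + j)) (j * (1 + k)) (f (1 + (k + l)) w)"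
          using w(3) unfolding eq act_assoc[OF v_closed[OF i] a uc[OF x]] by (simp add: add.assoc)
        then have "mact M 1 (k + l + j) (v i) (sgn_act (mcomp M (k + l + j)) (j * k) (mact M k (l + j) a (u l x))) = sf (1 + (k + l)) w"
          unfolding module_hom_sgn_act[OF M_module M_module vM[OF i] aM] sf_def
          by (simp only: sgn_act_sgn_act[OF M_module fw]) (rule sgn_act_cong, simp add: algebra_simps)
        moreover have "mact (P 0) 1 (k + l) (v i) (mact (P 0) k l a x) = \<delta> 1 (1 + (k + l)) w"
          using w(2) unfolding eq gr_mod(5)[OF P_graded v_closed[OF i] a x] .
        ultimately show "\<exists>w\<in>PC 1 (1 + (k + l)). mact (P 0) 1 (k + l) (v i) (mact (P 0) k l a x) = \<delta> 1 (1 + (k + l)) w \<and>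
            mact M 1 (k + l + j) (v i) (sgn_act (mcomp M (k + l + j)) (j * k) (mact M k (l + j) a (u l x))) = sf (1 + (k + l)) w"
          using w(1) unfolding eq by blast
      qed
    qed
  qed
  moreover have "u l (\<delta> 1 l x) = f l x" if x: "x \<in> PC 1 l" for l x
  proof (rule u_eq[OF \<delta>1(1)[OF x] fc[OF x]])
    fix i assume i: "i < e"
    have c: "mact M 1 (l + j) (v i) (f l x) \<in> MC (1 + l + j)" by (rule module_homD(1)[OF vM[OF i] fc[OF x]])
    have "mact M 1 (l + j) (v i) (f l x) = sf (1 + l) (mact (P 1) 1 l (v i) x)"
      unfolding sf_def gr_hom_D(2)[OF f v_closed[OF i] x] using sgn_act_cancel[OF M_module c, of j] by simp
    then show "\<exists>w\<in>PC 1 (1 + l). mact (P 0) 1 l (v i) (\<delta> 1 l x) = \<delta> 1 (1 + l) w \<and> mact M 1 (l + j) (v i) (f l x) = sf (1 + l) w"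
      using gr_hom_0D(2)[OF \<delta>1(2) v_closed[OF i] x] P_act_closed[OF v_closed[OF i] x] by metis
  qed
  ultimately show ?thesis by (intro bexI[of _ u]) simp_all
qed

lemma cobound:
  assumes f: "f \<in> gr_hom K E j (P n) M"
    and z: "\<And>l y. y \<in> PC (n + 1) l \<Longrightarrow> f l (\<delta> (n + 1) l y) = \<zero>\<^bsub>mcomp M (l + j)\<^esub>"
  shows "\<exists>u\<in>gr_hom K E j (P (n - 1)) M. \<forall>l. \<forall>x\<in>PC n l. u l (\<delta> n l x) = f l x"
proof -
  have "n \<le> 0 \<or> n = 1 \<or> (\<exists>N. n = int N + 1 + 1)"
  proof (cases "2 \<le> n")
    case True
    then have "n = int (nat (n - 2)) + 1 + 1" by simp
    then show ?thesis by blast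
  qed linarith
  then consider "n \<le> 0" | "n = 1" | N where "n = int N + 1 + 1" by blast
  then show ?thesis
  proof cases
    case 1
    then show ?thesis using gr_hom_zero[OF M_graded, of j "P (n - 1)"] cocycle_low[OF f 1 z] by (intro bexI) auto
  next
    case 2
    have "\<And>l y. y \<in> PC 2 l \<Longrightarrow> f l (\<delta> 2 l y) = \<zero>\<^bsub>mcomp M (l + j)\<^esub>" using z by (simp add: 2)
    moreover have "f \<in> gr_hom K E j (P 1) M" using f by (simp add: 2)
    ultimately have "\<exists>u\<in>gr_hom K E j (P 0) M. \<forall>l. \<forall>x\<in>PC 1 l. u l (\<delta> 1 l x) = f l x"
      by (intro cobound_one)
    then show ?thesis by (simp add: 2)
  next
    case 3
    have "f \<in> gr_hom K E j (P (int N + 1 + 1)) M" using f by (simp only: 3)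
    moreover have "\<And>l y. y \<in> PC (int N + 1 + 1 + 1) l \<Longrightarrow> f l (\<delta> (int N + 1 + 1 + 1) l y) = \<zero>\<^bsub>mcomp M (l + j)\<^esub>"
      using z by (simp only: 3)
    ultimately have "\<exists>u\<in>gr_hom K E j (P (int N + 1)) M. \<forall>l. \<forall>x\<in>PC (int N + 1 + 1) l. u l (\<delta> (int N + 1 + 1) l x) = f l x"
      by (intro cobound_high[OF _ _ _ refl]) simp_all
    then show ?thesis unfolding 3 add_diff_cancel_right' .
  qed
qed

lemma gr_hom_module_module: "module K (gr_hom_module K E j (P n) M)"
  and gr_hom_module_carrier: "f \<in> carrier (gr_hom_module K E j (P n) M) \<longleftrightarrow>
    f \<in> gr_hom K E j (P n) M \<and> (\<forall>l. f l \<in> extensional (PC n l))"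
proof -
  let ?H = "prod_module UNIV (\<lambda>l. hom_module K (mcomp (P n) l) (mcomp M (l + j)))"
  have H: "module K ?H" by (intro prod_module_module K.is_cring hom_module_module(2) P_mod M_module)
  have c: "f \<in> carrier ?H \<inter> gr_hom K E j (P n) M \<longleftrightarrow> f \<in> gr_hom K E j (P n) M \<and> (\<forall>l. f l \<in> extensional (PC n l))" for f
    by (auto simp: PiE_def Pi_def dest: gr_hom_D(1))
  then show "f \<in> carrier (gr_hom_module K E j (P n) M) \<longleftrightarrow>
    f \<in> gr_hom K E j (P n) M \<and> (\<forall>l. f l \<in> extensional (PC n l))"
    by (simp add: gr_hom_module_def Let_def)
  show "module K (gr_hom_module K E j (P n) M)"
    unfolding gr_hom_module_def Let_def
  proof (rule module_carrier_update(2)[OF H])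
    show "\<zero>\<^bsub>?H\<^esub> \<in> carrier ?H \<inter> gr_hom K E j (P n) M"
      unfolding c by (auto intro: gr_hom_cong[OF P_graded gr_hom_zero[OF M_graded]])
    fix f r assume f: "f \<in> carrier ?H \<inter> gr_hom K E j (P n) M" and r: "r \<in> carrier K"
    then have f': "f \<in> gr_hom K E j (P n) M" by simp
    have fc: "f l x \<in> MC (l + j)" if "x \<in> PC n l" for l x
      by (rule module_homD(1)[OF gr_hom_D(1)[OF f'] that])
    have "r \<odot>\<^bsub>?H\<^esub> f \<in> gr_hom K E j (P n) M"
      by (rule gr_hom_cong[OF P_graded gr_hom_lin[OF P_graded M_graded gr_hom_zero[OF M_graded] f' r]])
        (use r in \<open>simp add: fc\<close>)
    then show "r \<odot>\<^bsub>?H\<^esub> f \<in> carrier ?H \<inter> gr_hom K E j (P n) M" unfolding c by simp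
  next
    fix f g assume f: "f \<in> carrier ?H \<inter> gr_hom K E j (P n) M" and g: "g \<in> carrier ?H \<inter> gr_hom K E j (P n) M"
    then have f': "f \<in> gr_hom K E j (P n) M" and g': "g \<in> gr_hom K E j (P n) M" by simp_all
    have gc: "g l x \<in> MC (l + j)" if "x \<in> PC n l" for l x
      by (rule module_homD(1)[OF gr_hom_D(1)[OF g'] that])
    have "f \<oplus>\<^bsub>?H\<^esub> g \<in> gr_hom K E j (P n) M"
      by (rule gr_hom_cong[OF P_graded gr_hom_lin[OF P_graded M_graded f' g' K.one_closed]]) (simp add: gc)
    then show "f \<oplus>\<^bsub>?H\<^esub> g \<in> carrier ?H \<inter> gr_hom K E j (P n) M" unfolding c by simp
  qed auto
qed

text \<open>By \<open>cobound\<close> every cocycle is a coboundary in each degree, so the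
  cohomology is the quotient of a module by itself. Restricting to the carriers makes the extension
  an element of the complex without changing its boundary.\<close>

theorem Ext_vanishing: "carrier (gr_Ext K E P \<delta> M n j) = {\<zero>\<^bsub>gr_Ext K E P \<delta> M n j\<^esub>}"
proof -
  define C where "C = (\<lambda>i. gr_hom_module K E j (P i) M)"
  define D where "D = (\<lambda>i (f :: int \<Rightarrow> 'p \<Rightarrow> 's) l. \<lambda>x \<in> PC (i + 1) l. f l (\<delta> (i + 1) l x))"
  have zero: "\<zero>\<^bsub>C (n + 1)\<^esub> = (\<lambda>l. \<lambda>x\<in>PC (n + 1) l. \<zero>\<^bsub>mcomp M (l + j)\<^esub>)"
    by (simp add: C_def gr_hom_module_def Let_def restrict_def)
  have kern: "f \<in> carrier (cocycle_module C D n) \<longleftrightarrow>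
      f \<in> carrier (C n) \<and> (\<forall>l. \<forall>y\<in>PC (n + 1) l. f l (\<delta> (n + 1) l y) = \<zero>\<^bsub>mcomp M (l + j)\<^esub>)" for f
    unfolding cocycle_module_def a_kernel_def' zero D_def by (simp add: fun_eq_iff[of "\<lambda>l. restrict (_ l) (_ l)"] restrict_eq_iff)
  have Cn: "module K (C i)" for i unfolding C_def by (rule gr_hom_module_module)
  have ops: "add (C i) f g l x = f l x \<oplus>\<^bsub>mcomp M (l + j)\<^esub> g l x" "smult (C i) r f l x = r \<odot>\<^bsub>mcomp M (l + j)\<^esub> f l x"
    "\<zero>\<^bsub>C i\<^esub> l x = \<zero>\<^bsub>mcomp M (l + j)\<^esub>"
    if "x \<in> PC i l" for i f g r l x
    using that by (simp_all add: C_def gr_hom_module_def Let_def)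
  have Z: "module K (cocycle_module C D n)"
    unfolding cocycle_module_def
  proof (rule module_carrier_update(2)[OF Cn])
    have H: "H \<in> a_kernel (C n) (C (n + 1)) (D n) \<longleftrightarrow>
        H \<in> carrier (C n) \<and> (\<forall>l. \<forall>y\<in>PC (n + 1) l. H l (\<delta> (n + 1) l y) = \<zero>\<^bsub>mcomp M (l + j)\<^esub>)" for H
      using kern by (simp add: cocycle_module_def)
    interpret C: module K "C n" by (rule Cn)
    show "a_kernel (C n) (C (n + 1)) (D n) \<subseteq> carrier (C n)" using H by blast
    show "\<zero>\<^bsub>C n\<^esub> \<in> a_kernel (C n) (C (n + 1)) (D n)" by (simp add: H ops \<delta>_closed)
    show "f \<oplus>\<^bsub>C n\<^esub> g \<in> a_kernel (C n) (C (n + 1)) (D n)"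
      if "f \<in> a_kernel (C n) (C (n + 1)) (D n)" "g \<in> a_kernel (C n) (C (n + 1)) (D n)" for f g
      using that by (simp add: H ops \<delta>_closed)
    show "r \<odot>\<^bsub>C n\<^esub> f \<in> a_kernel (C n) (C (n + 1)) (D n)"
      if "r \<in> carrier K" "f \<in> a_kernel (C n) (C (n + 1)) (D n)" for r f
      using that by (simp add: H ops \<delta>_closed)
  qed
  have "coboundaries C D n = carrier (cocycle_module C D n)"
  proof
    show "coboundaries C D n \<subseteq> carrier (cocycle_module C D n)"
    proof
      fix f assume "f \<in> coboundaries C D n"
      then obtain u where u: "u \<in> gr_hom K E j (P (n - 1)) M" "f = D (n - 1) u"
        by (auto simp: coboundaries_def C_def gr_hom_module_carrier)
      have fx: "f l x = u l (\<delta> n l x)" if "x \<in> PC n l" for l x using that by (simp add: u(2) D_def)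
      have "(\<lambda>l x. u l (\<delta> n l x)) \<in> gr_hom K E j (P n) M"
        by (rule gr_hom_compose[OF \<delta>_hom' u(1)])
      then have "f \<in> gr_hom K E j (P n) M" by (rule gr_hom_cong[OF P_graded]) (simp add: fx)
      moreover have "f l \<in> extensional (PC n l)" for l by (simp add: u(2) D_def)
      moreover have "f l (\<delta> (n + 1) l y) = \<zero>\<^bsub>mcomp M (l + j)\<^esub>" if y: "y \<in> PC (n + 1) l" for l y
        unfolding fx[OF \<delta>_closed[OF y]]
        using \<delta>_\<delta>[of y "n - 1" l] y module_hom_zero[OF P_mod M_module gr_hom_D(1)[OF u(1)]] by simp
      ultimately show "f \<in> carrier (cocycle_module C D n)" unfolding kern by (simp add: C_def gr_hom_module_carrier)
    qed
    show "carrier (cocycle_module C D n) \<subseteq> coboundaries C D n"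
    proof
      fix f assume "f \<in> carrier (cocycle_module C D n)"
      then have f: "f \<in> gr_hom K E j (P n) M" "\<And>l. f l \<in> extensional (PC n l)"
        "\<And>l y. y \<in> PC (n + 1) l \<Longrightarrow> f l (\<delta> (n + 1) l y) = \<zero>\<^bsub>mcomp M (l + j)\<^esub>"
        unfolding kern by (auto simp: C_def gr_hom_module_carrier)
      obtain u where u: "u \<in> gr_hom K E j (P (n - 1)) M" "\<And>l x. x \<in> PC n l \<Longrightarrow> u l (\<delta> n l x) = f l x"
        using cobound[OF f(1,3)] by blast
      define u' where "u' = (\<lambda>l. restrict (u l) (PC (n - 1) l))"
      have "u' \<in> gr_hom K E j (P (n - 1)) M" by (rule gr_hom_cong[OF P_graded u(1)]) (simp add: u'_def)
      then have "u' \<in> carrier (C (n - 1))" by (simp add: C_def gr_hom_module_carrier u'_def)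
      moreover have "D (n - 1) u' = f"
      proof (intro ext)
        fix l x show "D (n - 1) u' l x = f l x"
        proof (cases "x \<in> PC n l")
          case True
          have "\<delta> n l x \<in> PC (n - 1) l" using \<delta>_closed[of x "n - 1" l] True by simp
          then show ?thesis using True u(2) by (simp add: D_def u'_def)
        next
          case False
          then show ?thesis using f(2)[of l] by (simp add: D_def extensional_def)
        qed
      qed
      ultimately show "f \<in> coboundaries C D n" unfolding coboundaries_def by blast
    qed
  qed
  then have "gr_Ext K E P \<delta> M n j = quot_module (cocycle_module C D n) (carrier (cocycle_module C D n))"
    unfolding gr_Ext_def cohomology_def C_def[symmetric] D_def[symmetric] by simp
  then show ?thesis using quot_module_self[OF module_abelian[OF Z]] by simp
qed

end

section \<open>Local rings whose maximal ideal has square zero\<close>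

lemma ring_module_coset: "U +>\<^bsub>ring_module R\<^esub> x = U +>\<^bsub>R\<^esub> x"
  by (simp add: a_r_coset_def')

lemma ideal_submodule:
  assumes "cring R"
  shows "submodule I R (ring_module R) \<longleftrightarrow> ideal I R"
proof -
  interpret cring R by fact
  interpret M: module R "ring_module R" by (rule ring_module_module[OF assms])
  show ?thesis
  proof
    assume I: "submodule I R (ring_module R)"
    have "I \<subseteq> carrier R" using M.submoduleE(1)[OF I] by simp
    moreover have "subgroup I (add_monoid R)"
      using submodule.axioms(1)[OF I] by (simp add: subgroup_def a_inv_def m_inv_def)
    moreover have "x \<otimes>\<^bsub>R\<^esub> a \<in> I" if "x \<in> carrier R" "a \<in> I" for x a
      using M.submoduleE(4)[OF I that] by simp
    moreover from this have "a \<otimes>\<^bsub>R\<^esub> x \<in> I" if "x \<in> carrier R" "a \<in> I" for x a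
      using m_comm[of a x] M.submoduleE(1)[OF I] that by auto
    ultimately show "ideal I R" by (intro idealI ring_axioms) simp_all
  next
    assume I: "ideal I R"
    then interpret ideal I R .
    show "submodule I R (ring_module R)"
      by (rule module_carrier_update(1)[OF ring_module_module[OF assms]]) (auto simp: a_subset I_l_closed)
  qed
qed

lemma lin_comb_ring_module:
  fixes n :: nat
  assumes "cring R" "c \<in> {..<n} \<rightarrow> carrier R" "r \<in> carrier (free_module R {..<n})"
  shows "lin_comb R (ring_module R) {..<n} c r = finsum R (\<lambda>i. r i \<otimes>\<^bsub>R\<^esub> c i) {..<n}"
  using lin_comb_superset[OF ring_module_module[OF assms(1)] _ assms(3) finite_lessThan Collect_restrict order_refl, of c] assms(2)
  by (simp add: finsum_ring_module)

lemma genideal_span: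
  fixes n :: nat
  assumes R: "cring R" and c: "c \<in> {..<n} \<rightarrow> carrier R"
  shows "genideal R (c ` {..<n}) = lin_comb R (ring_module R) {..<n} c ` carrier (free_module R {..<n})"
proof
  interpret cring R by fact
  let ?L = "lin_comb R (ring_module R) {..<n} c"
  note RM = ring_module_module[OF R]
  have c': "c \<in> {..<n} \<rightarrow> carrier (ring_module R)" using c by simp
  have Fr: "module R (free_module R {..<n})" by (intro coprod_module_module R RM)
  interpret Fr: module R "free_module R {..<n}" by (rule Fr)
  have I: "ideal (?L ` carrier (free_module R {..<n})) R"
    using submodule_image[OF Fr RM lin_comb_hom[OF RM c'] Fr.carrier_is_submodule] ideal_submodule[OF R] by blast
  show "genideal R (c ` {..<n}) \<subseteq> ?L ` carrier (free_module R {..<n})"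
  proof (rule genideal_minimal[OF I], rule image_subsetI)
    fix j assume j: "j \<in> {..<n}"
    define r where "r = (\<lambda>i\<in>{..<n}. if j = i then \<one>\<^bsub>R\<^esub> else \<zero>\<^bsub>R\<^esub>)"
    have r: "r \<in> carrier (free_module R {..<n})" by (auto simp: r_def)
    have "?L r = finsum R (\<lambda>i. r i \<otimes>\<^bsub>R\<^esub> c i) {..<n}" by (rule lin_comb_ring_module[OF R c r])
    also have "\<dots> = finsum R (\<lambda>i. if j = i then c i else \<zero>\<^bsub>R\<^esub>) {..<n}"
      by (rule finsum_cong') (use c in \<open>auto simp: r_def Pi_iff\<close>)
    also have "\<dots> = c j" by (rule finsum_singleton) (use c j in auto)
    finally show "c j \<in> ?L ` carrier (free_module R {..<n})" using r by (metis imageI)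
  qed
  have J: "ideal (genideal R (c ` {..<n})) R" by (rule genideal_ideal) (use c in auto)
  interpret J: ideal "genideal R (c ` {..<n})" R by (rule J)
  show "?L ` carrier (free_module R {..<n}) \<subseteq> genideal R (c ` {..<n})"
  proof (rule image_subsetI)
    fix r assume r: "r \<in> carrier (free_module R {..<n})"
    have "finsum R (\<lambda>i. r i \<otimes>\<^bsub>R\<^esub> c i) B \<in> genideal R (c ` {..<n})" if "finite B" "B \<subseteq> {..<n}" for B
      using that
    proof (induction B rule: finite_induct)
      case (insert i B)
      have ri: "r i \<in> carrier R" "\<And>i. i \<in> B \<Longrightarrow> r i \<in> carrier R" using r insert.prems by (auto simp: PiE_def Pi_def)
      have ci: "c i \<in> genideal R (c ` {..<n})" using genideal_self[of "c ` {..<n}"] c insert.prems by blast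
      have "finsum R (\<lambda>i. r i \<otimes>\<^bsub>R\<^esub> c i) (insert i B) = r i \<otimes>\<^bsub>R\<^esub> c i \<oplus>\<^bsub>R\<^esub> finsum R (\<lambda>i. r i \<otimes>\<^bsub>R\<^esub> c i) B"
        using insert ri c by (intro finsum_insert) auto
      then show ?case using J.I_l_closed[OF ci ri(1)] insert J.a_closed by simp
    qed (simp add: J.zero_closed)
    then show "?L r \<in> genideal R (c ` {..<n})" unfolding lin_comb_ring_module[OF R c r] by simp
  qed
qed

text \<open>Generators are taken in the least possible number. In a relation with a coefficient
  outside \<open>m\<close>, that coefficient has an inverse modulo \<open>m\<close>; because the
  square of \<open>m\<close> is zero this inverse works exactly on the generator, which is then
  redundant, contradicting minimality.\<close>

lemma square_zero_generators:
  assumes R: "local_ring R m" and mm: "\<And>a b. a \<in> m \<Longrightarrow> b \<in> m \<Longrightarrow> a \<otimes>\<^bsub>R\<^esub> b = \<zero>\<^bsub>R\<^esub>"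
  obtains c where "c \<in> {..<edim R m} \<rightarrow> m"
    and "m = lin_comb R (ring_module R) {..<edim R m} c ` carrier (free_module R {..<edim R m})"
    and "\<And>r j. (\<And>i. i < edim R m \<Longrightarrow> r i \<in> carrier R) \<Longrightarrow>
      finsum R (\<lambda>i. r i \<otimes>\<^bsub>R\<^esub> c i) {..<edim R m} = \<zero>\<^bsub>R\<^esub> \<Longrightarrow> j < edim R m \<Longrightarrow> r j \<in> m"
proof -
  have cr: "cring R" and nr: "noetherian_ring R" and mx: "maximalideal m R" using R by (auto simp: local_ring_def)
  interpret cring R by fact
  interpret m: maximalideal m R by fact
  interpret N: noetherian_ring R by fact
  let ?P = "\<lambda>n. \<exists>A. A \<subseteq> carrier R \<and> finite A \<and> card A = n \<and> genideal R A = m"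
  define n where "n = edim R m"
  obtain A where A: "A \<subseteq> carrier R \<and> finite A \<and> m = genideal R A"
    using N.finetely_gen[OF m.is_ideal] by blast
  then have "?P (card A)" by (intro exI[of _ A]) simp
  \<comment> \<open>The ring is noetherian, so the minimum defining \<open>edim\<close> is
    attained.\<close>
  then have "?P (LEAST n. ?P n)" by (rule LeastI)
  then have "?P n" by (simp only: n_def edim_def)
  then obtain A where A: "A \<subseteq> carrier R" "finite A" "card A = n" "genideal R A = m" by blast
  have least: "n \<le> card B" if "B \<subseteq> carrier R" "finite B" "genideal R B = m" for B
    unfolding n_def edim_def by (rule Least_le) (use that in blast)
  obtain c where "bij_betw c {0..<n} A" using ex_bij_betw_nat_finite[OF A(2)] A(3) by blast
  then have c: "inj_on c {..<n}" "c ` {..<n} = A" by (simp_all add: bij_betw_def atLeast0LessThan)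
  have cR: "c \<in> {..<n} \<rightarrow> carrier R" using c A by auto
  have Am: "A \<subseteq> m" using genideal_self[OF A(1)] A(4) by simp
  have cm: "c \<in> {..<n} \<rightarrow> m" using c(2) Am by auto
  have indep: "r j \<in> m" if r: "\<And>i. i < n \<Longrightarrow> r i \<in> carrier R" and s: "finsum R (\<lambda>i. r i \<otimes>\<^bsub>R\<^esub> c i) {..<n} = \<zero>\<^bsub>R\<^esub>" and j: "j < n" for r j
  proof (rule ccontr)
    assume nm: "r j \<notin> m"
    define B where "B = c ` ({..<n} - {j})"
    have B: "B \<subseteq> carrier R" "finite B" "B \<subseteq> A" using cR c(2) by (auto simp: B_def)
    have "card B = n - 1"
      unfolding B_def using inj_on_subset[OF c(1), of "{..<n} - {j}"] j by (simp add: card_image)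
    have J: "ideal (genideal R B) R" by (rule genideal_ideal[OF B(1)])
    interpret J: ideal "genideal R B" R by (rule J)
    have rc: "(\<lambda>i. r i \<otimes>\<^bsub>R\<^esub> c i) \<in> {..<n} \<rightarrow> carrier R" using r cR by auto
    have rest: "finsum R (\<lambda>i. r i \<otimes>\<^bsub>R\<^esub> c i) T \<in> genideal R B" if "finite T" "T \<subseteq> {..<n} - {j}" for T
      using that
    proof (induction T rule: finite_induct)
      case (insert i T)
      have ci: "c i \<in> genideal R B" using genideal_self[OF B(1)] insert.prems by (auto simp: B_def)
      have "finsum R (\<lambda>i. r i \<otimes>\<^bsub>R\<^esub> c i) (insert i T) = r i \<otimes>\<^bsub>R\<^esub> c i \<oplus>\<^bsub>R\<^esub> finsum R (\<lambda>i. r i \<otimes>\<^bsub>R\<^esub> c i) T"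
        using insert rc by (intro finsum_insert) auto
      then show ?case using J.I_l_closed[OF ci r] insert J.a_closed by simp
    qed (simp add: J.zero_closed)
    have cj: "c j \<in> m" "c j \<in> carrier R" "r j \<in> carrier R" using cm cR j r by auto
    define t where "t = finsum R (\<lambda>i. r i \<otimes>\<^bsub>R\<^esub> c i) ({..<n} - {j})"
    have t: "t \<in> genideal R B" unfolding t_def by (rule rest) auto
    have "finsum R (\<lambda>i. r i \<otimes>\<^bsub>R\<^esub> c i) (insert j ({..<n} - {j})) = r j \<otimes>\<^bsub>R\<^esub> c j \<oplus>\<^bsub>R\<^esub> t"
      unfolding t_def using rc j by (intro finsum_insert) auto
    then have "r j \<otimes>\<^bsub>R\<^esub> c j \<oplus>\<^bsub>R\<^esub> t = \<zero>\<^bsub>R\<^esub>" using s j by (simp add: insert_absorb)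
    then have "r j \<otimes>\<^bsub>R\<^esub> c j = \<ominus>\<^bsub>R\<^esub> t" using cj J.a_subset t by (intro minus_equality[symmetric]) auto
    then have rcj: "r j \<otimes>\<^bsub>R\<^esub> c j \<in> genideal R B" using J.a_inv_closed[OF t] by simp
    interpret Q: field "R Quot m" by (rule m.quotient_is_field[OF cr])
    have X: "m +>\<^bsub>R\<^esub> r j \<in> carrier (R Quot m)" using cj by (auto simp: FactRing_def A_RCOSETS_def')
    have "m +>\<^bsub>R\<^esub> r j \<noteq> \<zero>\<^bsub>R Quot m\<^esub>" using m.a_rcos_self[OF cj(3)] nm by (auto simp: FactRing_def)
    then have "m +>\<^bsub>R\<^esub> r j \<in> Units (R Quot m)" using X Q.field_Units by blast
    then obtain Y where Y: "Y \<in> carrier (R Quot m)" "Y \<otimes>\<^bsub>R Quot m\<^esub> (m +>\<^bsub>R\<^esub> r j) = \<one>\<^bsub>R Quot m\<^esub>" by (auto simp: Units_def)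
    obtain y where y: "y \<in> carrier R" "Y = m +>\<^bsub>R\<^esub> y" using Y(1) by (auto simp: FactRing_def A_RCOSETS_def')
    have "m +>\<^bsub>R\<^esub> (y \<otimes>\<^bsub>R\<^esub> r j) = m +>\<^bsub>R\<^esub> \<one>\<^bsub>R\<^esub>"
      using Y(2) m.rcoset_mult_add[OF y(1) cj(3)] by (simp add: FactRing_def y(2))
    then have "y \<otimes>\<^bsub>R\<^esub> r j \<ominus>\<^bsub>R\<^esub> \<one>\<^bsub>R\<^esub> \<in> m" using quotient_eq_iff_same_a_r_cos[OF m.is_ideal] y(1) cj(3) by simp
    \<comment> \<open>Both factors lie in \<open>m\<close>, so an equality modulo \<open>m\<close>
      becomes an equality after multiplication by the generator.\<close>
    then have "(y \<otimes>\<^bsub>R\<^esub> r j \<ominus>\<^bsub>R\<^esub> \<one>\<^bsub>R\<^esub>) \<otimes>\<^bsub>R\<^esub> c j = \<zero>\<^bsub>R\<^esub>" by (rule mm[OF _ cj(1)])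
    then have "y \<otimes>\<^bsub>R\<^esub> (r j \<otimes>\<^bsub>R\<^esub> c j) \<ominus>\<^bsub>R\<^esub> c j = \<zero>\<^bsub>R\<^esub>"
      using y(1) cj(2,3) by (simp add: a_minus_def l_distr l_minus m_assoc)
    then have "c j = y \<otimes>\<^bsub>R\<^esub> (r j \<otimes>\<^bsub>R\<^esub> c j)" using y(1) cj(2,3) by (simp add: r_right_minus_eq)
    then have "c j \<in> genideal R B" using J.I_l_closed[OF rcj y(1)] by simp
    then have "A \<subseteq> genideal R B" using genideal_self[OF B(1)] unfolding c(2)[symmetric] B_def by auto
    then have "m \<subseteq> genideal R B" using genideal_minimal[OF J] A(4) by blast
    moreover have "genideal R B \<subseteq> m" by (rule genideal_minimal[OF m.is_ideal]) (use B(3) Am in blast)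
    ultimately have "n \<le> n - 1" using least[OF B(1,2)] \<open>card B = n - 1\<close> by simp
    then show False using j by simp
  qed
  show thesis
  proof (rule that)
    show "c \<in> {..<edim R m} \<rightarrow> m" using cm unfolding n_def .
    show "m = lin_comb R (ring_module R) {..<edim R m} c ` carrier (free_module R {..<edim R m})"
      using genideal_span[OF cr cR] c(2) A(4) by (simp add: n_def)
    show "r j \<in> m" if "\<And>i. i < edim R m \<Longrightarrow> r i \<in> carrier R"
      "finsum R (\<lambda>i. r i \<otimes>\<^bsub>R\<^esub> c i) {..<edim R m} = \<zero>\<^bsub>R\<^esub>" "j < edim R m" for r j
      using that unfolding n_def[symmetric] by (rule indep)
  qed
qed

section \<open>From the given resolution to the numerical data\<close>

lemma resolution_data_ex:
  assumes R: "local_ring R m" and mm: "ideal_prod R m m = {\<zero>\<^bsub>R\<^esub>}"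
    and res: "projective_resolution R F d aug (quot_module (ring_module R) m)"
  shows "\<exists>c lam f0 psi. resolution_data R F d m (edim R m) c lam f0 psi"
proof -
  have cr: "cring R" and mx: "maximalideal m R" using R by (auto simp: local_ring_def)
  interpret cring R by fact
  interpret m: maximalideal m R by fact
  note RM = ring_module_module[OF cr]
  have m_m: "a \<otimes>\<^bsub>R\<^esub> b = \<zero>\<^bsub>R\<^esub>" if "a \<in> m" "b \<in> m" for a b using ideal_prod.prod[of a m b m R] that mm by simp
  obtain c where c: "c \<in> {..<edim R m} \<rightarrow> m"
    and span: "m = lin_comb R (ring_module R) {..<edim R m} c ` carrier (free_module R {..<edim R m})"
    and indep: "\<And>r j. (\<And>i. i < edim R m \<Longrightarrow> r i \<in> carrier R) \<Longrightarrow>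
      finsum R (\<lambda>i. r i \<otimes>\<^bsub>R\<^esub> c i) {..<edim R m} = \<zero>\<^bsub>R\<^esub> \<Longrightarrow> j < edim R m \<Longrightarrow> r j \<in> m"
    using square_zero_generators[OF R m_m] by blast
  have cR: "c \<in> {..<edim R m} \<rightarrow> carrier R" using c m.a_subset by auto
  let ?Q = "quot_module (ring_module R) m"
  have sub: "submodule m R (ring_module R)" using ideal_submodule[OF cr] m.is_ideal by blast
  note r = res[unfolded projective_resolution_def]
  have Q: "module R ?Q" using r by (elim conjE)
  have proj: "projective_module R (F i)" for i using r by (elim conjE) (rule spec)
  have F: "module R (F i)" for i using proj by (simp add: projective_module_def)
  have neg: "x = \<zero>\<^bsub>F i\<^esub>" if "i < 0" "x \<in> carrier (F i)" for i x using r that by simp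
  have d: "d i \<in> module_hom R (F i) (F (i - 1))" for i using r by (elim conjE) (rule spec)
  have aug: "aug \<in> module_hom R (F 0) ?Q" using r by (elim conjE)
  have aug_surj: "aug ` carrier (F 0) = carrier ?Q" using r by (elim conjE)
  have aug_ker: "a_kernel (F 0) ?Q aug = d 1 ` carrier (F 1)" using r by (elim conjE)
  have d_ker: "a_kernel (F i) (F (i - 1)) (d i) = d (i + 1) ` carrier (F (i + 1))" if "i \<ge> 1" for i using r that by simp
  have d_d: "d (i - 1) (d i x) = \<zero>\<^bsub>F (i - 2)\<^esub>" if x: "x \<in> carrier (F i)" for i x
  proof (cases "i \<ge> 2")
    case True
    have "d i x \<in> a_kernel (F (i - 1)) (F (i - 1 - 1)) (d (i - 1))" using d_ker[of "i - 1"] True x by simp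
    then show ?thesis by (simp add: a_kernel_def')
  next
    case False
    have "d (i - 1) (d i x) \<in> carrier (F (i - 1 - 1))" by (rule module_homD(1)[OF d module_homD(1)[OF d x]])
    then show ?thesis using neg[of "i - 2"] False by simp
  qed
  let ?q = "\<lambda>x. m +>\<^bsub>ring_module R\<^esub> x"
  have q: "?q \<in> module_hom R (ring_module R) ?Q"
    using quot_module_carrier[OF RM sub] quot_module_add[OF RM sub] quot_module_smult[OF RM sub]
    by (intro module_homI) auto
  have q_surj: "?q ` carrier (ring_module R) = carrier ?Q" using quot_module_carrier[OF RM sub] by simp
  have q_eq: "?q a = ?q b \<longleftrightarrow> a \<ominus>\<^bsub>R\<^esub> b \<in> m" if "a \<in> carrier R" "b \<in> carrier R" for a b
    unfolding ring_module_coset using quotient_eq_iff_same_a_r_cos[OF m.is_ideal that] ..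
  \<comment> \<open>Projectivity of \<open>F 0\<close> lifts the augmentation along the quotient map
    onto the residue field.\<close>
  obtain lam where lam: "lam \<in> module_hom R (F 0) (ring_module R)" and q_lam: "\<And>x. x \<in> carrier (F 0) \<Longrightarrow> ?q (lam x) = aug x"
  proof (rule projective_lift[OF proj RM Q q aug])
    fix h assume "h \<in> module_hom R (F 0) (ring_module R)" "\<And>x. x \<in> carrier (F 0) \<Longrightarrow> ?q (h x) = aug x"
    then show thesis by (rule that)
  next
    show "aug x \<in> ?q ` carrier (ring_module R)" if "x \<in> carrier (F 0)" for x
      unfolding q_surj by (rule module_homD(1)[OF aug that])
  qed
  have lamR: "lam x \<in> carrier R" if "x \<in> carrier (F 0)" for x using module_homD(1)[OF lam that] by simp
  have lam_m: "lam x \<in> m \<longleftrightarrow> x \<in> d 1 ` carrier (F 1)" if x: "x \<in> carrier (F 0)" for x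
  proof -
    have "lam x \<in> m \<longleftrightarrow> ?q (lam x) = ?q \<zero>\<^bsub>R\<^esub>" using q_eq[OF lamR[OF x] zero_closed] lamR[OF x] by (simp add: a_minus_def)
    also have "?q \<zero>\<^bsub>R\<^esub> = \<zero>\<^bsub>?Q\<^esub>" using quot_module_zero[OF RM sub] by simp
    also have "?q (lam x) = \<zero>\<^bsub>?Q\<^esub> \<longleftrightarrow> x \<in> a_kernel (F 0) ?Q aug" using x by (simp add: q_lam a_kernel_def')
    finally show ?thesis unfolding aug_ker .
  qed
  have "?q \<one>\<^bsub>R\<^esub> \<in> aug ` carrier (F 0)" unfolding aug_surj q_surj[symmetric] by simp
  then obtain f0 where f0: "f0 \<in> carrier (F 0)" "?q \<one>\<^bsub>R\<^esub> = aug f0" by blast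
  have lam_f0: "lam f0 \<ominus>\<^bsub>R\<^esub> \<one>\<^bsub>R\<^esub> \<in> m" using q_eq[OF lamR[OF f0(1)] one_closed] q_lam[OF f0(1)] f0(2) by simp
  let ?L = "lin_comb R (ring_module R) {..<edim R m} c"
  have Fr: "module R (free_module R {..<edim R m})" by (intro coprod_module_module cr RM)
  have L: "?L \<in> module_hom R (free_module R {..<edim R m}) (ring_module R)" by (rule lin_comb_hom[OF RM]) (use cR in simp)
  \<comment> \<open>Projectivity of \<open>F 1\<close> will lift \<open>lam\<close> after
    \<open>d 1\<close>, whose values lie in \<open>m\<close>, through the free module on the
    generators; the lift records the coordinates \<open>psi\<close>.\<close>
  have d1: "d 1 \<in> module_hom R (F 1) (F 0)" using d[of 1] by simp
  obtain psi where psi: "psi \<in> module_hom R (F 1) (free_module R {..<edim R m})"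
    and L_psi: "\<And>x. x \<in> carrier (F 1) \<Longrightarrow> ?L (psi x) = lam (d 1 x)"
  proof (rule projective_lift[OF proj Fr RM L module_hom_compose[OF d1 lam]])
    fix h assume "h \<in> module_hom R (F 1) (free_module R {..<edim R m})" "\<And>x. x \<in> carrier (F 1) \<Longrightarrow> ?L (h x) = lam (d 1 x)"
    then show thesis by (rule that)
  next
    show "lam (d 1 x) \<in> ?L ` carrier (free_module R {..<edim R m})" if "x \<in> carrier (F 1)" for x
      unfolding span[symmetric] using lam_m[OF module_homD(1)[OF d1 that]] that by blast
  qed
  have "resolution_data R F d m (edim R m) c lam f0 psi"
  proof (intro resolution_data.intro mod_complex.intro resolution_data_axioms.intro)
    show "module R (F i)" for i by (rule F)
    show "d i \<in> module_hom R (F i) (F (i - 1))" for i by (rule d)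
    show "d (i - 1) (d i x) = \<zero>\<^bsub>F (i - 2)\<^esub>" if "x \<in> carrier (F i)" for i x by (rule d_d[OF that])
    show "ideal m R" by (rule m.is_ideal)
    show "\<one>\<^bsub>R\<^esub> \<notin> m" using m.one_imp_carrier m.I_notcarr by blast
    show "a \<otimes>\<^bsub>R\<^esub> b = \<zero>\<^bsub>R\<^esub>" if "a \<in> m" "b \<in> m" for a b by (rule m_m[OF that])
    show "projective_module R (F k)" for k by (rule proj)
    show "x = \<zero>\<^bsub>F k\<^esub>" if "k < 0" "x \<in> carrier (F k)" for k x by (rule neg[OF that])
    show "x \<in> d (k + 1) ` carrier (F (k + 1))" if "k \<ge> 1" "x \<in> carrier (F k)" "d k x = \<zero>\<^bsub>F (k - 1)\<^esub>" for k x
      unfolding d_ker[OF that(1), symmetric] using that by (simp add: a_kernel_def')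
    show "c i \<in> m" if "i < edim R m" for i using c that by auto
    show "r i \<in> m" if "\<And>i. i < edim R m \<Longrightarrow> r i \<in> carrier R" "finsum R (\<lambda>i. r i \<otimes>\<^bsub>R\<^esub> c i) {..<edim R m} = \<zero>\<^bsub>R\<^esub>" "i < edim R m" for r i
      by (rule indep[OF that])
    show "lam \<in> module_hom R (F 0) (ring_module R)" by (rule lam)
    show "lam x \<in> m \<longleftrightarrow> x \<in> d 1 ` carrier (F 1)" if "x \<in> carrier (F 0)" for x by (rule lam_m[OF that])
    show "f0 \<in> carrier (F 0)" by (rule f0)
    show "lam f0 \<ominus>\<^bsub>R\<^esub> \<one>\<^bsub>R\<^esub> \<in> m" by (rule lam_f0)
    show "(\<lambda>x. psi x i) \<in> module_hom R (F 1) (ring_module R)" if "i < edim R m" for i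
      using module_homD[OF psi] that by (intro module_homI) auto
    show "finsum R (\<lambda>i. psi x i \<otimes>\<^bsub>R\<^esub> c i) {..<edim R m} = lam (d 1 x)" if "x \<in> carrier (F 1)" for x
      using L_psi[OF that] lin_comb_ring_module[OF cr cR module_homD(1)[OF psi that]] by simp
  qed
  then show ?thesis by blast
qed

text \<open>Here the computations with chain maps are handed over: all remaining arguments take
  place over the residue field, with stable Ext as a graded module over Ext.\<close>

lemma (in resolution_data) Ext_stable_pair:
  assumes "field (R Quot m)" "0 < e"
  shows "stable_pair (R Quot m) EE (module_via io SS) io e vE rcE wS"
proof -
  have M: "mcomp (module_via io SS) n = acomp SS n" "mact (module_via io SS) k n a s = amult SS k n (io k a) s" for k n a s
    by (simp_all add: module_via_def)
  show ?thesis
  proof (rule stable_pair.intro)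
    show "field (R Quot m)" "0 < e" by fact+
    show "graded_left_module (R Quot m) EE (regular_module EE)" by (rule Q.E.graded_regular)
    show "graded_left_module (R Quot m) EE (module_via io SS)" by (rule Q.graded_via)
    show "io \<in> gr_hom (R Quot m) EE 0 (regular_module EE) (module_via io SS)" by (rule Q.iota_gr_hom)
  qed (unfold M, (fact Q.E.amult_one_r Q.E.one_closed EE_one EE_neg EE_0 vE_closed rcE_hom rcE_v rcE_sum wS_hom wS_v wS_sum
      SS_local io_kernel)+)
qed

theorem theorem10p4:
  fixes R :: "('a, 'r) ring_scheme" and m :: "'a set" and e :: nat
    and K :: "'a set ring"
    and F :: "int \<Rightarrow> ('a, 'b) module" and d :: "int \<Rightarrow> 'b \<Rightarrow> 'b" and aug :: "'b \<Rightarrow> 'a set"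
    and E :: "('a set, (int \<Rightarrow> 'b \<Rightarrow> 'b) set) gr_algebra"
    and S :: "('a set, (int \<Rightarrow> 'b \<Rightarrow> 'b) set set) gr_algebra"
    and \<iota> :: "int \<Rightarrow> (int \<Rightarrow> 'b \<Rightarrow> 'b) set \<Rightarrow> (int \<Rightarrow> 'b \<Rightarrow> 'b) set set"
    and I :: "('a set, (int \<Rightarrow> 'b \<Rightarrow> 'b) set, (int \<Rightarrow> 'b \<Rightarrow> 'b) set \<Rightarrow> 'a set) gr_module"
  assumes "local_ring R m"
    and "ideal_prod R m m = {\<zero>\<^bsub>R\<^esub>}"
    and "edim R m = e"
    and "e \<ge> 2"
    and "K = R Quot m"
    and "projective_resolution R F d aug (quot_module (ring_module R) m)"
    and "E = Ext_algebra R F d"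
    and "S = stable_Ext_algebra R F d"
    and "\<iota> = Ext_to_stable_Ext R F d"
    and "I = gr_dual K E"
  shows "(\<exists>p. gr_short_exact K E (regular_module E) \<iota> (module_via \<iota> S) p
            (gr_dsum (gr_power (gr_shift 1 I) e)
               (gr_coprod UNIV (\<lambda>i::nat. gr_power (gr_shift (- int i) I) (e ^ i * (e\<^sup>2 - 1))))))
       \<and> \<not> has_direct_complement K E (module_via \<iota> S) (\<lambda>n. \<iota> n ` carrier (acomp E n))
       \<and> (\<forall>(P :: int \<Rightarrow> ('a set, (int \<Rightarrow> 'b \<Rightarrow> 'b) set, 'p) gr_module) \<delta> \<eta>.
            gr_projective_resolution K E P \<delta> \<eta>
              (gr_quot_module (regular_module E) (degree_ge_one E)) \<longrightarrow>
            (\<forall>n j. carrier (gr_Ext K E P \<delta> (module_via \<iota> S) n j)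
                 = {\<zero>\<^bsub>gr_Ext K E P \<delta> (module_via \<iota> S) n j\<^esub>}))"
proof -
  obtain c lam f0 psi where "resolution_data R F d m e c lam f0 psi"
    using resolution_data_ex[OF assms(1,2,6)] assms(3) by blast
  then interpret D: resolution_data R F d m e c lam f0 psi .
  have "field (R Quot m)" using assms(1) by (auto simp: local_ring_def intro: maximalideal.quotient_is_field)
  \<comment> \<open>The three claims are now the three theorems on stable pairs, the last one
    instantiated at each resolution of the trivial module.\<close>
  then interpret SP: stable_pair K E "module_via \<iota> S" \<iota> e D.vE D.rcE D.wS
    unfolding assms(5,7-9) by (rule D.Ext_stable_pair) (use assms(4) in simp)
  have "\<exists>p. gr_short_exact K E (regular_module E) \<iota> (module_via \<iota> S) p
    (gr_dsum (gr_power (gr_shift 1 I) e) (gr_coprod UNIV (\<lambda>i::nat. gr_power (gr_shift (- int i) I) (e ^ i * (e\<^sup>2 - 1)))))"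
    using SP.exact_sequence unfolding SP.target_def assms(10)[symmetric] by blast
  moreover have "carrier (gr_Ext K E P \<delta> (module_via \<iota> S) n j) = {\<zero>\<^bsub>gr_Ext K E P \<delta> (module_via \<iota> S) n j\<^esub>}"
    if "gr_projective_resolution K E P \<delta> \<eta> (gr_quot_module (regular_module E) (degree_ge_one E))"
    for P :: "int \<Rightarrow> ('a set, (int \<Rightarrow> 'b \<Rightarrow> 'b) set, 'p) gr_module" and \<delta> \<eta> n j
    by (rule stable_pair_resolution.Ext_vanishing[OF stable_pair_resolution.intro[OF SP.stable_pair_axioms stable_pair_resolution_axioms.intro[OF that]]])
  ultimately show ?thesis using SP.io_no_complement by blast
qed

end
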